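(* Let $X$ be a $\mathbb{Q}$-factorial complete toric variety (over $\mathbb{C}$, of any dimension) whose Picard number $r=\operatorname{rk}(\operatorname{Pic}(X))$ equals $2$. Then $X$ is projective.
   Context: A toric variety here is the normal variety $X(\Sigma)$ over $\mathbb{C}$ associated with a rational fan $\Sigma$ in $N_{\mathbb{R}}=N\otimes\mathbb{R}$, where $N\cong\mathbb{Z}^n$. It is $\mathbb{Q}$-factorial and complete exactly when $\Sigma$ is simplicial and complete; in that case, if $\Sigma$ has $n+r$ rays, then $r=\operatorname{rk}(\operatorname{Pic}(X))$ is the Picard number. *)

theory Defs
  imports "HOL-Analysis.Analysis" "HOL-Library.Extended_Nat"
begin

text \<open>
  Varieties over \<open>\<complex>\<close> are treated classically, as spaces with functions: a set of closed points with
  its Zariski topology and, for every open \<open>U\<close>, the regular functions on \<open>U\<close>.  Functions are total in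
  HOL; a member of \<open>regular X U\<close> is only constrained by its values on \<open>U\<close>, and \<open>regular X U\<close> is
  meaningful only for open \<open>U\<close>.
\<close>

record 'a space_with_functions =
  zariski :: "'a topology"
  regular :: "'a set \<Rightarrow> ('a \<Rightarrow> complex) set"

abbreviation points :: "'a space_with_functions \<Rightarrow> 'a set" where
  "points X \<equiv> topspace (zariski X)"

definition morphism ::
    "'a space_with_functions \<Rightarrow> 'b space_with_functions \<Rightarrow> ('a \<Rightarrow> 'b) \<Rightarrow> bool" where
  "morphism X Y \<phi> \<longleftrightarrow> continuous_map (zariski X) (zariski Y) \<phi> \<and>
     (\<forall>V f. openin (zariski Y) V \<and> f \<in> regular Y V \<longrightarrow>
        f \<circ> \<phi> \<in> regular X {x \<in> points X. \<phi> x \<in> V})"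

definition isomorphic :: "'a space_with_functions \<Rightarrow> 'b space_with_functions \<Rightarrow> bool" where
  "isomorphic X Y \<longleftrightarrow> (\<exists>\<phi> \<psi>. morphism X Y \<phi> \<and> morphism Y X \<psi> \<and>
     (\<forall>x \<in> points X. \<psi> (\<phi> x) = x) \<and> (\<forall>y \<in> points Y. \<phi> (\<psi> y) = y))"

text \<open>The reduced induced structure: regular functions on \<open>Z\<close> are locally restrictions from \<open>X\<close>.\<close>

definition induced_on :: "'a space_with_functions \<Rightarrow> 'a set \<Rightarrow> 'a space_with_functions" where
  "induced_on X Z = \<lparr>
     zariski = subtopology (zariski X) Z,
     regular = (\<lambda>U. {f. \<forall>p\<in>U. \<exists>V g. openin (zariski X) V \<and> p \<in> V \<and> g \<in> regular X V \<and>
                                     (\<forall>q \<in> V \<inter> Z. q \<in> U \<and> f q = g q)})\<rparr>"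

inductive_set generated_algebra :: "('a \<Rightarrow> complex) set \<Rightarrow> ('a \<Rightarrow> complex) set"
  for G :: "('a \<Rightarrow> complex) set" where
  const: "(\<lambda>_. c) \<in> generated_algebra G"
| gen: "f \<in> G \<Longrightarrow> f \<in> generated_algebra G"
| add: "f \<in> generated_algebra G \<Longrightarrow> g \<in> generated_algebra G \<Longrightarrow> (\<lambda>p. f p + g p) \<in> generated_algebra G"
| mult: "f \<in> generated_algebra G \<Longrightarrow> g \<in> generated_algebra G \<Longrightarrow> (\<lambda>p. f p * g p) \<in> generated_algebra G"

text \<open>
  The space obtained from affine charts.  A pair \<open>(W, G)\<close> is an affine open subset \<open>W\<close> together with
  functions \<open>G\<close> generating its coordinate ring.  The principal open subsets of the charts form a basis
  of the Zariski topology, and a function is regular if near every point it is a quotient of two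
  members of the coordinate ring of a chart.
\<close>

definition space_of_atlas :: "('a set \<times> ('a \<Rightarrow> complex) set) set \<Rightarrow> 'a space_with_functions" where
  "space_of_atlas A =
     (let T = topology_generated_by
                {{p \<in> W. f p \<noteq> 0} | W G f. (W, G) \<in> A \<and> f \<in> generated_algebra G}
      in \<lparr>zariski = T,
          regular = (\<lambda>U. {h. \<forall>p\<in>U. \<exists>(W, G) \<in> A. \<exists>f \<in> generated_algebra G. \<exists>g \<in> generated_algebra G.
                               \<exists>V. openin T V \<and> p \<in> V \<and> V \<subseteq> U \<inter> W \<and>
                                   (\<forall>q\<in>V. g q \<noteq> 0 \<and> h q = f q / g q)})\<rparr>)"

definition affine_space :: "nat \<Rightarrow> (nat \<Rightarrow> complex) space_with_functions" where
  "affine_space m = space_of_atlas {({v. \<forall>i\<ge>m. v i = 0}, {\<lambda>v. v i | i. i < m})}"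

text \<open>
  Points of projective \<open>N\<close>-space are the classes of nonzero vectors \<open>(v\<^sub>0, \<dots>, v\<^sub>N)\<close> up to scaling; the
  charts are the standard ones \<open>v\<^sub>i \<noteq> 0\<close>, with affine coordinates \<open>v\<^sub>j / v\<^sub>i\<close>.
\<close>

definition homogeneous_class :: "(nat \<Rightarrow> complex) \<Rightarrow> (nat \<Rightarrow> complex) set" where
  "homogeneous_class v = {\<lambda>i. c * v i | c. c \<noteq> 0}"

definition projective_space :: "nat \<Rightarrow> (nat \<Rightarrow> complex) set space_with_functions" where
  "projective_space N = space_of_atlas
     {({homogeneous_class v | v. (\<forall>k>N. v k = 0) \<and> v i \<noteq> 0},
       {\<lambda>L. (THE z. \<forall>v\<in>L. z = v j / v i) | j. j \<le> N}) | i. i \<le> N}"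

definition projective_variety :: "'a space_with_functions \<Rightarrow> bool" where
  "projective_variety X \<longleftrightarrow> (\<exists>N Z. closedin (zariski (projective_space N)) Z \<and>
     isomorphic X (induced_on (projective_space N) Z))"

text \<open>
  The Zariski topology on the product variety is not the product topology; its basic open sets are the
  nonvanishing loci of the functions \<open>\<Sum>i. f\<^sub>i \<otimes> g\<^sub>i\<close>.
\<close>

definition product_zariski ::
    "'a space_with_functions \<Rightarrow> 'b space_with_functions \<Rightarrow> ('a \<times> 'b) topology" where
  "product_zariski X Y = topology_generated_by
     {{(x, y) \<in> U \<times> V. (\<Sum>i<k. f i x * g i y) \<noteq> 0} | U V (k::nat) f g.
        openin (zariski X) U \<and> openin (zariski Y) V \<and>
        (\<forall>i<k. f i \<in> regular X U) \<and> (\<forall>i<k. g i \<in> regular Y V)}"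

text \<open>
  A variety \<open>X\<close> is complete if \<open>X \<times> Y \<rightarrow> Y\<close> is closed for every variety \<open>Y\<close>.  Closedness of a map can
  be checked on an affine open cover of the target, so \<open>Y\<close> ranges over the closed subvarieties of
  affine spaces.  Separatedness belongs to the notion of variety (and holds for the toric variety of
  every fan), so it is not repeated here.
\<close>

definition complete_variety :: "'a space_with_functions \<Rightarrow> bool" where
  "complete_variety X \<longleftrightarrow> (\<forall>m Z. closedin (zariski (affine_space m)) Z \<longrightarrow>
     (let Y = induced_on (affine_space m) Z
      in closed_map (product_zariski X Y) (zariski Y) snd))"

definition irreducible_closed :: "'a space_with_functions \<Rightarrow> 'a set \<Rightarrow> bool" where
  "irreducible_closed X Z \<longleftrightarrow> closedin (zariski X) Z \<and> Z \<noteq> {} \<and>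
     (\<forall>A B. closedin (zariski X) A \<and> closedin (zariski X) B \<and> Z \<subseteq> A \<union> B \<longrightarrow> Z \<subseteq> A \<or> Z \<subseteq> B)"

text \<open>Prime divisors of an irreducible variety: irreducible closed subsets of codimension one.\<close>

definition prime_divisor :: "'a space_with_functions \<Rightarrow> 'a set \<Rightarrow> bool" where
  "prime_divisor X D \<longleftrightarrow> irreducible_closed X D \<and> D \<noteq> points X \<and>
     (\<forall>Z. irreducible_closed X Z \<and> D \<subset> Z \<longrightarrow> Z = points X)"

definition vanishing_ideal ::
    "'a space_with_functions \<Rightarrow> 'a set \<Rightarrow> 'a set \<Rightarrow> ('a \<Rightarrow> complex) set" where
  "vanishing_ideal X D U = {f \<in> regular X U. \<forall>p \<in> D \<inter> U. f p = 0}"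

text \<open>
  Sections over \<open>U\<close> of the ideal sheaf \<open>O\<^sub>X(-nD)\<close> of the effective Weil divisor \<open>nD\<close>, for a prime
  divisor \<open>D\<close> on a normal variety: the regular functions of order at least \<open>n\<close> along \<open>D\<close>, that is,
  those whose germ at the generic point of \<open>D\<close> lies in the \<open>n\<close>-th power of the maximal ideal of the
  discrete valuation ring \<open>O\<^sub>X\<^sub>,\<^sub>D\<close>.  Germs at the generic point are represented on open sets \<open>W\<close>
  meeting \<open>D\<close>.
\<close>

definition divisor_ideal ::
    "'a space_with_functions \<Rightarrow> nat \<Rightarrow> 'a set \<Rightarrow> 'a set \<Rightarrow> ('a \<Rightarrow> complex) set" where
  "divisor_ideal X n D U = {f \<in> regular X U. D \<inter> U \<noteq> {} \<longrightarrow>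
     (\<exists>W. openin (zariski X) W \<and> W \<subseteq> U \<and> D \<inter> W \<noteq> {} \<and>
        (\<exists>(k::nat) c a. (\<forall>i<k. c i \<in> regular X W) \<and>
           (\<forall>i<k. \<forall>j<n. a i j \<in> vanishing_ideal X D W) \<and>
           (\<forall>q\<in>W. f q = (\<Sum>i<k. c i q * (\<Prod>j<n. a i j q)))))}"

text \<open>The effective divisor \<open>nD\<close> is Cartier if its ideal sheaf is locally generated by one function.\<close>

definition cartier_multiple :: "'a space_with_functions \<Rightarrow> nat \<Rightarrow> 'a set \<Rightarrow> bool" where
  "cartier_multiple X n D \<longleftrightarrow> (\<forall>p \<in> points X. \<exists>U f. openin (zariski X) U \<and> p \<in> U \<and>
     f \<in> divisor_ideal X n D U \<and>
     (\<forall>V g. openin (zariski X) V \<and> V \<subseteq> U \<and> g \<in> divisor_ideal X n D V \<longrightarrow>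
        (\<exists>h \<in> regular X V. \<forall>q\<in>V. g q = h q * f q)))"

text \<open>
  Every Weil divisor has a nonzero Cartier multiple; as Weil divisors are finite integer combinations
  of prime divisors, this is a condition on prime divisors.
\<close>

definition q_factorial :: "'a space_with_functions \<Rightarrow> bool" where
  "q_factorial X \<longleftrightarrow> (\<forall>D. prime_divisor X D \<longrightarrow> (\<exists>n>0. cartier_multiple X n D))"

text \<open>
  \<open>Pic(X) = H\<^sup>1(X, O\<^sub>X\<^sup>*)\<close>: a line bundle is given by transition functions \<open>g x y\<close> on \<open>U x \<inter> U y\<close> for an
  open cover \<open>U\<close>.  Indexing the cover by the points of \<open>X\<close>, with \<open>x \<in> U x\<close>, loses no generality, since
  every open cover has a refinement of this form.
\<close>

type_synonym 'a transition_data = "('a \<Rightarrow> 'a set) \<times> ('a \<Rightarrow> 'a \<Rightarrow> 'a \<Rightarrow> complex)"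

definition regular_units :: "'a space_with_functions \<Rightarrow> 'a set \<Rightarrow> ('a \<Rightarrow> complex) set" where
  "regular_units X U = {f \<in> regular X U. (\<forall>p\<in>U. f p \<noteq> 0) \<and> (\<lambda>p. inverse (f p)) \<in> regular X U}"

definition line_bundle :: "'a space_with_functions \<Rightarrow> 'a transition_data \<Rightarrow> bool" where
  "line_bundle X = (\<lambda>(U, g).
     (\<forall>x \<in> points X. openin (zariski X) (U x) \<and> x \<in> U x) \<and>
     (\<forall>x \<in> points X. \<forall>y \<in> points X. g x y \<in> regular_units X (U x \<inter> U y)) \<and>
     (\<forall>x \<in> points X. \<forall>y \<in> points X. \<forall>z \<in> points X. \<forall>p \<in> U x \<inter> U y \<inter> U z.
        g x y p * g y z p = g x z p))"

definition trivial_line_bundle :: "'a space_with_functions \<Rightarrow> 'a transition_data \<Rightarrow> bool" where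
  "trivial_line_bundle X = (\<lambda>(U, g). \<exists>V h.
     (\<forall>x \<in> points X. openin (zariski X) (V x) \<and> x \<in> V x \<and> V x \<subseteq> U x \<and>
        h x \<in> regular_units X (V x)) \<and>
     (\<forall>x \<in> points X. \<forall>y \<in> points X. \<forall>p \<in> V x \<inter> V y. g x y p = h x p / h y p))"

text \<open>The tensor product of the powers \<open>L i ^ a i\<close> for \<open>i < k\<close>.\<close>

definition tensor_combination ::
    "'a space_with_functions \<Rightarrow> nat \<Rightarrow> (nat \<Rightarrow> 'a transition_data) \<Rightarrow> (nat \<Rightarrow> int) \<Rightarrow> 'a transition_data"
  where
  "tensor_combination X k L a =
     (\<lambda>x. points X \<inter> (\<Inter>i<k. fst (L i) x), \<lambda>x y p. \<Prod>i<k. snd (L i) x y p powi a i)"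

text \<open>
  The rank of the abelian group \<open>Pic(X)\<close>: the supremum of the sizes of families of line bundles whose
  classes are linearly independent over the integers.
\<close>

definition picard_number :: "'a space_with_functions \<Rightarrow> enat" where
  "picard_number X = Sup {enat k | k L. (\<forall>i<k. line_bundle X (L i)) \<and>
     (\<forall>a. trivial_line_bundle X (tensor_combination X k L a) \<longrightarrow> (\<forall>i<k. a i = 0))}"

text \<open>
  Fans.  A basis of \<open>N\<close> is fixed, so \<open>N\<close> is the set of vectors of \<open>real ^ 'n\<close> with integral
  coordinates, and the dual lattice \<open>M\<close> is \<open>int ^ 'n\<close>.
\<close>

definition pairing :: "int ^ 'n \<Rightarrow> real ^ 'n \<Rightarrow> real" where
  "pairing m v = (\<Sum>i\<in>UNIV. real_of_int (m $ i) * v $ i)"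

definition rational_polyhedral_cone :: "(real ^ 'n) set \<Rightarrow> bool" where
  "rational_polyhedral_cone \<sigma> \<longleftrightarrow>
     (\<exists>S. finite S \<and> (\<forall>v\<in>S. \<forall>i. v $ i \<in> \<int>) \<and> \<sigma> = convex_cone hull S)"

definition strongly_convex :: "(real ^ 'n) set \<Rightarrow> bool" where
  "strongly_convex \<sigma> \<longleftrightarrow> (\<forall>v. v \<in> \<sigma> \<and> - v \<in> \<sigma> \<longrightarrow> v = 0)"

text \<open>For a polyhedral cone, the faces \<open>\<sigma> \<inter> u\<^sup>\<bottom>\<close> with \<open>u\<close> in the dual cone are exactly the nonempty
  faces of \<open>\<sigma>\<close> as a convex set.\<close>

definition fan :: "(real ^ 'n) set set \<Rightarrow> bool" where
  "fan \<Sigma> \<longleftrightarrow> finite \<Sigma> \<and> \<Sigma> \<noteq> {} \<and>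
     (\<forall>\<sigma>\<in>\<Sigma>. rational_polyhedral_cone \<sigma> \<and> strongly_convex \<sigma>) \<and>
     (\<forall>\<sigma>\<in>\<Sigma>. \<forall>\<tau>. \<tau> face_of \<sigma> \<and> \<tau> \<noteq> {} \<longrightarrow> \<tau> \<in> \<Sigma>) \<and>
     (\<forall>\<sigma>\<in>\<Sigma>. \<forall>\<tau>\<in>\<Sigma>. (\<sigma> \<inter> \<tau>) face_of \<sigma> \<and> (\<sigma> \<inter> \<tau>) face_of \<tau>)"

text \<open>The semigroup of lattice points of the dual cone.\<close>

definition dual_semigroup :: "(real ^ 'n) set \<Rightarrow> (int ^ 'n) set" where
  "dual_semigroup \<sigma> = {m. \<forall>v\<in>\<sigma>. 0 \<le> pairing m v}"

text \<open>
  The closed points of the affine toric variety \<open>U\<^sub>\<sigma> = Spec \<complex>[\<sigma>\<^sup>\<or> \<inter> M]\<close>, that is, the \<open>\<complex>\<close>-algebra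
  homomorphisms \<open>\<complex>[\<sigma>\<^sup>\<or> \<inter> M] \<rightarrow> \<complex>\<close>, given by the corresponding monoid homomorphisms from
  \<open>\<sigma>\<^sup>\<or> \<inter> M\<close> to the multiplicative monoid \<open>\<complex>\<close>.
\<close>

definition affine_toric_points :: "(real ^ 'n) set \<Rightarrow> (int ^ 'n \<Rightarrow> complex) set" where
  "affine_toric_points \<sigma> = {x \<in> extensional (dual_semigroup \<sigma>). x 0 = 1 \<and>
     (\<forall>m \<in> dual_semigroup \<sigma>. \<forall>m' \<in> dual_semigroup \<sigma>. x (m + m') = x m * x m')}"

text \<open>
  \<open>U\<^sub>\<sigma>\<close> and \<open>U\<^sub>\<tau>\<close> are glued along \<open>U\<^bsub>\<sigma> \<inter> \<tau>\<^esub>\<close>; the open immersion of \<open>U\<^bsub>\<sigma> \<inter> \<tau>\<^esub>\<close> into \<open>U\<^sub>\<sigma>\<close> restricts a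
  homomorphism to the smaller semigroup.
\<close>

type_synonym 'n local_toric_point = "(real ^ 'n) set \<times> (int ^ 'n \<Rightarrow> complex)"

definition toric_gluing ::
    "(real ^ 'n) set set \<Rightarrow> ('n local_toric_point \<times> 'n local_toric_point) set" where
  "toric_gluing \<Sigma> = {((\<sigma>, x), (\<tau>, y)). \<sigma> \<in> \<Sigma> \<and> \<tau> \<in> \<Sigma> \<and>
     (\<exists>z \<in> affine_toric_points (\<sigma> \<inter> \<tau>).
        x = restrict z (dual_semigroup \<sigma>) \<and> y = restrict z (dual_semigroup \<tau>))}"

definition toric_chart :: "(real ^ 'n) set set \<Rightarrow> (real ^ 'n) set \<Rightarrow> 'n local_toric_point set set" where
  "toric_chart \<Sigma> \<sigma> = {toric_gluing \<Sigma> `` {(\<sigma>, x)} | x. x \<in> affine_toric_points \<sigma>}"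

text \<open>The function \<open>\<chi>\<^sup>m\<close> on the chart of \<open>\<sigma>\<close>: a class \<open>p\<close> in this chart has exactly one member
  \<open>(\<sigma>, x)\<close>, and \<open>\<chi>\<^sup>m\<close> takes the value \<open>x m\<close> there.\<close>

definition toric_character :: "(real ^ 'n) set \<Rightarrow> int ^ 'n \<Rightarrow> 'n local_toric_point set \<Rightarrow> complex" where
  "toric_character \<sigma> m p = (THE x. (\<sigma>, x) \<in> p) m"

definition toric_variety ::
    "(real ^ 'n) set set \<Rightarrow> 'n local_toric_point set space_with_functions" where
  "toric_variety \<Sigma> =
     space_of_atlas {(toric_chart \<Sigma> \<sigma>, toric_character \<sigma> ` dual_semigroup \<sigma>) | \<sigma>. \<sigma> \<in> \<Sigma>}"

end

theory Submission
  imports Defs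
begin

text \<open>
  Completeness forces the cones of the fan to cover \<open>\<real>\<^sup>n\<close>, and an equation of a multiple of a
  torus-invariant prime divisor at the fixed point of a full-dimensional cone yields a character that is
  positive on one ray of the cone and zero on the others, so that the fan is simplicial.  The bundles of the
  \<open>r\<close> rays outside a full-dimensional cone are independent in the Picard group: a trivialisation would be a
  unit on the torus, which is topologically a character, and this character vanishes on a basis.  Hence Picard
  number 2 leaves at most \<open>n + 2\<close> rays.  Then the support functions modulo linear ones, cut down to a
  hyperplane of normalised functions, form a line, on which each full-dimensional cone selects an open
  interval of values convex at that cone.  The intervals meet pairwise, hence by Helly's theorem they have a
  common point: a strictly convex support function, which can be taken integral.  The monomials in a large
  multiple of its polytope embed the variety into projective space.
\<close>

subsection \<open>Pairing and lattice vectors\<close>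

text \<open>Picard number two enters through a dimension count. The value vectors that are convex at
  a given full-dimensional cone form a convex cone in the space of all value vectors modulo linear
  ones, and any two of these cones meet because any two cones of a fan are separated by a linear
  functional. In dimension two Helly's theorem would ask for triples. A positive relation among the
  rays, available because the fan is complete, defines a functional that kills linear functions and
  is negative on all of these cones at once; the slice where it equals -1 loses a dimension but
  keeps the pairwise intersections, and on a line pairs suffice. The fan is simplicial but need not
  be smooth, so dual bases of its cones exist only up to a factor; one positive integer
  \<open>N\<close> serves all cones and rays. Units are treated topologically because the pairing of
  a character with a ray is a winding number, which can be read off from an extension of the
  function over the orbit of the ray.\<close>

definition real_vec :: "int ^ 'n \<Rightarrow> real ^ 'n" where
  "real_vec m = (\<chi> i. real_of_int (m $ i))"

lemma pairing_eq_inner: "pairing m v = real_vec m \<bullet> v"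
  by (simp add: pairing_def real_vec_def inner_vec_def)

lemma pairing_add_left: "pairing (m + m') v = pairing m v + pairing m' v"
  by (simp add: pairing_def algebra_simps sum.distrib)

lemma pairing_diff_left: "pairing (m - m') v = pairing m v - pairing m' v"
  by (simp add: pairing_def algebra_simps sum_subtractf)

lemma pairing_uminus_left: "pairing (- m) v = - pairing m v"
  by (simp add: pairing_def sum_negf)

lemma pairing_zero_left [simp]: "pairing 0 v = 0"
  by (simp add: pairing_def)

lemma pairing_vmult: "pairing (k *s m) v = of_int k * pairing m v"
  by (simp add: pairing_def sum_distrib_left mult.assoc)

lemma pairing_add_right: "pairing m (v + w) = pairing m v + pairing m w"
  by (simp add: pairing_eq_inner inner_add_right)

lemma pairing_diff_right: "pairing m (v - w) = pairing m v - pairing m w"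
  by (simp add: pairing_eq_inner inner_diff_right)

lemma pairing_uminus_right [simp]: "pairing m (- v) = - pairing m v"
  by (simp add: pairing_eq_inner)

lemma pairing_zero_right [simp]: "pairing m 0 = 0"
  by (simp add: pairing_eq_inner)

lemma pairing_scaleR [simp]: "pairing m (c *\<^sub>R v) = c * pairing m v"
  by (simp add: pairing_eq_inner)

lemma pairing_sum_right: "pairing m (\<Sum>i\<in>I. f i) = (\<Sum>i\<in>I. pairing m (f i))"
  by (simp add: pairing_eq_inner inner_sum_right)

lemmas pairing_simps = pairing_add_left pairing_diff_left pairing_uminus_left pairing_vmult
  pairing_add_right pairing_diff_right

definition lattice_vec :: "real ^ 'n \<Rightarrow> bool" where
  "lattice_vec v \<longleftrightarrow> (\<forall>i. v $ i \<in> \<int>)"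

lemma pairing_Ints: "lattice_vec v \<Longrightarrow> pairing m v \<in> \<int>"
  unfolding pairing_def lattice_vec_def by (intro Ints_sum Ints_mult) auto

text \<open>The floor only changes the type: on lattice vectors it is exact, by
  \<open>of_int_ipair\<close>, and integrality then turns a strict inequality into a gap of at least
  one.\<close>

definition ipair :: "int ^ 'n \<Rightarrow> real ^ 'n \<Rightarrow> int" where
  "ipair m v = \<lfloor>pairing m v\<rfloor>"

lemma of_int_ipair: "lattice_vec v \<Longrightarrow> real_of_int (ipair m v) = pairing m v"
  unfolding ipair_def using pairing_Ints[of v m] by (auto elim: Ints_cases)

lemma ipair_add: "lattice_vec v \<Longrightarrow> ipair (m + m') v = ipair m v + ipair m' v"
  using of_int_ipair[of v] by (metis of_int_add of_int_eq_iff pairing_add_left)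

lemma ipair_diff: "lattice_vec v \<Longrightarrow> ipair (m - m') v = ipair m v - ipair m' v"
  using of_int_ipair[of v] by (metis of_int_diff of_int_eq_iff pairing_diff_left)

lemma ipair_vmult: "lattice_vec v \<Longrightarrow> ipair (k *s m) v = k * ipair m v"
  using of_int_ipair[of v] by (metis of_int_mult of_int_eq_iff pairing_vmult)

lemma ipair_zero [simp]: "ipair 0 v = 0"
  by (simp add: ipair_def)

lemma pairing_axis: "pairing (axis i 1) v = v $ i"
  by (simp add: pairing_def axis_def if_distrib[of real_of_int] if_distrib[of "\<lambda>x. x * _"] cong: if_cong)

lemma real_vec_eq_0: "real_vec m = 0 \<longleftrightarrow> m = 0"
  by (simp add: real_vec_def vec_eq_iff)

text \<open>Dirichlet approximation replaces a real solution of a finite system of homogeneous linear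
  sign conditions with integer coefficients by an integral one.\<close>

lemma integral_sign_vector:
  fixes x :: "'i \<Rightarrow> real" and C :: "('i \<Rightarrow> int) set"
  assumes "finite I" "finite C"
  obtains y :: "'i \<Rightarrow> int" where
    "\<And>c. c \<in> C \<Longrightarrow> sgn (\<Sum>i\<in>I. real_of_int (c i) * real_of_int (y i)) = sgn (\<Sum>i\<in>I. real_of_int (c i) * x i)"
proof -
  define L where "L c = (\<Sum>i\<in>I. real_of_int (c i) * x i)" for c :: "'i \<Rightarrow> int"
  \<comment> \<open>The leading 1 makes \<open>K\<close> positive and larger than the sum of the
    absolute coefficients of every form; coordinates approximated within 1/N then change the forms
    by at most K/N.\<close>
  define K where "K = 1 + (\<Sum>c\<in>C. \<Sum>i\<in>I. \<bar>real_of_int (c i)\<bar>)"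
  have K0: "K > 0" unfolding K_def by (intro add_pos_nonneg sum_nonneg) auto
  have cK: "(\<Sum>i\<in>I. \<bar>real_of_int (c i)\<bar>) < K" if "c \<in> C" for c
    using member_le_sum[OF that, of "\<lambda>c. \<Sum>i\<in>I. \<bar>real_of_int (c i)\<bar>"] assms(2)
    unfolding K_def by (simp add: sum_nonneg)
  \<comment> \<open>\<open>d\<close> is a lower bound for all nonzero absolute values of the forms;
    inserting 1 makes the set nonempty and gives \<open>d \<le> 1\<close>, which settles the forms
    of value zero.\<close>
  define D where "D = insert 1 ((\<lambda>c. \<bar>L c\<bar>) ` {c\<in>C. L c \<noteq> 0})"
  define d where "d = Min D"
  have D: "finite D" "D \<noteq> {}" "\<forall>t\<in>D. t > 0" using assms(2) by (auto simp: D_def)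
  have d0: "d > 0" using D by (simp add: d_def)
  have d1: "d \<le> 1" using D(1) by (simp add: d_def D_def)
  have dL: "d \<le> \<bar>L c\<bar>" if "c \<in> C" "L c \<noteq> 0" for c
    unfolding d_def using D(1) that by (intro Min_le) (auto simp: D_def)
  obtain N :: nat where N: "K / d < real N" using reals_Archimedean2 by blast
  have N0: "N > 0"
    using N K0 d0 by (metis divide_pos_pos gr0I of_nat_0 order_less_asym)
  have KN: "K / N < d" using N N0 d0 by (simp add: field_simps)
  obtain e where e: "bij_betw e I {0..<card I}"
    using ex_bij_betw_finite_nat[OF assms(1)] by blast
  define e' where "e' = inv_into I e"
  have e': "e' (e i) = i" if "i \<in> I" for i
    unfolding e'_def using that e by (simp add: bij_betw_def)
  have ei: "e i < card I" if "i \<in> I" for i using e that by (auto simp: bij_betw_def)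
  obtain q p where q: "0 < q" and qp: "\<And>i. i < card I \<Longrightarrow> \<bar>of_int q * x (e' i) - of_int (p i)\<bar> < 1 / N"
    using Dirichlet_approx_simult[OF N0, of "card I" "\<lambda>i. x (e' i)"] by metis
  define y where "y i = p (e i)" for i
  have qy: "\<bar>of_int q * x i - of_int (y i)\<bar> < 1 / N" if "i \<in> I" for i
    using qp[OF ei[OF that]] e'[OF that] by (simp add: y_def)
  have main: "sgn (\<Sum>i\<in>I. real_of_int (c i) * real_of_int (y i)) = sgn (L c)" if c: "c \<in> C" for c
  proof -
    define Y where "Y = (\<Sum>i\<in>I. c i * y i)"
    have Yr: "(\<Sum>i\<in>I. real_of_int (c i) * real_of_int (y i)) = of_int Y" by (simp add: Y_def)
    have "of_int q * L c - of_int Y = (\<Sum>i\<in>I. real_of_int (c i) * (of_int q * x i - of_int (y i)))"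
      unfolding L_def Y_def by (simp add: sum_distrib_left sum_subtractf algebra_simps)
    also have "\<bar>\<dots>\<bar> \<le> (\<Sum>i\<in>I. \<bar>real_of_int (c i)\<bar> * (1 / N))"
      by (rule order_trans[OF sum_abs], unfold abs_mult, intro sum_mono mult_left_mono less_imp_le[OF qy]) auto
    also have "\<dots> = (\<Sum>i\<in>I. \<bar>real_of_int (c i)\<bar>) * (1 / N)" by (simp add: sum_divide_distrib)
    also have "\<dots> \<le> K * (1 / N)" using cK[OF c] by (intro mult_right_mono) auto
    also have "\<dots> < d" using KN by simp
    finally have *: "\<bar>of_int q * L c - of_int Y\<bar> < d" .
    show ?thesis unfolding Yr
    proof (cases "L c = 0")
      case True
      \<comment> \<open>An integer of absolute value below 1 is 0, so equations are preserved
        exactly.\<close>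
      then have "\<bar>real_of_int Y\<bar> < 1" using * d1 by simp
      then have "Y = 0" by linarith
      then show "sgn (real_of_int Y) = sgn (L c)" using True by simp
    next
      case False
      have "d \<le> \<bar>L c\<bar>" using dL[OF c False] .
      \<comment> \<open>The common denominator \<open>q\<close> can only enlarge the value, which
        therefore still dominates the rounding error.\<close>
      moreover have "real_of_int q \<ge> 1" using q by linarith
      ultimately have "1 * d \<le> real_of_int q * \<bar>L c\<bar>" using d0 by (intro mult_mono) auto
      then have dqL: "d \<le> \<bar>of_int q * L c\<bar>" using q by (simp add: abs_mult)
      then show "sgn (real_of_int Y) = sgn (L c)"
        using * q False
      proof (cases "L c > 0")
        case True
        then have "0 < of_int q * L c" using q by simp
        with True show ?thesis using * dqL by (simp add: sgn_if)
      next
        case F: False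
        then have "of_int q * L c < 0" using q False by (simp add: mult_less_0_iff)
        moreover from this have "real_of_int Y < 0" using * dqL by linarith
        ultimately show ?thesis using F False by (simp add: sgn_if)
      qed
    qed
  qed
  show thesis by (rule that[of y]) (use main in \<open>simp add: L_def\<close>)
qed

text \<open>The bridge from separating hyperplanes to characters: strict inequalities, weak ones and
  zeros on finitely many lattice vectors all survive the rounding.\<close>

lemma integral_sign_pairing:
  fixes x :: "real ^ 'n" and S :: "(real ^ 'n) set"
  assumes "finite S" "\<And>v. v \<in> S \<Longrightarrow> lattice_vec v"
  obtains m where "\<And>v. v \<in> S \<Longrightarrow> sgn (pairing m v) = sgn (x \<bullet> v)"
proof -
  obtain y :: "'n \<Rightarrow> int" where y: "\<And>c. c \<in> (\<lambda>v i. \<lfloor>v $ i\<rfloor>) ` S \<Longrightarrow>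
    sgn (\<Sum>i\<in>UNIV. real_of_int (c i) * real_of_int (y i)) = sgn (\<Sum>i\<in>UNIV. real_of_int (c i) * x $ i)"
    using integral_sign_vector[of UNIV "(\<lambda>v i. \<lfloor>v $ i\<rfloor>) ` S" "\<lambda>i. x $ i"] assms(1) by auto
  show thesis
  proof (rule that[of "\<chi> i. y i"])
    fix v assume v: "v \<in> S"
    have "real_of_int \<lfloor>v $ i\<rfloor> = v $ i" for i
      using assms(2)[OF v] unfolding lattice_vec_def by (metis Ints_cases floor_of_int)
    then show "sgn (pairing (\<chi> i. y i) v) = sgn (x \<bullet> v)"
      using y[OF imageI[OF v]] unfolding pairing_def inner_vec_def by (simp add: mult.commute del: of_int_floor_cancel)
  qed
qed

subsection \<open>Finitely generated cones\<close>

lemma convex_cone_hull_finite: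
  fixes S :: "'a::real_vector set"
  assumes "finite S" "v \<in> convex_cone hull S"
  obtains c where "\<And>s. s \<in> S \<Longrightarrow> 0 \<le> c s" "v = (\<Sum>s\<in>S. c s *\<^sub>R s)"
proof -
  let ?T = "{\<Sum>s\<in>S. c s *\<^sub>R s | c. \<forall>s\<in>S. (0::real) \<le> c s}"
  have "convex_cone hull S \<subseteq> ?T"
  proof (rule hull_minimal)
    show "S \<subseteq> ?T"
    proof
      fix s assume "s \<in> S"
      then have "s = (\<Sum>t\<in>S. (if t = s then 1 else 0 :: real) *\<^sub>R t)"
        using assms(1) by (simp add: if_distrib[of "\<lambda>x. x *\<^sub>R _"] cong: if_cong)
      then show "s \<in> ?T" by (intro CollectI exI[of _ "\<lambda>t. if t = s then 1 else 0"]) auto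
    qed
    show "convex_cone ?T"
      unfolding convex_cone_iff
    proof (intro conjI ballI allI impI)
      show "0 \<in> ?T" by (auto intro!: exI[of _ "\<lambda>_. 0"])
      fix x y assume "x \<in> ?T" "y \<in> ?T"
      then obtain c d where "x = (\<Sum>s\<in>S. c s *\<^sub>R s)" "y = (\<Sum>s\<in>S. d s *\<^sub>R s)" "\<forall>s\<in>S. 0 \<le> c s" "\<forall>s\<in>S. 0 \<le> d s"
        by auto
      then show "x + y \<in> ?T"
        by (auto intro!: exI[of _ "\<lambda>s. c s + d s"] simp: sum.distrib scaleR_left_distrib)
    next
      fix x and a :: real assume "x \<in> ?T" "0 \<le> a"
      then obtain c where "x = (\<Sum>s\<in>S. c s *\<^sub>R s)" "\<forall>s\<in>S. 0 \<le> c s" by auto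
      then show "a *\<^sub>R x \<in> ?T" using \<open>0 \<le> a\<close>
        by (auto intro!: exI[of _ "\<lambda>s. a * c s"] simp: scaleR_sum_right)
    qed
  qed
  then show thesis using assms(2) that by blast
qed

lemma convex_cone_sum:
  assumes "convex_cone C" "\<And>i. i \<in> I \<Longrightarrow> f i \<in> C"
  shows "(\<Sum>i\<in>I. f i) \<in> C"
  using assms(2)
  by (induction I rule: infinite_finite_induct)
     (auto simp: convex_cone_contains_0[OF assms(1)] convex_cone_add[OF assms(1)])

lemma convex_cone_scaleR: "convex_cone C \<Longrightarrow> 0 \<le> c \<Longrightarrow> v \<in> C \<Longrightarrow> c *\<^sub>R v \<in> C"
  by (simp add: convex_cone_def conic_def)

text \<open>Faces are defined through open segments; halving the sum turns it into a midpoint, which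
  still lies in the cone \<open>F\<close>.\<close>

lemma face_of_cone_add:
  assumes F: "F face_of C" and C: "convex_cone C" "convex_cone F"
    and ab: "a \<in> C" "b \<in> C" "a + b \<in> F"
  shows "a \<in> F" "b \<in> F"
proof -
  have mid: "(1/2) *\<^sub>R (a + b) \<in> F" using convex_cone_scaleR[OF C(2) _ ab(3), of "1/2"] by simp
  have "a \<in> F \<and> b \<in> F"
  proof (cases "a = b")
    case True
    then have "(1/2) *\<^sub>R (a + b) = a" by (simp flip: scaleR_2)
    then show ?thesis using True mid by simp
  next
    case False
    then have "midpoint a b \<in> open_segment a b" by simp
    moreover have "midpoint a b \<in> F" using mid by (simp add: midpoint_def)
    ultimately show ?thesis using F ab unfolding face_of_def by blast
  qed
  then show "a \<in> F" "b \<in> F" by auto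
qed

lemma convex_cone_hull_pairing_nonneg:
  "(\<forall>v\<in>convex_cone hull S. 0 \<le> pairing m v) \<longleftrightarrow> (\<forall>v\<in>S. 0 \<le> pairing m v)"
proof
  assume "\<forall>v\<in>S. 0 \<le> pairing m v"
  then have "S \<subseteq> {v. 0 \<le> pairing m v}" by auto
  moreover have "convex_cone {v. 0 \<le> pairing m v}"
    by (auto simp: convex_cone_iff pairing_simps)
  ultimately have "convex_cone hull S \<subseteq> {v. 0 \<le> pairing m v}" by (rule hull_minimal)
  then show "\<forall>v\<in>convex_cone hull S. 0 \<le> pairing m v" by auto
qed (auto intro: hull_inc)

text \<open>The separation property of fans. On the cone \<open>C\<close> generated by
  \<open>S\<close> and the negatives of \<open>T\<close>, take a nonnegative functional that
  vanishes only on those generators whose negatives also lie in \<open>C\<close>. If it vanishes at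
  v in \<sigma>, then -v = a - b with a in \<sigma> and b in \<tau>, so v + a lies in both cones and
  the face property puts v into \<tau>; the other side is symmetric.\<close>

lemma separating_integral_functional:
  fixes S T :: "(real ^ 'n) set"
  assumes fin: "finite S" "finite T" and lat: "\<And>v. v \<in> S \<union> T \<Longrightarrow> lattice_vec v"
    and \<sigma>: "\<sigma> = convex_cone hull S" and \<tau>: "\<tau> = convex_cone hull T"
    and f\<sigma>: "(\<sigma> \<inter> \<tau>) face_of \<sigma>" and f\<tau>: "(\<sigma> \<inter> \<tau>) face_of \<tau>"
  obtains m where "\<And>v. v \<in> \<sigma> \<Longrightarrow> 0 \<le> pairing m v" "\<And>v. v \<in> \<sigma> \<Longrightarrow> pairing m v = 0 \<longleftrightarrow> v \<in> \<tau>"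
    "\<And>v. v \<in> \<tau> \<Longrightarrow> pairing m v \<le> 0" "\<And>v. v \<in> \<tau> \<Longrightarrow> pairing m v = 0 \<longleftrightarrow> v \<in> \<sigma>"
proof -
  define G where "G = S \<union> uminus ` T"
  define C where "C = convex_cone hull G"
  have finG: "finite G" using fin by (simp add: G_def)
  have cC: "convex_cone C" "closed C" "convex C"
    by (simp_all add: C_def convex_cone_convex_cone_hull closed_convex_cone_hull finG convex_convex_cone_hull)
  have c\<sigma>: "convex_cone \<sigma>" and c\<tau>: "convex_cone \<tau>" by (simp_all add: \<sigma> \<tau> convex_cone_convex_cone_hull)
  have cI: "convex_cone (\<sigma> \<inter> \<tau>)" using c\<sigma> c\<tau> by (auto simp: convex_cone_iff)
  \<comment> \<open>A hyperplane strictly separating -g from the closed cone \<open>C\<close> has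
    negative level, since 0 is in \<open>C\<close>; a point of negative value could be scaled down
    to that level, so there is none.\<close>
  have "\<exists>u. (\<forall>x\<in>C. 0 \<le> u \<bullet> x) \<and> (- g \<notin> C \<longrightarrow> 0 < u \<bullet> g)" for g
  proof (cases "- g \<in> C")
    case True then show ?thesis by (auto intro!: exI[of _ 0])
  next
    case False
    then obtain a b where ab: "a \<bullet> (- g) < b" "\<forall>x\<in>C. b < a \<bullet> x"
      using separating_hyperplane_closed_point cC by blast
    have b0: "b < 0" using ab(2) convex_cone_contains_0[OF cC(1)] by force
    have "0 \<le> a \<bullet> x" if x: "x \<in> C" for x
    proof (rule ccontr)
      assume "\<not> 0 \<le> a \<bullet> x"
      then have neg: "a \<bullet> x < 0" by simp
      have "(b / (a \<bullet> x)) *\<^sub>R x \<in> C"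
        using convex_cone_scaleR[OF cC(1) _ x] b0 neg by (simp add: divide_nonpos_nonpos)
      then have "b < a \<bullet> ((b / (a \<bullet> x)) *\<^sub>R x)" using ab(2) by blast
      then show False using neg by simp
    qed
    then show ?thesis using ab b0 by (intro exI[of _ a]) auto
  qed
  then obtain u where u: "\<And>g x. x \<in> C \<Longrightarrow> 0 \<le> u g \<bullet> x" "\<And>g. - g \<notin> C \<Longrightarrow> 0 < u g \<bullet> g" by metis
  \<comment> \<open>All summands are nonnegative on \<open>C\<close>, so the sum is positive
    wherever one of them is.\<close>
  define x where "x = (\<Sum>g\<in>G. u g)"
  have GC: "g \<in> C" if "g \<in> G" for g using that by (simp add: C_def hull_inc)
  have x0: "0 \<le> x \<bullet> g" if "g \<in> G" for g
    unfolding x_def inner_sum_left using u(1) GC[OF that] by (intro sum_nonneg) auto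
  have x1: "- g \<in> C" if g: "g \<in> G" "x \<bullet> g = 0" for g
  proof (rule ccontr)
    assume "- g \<notin> C"
    then have "0 < u g \<bullet> g" by (rule u(2))
    also have "u g \<bullet> g \<le> (\<Sum>h\<in>G. u h \<bullet> g)"
      using finG u(1) GC[OF g(1)] by (intro member_le_sum[OF g(1)]) auto
    finally show False using g(2) by (simp add: x_def inner_sum_left)
  qed
  have "lattice_vec g" if "g \<in> G" for g
    using that lat by (auto simp: G_def lattice_vec_def)
  then obtain m where m: "\<And>g. g \<in> G \<Longrightarrow> sgn (pairing m g) = sgn (x \<bullet> g)"
    using integral_sign_pairing[OF finG] by metis
  have m0: "0 \<le> pairing m g" if "g \<in> G" for g
    using m[OF that] x0[OF that] by (auto simp: sgn_if split: if_splits)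
  have m1: "- g \<in> C" if "g \<in> G" "pairing m g = 0" for g
    using m[OF that(1)] x1[OF that(1)] that(2) by (simp add: sgn_zero_iff)
  have mC: "0 \<le> pairing m v" if "v \<in> C" for v
    using convex_cone_hull_pairing_nonneg[of G m] m0 that by (auto simp: C_def)
  have C_elem: "\<exists>a\<in>\<sigma>. \<exists>b\<in>\<tau>. v = a - b" if "v \<in> C" for v
  proof -
    have "v \<in> convex_cone hull (S \<union> uminus ` T)" using that by (simp add: C_def G_def)
    then obtain a b where ab: "a \<in> convex_cone hull S" "b \<in> convex_cone hull (uminus ` T)" "v = a + b"
      unfolding convex_cone_hull_Un by auto
    have "linear (uminus :: real ^ 'n \<Rightarrow> _)" by (simp add: linear_iff)
    then have "b \<in> uminus ` \<tau>" using ab(2) by (simp add: convex_cone_hull_linear_image \<tau>)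
    then show ?thesis using ab by (force simp: \<sigma>)
  qed
  have \<sigma>C: "v \<in> C" if "v \<in> \<sigma>" for v
    using that hull_mono[of S G convex_cone] by (auto simp: \<sigma> C_def G_def)
  have \<tau>C: "- v \<in> C" if "v \<in> \<tau>" for v
  proof -
    have "linear (uminus :: real ^ 'n \<Rightarrow> _)" by (simp add: linear_iff)
    then have "- v \<in> convex_cone hull (uminus ` T)" using that by (simp add: convex_cone_hull_linear_image \<tau>)
    then show ?thesis using hull_mono[of "uminus ` T" G convex_cone] by (auto simp: C_def G_def)
  qed
  \<comment> \<open>A point of value zero is a combination of generators of value zero only, and the
    negatives of these lie in \<open>C\<close>.\<close>
  have neg\<sigma>: "- v \<in> C" if v: "v \<in> \<sigma>" "pairing m v = 0" for v
  proof -
    obtain c where c: "\<And>s. s \<in> S \<Longrightarrow> 0 \<le> c s" "v = (\<Sum>s\<in>S. c s *\<^sub>R s)"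
      using convex_cone_hull_finite[OF fin(1)] v(1) unfolding \<sigma> by metis
    have "(\<Sum>s\<in>S. c s * pairing m s) = 0" using v(2) c(2) by (simp add: pairing_sum_right)
    then have z: "c s * pairing m s = 0" if "s \<in> S" for s
      using sum_nonneg_eq_0_iff[OF fin(1), of "\<lambda>s. c s * pairing m s"] c(1) m0 that by (auto simp: G_def)
    have "- v = (\<Sum>s\<in>S. c s *\<^sub>R (- s))" by (simp add: c(2) sum_negf)
    also have "\<dots> \<in> C"
    proof (rule convex_cone_sum[OF cC(1)])
      fix s assume s: "s \<in> S"
      show "c s *\<^sub>R - s \<in> C"
        using z[OF s] m1[of s] s c(1)[OF s] convex_cone_scaleR[OF cC(1)] convex_cone_contains_0[OF cC(1)]
        by (cases "c s = 0") (auto simp: G_def simp del: scaleR_minus_right)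
    qed
    finally show ?thesis .
  qed
  have neg\<tau>: "v \<in> C" if v: "v \<in> \<tau>" "pairing m v = 0" for v
  proof -
    obtain c where c: "\<And>s. s \<in> T \<Longrightarrow> 0 \<le> c s" "v = (\<Sum>s\<in>T. c s *\<^sub>R s)"
      using convex_cone_hull_finite[OF fin(2)] v(1) unfolding \<tau> by metis
    have "(\<Sum>s\<in>T. c s * pairing m (- s)) = 0" using v(2) c(2) by (simp add: pairing_sum_right sum_negf)
    then have z: "c s * pairing m (- s) = 0" if "s \<in> T" for s
      using sum_nonneg_eq_0_iff[OF fin(2), of "\<lambda>s. c s * pairing m (- s)"] c(1) m0 that
      by (metis (no_types, lifting) G_def UnCI imageI mult_nonneg_nonneg)
    show ?thesis unfolding c(2)
    proof (rule convex_cone_sum[OF cC(1)])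
      fix s assume s: "s \<in> T"
      show "c s *\<^sub>R s \<in> C"
        using z[OF s] m1[of "- s"] s c(1)[OF s] convex_cone_scaleR[OF cC(1)] convex_cone_contains_0[OF cC(1)]
        by (cases "c s = 0") (auto simp: G_def)
    qed
  qed
  show thesis
  proof (rule that[of m])
    fix v assume v: "v \<in> \<sigma>"
    show "0 \<le> pairing m v" using mC[OF \<sigma>C[OF v]] .
    show "pairing m v = 0 \<longleftrightarrow> v \<in> \<tau>"
    proof
      assume "pairing m v = 0"
      from C_elem[OF neg\<sigma>[OF v this]] obtain a b where "a \<in> \<sigma>" "b \<in> \<tau>" "- v = a - b" by auto
      then have "v + a = b" by (simp add: algebra_simps minus_equation_iff[of v])
      moreover have "v + a \<in> \<sigma>" using convex_cone_add[OF c\<sigma>] v \<open>a \<in> \<sigma>\<close> by simp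
      ultimately have "v + a \<in> \<sigma> \<inter> \<tau>" using \<open>b \<in> \<tau>\<close> by simp
      then show "v \<in> \<tau>" using face_of_cone_add(1)[OF f\<sigma> c\<sigma> cI v \<open>a \<in> \<sigma>\<close>] by simp
    next
      assume "v \<in> \<tau>"
      then show "pairing m v = 0" using mC[OF \<sigma>C[OF v]] mC[OF \<tau>C[of v]] by (simp add: pairing_simps)
    qed
  next
    fix v assume v: "v \<in> \<tau>"
    show "pairing m v \<le> 0" using mC[OF \<tau>C[OF v]] by simp
    show "pairing m v = 0 \<longleftrightarrow> v \<in> \<sigma>"
    proof
      assume "pairing m v = 0"
      from C_elem[OF neg\<tau>[OF v this]] obtain a b where "a \<in> \<sigma>" "b \<in> \<tau>" "v = a - b" by auto
      then have "v + b \<in> \<sigma> \<inter> \<tau>" using convex_cone_add[OF c\<tau> v \<open>b \<in> \<tau>\<close>] by simp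
      then show "v \<in> \<sigma>" using face_of_cone_add(1)[OF f\<tau> c\<tau> cI v \<open>b \<in> \<tau>\<close>] by simp
    next
      assume "v \<in> \<sigma>"
      then show "pairing m v = 0" using mC[OF \<tau>C[OF v]] mC[OF \<sigma>C[of v]] by (simp add: pairing_simps)
    qed
  qed
qed


subsection \<open>Points of a toric variety\<close>

text \<open>The invertible elements of \<open>dual_semigroup \<sigma>\<close>: the characters that
  are units on the chart of \<sigma>.\<close>

definition perp :: "(real ^ 'n) set \<Rightarrow> (int ^ 'n) set" where
  "perp \<sigma> = {m. \<forall>v\<in>\<sigma>. pairing m v = 0}"

lemma perp_dual: "m \<in> perp \<sigma> \<Longrightarrow> m \<in> dual_semigroup \<sigma>"
  by (simp add: perp_def dual_semigroup_def)

lemma dual_zero [simp]: "0 \<in> dual_semigroup \<sigma>"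
  by (simp add: dual_semigroup_def)

lemma dual_add: "m \<in> dual_semigroup \<sigma> \<Longrightarrow> m' \<in> dual_semigroup \<sigma> \<Longrightarrow> m + m' \<in> dual_semigroup \<sigma>"
  by (auto simp: dual_semigroup_def pairing_simps)

lemma dual_antimono: "\<tau> \<subseteq> \<sigma> \<Longrightarrow> dual_semigroup \<sigma> \<subseteq> dual_semigroup \<tau>"
  by (auto simp: dual_semigroup_def)

lemma dual_vmult: "m \<in> dual_semigroup \<sigma> \<Longrightarrow> 0 \<le> k \<Longrightarrow> k *s m \<in> dual_semigroup \<sigma>"
  by (auto simp: dual_semigroup_def pairing_simps)

lemma perp_zero [simp]: "0 \<in> perp \<sigma>"
  by (simp add: perp_def)

lemma perp_add: "m \<in> perp \<sigma> \<Longrightarrow> m' \<in> perp \<sigma> \<Longrightarrow> m + m' \<in> perp \<sigma>"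
  by (auto simp: perp_def pairing_simps)

lemma perp_uminus: "m \<in> perp \<sigma> \<Longrightarrow> - m \<in> perp \<sigma>"
  by (auto simp: perp_def pairing_simps)

lemma perp_antimono: "\<tau> \<subseteq> \<sigma> \<Longrightarrow> perp \<sigma> \<subseteq> perp \<tau>"
  by (auto simp: perp_def)

lemma affine_pointD:
  assumes "x \<in> affine_toric_points \<sigma>"
  shows affine_point_extensional: "x \<in> extensional (dual_semigroup \<sigma>)"
    and affine_point_zero: "x 0 = 1"
    and affine_point_add: "m \<in> dual_semigroup \<sigma> \<Longrightarrow> m' \<in> dual_semigroup \<sigma> \<Longrightarrow> x (m + m') = x m * x m'"
  using assms by (auto simp: affine_toric_points_def)

lemma affine_point_vmult:
  assumes "x \<in> affine_toric_points \<sigma>" "m \<in> dual_semigroup \<sigma>"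
  shows "x (int k *s m) = x m ^ k"
proof (induction k)
  case 0 then show ?case using affine_point_zero[OF assms(1)] by (simp add: vec_eq_iff)
next
  case (Suc k)
  have "int (Suc k) *s m = m + int k *s m" by (simp add: vec_eq_iff algebra_simps)
  then show ?case
    using Suc affine_point_add[OF assms(1,2) dual_vmult[OF assms(2), of "int k"]] by simp
qed

lemma affine_point_restrict:
  assumes "\<tau> \<subseteq> \<sigma>" "z \<in> affine_toric_points \<tau>"
  shows "restrict z (dual_semigroup \<sigma>) \<in> affine_toric_points \<sigma>"
  using assms(2) subsetD[OF dual_antimono[OF assms(1)]]
  by (auto simp: affine_toric_points_def dual_add)

text \<open>The points of the closed torus orbit in the affine chart of \<gamma>: a character
  survives exactly when it is invertible there.\<close>

definition unit_type :: "(real ^ 'n) set \<Rightarrow> (int ^ 'n \<Rightarrow> complex) \<Rightarrow> bool" where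
  "unit_type \<gamma> z \<longleftrightarrow> z \<in> affine_toric_points \<gamma> \<and> (\<forall>m\<in>dual_semigroup \<gamma>. z m \<noteq> 0 \<longleftrightarrow> m \<in> perp \<gamma>)"

section \<open>Faces, separation and localisation in a fan\<close>

locale toric =
  fixes \<Sigma> :: "(real ^ 'n) set set"
  assumes fan: "fan \<Sigma>"
begin

lemma finite_fan: "finite \<Sigma>" and fan_ne: "\<Sigma> \<noteq> {}"
  using fan by (auto simp: fan_def)

lemma fan_gens:
  assumes "\<sigma> \<in> \<Sigma>"
  obtains S where "finite S" "\<And>v. v \<in> S \<Longrightarrow> lattice_vec v" "\<sigma> = convex_cone hull S"
  using fan assms unfolding fan_def rational_polyhedral_cone_def lattice_vec_def by metis

lemma fan_cone: "\<sigma> \<in> \<Sigma> \<Longrightarrow> convex_cone \<sigma>"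
  by (metis fan_gens convex_cone_convex_cone_hull)

lemma fan_zero_mem: "\<sigma> \<in> \<Sigma> \<Longrightarrow> 0 \<in> \<sigma>"
  by (simp add: convex_cone_contains_0 fan_cone)

lemma fan_closed: "\<sigma> \<in> \<Sigma> \<Longrightarrow> closed \<sigma>"
  by (metis fan_gens closed_convex_cone_hull)

lemma fan_pointed: "\<sigma> \<in> \<Sigma> \<Longrightarrow> v \<in> \<sigma> \<Longrightarrow> - v \<in> \<sigma> \<Longrightarrow> v = 0"
  using fan by (auto simp: fan_def strongly_convex_def)

lemma fan_face: "\<sigma> \<in> \<Sigma> \<Longrightarrow> \<tau> face_of \<sigma> \<Longrightarrow> \<tau> \<noteq> {} \<Longrightarrow> \<tau> \<in> \<Sigma>"
  using fan by (auto simp: fan_def)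

lemma fan_Int_face: "\<sigma> \<in> \<Sigma> \<Longrightarrow> \<tau> \<in> \<Sigma> \<Longrightarrow> (\<sigma> \<inter> \<tau>) face_of \<sigma>" "\<sigma> \<in> \<Sigma> \<Longrightarrow> \<tau> \<in> \<Sigma> \<Longrightarrow> (\<sigma> \<inter> \<tau>) face_of \<tau>"
  using fan by (auto simp: fan_def)

lemma fan_Int: "\<sigma> \<in> \<Sigma> \<Longrightarrow> \<tau> \<in> \<Sigma> \<Longrightarrow> \<sigma> \<inter> \<tau> \<in> \<Sigma>"
  using fan_face[OF _ fan_Int_face(1)] fan_zero_mem by blast

lemma fan_zero_cone: "{0} \<in> \<Sigma>"
proof -
  obtain \<sigma> where \<sigma>: "\<sigma> \<in> \<Sigma>" using fan_ne by blast
  have "{0} face_of \<sigma>"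
    unfolding face_of_singleton extreme_point_of_def
  proof (intro conjI ballI fan_zero_mem[OF \<sigma>] notI)
    fix a b assume ab: "a \<in> \<sigma>" "b \<in> \<sigma>" "0 \<in> open_segment a b"
    then obtain u where u: "a \<noteq> b" "0 < u" "u < 1" "0 = (1 - u) *\<^sub>R a + u *\<^sub>R b"
      by (auto simp: in_segment)
    have "(1 - u) *\<^sub>R a \<in> \<sigma>" "u *\<^sub>R b \<in> \<sigma>"
      using convex_cone_scaleR[OF fan_cone[OF \<sigma>]] ab u by auto
    moreover have "u *\<^sub>R b = - ((1 - u) *\<^sub>R a)" using u(4) by (simp add: eq_neg_iff_add_eq_0 add.commute)
    ultimately have "(1 - u) *\<^sub>R a = 0" using fan_pointed[OF \<sigma>] by metis
    then show False using u by auto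
  qed
  then show ?thesis using fan_face[OF \<sigma>] by blast
qed

lemma separation:
  assumes "\<sigma> \<in> \<Sigma>" "\<tau> \<in> \<Sigma>"
  obtains m where "m \<in> dual_semigroup \<sigma>" "\<And>v. v \<in> \<sigma> \<Longrightarrow> pairing m v = 0 \<longleftrightarrow> v \<in> \<tau>"
    "- m \<in> dual_semigroup \<tau>" "\<And>v. v \<in> \<tau> \<Longrightarrow> pairing m v = 0 \<longleftrightarrow> v \<in> \<sigma>"
proof -
  obtain S where S: "finite S" "\<And>v. v \<in> S \<Longrightarrow> lattice_vec v" "\<sigma> = convex_cone hull S"
    using fan_gens[OF assms(1)] by metis
  obtain T where T: "finite T" "\<And>v. v \<in> T \<Longrightarrow> lattice_vec v" "\<tau> = convex_cone hull T"
    using fan_gens[OF assms(2)] by metis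
  obtain m where m: "\<And>v. v \<in> \<sigma> \<Longrightarrow> 0 \<le> pairing m v" "\<And>v. v \<in> \<sigma> \<Longrightarrow> pairing m v = 0 \<longleftrightarrow> v \<in> \<tau>"
    "\<And>v. v \<in> \<tau> \<Longrightarrow> pairing m v \<le> 0" "\<And>v. v \<in> \<tau> \<Longrightarrow> pairing m v = 0 \<longleftrightarrow> v \<in> \<sigma>"
    using separating_integral_functional[OF S(1) T(1) _ S(3) T(3) fan_Int_face(1)[OF assms] fan_Int_face(2)[OF assms]]
      S(2) T(2) by (metis UnE)
  show thesis by (rule that[OF _ m(2) _ m(4)]) (use m in \<open>auto simp: dual_semigroup_def pairing_simps\<close>)
qed

lemma exposing:
  assumes "\<sigma> \<in> \<Sigma>" "\<gamma> \<in> \<Sigma>" "\<gamma> \<subseteq> \<sigma>"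
  obtains m where "m \<in> dual_semigroup \<sigma>" "m \<in> perp \<gamma>" "\<And>v. v \<in> \<sigma> \<Longrightarrow> pairing m v = 0 \<longleftrightarrow> v \<in> \<gamma>"
proof -
  obtain m where m: "m \<in> dual_semigroup \<sigma>" "\<And>v. v \<in> \<sigma> \<Longrightarrow> pairing m v = 0 \<longleftrightarrow> v \<in> \<gamma>"
    using separation[OF assms(1,2)] by metis
  then show thesis using that assms(3) by (auto simp: perp_def)
qed

text \<open>A large multiple of \<open>m0\<close> outweighs \<open>m\<close> on every generator
  where \<open>m0\<close> is positive. This is localisation of semigroup rings: characters on the
  chart of the face cut out by \<open>m0\<close> become regular on the chart of \<sigma> after
  multiplication by a power of the character of \<open>m0\<close>. All large exponents work, so
  finitely many characters can share one.\<close>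

lemma dual_shift:
  assumes \<sigma>: "\<sigma> \<in> \<Sigma>" and m0: "m0 \<in> dual_semigroup \<sigma>" and ex: "\<And>v. v \<in> \<sigma> \<Longrightarrow> pairing m0 v = 0 \<Longrightarrow> 0 \<le> pairing m v"
  shows "\<exists>L. \<forall>l\<ge>L. m + int l *s m0 \<in> dual_semigroup \<sigma>"
proof -
  obtain S where S: "finite S" "\<sigma> = convex_cone hull S" by (metis fan_gens[OF \<sigma>])
  have "\<forall>v\<in>S. \<exists>L. \<forall>l\<ge>L. 0 \<le> pairing (m + int l *s m0) v"
  proof
    fix v assume "v \<in> S"
    then have v: "v \<in> \<sigma>" using S by (simp add: hull_inc)
    have p: "0 \<le> pairing m0 v" using m0 v by (auto simp: dual_semigroup_def)
    show "\<exists>L. \<forall>l\<ge>L. 0 \<le> pairing (m + int l *s m0) v"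
    proof (cases "pairing m0 v = 0")
      case True then show ?thesis using ex[OF v] by (auto simp: pairing_simps)
    next
      case False
      then have pos: "pairing m0 v > 0" using p by simp
      obtain L :: nat where L: "- pairing m v / pairing m0 v < real L" using reals_Archimedean2 by blast
      show ?thesis
      proof (intro exI allI impI)
        fix l assume "l \<ge> L"
        then have "- pairing m v / pairing m0 v < real l" using L by linarith
        then show "0 \<le> pairing (m + int l *s m0) v" using pos by (simp add: pairing_simps field_simps)
      qed
    qed
  qed
  then obtain L where L: "\<And>v l. v \<in> S \<Longrightarrow> l \<ge> L v \<Longrightarrow> 0 \<le> pairing (m + int l *s m0) v" by metis
  show ?thesis
  proof (intro exI allI impI)
    fix l assume l: "l \<ge> Max (insert 0 (L ` S))"
    have "\<forall>v\<in>S. 0 \<le> pairing (m + int l *s m0) v"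
      using L l S(1) by auto
    then show "m + int l *s m0 \<in> dual_semigroup \<sigma>"
      using convex_cone_hull_pairing_nonneg[of S] S(2) by (simp add: dual_semigroup_def)
  qed
qed

section \<open>Orbits and the normal form of a local point\<close>

definition core :: "(real ^ 'n) set \<Rightarrow> (int ^ 'n \<Rightarrow> complex) \<Rightarrow> (real ^ 'n) set \<Rightarrow> (int ^ 'n \<Rightarrow> complex) \<Rightarrow> bool" where
  "core \<sigma> x \<gamma> z \<longleftrightarrow> \<gamma> \<in> \<Sigma> \<and> \<gamma> \<subseteq> \<sigma> \<and> unit_type \<gamma> z \<and> x = restrict z (dual_semigroup \<sigma>)"

text \<open>The core names the orbit of a point, by its cone, and the coordinates in that orbit. The
  functional exposing one candidate cone does not vanish at the point, hence is orthogonal to the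
  other candidate, which gives an inclusion and by symmetry equality. The coordinates are recovered
  from x, because a multiple of \<open>m0\<close> moves any character into the semigroup of \<sigma>
  and the character of \<open>m0\<close> is a unit on the orbit.\<close>

lemma core_unique:
  assumes \<sigma>: "\<sigma> \<in> \<Sigma>" and 1: "core \<sigma> x \<gamma> z" and 2: "core \<sigma> x \<gamma>' z'"
  shows "\<gamma> = \<gamma>'" "z = z'"
proof -
  have sub: "\<gamma>1 \<subseteq> \<gamma>2" if c: "core \<sigma> x \<gamma>1 z1" "core \<sigma> x \<gamma>2 z2" for \<gamma>1 \<gamma>2 z1 z2
  proof -
    obtain m where m: "m \<in> dual_semigroup \<sigma>" "m \<in> perp \<gamma>2" "\<And>v. v \<in> \<sigma> \<Longrightarrow> pairing m v = 0 \<longleftrightarrow> v \<in> \<gamma>2"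
      using exposing[OF \<sigma>] c unfolding core_def by metis
    have "z2 m \<noteq> 0" using c(2) m perp_dual unfolding core_def unit_type_def by metis
    moreover have "z1 m = z2 m" using c m(1) unfolding core_def by (metis restrict_apply')
    ultimately have "z1 m \<noteq> 0" by simp
    moreover have "m \<in> dual_semigroup \<gamma>1" using c(1) m(1) dual_antimono unfolding core_def by blast
    ultimately have "m \<in> perp \<gamma>1" using c(1) unfolding core_def unit_type_def by blast
    then show ?thesis using m(3) c(1) unfolding core_def perp_def by auto
  qed
  show g: "\<gamma> = \<gamma>'" using sub[OF 1 2] sub[OF 2 1] by blast
  obtain m0 where m0: "m0 \<in> dual_semigroup \<sigma>" "m0 \<in> perp \<gamma>" "\<And>v. v \<in> \<sigma> \<Longrightarrow> pairing m0 v = 0 \<longleftrightarrow> v \<in> \<gamma>"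
    using exposing[OF \<sigma>] 1 unfolding core_def by metis
  have z: "z \<in> affine_toric_points \<gamma>" "z' \<in> affine_toric_points \<gamma>" and xz: "x = restrict z (dual_semigroup \<sigma>)" "x = restrict z' (dual_semigroup \<sigma>)"
    using 1 2 g unfolding core_def unit_type_def by auto
  have "z m = z' m" if m: "m \<in> dual_semigroup \<gamma>" for m
  proof -
    obtain l where l: "m + int l *s m0 \<in> dual_semigroup \<sigma>"
      using dual_shift[OF \<sigma> m0(1), of m] m m0(3) by (auto simp: dual_semigroup_def)
    have d: "int l *s m0 \<in> dual_semigroup \<gamma>" "m0 \<in> dual_semigroup \<gamma>" using m0(2) by (auto intro: perp_dual dual_vmult)
    have e: "z (m + int l *s m0) = z' (m + int l *s m0)" "z m0 = z' m0"
      using xz l m0(1) by (metis restrict_apply')+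
    have "z m0 \<noteq> 0" using 1 d(2) m0(2) unfolding core_def unit_type_def by auto
    then show ?thesis using e affine_point_add[OF z(1) m d(1)] affine_point_add[OF z(2) m d(1)]
        affine_point_vmult[OF z(1) d(2)] affine_point_vmult[OF z(2) d(2)] by simp
  qed
  then show "z = z'" using affine_point_extensional[OF z(1)] affine_point_extensional[OF z(2)]
    by (metis extensionalityI)
qed

text \<open>The characters not vanishing at x form a face of the semigroup, because a product is
  nonzero exactly when both factors are. A nonvanishing character that is positive on as many
  generators as possible cuts out the cone of the orbit.\<close>

lemma core_exists:
  assumes \<sigma>: "\<sigma> \<in> \<Sigma>" and x: "x \<in> affine_toric_points \<sigma>"
  obtains \<gamma> z where "core \<sigma> x \<gamma> z"
proof -
  obtain S where S: "finite S" "\<sigma> = convex_cone hull S" by (metis fan_gens[OF \<sigma>])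
  define N where "N = {m\<in>dual_semigroup \<sigma>. x m \<noteq> 0}"
  have Nadd: "m + m' \<in> N \<longleftrightarrow> m \<in> N \<and> m' \<in> N" if "m \<in> dual_semigroup \<sigma>" "m' \<in> dual_semigroup \<sigma>" for m m'
    using that affine_point_add[OF x that] dual_add[OF that] by (auto simp: N_def)
  have N0: "0 \<in> N" using affine_point_zero[OF x] by (simp add: N_def)
  define T where "T m = {v\<in>S. pairing m v > 0}" for m
  have S\<sigma>: "v \<in> \<sigma>" if "v \<in> S" for v using that S by (simp add: hull_inc)
  have "\<exists>m. m \<in> N \<and> (\<forall>m'. m' \<in> N \<longrightarrow> card (T m') \<le> card (T m))"
  proof (rule ex_has_greatest_nat[of "\<lambda>m. m \<in> N" 0 "\<lambda>m. card (T m)" "Suc (card S)"])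
    show "\<forall>m. m \<in> N \<longrightarrow> card (T m) < Suc (card S)"
      using S(1) by (auto simp: T_def less_Suc_eq_le intro!: card_mono)
  qed (rule N0)
  then obtain m0 where m0: "m0 \<in> N" "\<And>m'. m' \<in> N \<Longrightarrow> card (T m') \<le> card (T m0)" by blast
  have m0d: "m0 \<in> dual_semigroup \<sigma>" using m0(1) by (simp add: N_def)
  \<comment> \<open>Otherwise \<open>m0 + m\<close> would be a nonvanishing character that is
    positive on more generators.\<close>
  have Nz: "pairing m v = 0" if m: "m \<in> N" and v: "v \<in> S" "pairing m0 v = 0" for m v
  proof (rule ccontr)
    assume "pairing m v \<noteq> 0"
    moreover have md: "m \<in> dual_semigroup \<sigma>" using m by (simp add: N_def)
    ultimately have pos: "pairing m v > 0" using S\<sigma>[OF v(1)] by (auto simp: dual_semigroup_def order_less_le)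
    have "T m0 \<subset> T (m0 + m)"
    proof
      show "T m0 \<subseteq> T (m0 + m)" using md S\<sigma> by (force simp: T_def dual_semigroup_def pairing_simps)
      have "v \<in> T (m0 + m)" "v \<notin> T m0" using v pos by (auto simp: T_def pairing_simps)
      then show "T m0 \<noteq> T (m0 + m)" by blast
    qed
    then have "card (T m0) < card (T (m0 + m))" using S(1) by (intro psubset_card_mono) (auto simp: T_def)
    then show False using m0(2)[of "m0 + m"] Nadd[OF m0d md] m0(1) m by auto
  qed
  define \<gamma> where "\<gamma> = \<sigma> \<inter> {v. real_vec m0 \<bullet> v = 0}"
  have \<gamma>_eq: "v \<in> \<gamma> \<longleftrightarrow> v \<in> \<sigma> \<and> pairing m0 v = 0" for v by (auto simp: \<gamma>_def pairing_eq_inner)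
  have "\<gamma> face_of \<sigma>" unfolding \<gamma>_def
    by (rule face_of_Int_supporting_hyperplane_ge)
       (use fan_cone[OF \<sigma>] m0d in \<open>auto simp: convex_cone_def dual_semigroup_def pairing_eq_inner\<close>)
  then have \<gamma>\<Sigma>: "\<gamma> \<in> \<Sigma>" using fan_face[OF \<sigma>] fan_zero_mem[OF \<sigma>] \<gamma>_eq[of 0] by auto
  have \<gamma>\<sigma>: "\<gamma> \<subseteq> \<sigma>" by (auto simp: \<gamma>_def)
  have m0p: "m0 \<in> perp \<gamma>" by (auto simp: perp_def \<gamma>_eq)
  have Nperp: "m \<in> N \<longleftrightarrow> m \<in> perp \<gamma>" if m: "m \<in> dual_semigroup \<sigma>" for m
  proof
    assume mN: "m \<in> N"
    show "m \<in> perp \<gamma>" unfolding perp_def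
    proof (intro CollectI ballI)
      fix v assume "v \<in> \<gamma>"
      then have v: "v \<in> \<sigma>" "pairing m0 v = 0" by (auto simp: \<gamma>_eq)
      obtain c where c: "\<And>s. s \<in> S \<Longrightarrow> 0 \<le> c s" "v = (\<Sum>s\<in>S. c s *\<^sub>R s)"
        using convex_cone_hull_finite[OF S(1)] v(1) unfolding S(2) by metis
      have nn: "0 \<le> pairing m0 s" if "s \<in> S" for s using m0d S\<sigma>[OF that] by (auto simp: dual_semigroup_def)
      have "(\<Sum>s\<in>S. c s * pairing m0 s) = 0" using v(2) c(2) by (simp add: pairing_sum_right)
      then have z: "c s * pairing m0 s = 0" if "s \<in> S" for s
        using sum_nonneg_eq_0_iff[OF S(1), of "\<lambda>s. c s * pairing m0 s"] c(1) nn that by auto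
      have "c s * pairing m s = 0" if "s \<in> S" for s
        using z[OF that] Nz[OF mN that] by auto
      then have "(\<Sum>s\<in>S. c s * pairing m s) = 0" by (intro sum.neutral) blast
      then show "pairing m v = 0" by (simp add: c(2) pairing_sum_right)
    qed
  next
    assume mp: "m \<in> perp \<gamma>"
    \<comment> \<open>\<open>m\<close> divides a power of the nonvanishing \<open>m0\<close>, so it
      does not vanish either.\<close>
    obtain l where l: "- m + int l *s m0 \<in> dual_semigroup \<sigma>"
      using dual_shift[OF \<sigma> m0d, of "- m"] mp by (auto simp: perp_def \<gamma>_eq pairing_simps)
    have "x (int l *s m0) \<noteq> 0" using affine_point_vmult[OF x m0d] m0(1) by (simp add: N_def)
    then have "m + (- m + int l *s m0) \<in> N" using dual_vmult[OF m0d] by (simp add: N_def)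
    then show "m \<in> N" using Nadd[OF m l] by simp
  qed
  have xm0: "x m0 \<noteq> 0" using m0(1) by (simp add: N_def)
  \<comment> \<open>Any admissible shift will do: \<open>z_eq\<close> shows that the quotient does
    not depend on it.\<close>
  define L where "L m = (SOME l. m + int l *s m0 \<in> dual_semigroup \<sigma>)" for m
  have L: "m + int (L m) *s m0 \<in> dual_semigroup \<sigma>" if "m \<in> dual_semigroup \<gamma>" for m
  proof -
    have "\<exists>l. m + int l *s m0 \<in> dual_semigroup \<sigma>"
      using dual_shift[OF \<sigma> m0d, of m] that by (auto simp: dual_semigroup_def \<gamma>_eq)
    then show ?thesis unfolding L_def by (rule someI_ex)
  qed
  define z where "z = restrict (\<lambda>m. x (m + int (L m) *s m0) / x m0 ^ L m) (dual_semigroup \<gamma>)"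
  have z_eq: "z m = x (m + int l *s m0) / x m0 ^ l" if m: "m \<in> dual_semigroup \<gamma>" and l: "m + int l *s m0 \<in> dual_semigroup \<sigma>" for m l
  proof -
    have "x ((m + int l *s m0) + int (L m) *s m0) = x (m + int l *s m0) * x m0 ^ L m"
      using affine_point_add[OF x l dual_vmult[OF m0d, of "int (L m)"]] affine_point_vmult[OF x m0d] by simp
    moreover have "x ((m + int (L m) *s m0) + int l *s m0) = x (m + int (L m) *s m0) * x m0 ^ l"
      using affine_point_add[OF x L[OF m] dual_vmult[OF m0d, of "int l"]] affine_point_vmult[OF x m0d] by simp
    moreover have "(m + int l *s m0) + int (L m) *s m0 = (m + int (L m) *s m0) + int l *s m0" by simp
    ultimately show ?thesis using m xm0 by (simp add: z_def field_simps)
  qed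
  have z\<sigma>: "z m = x m" if "m \<in> dual_semigroup \<sigma>" for m
    using z_eq[of m 0] that dual_antimono[OF \<gamma>\<sigma>] by auto
  have zaff: "z \<in> affine_toric_points \<gamma>"
    unfolding affine_toric_points_def
  proof (intro CollectI conjI ballI)
    show "z \<in> extensional (dual_semigroup \<gamma>)" by (simp add: z_def)
    show "z 0 = 1" using z\<sigma>[of 0] affine_point_zero[OF x] by simp
    fix m m' assume mm: "m \<in> dual_semigroup \<gamma>" "m' \<in> dual_semigroup \<gamma>"
    have e: "(m + m') + int (L m + L m') *s m0 = (m + int (L m) *s m0) + (m' + int (L m') *s m0)"
      by (simp add: vec_eq_iff algebra_simps)
    have "z (m + m') = x ((m + int (L m) *s m0) + (m' + int (L m') *s m0)) / x m0 ^ (L m + L m')"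
      using z_eq[OF dual_add[OF mm], of "L m + L m'"] dual_add[OF L[OF mm(1)] L[OF mm(2)]] unfolding e by simp
    also have "\<dots> = z m * z m'" using affine_point_add[OF x L[OF mm(1)] L[OF mm(2)]] mm
      by (simp add: z_def power_add)
    finally show "z (m + m') = z m * z m'" .
  qed
  have "unit_type \<gamma> z" unfolding unit_type_def
  proof (intro conjI ballI zaff)
    fix m assume m: "m \<in> dual_semigroup \<gamma>"
    have "z m \<noteq> 0 \<longleftrightarrow> m + int (L m) *s m0 \<in> N" using m L[OF m] xm0 by (simp add: z_def N_def)
    also have "\<dots> \<longleftrightarrow> m + int (L m) *s m0 \<in> perp \<gamma>" using Nperp[OF L[OF m]] .
    also have "\<dots> \<longleftrightarrow> m \<in> perp \<gamma>" using m0p by (auto simp: perp_def pairing_simps)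
    finally show "z m \<noteq> 0 \<longleftrightarrow> m \<in> perp \<gamma>" .
  qed
  moreover have "x = restrict z (dual_semigroup \<sigma>)"
    using z\<sigma> affine_point_extensional[OF x] by (auto intro!: extensionalityI[of x "dual_semigroup \<sigma>"])
  ultimately have "core \<sigma> x \<gamma> z" using \<gamma>\<Sigma> \<gamma>\<sigma> by (simp add: core_def)
  then show thesis by (rule that)
qed

text \<open>The class of a local point is determined by its unit-type core, which lies over the smallest
  cone whose chart contains the point.\<close>

definition core_class :: "(real ^ 'n) set \<Rightarrow> (int ^ 'n \<Rightarrow> complex) \<Rightarrow> 'n local_toric_point set" where
  "core_class \<gamma> z = {(\<tau>, restrict z (dual_semigroup \<tau>)) | \<tau>. \<tau> \<in> \<Sigma> \<and> \<gamma> \<subseteq> \<tau>}"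

text \<open>The class of a local point depends only on its core. This stands in for a separate proof
  that gluing is transitive.\<close>

lemma gluing_class:
  assumes \<sigma>: "\<sigma> \<in> \<Sigma>" and c: "core \<sigma> x \<gamma> z"
  shows "toric_gluing \<Sigma> `` {(\<sigma>, x)} = core_class \<gamma> z"
proof (intro set_eqI iffI)
  fix q assume "q \<in> toric_gluing \<Sigma> `` {(\<sigma>, x)}"
  then obtain \<tau> y z' where q: "q = (\<tau>, y)" "\<tau> \<in> \<Sigma>" "z' \<in> affine_toric_points (\<sigma> \<inter> \<tau>)"
    "x = restrict z' (dual_semigroup \<sigma>)" "y = restrict z' (dual_semigroup \<tau>)"
    by (auto simp: toric_gluing_def)
  obtain \<gamma>' z'' where c': "core (\<sigma> \<inter> \<tau>) z' \<gamma>' z''" using core_exists[OF fan_Int[OF \<sigma> q(2)] q(3)] .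
  have r: "restrict z' (dual_semigroup \<omega>) = restrict z'' (dual_semigroup \<omega>)" if "\<sigma> \<inter> \<tau> \<subseteq> \<omega>" for \<omega>
    using c' dual_antimono[OF that] unfolding core_def by (auto simp: restrict_def fun_eq_iff)
  have "core \<sigma> x \<gamma>' z''" using c' r[of \<sigma>] q unfolding core_def by auto
  from core_unique[OF \<sigma> c this] have e: "\<gamma> = \<gamma>'" "z = z''" .
  then show "q \<in> core_class \<gamma> z" using c' r[of \<tau>] q unfolding core_def core_class_def by auto
next
  fix q assume "q \<in> core_class \<gamma> z"
  then obtain \<tau> where \<tau>: "q = (\<tau>, restrict z (dual_semigroup \<tau>))" "\<tau> \<in> \<Sigma>" "\<gamma> \<subseteq> \<tau>" by (auto simp: core_class_def)
  have g: "\<gamma> \<subseteq> \<sigma> \<inter> \<tau>" using \<tau> c by (auto simp: core_def)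
  have "restrict z (dual_semigroup (\<sigma> \<inter> \<tau>)) \<in> affine_toric_points (\<sigma> \<inter> \<tau>)"
    using affine_point_restrict[OF g] c by (auto simp: core_def unit_type_def)
  moreover have "restrict (restrict z (dual_semigroup (\<sigma> \<inter> \<tau>))) (dual_semigroup \<omega>) = restrict z (dual_semigroup \<omega>)"
    if "\<sigma> \<inter> \<tau> \<subseteq> \<omega>" for \<omega>
    using dual_antimono[OF that] by (auto simp: restrict_def fun_eq_iff)
  ultimately show "q \<in> toric_gluing \<Sigma> `` {(\<sigma>, x)}"
    using \<tau> \<sigma> c unfolding toric_gluing_def core_def by (auto intro!: bexI[of _ "restrict z (dual_semigroup (\<sigma> \<inter> \<tau>))"])
qed

abbreviation X where "X \<equiv> toric_variety \<Sigma>"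

definition U :: "(real ^ 'n) set \<Rightarrow> 'n local_toric_point set set" where
  "U \<sigma> = toric_chart \<Sigma> \<sigma>"

definition pts where "pts = (\<Union>\<sigma>\<in>\<Sigma>. U \<sigma>)"

definition cone_of :: "'n local_toric_point set \<Rightarrow> (real ^ 'n) set" where
  "cone_of p = (THE \<gamma>. \<exists>z. unit_type \<gamma> z \<and> (\<gamma>, z) \<in> p)"

text \<open>One evaluation for all charts. The smallest chart around p has the largest semigroup, so
  every character regular at p gets its value here; elsewhere an extensional default is
  returned.\<close>

definition ev :: "'n local_toric_point set \<Rightarrow> int ^ 'n \<Rightarrow> complex" where
  "ev p = (THE z. (cone_of p, z) \<in> p)"

definition mk :: "(real ^ 'n) set \<Rightarrow> (int ^ 'n \<Rightarrow> complex) \<Rightarrow> 'n local_toric_point set" where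
  "mk \<sigma> x = toric_gluing \<Sigma> `` {(\<sigma>, restrict x (dual_semigroup \<sigma>))}"

lemma restrict_unit_type: "unit_type \<gamma> z \<Longrightarrow> restrict z (dual_semigroup \<gamma>) = z"
  using affine_point_extensional extensional_restrict unfolding unit_type_def by blast

lemma core_class_fst:
  assumes "\<gamma> \<in> \<Sigma>" "unit_type \<gamma> z" "(\<tau>, w) \<in> core_class \<gamma> z" "unit_type \<tau> w"
  shows "\<tau> = \<gamma>" "w = z"
proof -
  have t: "\<tau> \<in> \<Sigma>" "\<gamma> \<subseteq> \<tau>" "w = restrict z (dual_semigroup \<tau>)" using assms(3) by (auto simp: core_class_def)
  have "core \<tau> w \<gamma> z" using t assms by (auto simp: core_def)
  moreover have "core \<tau> w \<tau> w" using t assms restrict_unit_type by (auto simp: core_def)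
  ultimately show "\<tau> = \<gamma>" "w = z" using core_unique[OF t(1)] by blast+
qed

lemma core_class_props:
  assumes "\<gamma> \<in> \<Sigma>" "unit_type \<gamma> z"
  shows "cone_of (core_class \<gamma> z) = \<gamma>" "ev (core_class \<gamma> z) = z"
proof -
  have mem: "(\<gamma>, z) \<in> core_class \<gamma> z" using assms restrict_unit_type[OF assms(2)] by (auto simp: core_class_def)
  show c: "cone_of (core_class \<gamma> z) = \<gamma>" unfolding cone_of_def
    using assms mem core_class_fst[OF assms] by (intro the_equality) auto
  show "ev (core_class \<gamma> z) = z" unfolding ev_def c
    using mem restrict_unit_type[OF assms(2)] by (intro the_equality) (auto simp: core_class_def)
qed

text \<open>The orbit decomposition of a chart: its orbits belong to the cones of the fan inside
  \<sigma>, which by the intersection condition are the faces of \<sigma>.\<close>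

lemma U_eq_core_class:
  assumes "\<sigma> \<in> \<Sigma>"
  shows "U \<sigma> = {core_class \<gamma> z | \<gamma> z. \<gamma> \<in> \<Sigma> \<and> \<gamma> \<subseteq> \<sigma> \<and> unit_type \<gamma> z}"
proof (intro set_eqI iffI)
  fix p assume "p \<in> U \<sigma>"
  then obtain x where x: "p = toric_gluing \<Sigma> `` {(\<sigma>, x)}" "x \<in> affine_toric_points \<sigma>"
    by (auto simp: U_def toric_chart_def)
  obtain \<gamma> z where c: "core \<sigma> x \<gamma> z" using core_exists[OF assms x(2)] .
  show "p \<in> {core_class \<gamma> z | \<gamma> z. \<gamma> \<in> \<Sigma> \<and> \<gamma> \<subseteq> \<sigma> \<and> unit_type \<gamma> z}"
    using gluing_class[OF assms c] x(1) c unfolding core_def by blast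
next
  fix p assume "p \<in> {core_class \<gamma> z | \<gamma> z. \<gamma> \<in> \<Sigma> \<and> \<gamma> \<subseteq> \<sigma> \<and> unit_type \<gamma> z}"
  then obtain \<gamma> z where p: "p = core_class \<gamma> z" "\<gamma> \<in> \<Sigma>" "\<gamma> \<subseteq> \<sigma>" "unit_type \<gamma> z" by blast
  let ?x = "restrict z (dual_semigroup \<sigma>)"
  have "core \<sigma> ?x \<gamma> z" using p by (simp add: core_def)
  then have "p = toric_gluing \<Sigma> `` {(\<sigma>, ?x)}" using gluing_class[OF assms] p(1) by simp
  moreover have "?x \<in> affine_toric_points \<sigma>" using affine_point_restrict[OF p(3)] p(4) by (simp add: unit_type_def)
  ultimately show "p \<in> U \<sigma>" by (auto simp: U_def toric_chart_def)
qed

lemma pts_core_class: "p \<in> pts \<longleftrightarrow> (\<exists>\<gamma> z. \<gamma> \<in> \<Sigma> \<and> unit_type \<gamma> z \<and> p = core_class \<gamma> z)"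
  unfolding pts_def using U_eq_core_class by blast

lemma cone_of_mem: "p \<in> pts \<Longrightarrow> cone_of p \<in> \<Sigma>"
  by (auto simp: pts_core_class core_class_props)

lemma U_iff: "\<sigma> \<in> \<Sigma> \<Longrightarrow> p \<in> U \<sigma> \<longleftrightarrow> p \<in> pts \<and> cone_of p \<subseteq> \<sigma>"
  unfolding pts_core_class by (subst U_eq_core_class) (auto simp: core_class_props, metis)

lemma U_pts: "\<sigma> \<in> \<Sigma> \<Longrightarrow> p \<in> U \<sigma> \<Longrightarrow> p \<in> pts"
  by (simp add: U_iff)

lemma ev_unit_type: "p \<in> pts \<Longrightarrow> unit_type (cone_of p) (ev p)"
  by (auto simp: pts_core_class core_class_props)

lemma U_dual: "\<sigma> \<in> \<Sigma> \<Longrightarrow> p \<in> U \<sigma> \<Longrightarrow> m \<in> dual_semigroup \<sigma> \<Longrightarrow> m \<in> dual_semigroup (cone_of p)"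
  using dual_antimono[of "cone_of p" \<sigma>] by (auto simp: U_iff)

lemma ev_zero [simp]: "p \<in> pts \<Longrightarrow> ev p 0 = 1"
  using ev_unit_type affine_point_zero by (auto simp: unit_type_def)

lemma ev_add: "p \<in> pts \<Longrightarrow> m \<in> dual_semigroup (cone_of p) \<Longrightarrow> m' \<in> dual_semigroup (cone_of p) \<Longrightarrow> ev p (m + m') = ev p m * ev p m'"
  using ev_unit_type affine_point_add unfolding unit_type_def by metis

lemma ev_vmult: "p \<in> pts \<Longrightarrow> m \<in> dual_semigroup (cone_of p) \<Longrightarrow> ev p (int k *s m) = ev p m ^ k"
  using ev_unit_type affine_point_vmult unfolding unit_type_def by metis

lemma ev_nonzero_iff: "p \<in> pts \<Longrightarrow> m \<in> dual_semigroup (cone_of p) \<Longrightarrow> ev p m \<noteq> 0 \<longleftrightarrow> m \<in> perp (cone_of p)"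
  using ev_unit_type by (auto simp: unit_type_def)

lemma point_eqI:
  assumes \<sigma>: "\<sigma> \<in> \<Sigma>" and p: "p \<in> U \<sigma>" and q: "q \<in> U \<sigma>" and e: "\<And>m. m \<in> dual_semigroup \<sigma> \<Longrightarrow> ev p m = ev q m"
  shows "p = q"
proof -
  obtain \<gamma> z where p': "p = core_class \<gamma> z" "\<gamma> \<in> \<Sigma>" "\<gamma> \<subseteq> \<sigma>" "unit_type \<gamma> z" using p U_eq_core_class[OF \<sigma>] by blast
  obtain \<delta> w where q': "q = core_class \<delta> w" "\<delta> \<in> \<Sigma>" "\<delta> \<subseteq> \<sigma>" "unit_type \<delta> w" using q U_eq_core_class[OF \<sigma>] by blast
  have "restrict z (dual_semigroup \<sigma>) = restrict w (dual_semigroup \<sigma>)"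
    using e by (simp add: p' q' core_class_props restrict_def fun_eq_iff)
  then have "core \<sigma> (restrict z (dual_semigroup \<sigma>)) \<gamma> z" "core \<sigma> (restrict z (dual_semigroup \<sigma>)) \<delta> w"
    using p' q' by (auto simp: core_def)
  from core_unique[OF \<sigma> this] show ?thesis by (simp add: p' q')
qed

lemma mk_props:
  assumes \<sigma>: "\<sigma> \<in> \<Sigma>" and x: "x 0 = 1" "\<And>m m'. m \<in> dual_semigroup \<sigma> \<Longrightarrow> m' \<in> dual_semigroup \<sigma> \<Longrightarrow> x (m + m') = x m * x m'"
  shows mk_mem: "mk \<sigma> x \<in> U \<sigma>"
    and ev_mk: "m \<in> dual_semigroup \<sigma> \<Longrightarrow> ev (mk \<sigma> x) m = x m"
proof -
  have a: "restrict x (dual_semigroup \<sigma>) \<in> affine_toric_points \<sigma>"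
    using x by (auto simp: affine_toric_points_def dual_add)
  then show "mk \<sigma> x \<in> U \<sigma>" by (auto simp: mk_def U_def toric_chart_def)
  obtain \<gamma> z where c: "core \<sigma> (restrict x (dual_semigroup \<sigma>)) \<gamma> z" using core_exists[OF \<sigma> a] .
  assume "m \<in> dual_semigroup \<sigma>"
  then show "ev (mk \<sigma> x) m = x m"
    unfolding mk_def gluing_class[OF \<sigma> c] using c core_class_props[of \<gamma> z] unfolding core_def
    by (metis restrict_apply')
qed

text \<open>Passage from the characters of the definition, which depend on a chart, to the
  chart-free \<open>ev\<close>.\<close>

lemma toric_character_ev:
  assumes \<sigma>: "\<sigma> \<in> \<Sigma>" and p: "p \<in> U \<sigma>" and m: "m \<in> dual_semigroup \<sigma>"
  shows "toric_character \<sigma> m p = ev p m"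
proof -
  obtain \<gamma> z where p': "p = core_class \<gamma> z" "\<gamma> \<in> \<Sigma>" "\<gamma> \<subseteq> \<sigma>" "unit_type \<gamma> z" using p U_eq_core_class[OF \<sigma>] by blast
  have "(THE x. (\<sigma>, x) \<in> p) = restrict z (dual_semigroup \<sigma>)"
    using p' \<sigma> by (intro the_equality) (auto simp: core_class_def)
  then show ?thesis using m p' by (simp add: toric_character_def core_class_props)
qed

lemma U_Int: "\<sigma> \<in> \<Sigma> \<Longrightarrow> \<tau> \<in> \<Sigma> \<Longrightarrow> U \<sigma> \<inter> U \<tau> = U (\<sigma> \<inter> \<tau>)"
  using fan_Int by (auto simp: U_iff)

end


subsection \<open>Local description of open sets and regular functions\<close>

lemma generated_algebra_sum:
  assumes "\<And>i. i \<in> I \<Longrightarrow> f i \<in> generated_algebra G"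
  shows "(\<lambda>p. \<Sum>i\<in>I. f i p) \<in> generated_algebra G"
  using assms
  by (induction I rule: infinite_finite_induct) (auto intro: generated_algebra.intros)

context toric begin

text \<open>The coordinate ring of the chart. Functions being total, membership constrains the
  values on \<open>U \<sigma>\<close> only, which makes the ring stable under changes outside the
  chart.\<close>

definition chart_ring :: "(real ^ 'n) set \<Rightarrow> ('n local_toric_point set \<Rightarrow> complex) set" where
  "chart_ring \<sigma> = {f. \<exists>B c. finite B \<and> B \<subseteq> dual_semigroup \<sigma> \<and> (\<forall>p\<in>U \<sigma>. f p = (\<Sum>m\<in>B. c m * ev p m))}"

lemma chart_ringI:
  "finite B \<Longrightarrow> B \<subseteq> dual_semigroup \<sigma> \<Longrightarrow> (\<And>p. p \<in> U \<sigma> \<Longrightarrow> f p = (\<Sum>m\<in>B. c m * ev p m)) \<Longrightarrow> f \<in> chart_ring \<sigma>"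
  unfolding chart_ring_def by blast

lemma chart_ringE:
  assumes "f \<in> chart_ring \<sigma>"
  obtains B c where "finite B" "B \<subseteq> dual_semigroup \<sigma>" "\<And>p. p \<in> U \<sigma> \<Longrightarrow> f p = (\<Sum>m\<in>B. c m * ev p m)"
    "\<And>m. m \<in> B \<Longrightarrow> c m \<noteq> 0"
proof -
  obtain B c where B: "finite B" "B \<subseteq> dual_semigroup \<sigma>" "\<And>p. p \<in> U \<sigma> \<Longrightarrow> f p = (\<Sum>m\<in>B. c m * ev p m)"
    using assms unfolding chart_ring_def by blast
  have "(\<Sum>m\<in>B. c m * ev p m) = (\<Sum>m\<in>{m\<in>B. c m \<noteq> 0}. c m * ev p m)" for p
    using B(1) by (intro sum.mono_neutral_right) auto
  then show thesis using B by (intro that[of "{m\<in>B. c m \<noteq> 0}" c]) auto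
qed

lemma chart_ring_cong: "f \<in> chart_ring \<sigma> \<Longrightarrow> (\<And>p. p \<in> U \<sigma> \<Longrightarrow> g p = f p) \<Longrightarrow> g \<in> chart_ring \<sigma>"
  unfolding chart_ring_def by auto

lemma chart_ring_ev: "m \<in> dual_semigroup \<sigma> \<Longrightarrow> (\<lambda>p. ev p m) \<in> chart_ring \<sigma>"
  by (rule chart_ringI[of "{m}" _ _ "\<lambda>_. 1"]) auto

lemma chart_ring_const: "\<sigma> \<in> \<Sigma> \<Longrightarrow> (\<lambda>p. k) \<in> chart_ring \<sigma>"
  by (rule chart_ringI[of "{0}" _ _ "\<lambda>_. k"]) (auto simp: U_pts)

lemma chart_ring_add:
  assumes "f \<in> chart_ring \<sigma>" "g \<in> chart_ring \<sigma>"
  shows "(\<lambda>p. f p + g p) \<in> chart_ring \<sigma>"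
proof -
  obtain B b where B: "finite B" "B \<subseteq> dual_semigroup \<sigma>" "\<And>p. p \<in> U \<sigma> \<Longrightarrow> f p = (\<Sum>m\<in>B. b m * ev p m)"
    using chart_ringE[OF assms(1)] by metis
  obtain C c where C: "finite C" "C \<subseteq> dual_semigroup \<sigma>" "\<And>p. p \<in> U \<sigma> \<Longrightarrow> g p = (\<Sum>m\<in>C. c m * ev p m)"
    using chart_ringE[OF assms(2)] by metis
  have ext: "(\<Sum>m\<in>D. d m * ev p m) = (\<Sum>m\<in>B \<union> C. (if m \<in> D then d m else 0) * ev p m)" if "D = B \<or> D = C" for D d p
    using that B(1) C(1) by (intro sum.mono_neutral_cong_left) auto
  show ?thesis
    using B C ext by (intro chart_ringI[of "B \<union> C" _ _ "\<lambda>m. (if m \<in> B then b m else 0) + (if m \<in> C then c m else 0)"])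
      (auto simp: sum.distrib distrib_right simp del: if_distrib)
qed

lemma chart_ring_mult:
  assumes \<sigma>: "\<sigma> \<in> \<Sigma>" and fg: "f \<in> chart_ring \<sigma>" "g \<in> chart_ring \<sigma>"
  shows "(\<lambda>p. f p * g p) \<in> chart_ring \<sigma>"
proof -
  obtain B b where B: "finite B" "B \<subseteq> dual_semigroup \<sigma>" "\<And>p. p \<in> U \<sigma> \<Longrightarrow> f p = (\<Sum>m\<in>B. b m * ev p m)"
    using chart_ringE[OF fg(1)] by metis
  obtain C c where C: "finite C" "C \<subseteq> dual_semigroup \<sigma>" "\<And>p. p \<in> U \<sigma> \<Longrightarrow> g p = (\<Sum>m\<in>C. c m * ev p m)"
    using chart_ringE[OF fg(2)] by metis
  let ?s = "\<lambda>(m, m'). m + m' :: int ^ 'n"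
  show ?thesis
  proof (rule chart_ringI[of "?s ` (B \<times> C)" _ _ "\<lambda>k. \<Sum>(m, m')\<in>{x\<in>B \<times> C. ?s x = k}. b m * c m'"])
    fix p assume p: "p \<in> U \<sigma>"
    have "f p * g p = (\<Sum>(m, m')\<in>B \<times> C. (b m * ev p m) * (c m' * ev p m'))"
      using B(3)[OF p] C(3)[OF p] by (simp add: sum_product sum.cartesian_product)
    also have "\<dots> = (\<Sum>k\<in>?s ` (B \<times> C). \<Sum>(m, m')\<in>{x\<in>B \<times> C. ?s x = k}. (b m * ev p m) * (c m' * ev p m'))"
      using B(1) C(1) by (intro sum.image_gen) auto
    also have "\<dots> = (\<Sum>k\<in>?s ` (B \<times> C). (\<Sum>(m, m')\<in>{x\<in>B \<times> C. ?s x = k}. b m * c m') * ev p k)"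
    proof (rule sum.cong[OF refl])
      fix k
      show "(\<Sum>(m, m')\<in>{x\<in>B \<times> C. ?s x = k}. (b m * ev p m) * (c m' * ev p m')) = (\<Sum>(m, m')\<in>{x\<in>B \<times> C. ?s x = k}. b m * c m') * ev p k"
        unfolding sum_distrib_right
      proof (rule sum.cong[OF refl], clarify)
        fix m m' assume "m \<in> B" "m' \<in> C"
        then have "ev p (m + m') = ev p m * ev p m'"
          using B(2) C(2) p \<sigma> U_dual U_pts by (intro ev_add) blast+
        then show "b m * ev p m * (c m' * ev p m') = b m * c m' * ev p (m + m')" by simp
      qed
    qed
    finally show "f p * g p = (\<Sum>k\<in>?s ` (B \<times> C). (\<Sum>(m, m')\<in>{x\<in>B \<times> C. ?s x = k}. b m * c m') * ev p k)" .
  qed (use B(1) C(1) subsetD[OF B(2)] subsetD[OF C(2)] in \<open>auto intro!: finite_imageI dual_add\<close>)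
qed

lemma generated_algebra_chart:
  assumes \<sigma>: "\<sigma> \<in> \<Sigma>"
    and "f \<in> generated_algebra (toric_character \<sigma> ` dual_semigroup \<sigma>)"
  shows "f \<in> chart_ring \<sigma>"
  using assms(2)
proof induction
  case (const c) then show ?case using chart_ring_const[OF \<sigma>] .
next
  case (gen f)
  then obtain m where m: "m \<in> dual_semigroup \<sigma>" "f = toric_character \<sigma> m" by blast
  show ?case by (rule chart_ring_cong[OF chart_ring_ev[OF m(1)]]) (simp add: m toric_character_ev[OF \<sigma>])
next
  case (add f g) then show ?case using chart_ring_add by blast
next
  case (mult f g) then show ?case using chart_ring_mult[OF \<sigma>] by blast
qed

lemma chart_ring_generated:
  assumes \<sigma>: "\<sigma> \<in> \<Sigma>" and f: "f \<in> chart_ring \<sigma>"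
  obtains f' where "f' \<in> generated_algebra (toric_character \<sigma> ` dual_semigroup \<sigma>)" "\<And>p. p \<in> U \<sigma> \<Longrightarrow> f' p = f p"
proof -
  obtain B b where B: "finite B" "B \<subseteq> dual_semigroup \<sigma>" "\<And>p. p \<in> U \<sigma> \<Longrightarrow> f p = (\<Sum>m\<in>B. b m * ev p m)"
    using chart_ringE[OF f] by metis
  show thesis
  proof (rule that[of "\<lambda>p. \<Sum>m\<in>B. b m * toric_character \<sigma> m p"])
    show "(\<lambda>p. \<Sum>m\<in>B. b m * toric_character \<sigma> m p) \<in> generated_algebra (toric_character \<sigma> ` dual_semigroup \<sigma>)"
      using B(2) by (intro generated_algebra_sum generated_algebra.mult generated_algebra.const generated_algebra.gen) auto
    fix p assume p: "p \<in> U \<sigma>"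
    show "(\<Sum>m\<in>B. b m * toric_character \<sigma> m p) = f p"
      unfolding B(3)[OF p] using toric_character_ev[OF \<sigma> p] B(2) by (intro sum.cong) auto
  qed
qed

section \<open>The Zariski topology and regular functions, seen from a single chart\<close>

definition zar where "zar = zariski X"
definition atlas where "atlas = {(U \<sigma>, toric_character \<sigma> ` dual_semigroup \<sigma>) | \<sigma>. \<sigma> \<in> \<Sigma>}"
definition basics where
  "basics = {{p \<in> U \<sigma>. f p \<noteq> 0} | \<sigma> f. \<sigma> \<in> \<Sigma> \<and> f \<in> generated_algebra (toric_character \<sigma> ` dual_semigroup \<sigma>)}"

lemma zar_eq: "zar = topology_generated_by basics"
proof -
  have "{{p \<in> W. f p \<noteq> 0} | W G f. (W, G) \<in> {(U \<sigma>, toric_character \<sigma> ` dual_semigroup \<sigma>) | \<sigma>. \<sigma> \<in> \<Sigma>} \<and> f \<in> generated_algebra G} = basics"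
    unfolding basics_def by blast
  then show ?thesis by (simp add: zar_def toric_variety_def space_of_atlas_def Let_def U_def[symmetric])
qed

lemma regular_iff: "h \<in> regular X V \<longleftrightarrow> (\<forall>p\<in>V. \<exists>\<sigma>\<in>\<Sigma>.
    \<exists>f \<in> generated_algebra (toric_character \<sigma> ` dual_semigroup \<sigma>).
    \<exists>g \<in> generated_algebra (toric_character \<sigma> ` dual_semigroup \<sigma>).
    \<exists>V'. openin zar V' \<and> p \<in> V' \<and> V' \<subseteq> V \<inter> U \<sigma> \<and> (\<forall>q\<in>V'. g q \<noteq> 0 \<and> h q = f q / g q))"
proof -
  have A: "{(toric_chart \<Sigma> \<sigma>, toric_character \<sigma> ` dual_semigroup \<sigma>) | \<sigma>. \<sigma> \<in> \<Sigma>} = atlas"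
    by (simp add: atlas_def U_def)
  have "h \<in> regular X V \<longleftrightarrow> (\<forall>p\<in>V. \<exists>(W, G)\<in>atlas. \<exists>f \<in> generated_algebra G. \<exists>g \<in> generated_algebra G.
    \<exists>V'. openin zar V' \<and> p \<in> V' \<and> V' \<subseteq> V \<inter> W \<and> (\<forall>q\<in>V'. g q \<noteq> 0 \<and> h q = f q / g q))"
    unfolding zar_def toric_variety_def A by (simp add: space_of_atlas_def Let_def)
  also have "\<dots> \<longleftrightarrow> (\<forall>p\<in>V. \<exists>\<sigma>\<in>\<Sigma>.
    \<exists>f \<in> generated_algebra (toric_character \<sigma> ` dual_semigroup \<sigma>).
    \<exists>g \<in> generated_algebra (toric_character \<sigma> ` dual_semigroup \<sigma>).
    \<exists>V'. openin zar V' \<and> p \<in> V' \<and> V' \<subseteq> V \<inter> U \<sigma> \<and> (\<forall>q\<in>V'. g q \<noteq> 0 \<and> h q = f q / g q))"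
    unfolding atlas_def by (intro ball_cong refl) blast
  finally show ?thesis .
qed

lemma openin_principal:
  assumes \<sigma>: "\<sigma> \<in> \<Sigma>" and f: "f \<in> chart_ring \<sigma>"
  shows "openin zar {p \<in> U \<sigma>. f p \<noteq> 0}"
proof -
  obtain f' where f': "f' \<in> generated_algebra (toric_character \<sigma> ` dual_semigroup \<sigma>)" "\<And>p. p \<in> U \<sigma> \<Longrightarrow> f' p = f p"
    using chart_ring_generated[OF \<sigma> f] by metis
  have "{p \<in> U \<sigma>. f p \<noteq> 0} = {p \<in> U \<sigma>. f' p \<noteq> 0}" using f'(2) by auto
  then have "{p \<in> U \<sigma>. f p \<noteq> 0} \<in> basics" using f'(1) \<sigma> unfolding basics_def by blast
  then show ?thesis unfolding zar_eq by (rule topology_generated_by_Basis)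
qed

lemma openin_U: "\<sigma> \<in> \<Sigma> \<Longrightarrow> openin zar (U \<sigma>)"
  using openin_principal[OF _ chart_ring_const[of \<sigma> 1]] by simp

lemma topspace_zar: "topspace zar = pts"
proof
  show "pts \<subseteq> topspace zar" using openin_U openin_subset unfolding pts_def by blast
  show "topspace zar \<subseteq> pts" unfolding zar_eq topology_generated_by_topspace basics_def pts_def by auto
qed

lemma points_X: "points X = pts"
  using topspace_zar by (simp add: zar_def)

text \<open>The character of a separating functional survives on an orbit exactly when the cone of
  the orbit lies in \<tau>. So inside the chart of \<sigma> the chart of \<tau> cuts out a principal
  open set.\<close>

lemma U_iff_exposing:
  assumes "\<sigma> \<in> \<Sigma>" "\<tau> \<in> \<Sigma>" "m0 \<in> dual_semigroup \<sigma>" "\<And>v. v \<in> \<sigma> \<Longrightarrow> pairing m0 v = 0 \<longleftrightarrow> v \<in> \<tau>" "q \<in> U \<sigma>"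
  shows "q \<in> U \<tau> \<longleftrightarrow> ev q m0 \<noteq> 0"
proof -
  have q: "q \<in> pts" "cone_of q \<subseteq> \<sigma>" using assms(1,5) U_iff by auto
  have "ev q m0 \<noteq> 0 \<longleftrightarrow> m0 \<in> perp (cone_of q)"
    using ev_nonzero_iff[OF q(1)] U_dual[OF assms(1,5,3)] by blast
  also have "\<dots> \<longleftrightarrow> cone_of q \<subseteq> \<tau>" using q(2) assms(4) by (auto simp: perp_def)
  finally show ?thesis using q U_iff[OF assms(2)] by simp
qed

text \<open>Clearing denominators by \<open>dual_shift\<close>. All large exponents are allowed so
  that numerator and denominator of a fraction can be multiplied by the same power.\<close>

lemma chart_ring_change:
  assumes \<sigma>: "\<sigma> \<in> \<Sigma>" and \<tau>: "\<tau> \<in> \<Sigma>" and m0: "m0 \<in> dual_semigroup \<sigma>" "\<And>v. v \<in> \<sigma> \<Longrightarrow> pairing m0 v = 0 \<longleftrightarrow> v \<in> \<tau>"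
    and f: "f \<in> chart_ring \<tau>"
  shows "\<exists>L. \<forall>l\<ge>L. \<exists>f'\<in>chart_ring \<sigma>. \<forall>q\<in>U \<sigma> \<inter> U \<tau>. f' q = ev q m0 ^ l * f q"
proof -
  obtain B b where B: "finite B" "B \<subseteq> dual_semigroup \<tau>" "\<And>p. p \<in> U \<tau> \<Longrightarrow> f p = (\<Sum>m\<in>B. b m * ev p m)"
    using chart_ringE[OF f] by metis
  have "\<forall>m\<in>B. \<exists>L. \<forall>l\<ge>L. m + int l *s m0 \<in> dual_semigroup \<sigma>"
    using dual_shift[OF \<sigma> m0(1)] m0(2) B(2) by (force simp: dual_semigroup_def)
  then obtain L where L: "\<And>m l. m \<in> B \<Longrightarrow> l \<ge> L m \<Longrightarrow> m + int l *s m0 \<in> dual_semigroup \<sigma>" by metis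
  show ?thesis
  proof (intro exI allI impI)
    fix l assume l: "l \<ge> Max (insert 0 (L ` B))"
    have in\<sigma>: "m + int l *s m0 \<in> dual_semigroup \<sigma>" if "m \<in> B" for m using L[OF that, of l] l B(1) that by auto
    show "\<exists>f'\<in>chart_ring \<sigma>. \<forall>q\<in>U \<sigma> \<inter> U \<tau>. f' q = ev q m0 ^ l * f q"
    proof (intro bexI ballI)
      show "(\<lambda>q. \<Sum>k\<in>(\<lambda>m. m + int l *s m0) ` B. b (k - int l *s m0) * ev q k) \<in> chart_ring \<sigma>"
        using in\<sigma> B(1) by (intro chart_ringI[OF _ _ refl]) auto
      fix q assume q: "q \<in> U \<sigma> \<inter> U \<tau>"
      then have qp: "q \<in> pts" using U_pts \<sigma> by blast
      have m0q: "m0 \<in> dual_semigroup (cone_of q)" using U_dual[OF \<sigma> _ m0(1)] q by blast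
      have "(\<Sum>k\<in>(\<lambda>m. m + int l *s m0) ` B. b (k - int l *s m0) * ev q k) = (\<Sum>m\<in>B. b m * ev q (m + int l *s m0))"
        by (subst sum.reindex) (auto simp: inj_on_def)
      also have "\<dots> = (\<Sum>m\<in>B. ev q m0 ^ l * (b m * ev q m))"
      proof (rule sum.cong[OF refl])
        fix m assume "m \<in> B"
        then have "m \<in> dual_semigroup (cone_of q)" using B(2) U_dual[OF \<tau>] q by blast
        then show "b m * ev q (m + int l *s m0) = ev q m0 ^ l * (b m * ev q m)"
          using ev_add[OF qp _ dual_vmult[OF m0q, of "int l"]] ev_vmult[OF qp m0q] by simp
      qed
      also have "\<dots> = ev q m0 ^ l * f q" using B(3) q by (simp add: sum_distrib_left)
      finally show "(\<Sum>k\<in>(\<lambda>m. m + int l *s m0) ` B. b (k - int l *s m0) * ev q k) = ev q m0 ^ l * f q" .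
    qed
  qed
qed

text \<open>The principal open sets of any one chart around p form a basis at p, although the
  topology is generated by those of all charts: a basic set from another chart is rewritten with its
  denominators cleared.\<close>

lemma openin_local:
  assumes "openin zar V" "p \<in> V" "\<sigma> \<in> \<Sigma>" "p \<in> U \<sigma>"
  shows "\<exists>f\<in>chart_ring \<sigma>. f p \<noteq> 0 \<and> {q \<in> U \<sigma>. f q \<noteq> 0} \<subseteq> V"
proof -
  have "generate_topology_on basics V" using assms(1) unfolding zar_eq openin_topology_generated_by_iff .
  then show ?thesis using assms(2)
  proof induction
    case Empty then show ?case by simp
  next
    case (Int a b)
    then obtain f g where "f \<in> chart_ring \<sigma>" "f p \<noteq> 0" "{q \<in> U \<sigma>. f q \<noteq> 0} \<subseteq> a" "g \<in> chart_ring \<sigma>" "g p \<noteq> 0" "{q \<in> U \<sigma>. g q \<noteq> 0} \<subseteq> b"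
      by blast
    then show ?case using chart_ring_mult[OF assms(3), of f g] by (intro bexI[of _ "\<lambda>q. f q * g q"]) auto
  next
    case (UN K)
    then obtain k where "k \<in> K" "p \<in> k" by blast
    then show ?case using UN.IH[of k] by blast
  next
    case (Basis s)
    then obtain \<tau> f where \<tau>: "\<tau> \<in> \<Sigma>" and f: "f \<in> generated_algebra (toric_character \<tau> ` dual_semigroup \<tau>)" and s: "s = {q \<in> U \<tau>. f q \<noteq> 0}"
      unfolding basics_def by blast
    obtain m0 where m0: "m0 \<in> dual_semigroup \<sigma>" "\<And>v. v \<in> \<sigma> \<Longrightarrow> pairing m0 v = 0 \<longleftrightarrow> v \<in> \<tau>"
      using separation[OF assms(3) \<tau>] by metis
    obtain l f' where f': "f' \<in> chart_ring \<sigma>" "\<And>q. q \<in> U \<sigma> \<inter> U \<tau> \<Longrightarrow> f' q = ev q m0 ^ l * f q"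
      using chart_ring_change[OF assms(3) \<tau> m0 generated_algebra_chart[OF \<tau> f]] by blast
    note iff = U_iff_exposing[OF assms(3) \<tau> m0]
    show ?case
    proof (intro bexI conjI subsetI)
      \<comment> \<open>The extra factor removes the points of the chart outside
        \<open>U \<tau>\<close>, where \<open>f'\<close> is not controlled.\<close>
      show "(\<lambda>q. f' q * ev q m0) \<in> chart_ring \<sigma>" using chart_ring_mult[OF assms(3) f'(1) chart_ring_ev[OF m0(1)]] .
      show "f' p * ev p m0 \<noteq> 0" using Basis.prems s f'(2)[of p] iff[of p] assms(4) by auto
      fix q assume "q \<in> {q \<in> U \<sigma>. f' q * ev q m0 \<noteq> 0}"
      then show "q \<in> s" using s f'(2)[of q] iff[of q] by auto
    qed
  qed
qed

text \<open>In the definition each point chooses its chart; here the chart is prescribed. A common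
  power of the separating character carries both parts of the fraction over to it.\<close>

lemma regular_local:
  assumes h: "h \<in> regular X V" and p: "p \<in> V" and \<sigma>: "\<sigma> \<in> \<Sigma>" "p \<in> U \<sigma>"
  shows "\<exists>f\<in>chart_ring \<sigma>. \<exists>g\<in>chart_ring \<sigma>. g p \<noteq> 0 \<and> (\<forall>q\<in>U \<sigma>. g q \<noteq> 0 \<longrightarrow> q \<in> V \<and> h q = f q / g q)"
proof -
  obtain \<tau> f g V' where \<tau>: "\<tau> \<in> \<Sigma>" and fg: "f \<in> generated_algebra (toric_character \<tau> ` dual_semigroup \<tau>)" "g \<in> generated_algebra (toric_character \<tau> ` dual_semigroup \<tau>)"
    and V': "openin zar V'" "p \<in> V'" "V' \<subseteq> V \<inter> U \<tau>" "\<And>q. q \<in> V' \<Longrightarrow> g q \<noteq> 0 \<and> h q = f q / g q"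
    using h p unfolding regular_iff by metis
  obtain m0 where m0: "m0 \<in> dual_semigroup \<sigma>" "\<And>v. v \<in> \<sigma> \<Longrightarrow> pairing m0 v = 0 \<longleftrightarrow> v \<in> \<tau>"
    using separation[OF \<sigma>(1) \<tau>] by metis
  note iff = U_iff_exposing[OF \<sigma>(1) \<tau> m0]
  obtain l1 l2 where l: "\<forall>l\<ge>l1. \<exists>f'\<in>chart_ring \<sigma>. \<forall>q\<in>U \<sigma> \<inter> U \<tau>. f' q = ev q m0 ^ l * f q"
      "\<forall>l\<ge>l2. \<exists>g'\<in>chart_ring \<sigma>. \<forall>q\<in>U \<sigma> \<inter> U \<tau>. g' q = ev q m0 ^ l * g q"
    using chart_ring_change[OF \<sigma>(1) \<tau> m0 generated_algebra_chart[OF \<tau> fg(1)]]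
      chart_ring_change[OF \<sigma>(1) \<tau> m0 generated_algebra_chart[OF \<tau> fg(2)]] by blast
  define l where "l = max l1 l2"
  obtain f' where f': "f' \<in> chart_ring \<sigma>" "\<And>q. q \<in> U \<sigma> \<inter> U \<tau> \<Longrightarrow> f' q = ev q m0 ^ l * f q"
    using l(1)[rule_format, of l] by (auto simp: l_def)
  obtain g' where g': "g' \<in> chart_ring \<sigma>" "\<And>q. q \<in> U \<sigma> \<inter> U \<tau> \<Longrightarrow> g' q = ev q m0 ^ l * g q"
    using l(2)[rule_format, of l] by (auto simp: l_def)
  \<comment> \<open>\<open>e\<close> shrinks the neighbourhood to \<open>V'\<close>, where the
    fraction is known to represent \<open>h\<close>.\<close>
  obtain e where e: "e \<in> chart_ring \<sigma>" "e p \<noteq> 0" "{q \<in> U \<sigma>. e q \<noteq> 0} \<subseteq> V'"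
    using openin_local[OF V'(1,2) \<sigma>] by blast
  show ?thesis
  proof (rule bexI[of _ "\<lambda>q. e q * f' q"], rule bexI[of _ "\<lambda>q. e q * g' q"], intro conjI ballI impI)
    show "(\<lambda>q. e q * f' q) \<in> chart_ring \<sigma>" "(\<lambda>q. e q * g' q) \<in> chart_ring \<sigma>"
      using chart_ring_mult[OF \<sigma>(1)] e f' g' by auto
    show "e p * g' p \<noteq> 0" using e(2) g'(2)[of p] V'(2,3,4) iff[of p] \<sigma>(2) by auto
    fix q assume q: "q \<in> U \<sigma>" "e q * g' q \<noteq> 0"
    then have q': "q \<in> V'" using e(3) by auto
    then show "q \<in> V" using V'(3) by auto
    have "ev q m0 \<noteq> 0" using iff[of q] q q' V'(3) by auto
    then show "h q = e q * f' q / (e q * g' q)" using q q' V'(3) V'(4)[OF q'] f'(2)[of q] g'(2)[of q] by auto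
  qed
qed

lemma regularI:
  assumes "\<And>p. p \<in> V \<Longrightarrow> \<exists>\<sigma>\<in>\<Sigma>. p \<in> U \<sigma> \<and> (\<exists>f\<in>chart_ring \<sigma>. \<exists>g\<in>chart_ring \<sigma>. g p \<noteq> 0 \<and> (\<forall>q\<in>U \<sigma>. g q \<noteq> 0 \<longrightarrow> q \<in> V \<and> h q = f q / g q))"
  shows "h \<in> regular X V"
  unfolding regular_iff
proof
  fix p assume "p \<in> V"
  from assms[OF this] obtain \<sigma> f g where \<sigma>: "\<sigma> \<in> \<Sigma>" "p \<in> U \<sigma>" and fg: "f \<in> chart_ring \<sigma>" "g \<in> chart_ring \<sigma>" "g p \<noteq> 0"
    and h: "\<And>q. q \<in> U \<sigma> \<Longrightarrow> g q \<noteq> 0 \<Longrightarrow> q \<in> V \<and> h q = f q / g q" by blast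
  obtain f' where f': "f' \<in> generated_algebra (toric_character \<sigma> ` dual_semigroup \<sigma>)" "\<And>p. p \<in> U \<sigma> \<Longrightarrow> f' p = f p"
    using chart_ring_generated[OF \<sigma>(1) fg(1)] by metis
  obtain g' where g': "g' \<in> generated_algebra (toric_character \<sigma> ` dual_semigroup \<sigma>)" "\<And>p. p \<in> U \<sigma> \<Longrightarrow> g' p = g p"
    using chart_ring_generated[OF \<sigma>(1) fg(2)] by metis
  show "\<exists>\<sigma>\<in>\<Sigma>. \<exists>f \<in> generated_algebra (toric_character \<sigma> ` dual_semigroup \<sigma>).
    \<exists>g \<in> generated_algebra (toric_character \<sigma> ` dual_semigroup \<sigma>).
    \<exists>V'. openin zar V' \<and> p \<in> V' \<and> V' \<subseteq> V \<inter> U \<sigma> \<and> (\<forall>q\<in>V'. g q \<noteq> 0 \<and> h q = f q / g q)"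
    using \<sigma> fg f' g' h openin_principal[OF \<sigma>(1) fg(2)]
    by (intro bexI[OF _ \<sigma>(1)] bexI[OF _ f'(1)] bexI[OF _ g'(1)] exI[of _ "{q \<in> U \<sigma>. g q \<noteq> 0}"]) auto
qed

lemma regular_chart_ring:
  assumes \<sigma>: "\<sigma> \<in> \<Sigma>" and f: "f \<in> chart_ring \<sigma>"
  shows "f \<in> regular X (U \<sigma>)"
proof (rule regularI)
  fix p assume p: "p \<in> U \<sigma>"
  show "\<exists>\<sigma>'\<in>\<Sigma>. p \<in> U \<sigma>' \<and> (\<exists>f'\<in>chart_ring \<sigma>'. \<exists>g\<in>chart_ring \<sigma>'. g p \<noteq> 0 \<and> (\<forall>q\<in>U \<sigma>'. g q \<noteq> 0 \<longrightarrow> q \<in> U \<sigma> \<and> f q = f' q / g q))"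
    by (rule bexI[OF _ \<sigma>], rule conjI[OF p], rule bexI[OF _ f], rule bexI[OF _ chart_ring_const[OF \<sigma>, of 1]]) auto
qed

lemma cone_of_U: "p \<in> pts \<Longrightarrow> p \<in> U (cone_of p)"
  by (simp add: U_iff cone_of_mem)

lemma open_pts: "openin zar V \<Longrightarrow> p \<in> V \<Longrightarrow> p \<in> pts"
  using openin_subset topspace_zar by blast

lemma regular_restrict:
  assumes h: "h \<in> regular X V" and W: "openin zar W" "W \<subseteq> V" and eq: "\<And>q. q \<in> W \<Longrightarrow> h' q = h q"
  shows "h' \<in> regular X W"
proof (rule regularI)
  fix p assume p: "p \<in> W"
  let ?\<sigma> = "cone_of p"
  have \<sigma>: "?\<sigma> \<in> \<Sigma>" "p \<in> U ?\<sigma>" using open_pts[OF W(1) p] cone_of_mem cone_of_U by auto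
  obtain f g where fg: "f \<in> chart_ring ?\<sigma>" "g \<in> chart_ring ?\<sigma>" "g p \<noteq> 0" "\<And>q. q \<in> U ?\<sigma> \<Longrightarrow> g q \<noteq> 0 \<Longrightarrow> q \<in> V \<and> h q = f q / g q"
    using regular_local[OF h _ \<sigma>] p W(2) by blast
  obtain e where e: "e \<in> chart_ring ?\<sigma>" "e p \<noteq> 0" "{q \<in> U ?\<sigma>. e q \<noteq> 0} \<subseteq> W"
    using openin_local[OF W(1) p \<sigma>] by blast
  show "\<exists>\<sigma>\<in>\<Sigma>. p \<in> U \<sigma> \<and> (\<exists>f\<in>chart_ring \<sigma>. \<exists>g\<in>chart_ring \<sigma>. g p \<noteq> 0 \<and> (\<forall>q\<in>U \<sigma>. g q \<noteq> 0 \<longrightarrow> q \<in> W \<and> h' q = f q / g q))"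
    using \<sigma> fg e eq chart_ring_mult[OF \<sigma>(1) e(1) fg(1)] chart_ring_mult[OF \<sigma>(1) e(1) fg(2)]
    by (intro bexI[OF _ \<sigma>(1)] conjI bexI[of _ "\<lambda>q. e q * f q"] bexI[of _ "\<lambda>q. e q * g q"]) auto
qed

lemma regular_localI:
  assumes "\<And>p. p \<in> V \<Longrightarrow> \<exists>W h'. openin zar W \<and> p \<in> W \<and> W \<subseteq> V \<and> h' \<in> regular X W \<and> (\<forall>q\<in>W. h q = h' q)"
  shows "h \<in> regular X V"
  unfolding regular_iff
proof
  fix p assume "p \<in> V"
  from assms[OF this] obtain W h' where W: "openin zar W" "p \<in> W" "W \<subseteq> V" "h' \<in> regular X W" "\<And>q. q \<in> W \<Longrightarrow> h q = h' q" by blast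
  from W(4)[unfolded regular_iff, rule_format, OF W(2)] obtain \<sigma> f g V' where
    *: "\<sigma> \<in> \<Sigma>" "f \<in> generated_algebra (toric_character \<sigma> ` dual_semigroup \<sigma>)"
    "g \<in> generated_algebra (toric_character \<sigma> ` dual_semigroup \<sigma>)"
    "openin zar V'" "p \<in> V'" "V' \<subseteq> W \<inter> U \<sigma>" "\<forall>q\<in>V'. g q \<noteq> 0 \<and> h' q = f q / g q" by blast
  have "\<forall>q\<in>V'. g q \<noteq> 0 \<and> h q = f q / g q" using * W(5) by (metis IntD1 subsetD)
  moreover have "V' \<subseteq> V \<inter> U \<sigma>" using * W(3) by blast
  ultimately show "\<exists>\<sigma>\<in>\<Sigma>. \<exists>f \<in> generated_algebra (toric_character \<sigma> ` dual_semigroup \<sigma>).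
    \<exists>g \<in> generated_algebra (toric_character \<sigma> ` dual_semigroup \<sigma>).
    \<exists>V'. openin zar V' \<and> p \<in> V' \<and> V' \<subseteq> V \<inter> U \<sigma> \<and> (\<forall>q\<in>V'. g q \<noteq> 0 \<and> h q = f q / g q)"
    using *(4,5)
    by (intro bexI[OF _ *(1)] bexI[OF _ *(2)] bexI[OF _ *(3)] exI[of _ V'] conjI)
qed

lemma regular_binop:
  assumes V: "openin zar V" and h: "h1 \<in> regular X V" "h2 \<in> regular X V"
  shows regular_add: "(\<lambda>q. h1 q + h2 q) \<in> regular X V"
    and regular_mult: "(\<lambda>q. h1 q * h2 q) \<in> regular X V"
proof -
  have loc: "\<exists>\<sigma> f1 f2 g. \<sigma> \<in> \<Sigma> \<and> p \<in> U \<sigma> \<and> f1 \<in> chart_ring \<sigma> \<and> f2 \<in> chart_ring \<sigma> \<and> g \<in> chart_ring \<sigma> \<and> g p \<noteq> 0 \<and>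
      (\<forall>q\<in>U \<sigma>. g q \<noteq> 0 \<longrightarrow> q \<in> V \<and> h1 q = f1 q / g q \<and> h2 q = f2 q / g q)" if p: "p \<in> V" for p
  proof -
    let ?\<sigma> = "cone_of p"
    have \<sigma>: "?\<sigma> \<in> \<Sigma>" "p \<in> U ?\<sigma>" using open_pts[OF V p] cone_of_mem cone_of_U by auto
    obtain f1 g1 where 1: "f1 \<in> chart_ring ?\<sigma>" "g1 \<in> chart_ring ?\<sigma>" "g1 p \<noteq> 0" "\<And>q. q \<in> U ?\<sigma> \<Longrightarrow> g1 q \<noteq> 0 \<Longrightarrow> q \<in> V \<and> h1 q = f1 q / g1 q"
      using regular_local[OF h(1) p \<sigma>] by blast
    obtain f2 g2 where 2: "f2 \<in> chart_ring ?\<sigma>" "g2 \<in> chart_ring ?\<sigma>" "g2 p \<noteq> 0" "\<And>q. q \<in> U ?\<sigma> \<Longrightarrow> g2 q \<noteq> 0 \<Longrightarrow> q \<in> V \<and> h2 q = f2 q / g2 q"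
      using regular_local[OF h(2) p \<sigma>] by blast
    show ?thesis
      using \<sigma> 1 2 chart_ring_mult[OF \<sigma>(1)]
      by (intro exI[of _ ?\<sigma>] exI[of _ "\<lambda>q. f1 q * g2 q"] exI[of _ "\<lambda>q. g1 q * f2 q"] exI[of _ "\<lambda>q. g1 q * g2 q"]) auto
  qed
  show "(\<lambda>q. h1 q + h2 q) \<in> regular X V"
  proof (rule regularI)
    fix p assume "p \<in> V"
    from loc[OF this] obtain \<sigma> f1 f2 g where "\<sigma> \<in> \<Sigma>" "p \<in> U \<sigma>" "f1 \<in> chart_ring \<sigma>" "f2 \<in> chart_ring \<sigma>" "g \<in> chart_ring \<sigma>" "g p \<noteq> 0"
      "\<forall>q\<in>U \<sigma>. g q \<noteq> 0 \<longrightarrow> q \<in> V \<and> h1 q = f1 q / g q \<and> h2 q = f2 q / g q" by blast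
    then show "\<exists>\<sigma>\<in>\<Sigma>. p \<in> U \<sigma> \<and> (\<exists>f\<in>chart_ring \<sigma>. \<exists>g\<in>chart_ring \<sigma>. g p \<noteq> 0 \<and> (\<forall>q\<in>U \<sigma>. g q \<noteq> 0 \<longrightarrow> q \<in> V \<and> h1 q + h2 q = f q / g q))"
      using chart_ring_add[of f1 \<sigma> f2]
      by (intro bexI[of _ \<sigma>] conjI bexI[of _ "\<lambda>q. f1 q + f2 q"] bexI[of _ g]) (auto simp: add_divide_distrib)
  qed
  show "(\<lambda>q. h1 q * h2 q) \<in> regular X V"
  proof (rule regularI)
    fix p assume "p \<in> V"
    from loc[OF this] obtain \<sigma> f1 f2 g where a: "\<sigma> \<in> \<Sigma>" "p \<in> U \<sigma>" "f1 \<in> chart_ring \<sigma>" "f2 \<in> chart_ring \<sigma>" "g \<in> chart_ring \<sigma>" "g p \<noteq> 0"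
      "\<forall>q\<in>U \<sigma>. g q \<noteq> 0 \<longrightarrow> q \<in> V \<and> h1 q = f1 q / g q \<and> h2 q = f2 q / g q" by blast
    then show "\<exists>\<sigma>\<in>\<Sigma>. p \<in> U \<sigma> \<and> (\<exists>f\<in>chart_ring \<sigma>. \<exists>g\<in>chart_ring \<sigma>. g p \<noteq> 0 \<and> (\<forall>q\<in>U \<sigma>. g q \<noteq> 0 \<longrightarrow> q \<in> V \<and> h1 q * h2 q = f q / g q))"
      using chart_ring_mult[OF a(1), of f1 f2] chart_ring_mult[OF a(1), of g g]
      by (intro bexI[of _ \<sigma>] conjI bexI[of _ "\<lambda>q. f1 q * f2 q"] bexI[of _ "\<lambda>q. g q * g q"]) auto
  qed
qed

lemma regular_const:
  assumes V: "openin zar V"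
  shows "(\<lambda>_. k) \<in> regular X V"
proof (rule regular_localI)
  fix p assume p: "p \<in> V"
  let ?\<sigma> = "cone_of p"
  have \<sigma>: "?\<sigma> \<in> \<Sigma>" "p \<in> U ?\<sigma>" using open_pts[OF V p] cone_of_mem cone_of_U by auto
  have o: "openin zar (V \<inter> U ?\<sigma>)" using V openin_U[OF \<sigma>(1)] by blast
  have "(\<lambda>_. k) \<in> regular X (V \<inter> U ?\<sigma>)"
    by (rule regular_restrict[OF regular_chart_ring[OF \<sigma>(1) chart_ring_const[OF \<sigma>(1), of k]] o]) auto
  then show "\<exists>W h'. openin zar W \<and> p \<in> W \<and> W \<subseteq> V \<and> h' \<in> regular X W \<and> (\<forall>q\<in>W. k = h' q)"
    using p \<sigma> o by (intro exI[of _ "V \<inter> U ?\<sigma>"] exI[of _ "\<lambda>_. k"] conjI) simp_all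
qed

lemma regular_inverse:
  assumes V: "openin zar V" and h: "h \<in> regular X V" and nz: "\<And>q. q \<in> V \<Longrightarrow> h q \<noteq> 0"
  shows "(\<lambda>q. inverse (h q)) \<in> regular X V"
proof (rule regularI)
  fix p assume p: "p \<in> V"
  let ?\<sigma> = "cone_of p"
  have \<sigma>: "?\<sigma> \<in> \<Sigma>" "p \<in> U ?\<sigma>" using open_pts[OF V p] cone_of_mem cone_of_U by auto
  obtain f g where fg: "f \<in> chart_ring ?\<sigma>" "g \<in> chart_ring ?\<sigma>" "g p \<noteq> 0" "\<And>q. q \<in> U ?\<sigma> \<Longrightarrow> g q \<noteq> 0 \<Longrightarrow> q \<in> V \<and> h q = f q / g q"
    using regular_local[OF h p \<sigma>] by blast
  show "\<exists>\<sigma>\<in>\<Sigma>. p \<in> U \<sigma> \<and> (\<exists>f\<in>chart_ring \<sigma>. \<exists>g\<in>chart_ring \<sigma>. g p \<noteq> 0 \<and> (\<forall>q\<in>U \<sigma>. g q \<noteq> 0 \<longrightarrow> q \<in> V \<and> inverse (h q) = f q / g q))"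
    using \<sigma> fg nz[OF p] chart_ring_mult[OF \<sigma>(1)]
    by (intro bexI[OF _ \<sigma>(1)] conjI bexI[of _ "\<lambda>q. g q * g q"] bexI[of _ "\<lambda>q. f q * g q"]) auto
qed

lemma openin_nonvanishing:
  assumes V: "openin zar V" and h: "h \<in> regular X V"
  shows "openin zar {q \<in> V. h q \<noteq> 0}"
proof (subst openin_subopen, safe)
  fix p assume p: "p \<in> V" and nz: "h p \<noteq> 0"
  let ?\<sigma> = "cone_of p"
  have \<sigma>: "?\<sigma> \<in> \<Sigma>" "p \<in> U ?\<sigma>" using open_pts[OF V p] cone_of_mem cone_of_U by auto
  obtain f g where fg: "f \<in> chart_ring ?\<sigma>" "g \<in> chart_ring ?\<sigma>" "g p \<noteq> 0" "\<And>q. q \<in> U ?\<sigma> \<Longrightarrow> g q \<noteq> 0 \<Longrightarrow> q \<in> V \<and> h q = f q / g q"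
    using regular_local[OF h p \<sigma>] by blast
  have "openin zar {q \<in> U ?\<sigma>. f q * g q \<noteq> 0}"
    using openin_principal[OF \<sigma>(1) chart_ring_mult[OF \<sigma>(1) fg(1,2)]] .
  moreover have "p \<in> {q \<in> U ?\<sigma>. f q * g q \<noteq> 0}" using fg \<sigma> nz by auto
  moreover have "{q \<in> U ?\<sigma>. f q * g q \<noteq> 0} \<subseteq> {q \<in> V. h q \<noteq> 0}" using fg by auto
  ultimately show "\<exists>T. openin zar T \<and> p \<in> T \<and> T \<subseteq> {q \<in> V. h q \<noteq> 0}" by blast
qed


lemma regular_ev: "\<sigma> \<in> \<Sigma> \<Longrightarrow> m \<in> dual_semigroup \<sigma> \<Longrightarrow> (\<lambda>p. ev p m) \<in> regular X (U \<sigma>)"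
  by (rule regular_chart_ring[OF _ chart_ring_ev])

end


subsection \<open>The torus and its orbits\<close>

definition torus :: "(complex ^ 'n) set" where
  "torus = {t. \<forall>i. t $ i \<noteq> 0}"

definition tpow :: "complex ^ 'n \<Rightarrow> int ^ 'n \<Rightarrow> complex" where
  "tpow t m = (\<Prod>i\<in>UNIV. (t $ i) powi (m $ i))"

lemma tpow_zero [simp]: "tpow t 0 = 1"
  by (simp add: tpow_def)

lemma tpow_add: "t \<in> torus \<Longrightarrow> tpow t (m + m') = tpow t m * tpow t m'"
  by (simp add: tpow_def torus_def power_int_add prod.distrib)

lemma tpow_nonzero: "t \<in> torus \<Longrightarrow> tpow t m \<noteq> 0"
  by (simp add: tpow_def torus_def)

lemma tpow_mult_torus: "tpow (\<chi> i. t $ i * t' $ i) m = tpow t m * tpow t' m"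
  by (simp add: tpow_def power_int_mult_distrib prod.distrib)

lemma torus_mult: "t \<in> torus \<Longrightarrow> t' \<in> torus \<Longrightarrow> (\<chi> i. t $ i * t' $ i) \<in> torus"
  by (simp add: torus_def)

lemma torus_1: "1 \<in> torus"
  by (simp add: torus_def)

lemma tpow_one [simp]: "tpow 1 m = 1"
  by (simp add: tpow_def)

lemma tpow_separates:
  fixes m m' :: "int ^ 'n"
  assumes "m \<noteq> m'"
  obtains t where "t \<in> torus" "tpow t m \<noteq> tpow t m'"
proof -
  obtain i where i: "m $ i \<noteq> m' $ i" using assms by (auto simp: vec_eq_iff)
  define t :: "complex ^ 'n" where "t = (\<chi> j. if j = i then 2 else 1)"
  have t: "tpow t k = 2 powi (k $ i)" for k
  proof -
    have "tpow t k = (\<Prod>j\<in>UNIV. if j = i then 2 powi (k $ i) else 1)"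
      unfolding tpow_def t_def by (intro prod.cong) auto
    then show ?thesis by simp
  qed
  have "(2::complex) powi (m $ i) \<noteq> 2 powi (m' $ i)"
  proof
    assume "(2::complex) powi (m $ i) = 2 powi (m' $ i)"
    then have "norm ((2::complex) powi (m $ i)) = norm ((2::complex) powi (m' $ i))" by simp
    then have "(2::real) powi (m $ i) = 2 powi (m' $ i)" by (simp add: norm_power_int)
    then show False using i power_int_strict_increasing[of "m $ i" "m' $ i" "2::real"] power_int_strict_increasing[of "m' $ i" "m $ i" "2::real"]
      by (metis linorder_neqE_linordered_idom one_less_numeral_iff order_less_irrefl semiring_norm(76))
  qed
  then show thesis using that[of t] t by (simp add: torus_def t_def)
qed

text \<open>Artin's argument for the independence of characters: replace t by t0 t, with t0
  separating b from b', and subtract \<open>tpow t0 b\<close> times the original relation; the term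
  of b drops out while that of b' keeps a nonzero factor.\<close>

lemma tpow_independent:
  assumes "finite B" "\<And>t. t \<in> torus \<Longrightarrow> (\<Sum>m\<in>B. c m * tpow t m) = 0" "m \<in> B"
  shows "c m = 0"
  using assms
proof (induction B arbitrary: c m rule: finite_induct)
  case empty then show ?case by simp
next
  case (insert b B)
  have B: "c b' = 0" if b': "b' \<in> B" for b'
  proof -
    have "b \<noteq> b'" using insert.hyps b' by blast
    then obtain t0 where t0: "t0 \<in> torus" "tpow t0 b \<noteq> tpow t0 b'" using tpow_separates by metis
    have "(\<Sum>m\<in>B. (c m * (tpow t0 m - tpow t0 b)) * tpow t m) = 0" if t: "t \<in> torus" for t
    proof -
      have 1: "c b * tpow t b + (\<Sum>m\<in>B. c m * tpow t m) = 0"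
        using insert.prems(1)[OF t] insert.hyps by simp
      have 2: "c b * (tpow t b * tpow t0 b) + (\<Sum>m\<in>B. c m * (tpow t m * tpow t0 m)) = 0"
        using insert.prems(1)[OF torus_mult[OF t t0(1)]] insert.hyps by (simp add: tpow_mult_torus)
      have "(\<Sum>m\<in>B. (c m * (tpow t0 m - tpow t0 b)) * tpow t m) =
         (\<Sum>m\<in>B. c m * (tpow t m * tpow t0 m)) - tpow t0 b * (\<Sum>m\<in>B. c m * tpow t m)"
        by (simp add: sum_distrib_left sum_subtractf[symmetric] algebra_simps)
      also have "\<dots> = - (c b * (tpow t b * tpow t0 b)) - tpow t0 b * (- (c b * tpow t b))"
        using 1 2 by (simp only: add_eq_0_iff)
      also have "\<dots> = 0" by simp
      finally show ?thesis .
    qed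
    from insert.IH[OF this b'] show ?thesis using t0(2) by simp
  qed
  have "c b = 0" using insert.prems(1)[OF torus_1] insert.hyps B by simp
  then show ?case using B insert.prems(2) by auto
qed

text \<open>A character restricted to the one-parameter subgroup of v, translated by t, is the power
  given by its pairing with v.\<close>

lemma tpow_twist:
  assumes "t \<in> torus" "s \<noteq> 0" "lattice_vec v"
  shows "tpow (\<chi> i. t $ i * s powi \<lfloor>v $ i\<rfloor>) m = tpow t m * s powi (ipair m v)"
proof -
  have fl: "real_of_int \<lfloor>v $ i\<rfloor> = v $ i" for i
    using assms(3) unfolding lattice_vec_def by (metis Ints_cases floor_of_int)
  have "pairing m v = real_of_int (\<Sum>i\<in>UNIV. m $ i * \<lfloor>v $ i\<rfloor>)"
    by (simp add: pairing_def fl)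
  then have ip: "ipair m v = (\<Sum>i\<in>UNIV. m $ i * \<lfloor>v $ i\<rfloor>)" unfolding ipair_def by (metis floor_of_int)
  have S: "s powi (\<Sum>i\<in>I. m $ i * \<lfloor>v $ i\<rfloor>) = (\<Prod>i\<in>I. s powi (m $ i * \<lfloor>v $ i\<rfloor>))" for I
    by (induction I rule: infinite_finite_induct) (use assms(2) in \<open>auto simp: power_int_add\<close>)
  show ?thesis unfolding ip S
    by (simp add: tpow_def power_int_mult_distrib prod.distrib power_int_mult[symmetric] mult.commute)
qed

lemma torus_twist: "t \<in> torus \<Longrightarrow> s \<noteq> 0 \<Longrightarrow> (\<chi> i. t $ i * s powi f i) \<in> torus"
  by (simp add: torus_def)

text \<open>Along the complex line through two points of the torus a Laurent polynomial becomes a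
  polynomial after multiplication by a power of the coordinates.\<close>

lemma laurent_line:
  fixes t1 t2 :: "complex ^ 'n"
  assumes "finite B" and l: "\<And>s i. l s $ i = t1 $ i + s * (t2 $ i - t1 $ i)"
  shows "\<exists>P K. \<forall>s. l s \<in> torus \<longrightarrow> poly P s = (\<Prod>i\<in>UNIV. l s $ i ^ K) * (\<Sum>m\<in>B. c m * tpow (l s) m)"
proof -
  define K where "K = (\<Sum>m\<in>B. \<Sum>i\<in>UNIV. nat \<bar>m $ i\<bar>)"
  have K: "nat \<bar>m $ i\<bar> \<le> K" if "m \<in> B" for m i
  proof -
    have "nat \<bar>m $ i\<bar> \<le> (\<Sum>i\<in>UNIV. nat \<bar>m $ i\<bar>)" by (rule member_le_sum) auto
    also have "\<dots> \<le> K" unfolding K_def using assms that by (intro member_le_sum) auto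
    finally show ?thesis .
  qed
  define p where "p i = [:t1 $ i, t2 $ i - t1 $ i:]" for i
  define P where "P = (\<Sum>m\<in>B. smult (c m) (\<Prod>i\<in>UNIV. p i ^ nat (m $ i + int K)))"
  show ?thesis
  proof (intro exI allI impI)
    fix s assume ts: "l s \<in> torus"
    define t where "t = l s"
    have tn: "t $ i \<noteq> 0" for i using ts by (simp add: torus_def t_def)
    have pt: "poly (p i) s = t $ i" for i by (simp add: p_def t_def l)
    have "poly P s = (\<Sum>m\<in>B. c m * (\<Prod>i\<in>UNIV. (t $ i) ^ nat (m $ i + int K)))"
      by (simp add: P_def poly_sum poly_prod pt)
    also have "\<dots> = (\<Sum>m\<in>B. c m * ((\<Prod>i\<in>UNIV. t $ i ^ K) * tpow t m))"
    proof (rule sum.cong[OF refl])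
      fix m assume m: "m \<in> B"
      have "(t $ i) ^ nat (m $ i + int K) = t $ i ^ K * t $ i powi (m $ i)" for i
      proof -
        have "0 \<le> m $ i + int K" using K[OF m, of i] by linarith
        then have "(t $ i) ^ nat (m $ i + int K) = t $ i powi (m $ i + int K)" by (simp add: power_int_def)
        also have "\<dots> = t $ i powi (m $ i) * t $ i powi (int K)" using tn[of i] by (simp add: power_int_add)
        finally show ?thesis by simp
      qed
      then show "c m * (\<Prod>i\<in>UNIV. (t $ i) ^ nat (m $ i + int K)) = c m * ((\<Prod>i\<in>UNIV. t $ i ^ K) * tpow t m)"
        by (simp add: tpow_def prod.distrib)
    qed
    also have "\<dots> = (\<Prod>i\<in>UNIV. t $ i ^ K) * (\<Sum>m\<in>B. c m * tpow t m)"
      by (simp add: sum_distrib_left mult.left_commute)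
    finally show "poly P s = (\<Prod>i\<in>UNIV. l s $ i ^ K) * (\<Sum>m\<in>B. c m * tpow (l s) m)"
      by (simp only: t_def)
  qed
qed

text \<open>Irreducibility of the torus, by restriction to the complex line through the two points,
  where nonzero polynomials have finitely many roots.\<close>

lemma laurent_domain:
  assumes B: "finite B" "t1 \<in> torus" "(\<Sum>m\<in>B. b m * tpow t1 m) \<noteq> 0"
    and C: "finite C" "t2 \<in> torus" "(\<Sum>m\<in>C. c m * tpow t2 m) \<noteq> 0"
  obtains t where "t \<in> torus" "(\<Sum>m\<in>B. b m * tpow t m) \<noteq> 0" "(\<Sum>m\<in>C. c m * tpow t m) \<noteq> 0"
proof -
  define l where "l s = (\<chi> i. t1 $ i + s * (t2 $ i - t1 $ i))" for s
  have l: "l s $ i = t1 $ i + s * (t2 $ i - t1 $ i)" for s i by (simp add: l_def)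
  have l0: "l 0 = t1" and l1: "l 1 = t2" by (simp_all add: l_def vec_eq_iff)
  obtain P K where P: "\<And>s. l s \<in> torus \<Longrightarrow> poly P s = (\<Prod>i\<in>UNIV. l s $ i ^ K) * (\<Sum>m\<in>B. b m * tpow (l s) m)"
    using laurent_line[OF B(1) l, of b] by blast
  obtain Q L where Q: "\<And>s. l s \<in> torus \<Longrightarrow> poly Q s = (\<Prod>i\<in>UNIV. l s $ i ^ L) * (\<Sum>m\<in>C. c m * tpow (l s) m)"
    using laurent_line[OF C(1) l, of c] by blast
  have nz: "(\<Prod>i\<in>UNIV. l s $ i ^ k) \<noteq> 0" if "l s \<in> torus" for s k using that by (simp add: torus_def)
  have "poly P 0 \<noteq> 0" using P[of 0] nz[of 0 K] B by (simp add: l0)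
  then have P0: "P \<noteq> 0" by auto
  have "poly Q 1 \<noteq> 0" using Q[of 1] nz[of 1 L] C by (simp add: l1)
  then have Q0: "Q \<noteq> 0" by auto
  \<comment> \<open>The product of the coordinates keeps the chosen parameter inside the
    torus.\<close>
  define R where "R = P * Q * (\<Prod>i\<in>UNIV. [:t1 $ i, t2 $ i - t1 $ i:])"
  have "R \<noteq> 0" using P0 Q0 B(2) by (auto simp: R_def torus_def)
  then have "finite {s. poly R s = 0}" by (rule poly_roots_finite)
  then obtain s where s: "poly R s \<noteq> 0" using ex_new_if_finite[OF infinite_UNIV_char_0] by blast
  have "l s \<in> torus" using s by (auto simp: R_def poly_prod l_def torus_def)
  then show thesis using that[of "l s"] P[of s] Q[of s] s by (auto simp: R_def)
qed

context toric begin

text \<open>The whole torus parametrises every orbit, redundantly: only the values on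
  \<open>perp \<gamma>\<close> count. The parameter 1 gives the distinguished point of the
  orbit.\<close>

definition orb :: "(real ^ 'n) set \<Rightarrow> complex ^ 'n \<Rightarrow> 'n local_toric_point set" where
  "orb \<gamma> t = mk \<gamma> (\<lambda>m. if m \<in> perp \<gamma> then tpow t m else 0)"

abbreviation tor where "tor \<equiv> orb {0}"

lemma perp_add_iff:
  assumes "m \<in> dual_semigroup \<gamma>" "m' \<in> dual_semigroup \<gamma>"
  shows "m + m' \<in> perp \<gamma> \<longleftrightarrow> m \<in> perp \<gamma> \<and> m' \<in> perp \<gamma>"
proof
  assume s: "m + m' \<in> perp \<gamma>"
  have "pairing m v = 0 \<and> pairing m' v = 0" if v: "v \<in> \<gamma>" for v
  proof -
    have "pairing m v + pairing m' v = 0" "0 \<le> pairing m v" "0 \<le> pairing m' v"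
      using s assms v by (auto simp: perp_def dual_semigroup_def pairing_simps)
    then show ?thesis by linarith
  qed
  then show "m \<in> perp \<gamma> \<and> m' \<in> perp \<gamma>" by (simp add: perp_def)
qed (auto intro: perp_add)

lemma perp_zero_cone [simp]: "perp {0} = UNIV" and dual_zero_cone [simp]: "dual_semigroup {0} = UNIV"
  by (auto simp: perp_def dual_semigroup_def)

lemma orb_props:
  assumes "\<gamma> \<in> \<Sigma>" "t \<in> torus"
  shows orb_U: "orb \<gamma> t \<in> U \<gamma>"
    and ev_orb: "m \<in> dual_semigroup \<gamma> \<Longrightarrow> ev (orb \<gamma> t) m = (if m \<in> perp \<gamma> then tpow t m else 0)"
  unfolding orb_def
  using assms by (auto intro!: mk_mem ev_mk[THEN trans] simp: perp_add_iff tpow_add)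

lemma orb_pts: "\<gamma> \<in> \<Sigma> \<Longrightarrow> t \<in> torus \<Longrightarrow> orb \<gamma> t \<in> pts"
  using orb_U U_pts by blast

lemma cone_of_orb:
  assumes "\<gamma> \<in> \<Sigma>" "t \<in> torus"
  shows "cone_of (orb \<gamma> t) = \<gamma>"
proof
  let ?p = "orb \<gamma> t"
  have p: "?p \<in> pts" "cone_of ?p \<subseteq> \<gamma>" "cone_of ?p \<in> \<Sigma>"
    using orb_U[OF assms] U_iff[OF assms(1)] cone_of_mem by auto
  then show "cone_of ?p \<subseteq> \<gamma>" by simp
  obtain m where m: "m \<in> dual_semigroup \<gamma>" "m \<in> perp (cone_of ?p)" "\<And>v. v \<in> \<gamma> \<Longrightarrow> pairing m v = 0 \<longleftrightarrow> v \<in> cone_of ?p"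
    using exposing[OF assms(1) p(3,2)] by metis
  have "ev ?p m \<noteq> 0" using ev_nonzero_iff[OF p(1) perp_dual[OF m(2)]] m(2) by simp
  then have "m \<in> perp \<gamma>" using ev_orb[OF assms m(1)] by (auto split: if_splits)
  then show "\<gamma> \<subseteq> cone_of ?p" using m(3) by (auto simp: perp_def)
qed

lemma orb_in_U: "\<gamma> \<in> \<Sigma> \<Longrightarrow> t \<in> torus \<Longrightarrow> \<sigma> \<in> \<Sigma> \<Longrightarrow> orb \<gamma> t \<in> U \<sigma> \<longleftrightarrow> \<gamma> \<subseteq> \<sigma>"
  using U_iff orb_pts cone_of_orb by auto

lemma ev_tor [simp]: "t \<in> torus \<Longrightarrow> ev (tor t) m = tpow t m"
  using ev_orb[OF fan_zero_cone] by simp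

lemma zero_cone_subset: "\<sigma> \<in> \<Sigma> \<Longrightarrow> {0} \<subseteq> \<sigma>"
  using fan_zero_mem by blast

lemma tor_U: "t \<in> torus \<Longrightarrow> \<sigma> \<in> \<Sigma> \<Longrightarrow> tor t \<in> U \<sigma>"
  using orb_in_U[OF fan_zero_cone] zero_cone_subset by blast

lemma chart_ring_orb:
  assumes \<sigma>: "\<sigma> \<in> \<Sigma>" and \<gamma>: "\<gamma> \<in> \<Sigma>" "\<gamma> \<subseteq> \<sigma>" and B: "B \<subseteq> dual_semigroup \<sigma>" "finite B"
    and f: "\<forall>p\<in>U \<sigma>. f p = (\<Sum>m\<in>B. c m * ev p m)" and t: "t \<in> torus"
  shows "f (orb \<gamma> t) = (\<Sum>m\<in>B \<inter> perp \<gamma>. c m * tpow t m)"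
proof -
  have "orb \<gamma> t \<in> U \<sigma>" using orb_in_U \<sigma> \<gamma> t by blast
  then have "f (orb \<gamma> t) = (\<Sum>m\<in>B. c m * ev (orb \<gamma> t) m)" using f by blast
  also have "\<dots> = (\<Sum>m\<in>B. if m \<in> perp \<gamma> then c m * tpow t m else 0)"
    using ev_orb[OF \<gamma>(1) t] B dual_antimono[OF \<gamma>(2)] by (intro sum.cong) auto
  also have "\<dots> = (\<Sum>m\<in>B \<inter> perp \<gamma>. c m * tpow t m)" using B(2) by (simp add: sum.inter_restrict)
  finally show ?thesis .
qed

text \<open>Some monomial of f is nonzero at p, so its exponent is orthogonal to the cone of p and
  hence to \<gamma>. It survives restriction to the orbit of \<gamma>, where characters are
  independent. This is what puts p into the closure of that orbit.\<close>

lemma chart_ring_nonzero_orb: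
  assumes \<sigma>: "\<sigma> \<in> \<Sigma>" "p \<in> U \<sigma>" and \<gamma>: "\<gamma> \<in> \<Sigma>" "\<gamma> \<subseteq> cone_of p" and f: "f \<in> chart_ring \<sigma>" "f p \<noteq> 0"
  obtains t where "t \<in> torus" "f (orb \<gamma> t) \<noteq> 0"
proof -
  obtain B c where B: "finite B" "B \<subseteq> dual_semigroup \<sigma>" "\<And>p. p \<in> U \<sigma> \<Longrightarrow> f p = (\<Sum>m\<in>B. c m * ev p m)"
    using chart_ringE[OF f(1)] by metis
  have B3: "\<forall>p\<in>U \<sigma>. f p = (\<Sum>m\<in>B. c m * ev p m)" using B(3) by blast
  have \<gamma>\<sigma>: "\<gamma> \<subseteq> \<sigma>" using \<gamma> U_iff \<sigma> by blast
  obtain m where m: "m \<in> B" "c m * ev p m \<noteq> 0" using f(2) B(3)[OF \<sigma>(2)] by (metis (no_types, lifting) sum.neutral)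
  then have "m \<in> perp (cone_of p)" using ev_nonzero_iff[of p m] U_dual[OF \<sigma>, of m] B(2) U_pts \<sigma> by auto
  then have mg: "m \<in> B \<inter> perp \<gamma>" using perp_antimono[OF \<gamma>(2)] m(1) by blast
  have "\<exists>t\<in>torus. (\<Sum>m\<in>B \<inter> perp \<gamma>. c m * tpow t m) \<noteq> 0"
  proof (rule ccontr)
    assume "\<not> ?thesis"
    then have "c m = 0" using tpow_independent[of "B \<inter> perp \<gamma>" c m] B(1) mg by blast
    then show False using m(2) by simp
  qed
  then show thesis using chart_ring_orb[OF \<sigma>(1) \<gamma>(1) \<gamma>\<sigma> B(2,1) B3] that by (metis (no_types, lifting))
qed

lemma chart_ring_orb_domain:
  assumes \<sigma>: "\<sigma> \<in> \<Sigma>" and \<gamma>: "\<gamma> \<in> \<Sigma>" "\<gamma> \<subseteq> \<sigma>" and f: "f \<in> chart_ring \<sigma>" and g: "g \<in> chart_ring \<sigma>"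
    and t: "t1 \<in> torus" "f (orb \<gamma> t1) \<noteq> 0" "t2 \<in> torus" "g (orb \<gamma> t2) \<noteq> 0"
  obtains t where "t \<in> torus" "f (orb \<gamma> t) \<noteq> 0" "g (orb \<gamma> t) \<noteq> 0"
proof -
  obtain B b where B: "finite B" "B \<subseteq> dual_semigroup \<sigma>" "\<And>p. p \<in> U \<sigma> \<Longrightarrow> f p = (\<Sum>m\<in>B. b m * ev p m)"
    using chart_ringE[OF f] by metis
  obtain C c where C: "finite C" "C \<subseteq> dual_semigroup \<sigma>" "\<And>p. p \<in> U \<sigma> \<Longrightarrow> g p = (\<Sum>m\<in>C. c m * ev p m)"
    using chart_ringE[OF g] by metis
  have B3: "\<forall>p\<in>U \<sigma>. f p = (\<Sum>m\<in>B. b m * ev p m)" and C3: "\<forall>p\<in>U \<sigma>. g p = (\<Sum>m\<in>C. c m * ev p m)"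
    using B(3) C(3) by blast+
  note fo = chart_ring_orb[OF \<sigma> \<gamma> B(2,1) B3] and go = chart_ring_orb[OF \<sigma> \<gamma> C(2,1) C3]
  obtain t where "t \<in> torus" "(\<Sum>m\<in>B \<inter> perp \<gamma>. b m * tpow t m) \<noteq> 0" "(\<Sum>m\<in>C \<inter> perp \<gamma>. c m * tpow t m) \<noteq> 0"
    using laurent_domain[of "B \<inter> perp \<gamma>" t1 b "C \<inter> perp \<gamma>" t2 c] B(1) C(1) t fo[OF t(1)] go[OF t(3)] by auto
  then show thesis using that fo go by metis
qed

lemma orb_closure_mem:
  assumes \<gamma>: "\<gamma> \<in> \<Sigma>" and p: "p \<in> pts" "\<gamma> \<subseteq> cone_of p"
  shows "p \<in> zar closure_of (orb \<gamma> ` torus)"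
  unfolding in_closure_of topspace_zar
proof (intro conjI p(1) allI impI)
  fix V assume V: "p \<in> V \<and> openin zar V"
  obtain f where f: "f \<in> chart_ring (cone_of p)" "f p \<noteq> 0" "{q \<in> U (cone_of p). f q \<noteq> 0} \<subseteq> V"
    using openin_local[of V p "cone_of p"] V cone_of_mem[OF p(1)] cone_of_U[OF p(1)] by blast
  obtain t where "t \<in> torus" "f (orb \<gamma> t) \<noteq> 0"
    using chart_ring_nonzero_orb[OF cone_of_mem[OF p(1)] cone_of_U[OF p(1)] \<gamma> p(2) f(1,2)] .
  then show "\<exists>y. y \<in> orb \<gamma> ` torus \<and> y \<in> V"
    using f(3) orb_in_U[OF \<gamma> _ cone_of_mem[OF p(1)]] p(2) by blast
qed

lemma tor_dense:
  assumes "openin zar V" "V \<noteq> {}"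
  obtains t where "t \<in> torus" "tor t \<in> V"
proof -
  obtain p where p: "p \<in> V" using assms by blast
  then have "p \<in> pts" using open_pts assms by blast
  then have "p \<in> zar closure_of (tor ` torus)"
    using orb_closure_mem[OF fan_zero_cone] zero_cone_subset cone_of_mem by blast
  then show thesis using that assms p unfolding in_closure_of by blast
qed

lemma orb_open_Int:
  assumes \<gamma>: "\<gamma> \<in> \<Sigma>" and V: "openin zar V" "openin zar W" and t: "t1 \<in> torus" "orb \<gamma> t1 \<in> V" "t2 \<in> torus" "orb \<gamma> t2 \<in> W"
  obtains t where "t \<in> torus" "orb \<gamma> t \<in> V \<inter> W"
proof -
  obtain f where f: "f \<in> chart_ring \<gamma>" "f (orb \<gamma> t1) \<noteq> 0" "{q \<in> U \<gamma>. f q \<noteq> 0} \<subseteq> V"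
    using openin_local[OF V(1) t(2) \<gamma> orb_U[OF \<gamma> t(1)]] by blast
  obtain g where g: "g \<in> chart_ring \<gamma>" "g (orb \<gamma> t2) \<noteq> 0" "{q \<in> U \<gamma>. g q \<noteq> 0} \<subseteq> W"
    using openin_local[OF V(2) t(4) \<gamma> orb_U[OF \<gamma> t(3)]] by blast
  obtain t where "t \<in> torus" "f (orb \<gamma> t) \<noteq> 0" "g (orb \<gamma> t) \<noteq> 0"
    using chart_ring_orb_domain[OF \<gamma> \<gamma> order.refl f(1) g(1) t(1) f(2) t(3) g(2)] .
  then show thesis using that f(3) g(3) orb_U[OF \<gamma>] by blast
qed

lemma orb_closure_irreducible:
  assumes \<gamma>: "\<gamma> \<in> \<Sigma>"
  shows "irreducible_closed X (zar closure_of (orb \<gamma> ` torus))"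
  unfolding irreducible_closed_def zar_def[symmetric]
proof (intro conjI allI impI closedin_closure_of)
  have sub: "orb \<gamma> ` torus \<subseteq> topspace zar" using orb_pts[OF \<gamma>] topspace_zar by blast
  have inc: "orb \<gamma> t \<in> zar closure_of (orb \<gamma> ` torus)" if "t \<in> torus" for t
    using closure_of_subset[OF sub] that by blast
  show "zar closure_of (orb \<gamma> ` torus) \<noteq> {}" using inc[OF torus_1] by blast
  fix A B assume AB: "closedin zar A \<and> closedin zar B \<and> zar closure_of (orb \<gamma> ` torus) \<subseteq> A \<union> B"
  show "zar closure_of (orb \<gamma> ` torus) \<subseteq> A \<or> zar closure_of (orb \<gamma> ` torus) \<subseteq> B"
  proof (rule ccontr)
    assume "\<not> ?thesis"
    then have n: "\<not> orb \<gamma> ` torus \<subseteq> A" "\<not> orb \<gamma> ` torus \<subseteq> B" using AB closure_of_minimal by blast+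
    have o: "openin zar (topspace zar - A)" "openin zar (topspace zar - B)" using AB by auto
    obtain t1 t2 where "t1 \<in> torus" "orb \<gamma> t1 \<in> topspace zar - A" "t2 \<in> torus" "orb \<gamma> t2 \<in> topspace zar - B"
      using n sub by blast
    from orb_open_Int[OF \<gamma> o this] obtain t where "t \<in> torus" "orb \<gamma> t \<in> (topspace zar - A) \<inter> (topspace zar - B)" .
    then show False using AB inc by blast
  qed
qed

section \<open>One-parameter arcs and their limit points\<close>

definition ray_arc :: "(real ^ 'n) set \<Rightarrow> real ^ 'n \<Rightarrow> complex ^ 'n \<Rightarrow> complex \<Rightarrow> 'n local_toric_point set" where
  "ray_arc \<sigma> v t s = mk \<sigma> (\<lambda>m. tpow t m * s ^ nat (ipair m v))"

text \<open>Pairings with v are nonnegative on the dual semigroup, so the one-parameter subgroup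
  extends over s = 0; there 0^0 = 1 keeps exactly the characters orthogonal to v.\<close>

lemma ray_arc_props:
  assumes \<sigma>: "\<sigma> \<in> \<Sigma>" and v: "v \<in> \<sigma>" "lattice_vec v" and t: "t \<in> torus"
  shows ray_arc_U: "ray_arc \<sigma> v t s \<in> U \<sigma>"
    and ev_ray_arc: "m \<in> dual_semigroup \<sigma> \<Longrightarrow> ev (ray_arc \<sigma> v t s) m = tpow t m * s ^ nat (ipair m v)"
proof -
  have ip: "0 \<le> ipair m v" if "m \<in> dual_semigroup \<sigma>" for m
    using that v(1) by (auto simp: dual_semigroup_def ipair_def)
  have add: "tpow t (m + m') * s ^ nat (ipair (m + m') v) = tpow t m * s ^ nat (ipair m v) * (tpow t m' * s ^ nat (ipair m' v))"
    if "m \<in> dual_semigroup \<sigma>" "m' \<in> dual_semigroup \<sigma>" for m m'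
    using ip[OF that(1)] ip[OF that(2)] by (simp add: ipair_add[OF v(2)] nat_add_distrib power_add tpow_add[OF t])
  show "ray_arc \<sigma> v t s \<in> U \<sigma>" unfolding ray_arc_def by (rule mk_mem[OF \<sigma>]) (use add in auto)
  show "ev (ray_arc \<sigma> v t s) m = tpow t m * s ^ nat (ipair m v)" if "m \<in> dual_semigroup \<sigma>"
    unfolding ray_arc_def by (rule ev_mk[OF \<sigma>]) (use add that in auto)
qed

lemma ray_arc_nonzero:
  assumes \<sigma>: "\<sigma> \<in> \<Sigma>" and v: "v \<in> \<sigma>" "lattice_vec v" and t: "t \<in> torus" and s: "s \<noteq> 0"
  shows "ray_arc \<sigma> v t s = tor (\<chi> i. t $ i * s powi \<lfloor>v $ i\<rfloor>)"
proof (rule point_eqI[OF \<sigma> ray_arc_U[OF \<sigma> v t] tor_U[OF torus_twist[OF t s] \<sigma>]])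
  fix m assume m: "m \<in> dual_semigroup \<sigma>"
  have "0 \<le> ipair m v" using m v(1) by (auto simp: dual_semigroup_def ipair_def)
  then show "ev (ray_arc \<sigma> v t s) m = ev (tor (\<chi> i. t $ i * s powi \<lfloor>v $ i\<rfloor>)) m"
    unfolding ev_ray_arc[OF \<sigma> v t m] ev_tor[OF torus_twist[OF t s]] tpow_twist[OF t s v(2)]
    by (simp add: power_int_def)
qed

lemma continuous_on_tpow: "continuous_on torus (\<lambda>t. tpow t m)"
  unfolding tpow_def by (intro continuous_intros) (auto simp: torus_def)

lemma continuous_on_chart_ring_tor:
  assumes "f \<in> chart_ring \<sigma>" "\<sigma> \<in> \<Sigma>"
  shows "continuous_on torus (\<lambda>t. f (tor t))"
proof -
  obtain B c where B: "finite B" "B \<subseteq> dual_semigroup \<sigma>" "\<And>p. p \<in> U \<sigma> \<Longrightarrow> f p = (\<Sum>m\<in>B. c m * ev p m)"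
    using chart_ringE[OF assms(1)] by metis
  have "continuous_on torus (\<lambda>t. \<Sum>m\<in>B. c m * tpow t m)"
    by (intro continuous_intros continuous_on_tpow)
  then show ?thesis by (rule continuous_on_eq) (simp add: B(3) tor_U assms(2))
qed

lemma continuous_on_chart_ring_arc:
  assumes "f \<in> chart_ring \<sigma>" "\<sigma> \<in> \<Sigma>" "v \<in> \<sigma>" "lattice_vec v" "t \<in> torus"
  shows "continuous_on UNIV (\<lambda>s. f (ray_arc \<sigma> v t s))"
proof -
  obtain B c where B: "finite B" "B \<subseteq> dual_semigroup \<sigma>" "\<And>p. p \<in> U \<sigma> \<Longrightarrow> f p = (\<Sum>m\<in>B. c m * ev p m)"
    using chart_ringE[OF assms(1)] by metis
  have "f (ray_arc \<sigma> v t s) = (\<Sum>m\<in>B. c m * (tpow t m * s ^ nat (ipair m v)))" for s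
    using B(2) ev_ray_arc[OF assms(2-5)] by (subst B(3)[OF ray_arc_U[OF assms(2-5)]]) (auto intro!: sum.cong)
  then show ?thesis by (simp, intro continuous_intros)
qed

end


subsection \<open>Completeness and the support of the fan\<close>

definition affine_carrier :: "nat \<Rightarrow> (nat \<Rightarrow> complex) set" where
  "affine_carrier k = {v. \<forall>i\<ge>k. v i = 0}"

definition affine_ring :: "nat \<Rightarrow> ((nat \<Rightarrow> complex) \<Rightarrow> complex) set" where
  "affine_ring k = generated_algebra {\<lambda>v. v i | i. i < k}"

lemma affine_zariski:
  "zariski (affine_space k) = topology_generated_by {{p \<in> affine_carrier k. f p \<noteq> 0} | f. f \<in> affine_ring k}"
proof -
  have "{{p \<in> W. f p \<noteq> 0} | W G f. (W, G) \<in> {({v. \<forall>i\<ge>k. v i = 0}, {\<lambda>v. v i | i. i < k})} \<and> f \<in> generated_algebra G}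
     = {{p \<in> affine_carrier k. f p \<noteq> 0} | f. f \<in> affine_ring k}"
    unfolding affine_carrier_def affine_ring_def by blast
  then show ?thesis by (simp add: affine_space_def space_of_atlas_def Let_def)
qed

lemma affine_ring_const: "(\<lambda>_. c) \<in> affine_ring k"
  by (simp add: affine_ring_def generated_algebra.const)

lemma affine_ring_coord: "i < k \<Longrightarrow> (\<lambda>v. v i) \<in> affine_ring k"
  unfolding affine_ring_def by (rule generated_algebra.gen) blast

lemma affine_ring_mult: "f \<in> affine_ring k \<Longrightarrow> g \<in> affine_ring k \<Longrightarrow> (\<lambda>v. f v * g v) \<in> affine_ring k"
  unfolding affine_ring_def by (rule generated_algebra.mult)

lemma affine_ring_power: "f \<in> affine_ring k \<Longrightarrow> (\<lambda>v. f v ^ j) \<in> affine_ring k"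
  by (induction j) (auto simp: affine_ring_const affine_ring_mult)

lemma affine_openin: "f \<in> affine_ring k \<Longrightarrow> openin (zariski (affine_space k)) {p \<in> affine_carrier k. f p \<noteq> 0}"
  unfolding affine_zariski by (rule topology_generated_by_Basis) blast

lemma affine_topspace: "topspace (zariski (affine_space k)) = affine_carrier k"
proof
  show "affine_carrier k \<subseteq> topspace (zariski (affine_space k))"
    using affine_openin[OF affine_ring_const[of 1 k]] openin_subset by force
qed (auto simp: affine_zariski)

lemma affine_regular:
  assumes f: "f \<in> affine_ring k"
  shows "f \<in> regular (affine_space k) (affine_carrier k)"
proof -
  have "\<exists>f'\<in>affine_ring k. \<exists>g\<in>affine_ring k. \<exists>V. openin (zariski (affine_space k)) V \<and> p \<in> V \<and>
     V \<subseteq> affine_carrier k \<inter> affine_carrier k \<and> (\<forall>q\<in>V. g q \<noteq> 0 \<and> f q = f' q / g q)" if "p \<in> affine_carrier k" for p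
    using that openin_topspace[of "zariski (affine_space k)"]
    by (intro bexI[OF _ f] bexI[OF _ affine_ring_const[of 1 k]] exI[of _ "affine_carrier k"])
      (auto simp: affine_topspace)
  then show ?thesis
    unfolding affine_space_def space_of_atlas_def Let_def affine_carrier_def[symmetric] affine_ring_def by simp
qed

text \<open>Affine space as a closed subvariety of itself, the shape in which
  \<open>complete_variety\<close> takes its second factor.\<close>

abbreviation affine_var :: "nat \<Rightarrow> (nat \<Rightarrow> complex) space_with_functions" where
  "affine_var k \<equiv> induced_on (affine_space k) (affine_carrier k)"

lemma affine_var_zariski: "zariski (affine_var k) = zariski (affine_space k)"
  by (simp add: induced_on_def affine_topspace[symmetric] subtopology_topspace)

lemma affine_var_regular: "f \<in> affine_ring k \<Longrightarrow> f \<in> regular (affine_var k) (affine_carrier k)"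
proof -
  assume f: "f \<in> affine_ring k"
  have "openin (zariski (affine_space k)) (affine_carrier k)"
    using openin_topspace[of "zariski (affine_space k)"] by (simp add: affine_topspace)
  then show ?thesis using affine_regular[OF f]
    by (auto simp: induced_on_def intro!: exI[of _ "affine_carrier k"] exI[of _ f])
qed

lemma face_of_cone_sum:
  assumes F: "F face_of C" and C: "convex_cone C" "convex_cone F"
    and fin: "finite I" and f: "\<And>i. i \<in> I \<Longrightarrow> f i \<in> C" and s: "(\<Sum>i\<in>I. f i) \<in> F" and i: "i \<in> I"
  shows "f i \<in> F"
proof -
  have "(\<Sum>i\<in>I. f i) = f i + (\<Sum>i\<in>I - {i}. f i)" using fin i by (rule sum.remove)
  moreover have "(\<Sum>i\<in>I - {i}. f i) \<in> C" using f by (intro convex_cone_sum[OF C(1)]) auto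
  ultimately show ?thesis using face_of_cone_add(1)[OF F C f[OF i]] s by simp
qed

context toric begin

lemma product_topspace: "topspace (product_zariski X (affine_var k)) = pts \<times> affine_carrier k"
proof
  have a: "openin (zariski X) pts" by (metis openin_topspace topspace_zar zar_def)
  have b: "openin (zariski (affine_var k)) (affine_carrier k)"
    using openin_topspace[of "zariski (affine_space k)"] by (simp add: affine_topspace affine_var_zariski)
  have c: "(\<lambda>_. 1) \<in> regular X pts" using a regular_const[of pts 1] by (simp add: zar_def)
  have mem: "{(x, y) \<in> pts \<times> affine_carrier k. (\<Sum>i<Suc 0. (\<lambda>_ _. 1) i x * (\<lambda>_ _. 1) i y) \<noteq> (0::complex)} \<in>
    {{(x, y) \<in> U \<times> V. (\<Sum>i<j. f i x * g i y) \<noteq> 0} | U V (j::nat) f g.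
        openin (zariski X) U \<and> openin (zariski (affine_var k)) V \<and>
        (\<forall>i<j. f i \<in> regular X U) \<and> (\<forall>i<j. g i \<in> regular (affine_var k) V)}"
    using a b c affine_var_regular[OF affine_ring_const[of 1 k]]
    by (intro CollectI exI[of _ pts] exI[of _ "affine_carrier k"] exI[of _ "Suc 0"] exI[of _ "\<lambda>_ _. 1"] conjI refl) auto
  have e: "pts \<times> affine_carrier k = {(x, y) \<in> pts \<times> affine_carrier k. (\<Sum>i<Suc 0. (\<lambda>_ _. 1) i x * (\<lambda>_ _. 1) i y) \<noteq> (0::complex)}"
    by auto
  show "pts \<times> affine_carrier k \<subseteq> topspace (product_zariski X (affine_var k))"
    unfolding product_zariski_def topology_generated_by_topspace
    by (rule subset_trans[OF eq_refl[OF e] Union_upper[OF mem]])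
  show "topspace (product_zariski X (affine_var k)) \<subseteq> pts \<times> affine_carrier k"
    unfolding product_zariski_def topology_generated_by_topspace
    using openin_subset[of "zariski X"] openin_subset[of "zariski (affine_var k)"]
    unfolding affine_var_zariski affine_topspace points_X by fast
qed

lemma product_openin:
  assumes V: "openin zar V" and f: "f0 \<in> regular X V" "f1 \<in> regular X V" and g: "g0 \<in> affine_ring k" "g1 \<in> affine_ring k"
  shows "openin (product_zariski X (affine_var k)) {(x, y) \<in> V \<times> affine_carrier k. f0 x * g0 y + f1 x * g1 y \<noteq> 0}"
proof -
  have b: "openin (zariski (affine_var k)) (affine_carrier k)"
    using openin_topspace[of "zariski (affine_space k)"] by (simp add: affine_topspace affine_var_zariski)
  let ?f = "\<lambda>i::nat. if i = 0 then f0 else f1" and ?g = "\<lambda>i::nat. if i = 0 then g0 else g1"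
  have "{(x, y) \<in> V \<times> affine_carrier k. (\<Sum>i<2. ?f i x * ?g i y) \<noteq> 0} \<in>
    {{(x, y) \<in> U \<times> V. (\<Sum>i<j. f i x * g i y) \<noteq> 0} | U V (j::nat) f g.
        openin (zariski X) U \<and> openin (zariski (affine_var k)) V \<and>
        (\<forall>i<j. f i \<in> regular X U) \<and> (\<forall>i<j. g i \<in> regular (affine_var k) V)}"
    using V f b g[THEN affine_var_regular]
    by (intro CollectI exI[of _ V] exI[of _ "affine_carrier k"] exI[of _ "2::nat"] exI[of _ ?f] exI[of _ ?g] conjI refl) (auto simp: zar_def)
  moreover have "(\<Sum>i<2. ?f i x * ?g i y) = f0 x * g0 y + f1 x * g1 y" for x y
    by (simp add: numeral_2_eq_2)
  ultimately show ?thesis unfolding product_zariski_def by (intro topology_generated_by_Basis) simp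
qed

text \<open>Completeness is applied through this criterion, once to a one-parameter subgroup and
  once to the cone over a projective image. Two-term equations suffice for both, and each has to
  hold on \<open>C\<close> only over the open set \<open>V\<close>.\<close>

lemma complete_image_closed:
  assumes complete: "complete_variety X" and C: "C \<subseteq> pts \<times> affine_carrier k"
    and sep: "\<And>x y. x \<in> pts \<Longrightarrow> y \<in> affine_carrier k \<Longrightarrow> (x, y) \<notin> C \<Longrightarrow>
      \<exists>V f0 f1 g0 g1. openin zar V \<and> x \<in> V \<and> f0 \<in> regular X V \<and> f1 \<in> regular X V \<and> g0 \<in> affine_ring k \<and> g1 \<in> affine_ring k \<and>
        f0 x * g0 y + f1 x * g1 y \<noteq> 0 \<and> (\<forall>(x', y')\<in>C. x' \<in> V \<longrightarrow> f0 x' * g0 y' + f1 x' * g1 y' = 0)"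
  shows "closedin (zariski (affine_space k)) (snd ` C)"
proof -
  let ?T = "product_zariski X (affine_var k)"
  have "openin ?T (topspace ?T - C)"
  proof (subst openin_subopen, clarify)
    fix x y assume "(x, y) \<in> topspace ?T" "(x, y) \<notin> C"
    then have xy: "x \<in> pts" "y \<in> affine_carrier k" "(x, y) \<notin> C" by (auto simp: product_topspace)
    obtain V f0 f1 g0 g1 where V: "openin zar V" "x \<in> V" "f0 \<in> regular X V" "f1 \<in> regular X V" "g0 \<in> affine_ring k" "g1 \<in> affine_ring k"
      "f0 x * g0 y + f1 x * g1 y \<noteq> 0" "\<And>x' y'. (x', y') \<in> C \<Longrightarrow> x' \<in> V \<Longrightarrow> f0 x' * g0 y' + f1 x' * g1 y' = 0"
      using sep[OF xy] by fast
    let ?W = "{(x, y) \<in> V \<times> affine_carrier k. f0 x * g0 y + f1 x * g1 y \<noteq> 0}"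
    have "openin ?T ?W" using product_openin[OF V(1,3-6)] .
    moreover have "(x, y) \<in> ?W" using V xy by simp
    moreover have "?W \<subseteq> topspace ?T - C" using openin_subset[OF \<open>openin ?T ?W\<close>] V(8) by auto
    ultimately show "\<exists>T. openin ?T T \<and> (x, y) \<in> T \<and> T \<subseteq> topspace ?T - C" by blast
  qed
  then have cl: "closedin ?T C" using C by (simp add: closedin_def product_topspace)
  have "closedin (zariski (affine_space k)) (affine_carrier k)"
    using closedin_topspace[of "zariski (affine_space k)"] by (simp add: affine_topspace)
  then have "closed_map ?T (zariski (affine_var k)) snd"
    using complete unfolding complete_variety_def Let_def by blast
  then show ?thesis using cl unfolding closed_map_def affine_var_zariski by blast
qed

text \<open>Duality of cones with an integral functional: the separating hyperplane is rounded with
  v and the generators treated together, so that the strict sign at v and the weak signs on \<sigma>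
  persist.\<close>

lemma dual_separates:
  assumes \<sigma>: "\<sigma> \<in> \<Sigma>" and v: "lattice_vec v" "v \<notin> \<sigma>"
  obtains m where "m \<in> dual_semigroup \<sigma>" "pairing m v < 0"
proof -
  obtain S where S: "finite S" "\<And>w. w \<in> S \<Longrightarrow> lattice_vec w" "\<sigma> = convex_cone hull S" using fan_gens[OF \<sigma>] by metis
  have cc: "convex_cone \<sigma>" by (rule fan_cone[OF \<sigma>])
  then have "convex \<sigma>" by (simp add: convex_cone_def)
  then obtain a b where ab: "a \<bullet> v < b" "\<forall>x\<in>\<sigma>. b < a \<bullet> x"
    using separating_hyperplane_closed_point[OF _ fan_closed[OF \<sigma>] v(2)] by blast
  have b0: "b < 0" using ab(2) fan_zero_mem[OF \<sigma>] by force
  have nn: "0 \<le> a \<bullet> x" if x: "x \<in> \<sigma>" for x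
  proof (rule ccontr)
    assume "\<not> 0 \<le> a \<bullet> x"
    then have neg: "a \<bullet> x < 0" by simp
    have "(b / (a \<bullet> x)) *\<^sub>R x \<in> \<sigma>"
      using convex_cone_scaleR[OF cc _ x] b0 neg by (simp add: divide_nonpos_nonpos)
    then have "b < a \<bullet> ((b / (a \<bullet> x)) *\<^sub>R x)" using ab(2) by blast
    then show False using neg by simp
  qed
  have "\<And>w. w \<in> insert v S \<Longrightarrow> lattice_vec w" using S v by auto
  then obtain m where m: "\<And>w. w \<in> insert v S \<Longrightarrow> sgn (pairing m w) = sgn (a \<bullet> w)"
    using integral_sign_pairing[of "insert v S" a] S(1) by auto
  show thesis
  proof (rule that[of m])
    have "0 \<le> pairing m w" if "w \<in> S" for w
      using m[of w] nn[of w] that S(3) by (auto simp: hull_inc sgn_if split: if_splits)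
    then show "m \<in> dual_semigroup \<sigma>" using convex_cone_hull_pairing_nonneg[of S m] S(3) by (simp add: dual_semigroup_def)
    show "pairing m v < 0" using m[of v] ab(1) b0 by (auto simp: sgn_if split: if_splits)
  qed
qed

text \<open>If the lattice vector \<open>v\<close> lies in no cone, the graph of the one-parameter subgroup of \<open>v\<close> is
  closed in \<open>X \<times> \<complex>\<close>, although its image in \<open>\<complex>\<close> is not.\<close>

lemma complete_lattice_vec_mem:
  assumes complete: "complete_variety X" and v: "lattice_vec v"
  shows "v \<in> \<Union>\<Sigma>"
proof (rule ccontr)
  assume nv: "v \<notin> \<Union>\<Sigma>"
  \<comment> \<open>Points of affine 1-space are sequences supported at index 0.\<close>
  define pt where "pt s = (\<lambda>i::nat. if i = 0 then s else (0::complex))" for s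
  define l where "l s = tor (\<chi> i. (1::complex ^ 'n) $ i * s powi \<lfloor>v $ i\<rfloor>)" for s
  have ptc: "pt s \<in> affine_carrier 1" for s by (simp add: pt_def affine_carrier_def)
  have lt: "(\<chi> i. (1::complex ^ 'n) $ i * s powi \<lfloor>v $ i\<rfloor>) \<in> torus" if "s \<noteq> 0" for s
    using torus_twist[OF torus_1 that] .
  have evl: "ev (l s) m = s powi (ipair m v)" if "s \<noteq> 0" for s m
    unfolding l_def using ev_tor[OF lt[OF that]] tpow_twist[OF torus_1 that v] by simp
  have lU: "l s \<in> U \<sigma>" if "s \<noteq> 0" "\<sigma> \<in> \<Sigma>" for s \<sigma> unfolding l_def using tor_U[OF lt[OF that(1)] that(2)] .
  define C where "C = {(l s, pt s) | s. s \<noteq> 0}"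
  have cl: "closedin (zariski (affine_space 1)) (snd ` C)"
  proof (rule complete_image_closed[OF complete])
    show "C \<subseteq> pts \<times> affine_carrier 1"
      unfolding C_def using lU[OF _ fan_zero_cone] U_pts[OF fan_zero_cone] ptc by blast
    fix x y assume xy: "x \<in> pts" "y \<in> affine_carrier 1" "(x, y) \<notin> C"
    let ?\<sigma> = "cone_of x"
    have \<sigma>: "?\<sigma> \<in> \<Sigma>" "x \<in> U ?\<sigma>" using cone_of_mem cone_of_U xy by auto
    have y: "y = pt (y 0)" using xy(2) by (auto simp: pt_def affine_carrier_def fun_eq_iff)
    have coord: "(\<lambda>v. v 0) \<in> affine_ring 1" by (rule affine_ring_coord) simp
    have found: "\<exists>V f0 f1 g0 g1. openin zar V \<and> x \<in> V \<and> f0 \<in> regular X V \<and> f1 \<in> regular X V \<and> g0 \<in> affine_ring 1 \<and> g1 \<in> affine_ring 1 \<and>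
        f0 x * g0 y + f1 x * g1 y \<noteq> 0 \<and> (\<forall>(x', y')\<in>C. x' \<in> V \<longrightarrow> f0 x' * g0 y' + f1 x' * g1 y' = 0)"
      if "f0 \<in> regular X (U ?\<sigma>)" "f1 \<in> regular X (U ?\<sigma>)" "g0 \<in> affine_ring 1" "g1 \<in> affine_ring 1"
        "f0 x * g0 y + f1 x * g1 y \<noteq> 0" "\<And>s. s \<noteq> 0 \<Longrightarrow> f0 (l s) * g0 (pt s) + f1 (l s) * g1 (pt s) = 0"
      for f0 f1 g0 g1
    proof (intro exI conjI)
      show "\<forall>(x', y')\<in>C. x' \<in> U ?\<sigma> \<longrightarrow> f0 x' * g0 y' + f1 x' * g1 y' = 0"
        using that(6) by (auto simp: C_def)
    qed (use that \<sigma> openin_U[OF \<sigma>(1)] in blast)+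
    have rc: "(\<lambda>_. c) \<in> regular X (U ?\<sigma>)" for c using regular_const[OF openin_U[OF \<sigma>(1)]] .
    have pt0 [simp]: "pt s 0 = s" for s by (simp add: pt_def)
    \<comment> \<open>A character regular near x with negative pairing has a pole along the subgroup
      at s = 0, so no point over y = 0 lies in the closure of the graph.\<close>
    have "v \<notin> ?\<sigma>" using nv \<sigma>(1) by blast
    then obtain m where m: "m \<in> dual_semigroup ?\<sigma>" "pairing m v < 0" using dual_separates[OF \<sigma>(1) v] by metis
    have im: "ipair m v < 0" using m(2) of_int_ipair[OF v, of m] by linarith
    have pw: "s powi j * s ^ nat (- j) = 1" if "s \<noteq> 0" "j < 0" for s :: complex and j
      using that by (simp add: power_int_def field_simps)
    show "\<exists>V f0 f1 g0 g1. openin zar V \<and> x \<in> V \<and> f0 \<in> regular X V \<and> f1 \<in> regular X V \<and> g0 \<in> affine_ring 1 \<and> g1 \<in> affine_ring 1 \<and>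
        f0 x * g0 y + f1 x * g1 y \<noteq> 0 \<and> (\<forall>(x', y')\<in>C. x' \<in> V \<longrightarrow> f0 x' * g0 y' + f1 x' * g1 y' = 0)"
    \<comment> \<open>On the graph this product is 1. If it differs from 1 at (x, y), it gives the
      separating equation; otherwise y is nonzero, and the point of the graph over y differs from x
      in another character.\<close>
    proof (cases "ev x m * y 0 ^ nat (- ipair m v) = 1")
      case False
      show ?thesis
        by (rule found[OF regular_ev[OF \<sigma>(1) m(1)] rc[of 1] affine_ring_power[OF coord, of "nat (- ipair m v)"] affine_ring_const[of "- 1"]])
           (use False pw im in \<open>auto simp: evl\<close>)
    next
      case True
      then have s: "y 0 \<noteq> 0" using im by (auto simp: power_0_left)
      then have "x \<noteq> l (y 0)" using xy(3) y unfolding C_def by blast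
      then obtain m' where m': "m' \<in> dual_semigroup ?\<sigma>" "ev x m' \<noteq> ev (l (y 0)) m'"
        using point_eqI[OF \<sigma> lU[OF s \<sigma>(1)]] by blast
      then have ne: "ev x m' \<noteq> y 0 powi (ipair m' v)" using evl[OF s] by simp
      show ?thesis
      proof (cases "0 \<le> ipair m' v")
        case True
        show ?thesis
          by (rule found[OF regular_ev[OF \<sigma>(1) m'(1)] rc[of "- 1"] affine_ring_const[of 1] affine_ring_power[OF coord, of "nat (ipair m' v)"]])
             (use True ne in \<open>auto simp: evl power_int_def\<close>)
      next
        case F: False
        then have neg: "ipair m' v < 0" by simp
        have ne': "ev x m' * y 0 ^ nat (- ipair m' v) \<noteq> 1" using ne pw[OF s neg] s by (metis mult_right_cancel power_not_zero)
        show ?thesis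
          by (rule found[OF regular_ev[OF \<sigma>(1) m'(1)] rc[of 1] affine_ring_power[OF coord, of "nat (- ipair m' v)"] affine_ring_const[of "- 1"]])
             (use ne' pw[OF _ neg] in \<open>auto simp: evl\<close>)
      qed
    qed
  qed
  \<comment> \<open>Zariski open sets of the line are open in the classical topology, whereas the
    complement of the image is the single point 0.\<close>
  have cont: "continuous_on UNIV (\<lambda>s. f (pt s))" if "f \<in> affine_ring 1" for f
    using that unfolding affine_ring_def
  proof induction
    case (gen f)
    then obtain i where "f = (\<lambda>v. v i)" by blast
    then show ?case by (cases "i = 0") (auto simp: pt_def)
  qed (auto intro!: continuous_intros)
  have op: "open {s. pt s \<in> W}" if "openin (zariski (affine_space 1)) W" for W
    using that unfolding affine_zariski openin_topology_generated_by_iff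
  proof induction
    case (Int a b)
    have "{s. pt s \<in> a \<inter> b} = {s. pt s \<in> a} \<inter> {s. pt s \<in> b}" by auto
    then show ?case using Int by auto
  next
    case (UN K)
    have "{s. pt s \<in> \<Union>K} = (\<Union>k\<in>K. {s. pt s \<in> k})" by auto
    then show ?case using UN by auto
  next
    case (Basis W)
    then obtain f where f: "f \<in> affine_ring 1" "W = {p \<in> affine_carrier 1. f p \<noteq> 0}" by blast
    have "{s. pt s \<in> W} = {s. f (pt s) \<noteq> 0}" using f(2) ptc by auto
    then show ?case using open_Collect_neq[OF cont[OF f(1)] continuous_on_const[of UNIV 0]] by simp
  qed auto
  have "openin (zariski (affine_space 1)) (affine_carrier 1 - snd ` C)"
    using cl by (simp add: closedin_def affine_topspace)
  then have "open {s. pt s \<in> affine_carrier 1 - snd ` C}" by (rule op)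
  moreover have "{s. pt s \<in> affine_carrier 1 - snd ` C} = {0}"
  proof -
    have "pt s = pt s' \<longleftrightarrow> s = s'" for s s' by (auto simp: pt_def fun_eq_iff)
    then show ?thesis using ptc by (auto simp: C_def image_iff)
  qed
  ultimately show False using not_open_singleton[of "0::complex"] by simp
qed

text \<open>Rational directions are dense, and the support is closed.\<close>

lemma complete_support:
  assumes complete: "complete_variety X"
  shows "\<Union>\<Sigma> = UNIV"
proof (rule ccontr)
  assume "\<Union>\<Sigma> \<noteq> UNIV"
  then obtain v where v: "v \<notin> \<Union>\<Sigma>" by blast
  have "closed (\<Union>\<Sigma>)" using finite_fan fan_closed by (intro closed_Union) auto
  then have "open (- \<Union>\<Sigma>)" by (simp add: open_Compl)
  then obtain e where e: "e > 0" "ball v e \<subseteq> - \<Union>\<Sigma>" using v by (meson ComplI openE)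
  obtain N :: nat where N: "real CARD('n) / e < real N" using reals_Archimedean2 by blast
  have N0: "real N > 0" using N e(1) by (metis divide_nonneg_pos of_nat_0_le_iff order_le_less_trans)
  \<comment> \<open>\<open>v\<close> rounded down to the grid of mesh 1/N; \<open>N\<close> times
    \<open>w\<close> is a lattice vector.\<close>
  define w :: "real ^ 'n" where "w = (\<chi> i. real_of_int \<lfloor>real N * v $ i\<rfloor> / real N)"
  have "\<bar>(w - v) $ i\<bar> \<le> 1 / real N" for i
  proof -
    have "\<bar>real_of_int \<lfloor>real N * v $ i\<rfloor> - real N * v $ i\<bar> \<le> 1" by linarith
    then have "\<bar>(real_of_int \<lfloor>real N * v $ i\<rfloor> - real N * v $ i) / real N\<bar> \<le> 1 / real N"
      using N0 by (simp add: divide_right_mono)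
    moreover have "(real_of_int \<lfloor>real N * v $ i\<rfloor> - real N * v $ i) / real N = (w - v) $ i"
      using N0 by (simp add: w_def diff_divide_distrib)
    ultimately show ?thesis by simp
  qed
  then have "(\<Sum>i\<in>UNIV. \<bar>(w - v) $ i\<bar>) \<le> real CARD('n) * (1 / real N)"
    using sum_bounded_above[of "UNIV::'n set" "\<lambda>i. \<bar>(w - v) $ i\<bar>" "1 / real N"] by simp
  also have "\<dots> < e" using N N0 e(1) by (simp add: field_simps)
  finally have "norm (w - v) < e" using norm_le_l1_cart[of "w - v"] by linarith
  then have "w \<in> ball v e" by (simp add: dist_norm norm_minus_commute)
  then have nw: "w \<notin> \<Union>\<Sigma>" using e(2) by blast
  have "lattice_vec (real N *\<^sub>R w)" using N0 by (simp add: lattice_vec_def w_def)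
  then obtain \<sigma> where \<sigma>: "\<sigma> \<in> \<Sigma>" "real N *\<^sub>R w \<in> \<sigma>"
    using complete_lattice_vec_mem[OF complete] by blast
  have "(1 / real N) *\<^sub>R (real N *\<^sub>R w) \<in> \<sigma>"
    by (rule convex_cone_scaleR[OF fan_cone[OF \<sigma>(1)] _ \<sigma>(2)]) simp
  moreover have "(1 / real N) *\<^sub>R (real N *\<^sub>R w) = w" using N0 by simp
  ultimately show False using nw \<sigma>(1) by auto
qed

section \<open>Full-dimensional cones\<close>

definition full_cones :: "(real ^ 'n) set set" where
  "full_cones = {\<sigma>\<in>\<Sigma>. span \<sigma> = UNIV}"

text \<open>Cones that do not span are negligible, while the complement of the closed union of the
  others is open, and a nonempty open set is not negligible.\<close>

lemma full_cones_cover: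
  assumes supp: "\<Union>\<Sigma> = UNIV"
  shows "\<Union>full_cones = UNIV"
proof (rule ccontr)
  assume ne: "\<Union>full_cones \<noteq> UNIV"
  have "closed (\<Union>full_cones)" using finite_fan fan_closed by (intro closed_Union) (auto simp: full_cones_def)
  then have o: "open (- \<Union>full_cones)" by (simp add: open_Compl)
  have "negligible (\<Union>(\<Sigma> - full_cones))"
  proof (rule negligible_Union)
    fix \<sigma> assume "\<sigma> \<in> \<Sigma> - full_cones"
    then have "span \<sigma> \<noteq> UNIV" by (simp add: full_cones_def)
    then have "dim \<sigma> < DIM(real ^ 'n)" using dim_eq_full[of \<sigma>] dim_subset_UNIV[of \<sigma>] by linarith
    then show "negligible \<sigma>" by (rule negligible_lowdim)
  qed (use finite_fan in auto)
  moreover have "- \<Union>full_cones \<subseteq> \<Union>(\<Sigma> - full_cones)" using supp by blast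
  ultimately have "negligible (- \<Union>full_cones)" by (rule negligible_subset)
  then show False using open_not_negligible[OF o] ne by blast
qed

text \<open>The sum of the generators lies in the relative interior of \<gamma>. A full-dimensional
  cone containing it contains all of \<gamma>, because a face that contains a sum contains the
  summands.\<close>

lemma full_cone_above:
  assumes supp: "\<Union>\<Sigma> = UNIV" and \<gamma>: "\<gamma> \<in> \<Sigma>"
  obtains \<sigma> where "\<sigma> \<in> full_cones" "\<gamma> \<subseteq> \<sigma>"
proof -
  obtain S where S: "finite S" "\<gamma> = convex_cone hull S" using fan_gens[OF \<gamma>] by metis
  obtain \<sigma> where \<sigma>: "\<sigma> \<in> full_cones" "(\<Sum>s\<in>S. s) \<in> \<sigma>" using full_cones_cover[OF supp] by blast
  have \<sigma>\<Sigma>: "\<sigma> \<in> \<Sigma>" using \<sigma> by (simp add: full_cones_def)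
  have Sg: "s \<in> \<gamma>" if "s \<in> S" for s using that S(2) by (simp add: hull_inc)
  have sum: "(\<Sum>s\<in>S. s) \<in> \<gamma> \<inter> \<sigma>" using convex_cone_sum[OF fan_cone[OF \<gamma>] Sg, of S "\<lambda>s. s"] \<sigma>(2) by simp
  have "s \<in> \<gamma> \<inter> \<sigma>" if "s \<in> S" for s
    using face_of_cone_sum[OF fan_Int_face(1)[OF \<gamma> \<sigma>\<Sigma>] fan_cone[OF \<gamma>] fan_cone[OF fan_Int[OF \<gamma> \<sigma>\<Sigma>]] S(1) Sg sum that] .
  then have "S \<subseteq> \<sigma>" by blast
  then have "\<gamma> \<subseteq> \<sigma>" unfolding S(2) using fan_cone[OF \<sigma>\<Sigma>] by (rule hull_minimal)
  then show thesis using that \<sigma>(1) by blast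
qed

end


subsection \<open>Rays\<close>

definition cone_ray :: "real ^ 'n \<Rightarrow> (real ^ 'n) set" where
  "cone_ray v = {c *\<^sub>R v | c. 0 \<le> c}"

lemma mem_cone_ray: "v \<in> cone_ray v"
  unfolding cone_ray_def by (intro CollectI exI[of _ 1]) simp

lemma cone_ray_scale: "0 < d \<Longrightarrow> cone_ray (d *\<^sub>R v) = cone_ray v"
proof -
  assume d: "0 < d"
  have "\<exists>c'. c *\<^sub>R v = c' *\<^sub>R d *\<^sub>R v \<and> 0 \<le> c'" if "0 \<le> c" for c
    using d that by (intro exI[of _ "c / d"]) simp
  moreover have "\<exists>c'. c *\<^sub>R d *\<^sub>R v = c' *\<^sub>R v \<and> 0 \<le> c'" if "0 \<le> c" for c
    using d that by (intro exI[of _ "c * d"]) simp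
  ultimately show ?thesis unfolding cone_ray_def by blast
qed

lemma cone_ray_subset: "convex_cone C \<Longrightarrow> v \<in> C \<Longrightarrow> cone_ray v \<subseteq> C"
  unfolding cone_ray_def using convex_cone_scaleR by blast

text \<open>\<open>d\<close> is the least positive pairing of v with a character. Division with
  remainder shows that it divides all pairings, in particular the coordinates.\<close>

lemma lattice_vec_primitive:
  assumes v: "lattice_vec v" "v \<noteq> 0"
  obtains d w u where "d > 0" "v = d *\<^sub>R w" "lattice_vec w" "pairing u w = 1"
proof -
  obtain i where i: "v $ i \<noteq> 0" using v(2) by (auto simp: vec_eq_iff)
  have "\<exists>m. 0 < ipair m v"
  proof (cases "v $ i > 0")
    case True
    then have "0 < real_of_int (ipair (axis i 1) v)" by (simp add: of_int_ipair[OF v(1)] pairing_axis)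
    then show ?thesis by (auto simp del: of_int_0_less_iff simp: of_int_0_less_iff)
  next
    case False
    then have "0 < real_of_int (ipair (- axis i 1) v)"
      using i by (simp add: of_int_ipair[OF v(1)] pairing_axis pairing_uminus_left)
    then show ?thesis by (auto simp del: of_int_0_less_iff simp: of_int_0_less_iff)
  qed
  then have "\<exists>k m. k > 0 \<and> ipair m v = int k" by (metis zero_less_imp_eq_int)
  then obtain d where d: "d > 0 \<and> (\<exists>m. ipair m v = int d)" and min: "\<And>k. k > 0 \<and> (\<exists>m. ipair m v = int k) \<Longrightarrow> d \<le> k"
    using exists_least_iff[of "\<lambda>k. k > 0 \<and> (\<exists>m. ipair m v = int k)"] by (metis not_le)
  obtain u where u: "ipair u v = int d" using d by blast
  have dvd: "int d dvd ipair m v" for m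
  proof -
    define r where "r = ipair m v mod int d"
    have r: "r = ipair (m - (ipair m v div int d) *s u) v"
      unfolding ipair_diff[OF v(1)] ipair_vmult[OF v(1)] u r_def by (metis minus_div_mult_eq_mod)
    have rb: "0 \<le> r" "r < int d" using d by (simp_all add: r_def)
    have "r = 0"
    proof (rule ccontr)
      assume "r \<noteq> 0"
      then have "nat r > 0" "r = int (nat r)" using rb by auto
      then have "d \<le> nat r" using min[of "nat r"] r by metis
      then show False using rb by linarith
    qed
    then show ?thesis by (auto simp: r_def)
  qed
  define w where "w = (1 / real d) *\<^sub>R v"
  have vw: "v = real d *\<^sub>R w" using d by (simp add: w_def)
  have "lattice_vec w" unfolding lattice_vec_def
  proof
    fix j
    obtain k where "ipair (axis j 1) v = int d * k" using dvd by blast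
    then have "v $ j = real_of_int (int d * k)" using of_int_ipair[OF v(1), of "axis j 1"] by (simp add: pairing_axis)
    then show "w $ j \<in> \<int>" using d by (simp add: w_def)
  qed
  moreover have "pairing u w = 1" using of_int_ipair[OF v(1), of u] u d by (simp add: w_def)
  ultimately show thesis using that[of "real d" w u] d vw by simp
qed

lemma perp_span_UNIV:
  fixes m :: "int ^ 'n"
  assumes "span \<sigma> = UNIV" "m \<in> perp \<sigma>"
  shows "m = 0"
proof -
  have "subspace {v. pairing m v = 0}" by (auto simp: subspace_def pairing_simps)
  then have "span \<sigma> \<subseteq> {v. pairing m v = 0}" using assms(2) by (intro span_minimal) (auto simp: perp_def)
  then have z: "pairing m v = 0" for v using assms(1) by auto
  have "real_vec m \<bullet> real_vec m = 0" using z[of "real_vec m"] by (simp add: pairing_eq_inner)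
  then show ?thesis by (simp add: real_vec_eq_0)
qed

text \<open>Finitely many hyperplanes do not cover a full-dimensional cone: move along a direction
  \<open>g\<close> on which the new functional is nonzero, avoiding finitely many
  parameters.\<close>

lemma generic_weight:
  fixes D :: "(int ^ 'n) set"
  assumes \<sigma>: "convex_cone \<sigma>" "span \<sigma> = UNIV" and D: "finite D" "0 \<notin> D"
  obtains w where "w \<in> \<sigma>" "\<And>m. m \<in> D \<Longrightarrow> pairing m w \<noteq> 0"
proof -
  have "\<exists>w\<in>\<sigma>. \<forall>m\<in>D. pairing m w \<noteq> 0" using D
  proof (induction D rule: finite_induct)
    case empty then show ?case using convex_cone_contains_0[OF \<sigma>(1)] by blast
  next
    case (insert d D)
    then obtain w where w: "w \<in> \<sigma>" "\<forall>m\<in>D. pairing m w \<noteq> 0" by blast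
    have "d \<notin> perp \<sigma>" using perp_span_UNIV[OF \<sigma>(2)] insert.prems by blast
    then obtain g where g: "g \<in> \<sigma>" "pairing d g \<noteq> 0" by (auto simp: perp_def)
    \<comment> \<open>0 is inserted so that \<open>s\<close> is positive and the moved point stays
      in the cone.\<close>
    define F where "F = insert 0 ((\<lambda>m. - pairing m w / pairing m g) ` insert d D)"
    define s where "s = Max F + 1"
    have F: "y < s" if "y \<in> F" for y
    proof -
      have "y \<le> Max F" using insert.hyps that by (intro Max_ge) (auto simp: F_def)
      then show ?thesis by (simp add: s_def)
    qed
    have "w + s *\<^sub>R g \<in> \<sigma>"
      using w g F[of 0] by (intro convex_cone_add[OF \<sigma>(1)] convex_cone_scaleR[OF \<sigma>(1)]) (auto simp: F_def)
    moreover have "pairing m (w + s *\<^sub>R g) \<noteq> 0" if m: "m \<in> insert d D" for m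
    proof (cases "pairing m g = 0")
      case True
      then show ?thesis using w g m by (auto simp: pairing_simps)
    next
      case False
      show ?thesis
      proof
        assume "pairing m (w + s *\<^sub>R g) = 0"
        then have "s = - pairing m w / pairing m g" using False by (simp add: pairing_simps field_simps)
        moreover have "- pairing m w / pairing m g \<in> F" using m unfolding F_def by blast
        ultimately show False using F by fastforce
      qed
    qed
    ultimately show ?case by blast
  qed
  then show thesis using that by blast
qed

text \<open>Comparison of coefficients for Laurent polynomials written with repeated exponents, as
  they arise from products.\<close>

lemma tpow_fibre_sums:
  fixes e1 :: "'i \<Rightarrow> int ^ 'n" and e2 :: "'j \<Rightarrow> int ^ 'n"
  assumes fin: "finite I" "finite J"
    and eq: "\<And>t. t \<in> torus \<Longrightarrow> (\<Sum>i\<in>I. c i * tpow t (e1 i)) = (\<Sum>j\<in>J. d j * tpow t (e2 j))"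
  shows "(\<Sum>i\<in>{i\<in>I. e1 i = k}. c i) = (\<Sum>j\<in>{j\<in>J. e2 j = k}. d j)"
proof -
  define K where "K = insert k (e1 ` I \<union> e2 ` J)"
  have K: "finite K" "k \<in> K" "e1 ` I \<subseteq> K" "e2 ` J \<subseteq> K" using fin by (auto simp: K_def)
  let ?a = "\<lambda>k. (\<Sum>i\<in>{i\<in>I. e1 i = k}. c i)" and ?b = "\<lambda>k. (\<Sum>j\<in>{j\<in>J. e2 j = k}. d j)"
  have 1: "(\<Sum>i\<in>I. c i * tpow t (e1 i)) = (\<Sum>k\<in>K. ?a k * tpow t k)" for t
    by (subst sum.group[OF fin(1) K(1,3), symmetric]) (auto simp: sum_distrib_right intro!: sum.cong)
  have 2: "(\<Sum>j\<in>J. d j * tpow t (e2 j)) = (\<Sum>k\<in>K. ?b k * tpow t k)" for t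
    by (subst sum.group[OF fin(2) K(1,4), symmetric]) (auto simp: sum_distrib_right intro!: sum.cong)
  have "(\<Sum>k\<in>K. (?a k - ?b k) * tpow t k) = 0" if "t \<in> torus" for t
    using eq[OF that] unfolding 1 2 by (simp add: left_diff_distrib sum_subtractf)
  from tpow_independent[OF K(1) this K(2)] show ?thesis by simp
qed

context toric begin

text \<open>One vector for each one-dimensional cone: a character of value 1 at v forces v to be
  primitive.\<close>

definition rays :: "(real ^ 'n) set" where
  "rays = {v. lattice_vec v \<and> (\<exists>u. pairing u v = 1) \<and> cone_ray v \<in> \<Sigma>}"

lemma rays_lattice: "v \<in> rays \<Longrightarrow> lattice_vec v" and rays_cone: "v \<in> rays \<Longrightarrow> cone_ray v \<in> \<Sigma>"
  and rays_unit: "v \<in> rays \<Longrightarrow> \<exists>u. pairing u v = 1"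
  by (auto simp: rays_def)

lemma rays_nonzero: "v \<in> rays \<Longrightarrow> v \<noteq> 0"
  by (auto simp: rays_def)

lemma rays_eqI:
  assumes v: "v \<in> rays" and w: "w \<in> rays" and vw: "v \<in> cone_ray w"
  shows "v = w"
proof -
  obtain c where c: "v = c *\<^sub>R w" "0 \<le> c" using vw by (auto simp: cone_ray_def)
  obtain u u' where u: "pairing u v = 1" "pairing u' w = 1" using v w rays_unit by metis
  have "c \<in> \<int>" using pairing_Ints[OF rays_lattice[OF v], of u'] c u(2) by simp
  then obtain a where a: "c = of_int a" by (auto elim: Ints_cases)
  have "pairing u w \<in> \<int>" using pairing_Ints[OF rays_lattice[OF w]] .
  then obtain b where b: "pairing u w = of_int b" by (auto elim: Ints_cases)
  have "of_int (a * b) = (1::real)" using u(1) c(1) a b by simp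
  then have "a * b = 1" by linarith
  then have "a = 1" using c(2) a by (auto simp: zmult_eq_1_iff)
  then show ?thesis using c a by simp
qed

lemma finite_rays: "finite rays"
proof (rule finite_imageD)
  show "finite (cone_ray ` rays)" using finite_fan rays_cone by (meson finite_subset image_subsetI)
  show "inj_on cone_ray rays" using rays_eqI mem_cone_ray by (metis inj_onI)
qed

text \<open>Take a generating set of least size. Then no generator is redundant, and together with
  strong convexity this makes each generator span a face, which belongs to the fan.\<close>

lemma cone_generated_by_rays:
  assumes \<sigma>: "\<sigma> \<in> \<Sigma>"
  shows "\<sigma> = convex_cone hull (rays \<inter> \<sigma>)"
proof -
  define good where "good k \<longleftrightarrow> (\<exists>S. finite S \<and> (\<forall>v\<in>S. lattice_vec v) \<and> \<sigma> = convex_cone hull S \<and> card S = k)" for k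
  have "\<exists>k. good k" using fan_gens[OF \<sigma>] unfolding good_def by metis
  then obtain k where "good k" and min: "\<And>j. good j \<Longrightarrow> k \<le> j" using exists_least_iff[of good] by (metis not_le)
  then obtain S where S: "finite S" "\<forall>v\<in>S. lattice_vec v" "\<sigma> = convex_cone hull S" "card S = k" unfolding good_def by blast
  have S\<sigma>: "s \<in> \<sigma>" if "s \<in> S" for s using that S(3) by (simp add: hull_inc)
  have cc: "convex_cone \<sigma>" using fan_cone[OF \<sigma>] .
  have irr: "v \<notin> convex_cone hull (S - {v})" if v: "v \<in> S" for v
  proof
    assume "v \<in> convex_cone hull (S - {v})"
    then have "convex_cone hull (insert v (S - {v})) = convex_cone hull (S - {v})" by (rule hull_redundant)
    then have "\<sigma> = convex_cone hull (S - {v})" using S(3) v by (simp add: insert_absorb)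
    then have "good (card (S - {v}))" using S unfolding good_def by blast
    then show False using min S(1,4) v by (metis card_Diff1_less not_le)
  qed
  have nz: "s \<noteq> 0" if "s \<in> S" for s using irr[OF that] convex_cone_hull_contains_0 by metis
  have face: "cone_ray v face_of \<sigma>" if v: "v \<in> S" for v
    unfolding face_of_def
  proof (intro conjI ballI impI)
    show "cone_ray v \<subseteq> \<sigma>" using cone_ray_subset[OF cc S\<sigma>[OF v]] .
    have "convex_cone (cone_ray v)"
      unfolding convex_cone_iff cone_ray_def
    proof (intro conjI ballI allI impI)
      show "0 \<in> {c *\<^sub>R v |c. 0 \<le> c}" by (auto intro: exI[of _ 0])
      fix x y assume "x \<in> {c *\<^sub>R v |c. 0 \<le> c}" "y \<in> {c *\<^sub>R v |c. 0 \<le> c}"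
      then obtain c d where "x = c *\<^sub>R v" "y = d *\<^sub>R v" "0 \<le> c" "0 \<le> d" by blast
      then show "x + y \<in> {c *\<^sub>R v |c. 0 \<le> c}" by (auto intro!: exI[of _ "c + d"] simp: scaleR_left_distrib)
    next
      fix x and a :: real assume "x \<in> {c *\<^sub>R v |c. 0 \<le> c}" "0 \<le> a"
      then show "a *\<^sub>R x \<in> {c *\<^sub>R v |c. 0 \<le> c}" using mult_nonneg_nonneg by fastforce
    qed
    then show "convex (cone_ray v)" by (simp add: convex_cone_def)
    fix a b x assume a: "a \<in> \<sigma>" and b: "b \<in> \<sigma>" and x: "x \<in> cone_ray v" "x \<in> open_segment a b"
    obtain r where r: "0 < r" "r < 1" "x = (1 - r) *\<^sub>R a + r *\<^sub>R b" using x(2) by (auto simp: in_segment)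
    obtain c where c: "x = c *\<^sub>R v" "0 \<le> c" using x(1) by (auto simp: cone_ray_def)
    have "(1 - r) *\<^sub>R a \<in> \<sigma>" "r *\<^sub>R b \<in> \<sigma>" using convex_cone_scaleR[OF cc] a b r by auto
    then have ab: "(1 - r) *\<^sub>R a \<in> convex_cone hull S" "r *\<^sub>R b \<in> convex_cone hull S" by (simp_all add: S(3))
    obtain \<alpha> where \<alpha>: "\<And>s. s \<in> S \<Longrightarrow> 0 \<le> \<alpha> s" "(1 - r) *\<^sub>R a = (\<Sum>s\<in>S. \<alpha> s *\<^sub>R s)"
      using convex_cone_hull_finite[OF S(1) ab(1)] by blast
    obtain \<beta> where \<beta>: "\<And>s. s \<in> S \<Longrightarrow> 0 \<le> \<beta> s" "r *\<^sub>R b = (\<Sum>s\<in>S. \<beta> s *\<^sub>R s)"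
      using convex_cone_hull_finite[OF S(1) ab(2)] by blast
    \<comment> \<open>\<open>y\<close> collects the terms off \<open>v\<close> and is a multiple of
      \<open>v\<close>: a positive multiple would make \<open>v\<close> redundant, any other puts
      both \<open>y\<close> and its negative into the cone, so \<open>y\<close> is 0.\<close>
    define y where "y = (\<Sum>s\<in>S - {v}. (\<alpha> s + \<beta> s) *\<^sub>R s)"
    have "c *\<^sub>R v = (\<Sum>s\<in>S. (\<alpha> s + \<beta> s) *\<^sub>R s)"
      using r(3) c(1) \<alpha>(2) \<beta>(2) by (simp add: scaleR_left_distrib sum.distrib)
    also have "\<dots> = (\<alpha> v + \<beta> v) *\<^sub>R v + y" unfolding y_def using S(1) v by (rule sum.remove)
    finally have ky: "(c - \<alpha> v - \<beta> v) *\<^sub>R v = y" by (simp add: algebra_simps)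
    have yS: "y \<in> convex_cone hull (S - {v})" unfolding y_def
      by (intro convex_cone_sum[OF convex_cone_convex_cone_hull] convex_cone_hull_mul hull_inc) (auto simp: \<alpha>(1) \<beta>(1))
    have y\<sigma>: "y \<in> \<sigma>" unfolding y_def
      by (intro convex_cone_sum[OF cc] convex_cone_scaleR[OF cc] S\<sigma>) (auto simp: \<alpha>(1) \<beta>(1))
    have "\<not> c - \<alpha> v - \<beta> v > 0"
    proof
      assume p: "c - \<alpha> v - \<beta> v > 0"
      then have "v = (1 / (c - \<alpha> v - \<beta> v)) *\<^sub>R y" unfolding ky[symmetric] using p by simp
      then have "v \<in> convex_cone hull (S - {v})" using convex_cone_hull_mul[OF yS] p by (metis less_imp_le zero_le_divide_1_iff)
      then show False using irr[OF v] by blast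
    qed
    then have "- y \<in> \<sigma>" using convex_cone_scaleR[OF cc _ S\<sigma>[OF v], of "- (c - \<alpha> v - \<beta> v)"] ky by (simp add: algebra_simps)
    then have y0: "y = 0" using fan_pointed[OF \<sigma> y\<sigma>] by simp
    \<comment> \<open>Strong convexity again: a vanishing sum of elements of the cone has only zero
      summands. Hence a and b are multiples of \<open>v\<close>.\<close>
    have z: "\<alpha> s = 0 \<and> \<beta> s = 0" if s: "s \<in> S - {v}" for s
    proof -
      have "y = (\<alpha> s + \<beta> s) *\<^sub>R s + (\<Sum>s\<in>S - {v} - {s}. (\<alpha> s + \<beta> s) *\<^sub>R s)"
        unfolding y_def using S(1) s by (intro sum.remove) auto
      then have "(\<alpha> s + \<beta> s) *\<^sub>R s + (\<Sum>s\<in>S - {v} - {s}. (\<alpha> s + \<beta> s) *\<^sub>R s) = 0" using y0 by simp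
      then have "- ((\<alpha> s + \<beta> s) *\<^sub>R s) = (\<Sum>s\<in>S - {v} - {s}. (\<alpha> s + \<beta> s) *\<^sub>R s)" by (rule minus_unique)
      also have "\<dots> \<in> \<sigma>" by (intro convex_cone_sum[OF cc] convex_cone_scaleR[OF cc] S\<sigma>) (auto simp: \<alpha>(1) \<beta>(1))
      finally have "(\<alpha> s + \<beta> s) *\<^sub>R s = 0"
        using fan_pointed[OF \<sigma> convex_cone_scaleR[OF cc _ S\<sigma>, of "\<alpha> s + \<beta> s" s]] s \<alpha>(1)[of s] \<beta>(1)[of s] by auto
      then have "\<alpha> s + \<beta> s = 0" using nz[of s] s by auto
      then show ?thesis using \<alpha>(1)[of s] \<beta>(1)[of s] s by auto
    qed
    have red: "(\<Sum>s\<in>S. f s *\<^sub>R s) = f v *\<^sub>R v" if "\<And>s. s \<in> S - {v} \<Longrightarrow> f s = 0" for f :: "_ \<Rightarrow> real"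
      using sum.remove[OF S(1) v, of "\<lambda>s. f s *\<^sub>R s"] that by simp
    have cancel: "y = (p / k) *\<^sub>R v" if "k *\<^sub>R y = p *\<^sub>R v" "k \<noteq> 0" for y p and k :: real
    proof -
      have "(1 / k) *\<^sub>R (k *\<^sub>R y) = (1 / k) *\<^sub>R (p *\<^sub>R v)" using that(1) by simp
      then show ?thesis using that(2) by simp
    qed
    have "(1 - r) *\<^sub>R a = \<alpha> v *\<^sub>R v" "r *\<^sub>R b = \<beta> v *\<^sub>R v"
      using \<alpha>(2) \<beta>(2) red[of \<alpha>] red[of \<beta>] z by simp_all
    then have "a = (\<alpha> v / (1 - r)) *\<^sub>R v" "b = (\<beta> v / r) *\<^sub>R v" using cancel r(1,2) by auto
    then show "a \<in> cone_ray v" "b \<in> cone_ray v"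
      unfolding cone_ray_def using \<alpha>(1)[OF v] \<beta>(1)[OF v] r by (auto intro!: divide_nonneg_pos)
  qed
  have "v \<in> convex_cone hull (rays \<inter> \<sigma>)" if v: "v \<in> S" for v
  proof -
    obtain d w u where w: "d > 0" "v = d *\<^sub>R w" "lattice_vec w" "pairing u w = 1"
      using lattice_vec_primitive[of v] S(2) nz v by metis
    have "cone_ray w = cone_ray v" using cone_ray_scale[OF w(1), of w] w(2) by simp
    then have f: "cone_ray w face_of \<sigma>" using face[OF v] by simp
    then have "cone_ray w \<in> \<Sigma>" using fan_face[OF \<sigma>] mem_cone_ray by blast
    moreover have "w \<in> \<sigma>" using f mem_cone_ray face_of_imp_subset by blast
    ultimately have "w \<in> rays \<inter> \<sigma>" using w by (auto simp: rays_def)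
    then show ?thesis using w(1,2) by (metis convex_cone_hull_mul hull_inc less_imp_le)
  qed
  then have "\<sigma> \<subseteq> convex_cone hull (rays \<inter> \<sigma>)"
    unfolding S(3) by (intro hull_minimal convex_cone_convex_cone_hull subsetI) (simp add: S(3)[symmetric])
  moreover have "convex_cone hull (rays \<inter> \<sigma>) \<subseteq> \<sigma>" using cc by (intro hull_minimal) auto
  ultimately show ?thesis by blast
qed

lemma rays_separated:
  assumes \<sigma>: "\<sigma> \<in> \<Sigma>" and v: "v \<in> rays" "v \<in> \<sigma>" and v': "v' \<in> rays" "v' \<in> \<sigma>" and ne: "v \<noteq> v'"
  obtains m where "m \<in> dual_semigroup \<sigma>" "pairing m v' = 0" "pairing m v > 0"
proof -
  obtain m where m: "m \<in> dual_semigroup \<sigma>" "\<And>w. w \<in> \<sigma> \<Longrightarrow> pairing m w = 0 \<longleftrightarrow> w \<in> cone_ray v'"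
    using exposing[OF \<sigma> rays_cone[OF v'(1)] cone_ray_subset[OF fan_cone[OF \<sigma>] v'(2)]] by metis
  have "pairing m v \<noteq> 0" using m(2)[OF v(2)] rays_eqI[OF v(1) v'(1)] ne by blast
  moreover have "0 \<le> pairing m v" using m(1) v(2) by (auto simp: dual_semigroup_def)
  ultimately show thesis using that[of m] m mem_cone_ray v'(2) by auto
qed

subsection \<open>Torus-invariant prime divisors\<close>

definition ray_divisor :: "real ^ 'n \<Rightarrow> 'n local_toric_point set set" where
  "ray_divisor v = zar closure_of (orb (cone_ray v) ` torus)"

lemma dual_cone_ray: "m \<in> dual_semigroup (cone_ray v) \<longleftrightarrow> 0 \<le> pairing m v"
  and perp_cone_ray: "m \<in> perp (cone_ray v) \<longleftrightarrow> pairing m v = 0"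
proof -
  show "m \<in> dual_semigroup (cone_ray v) \<longleftrightarrow> 0 \<le> pairing m v"
    using mem_cone_ray[of v] by (auto simp: dual_semigroup_def cone_ray_def)
  show "m \<in> perp (cone_ray v) \<longleftrightarrow> pairing m v = 0"
    using mem_cone_ray[of v] by (auto simp: perp_def cone_ray_def)
qed

lemma orb_in_ray_divisor: "v \<in> rays \<Longrightarrow> t \<in> torus \<Longrightarrow> orb (cone_ray v) t \<in> ray_divisor v"
  unfolding ray_divisor_def using orb_closure_mem[OF rays_cone orb_pts[OF rays_cone]] cone_of_orb[OF rays_cone] by auto

lemma ray_divisor_meets:
  assumes "openin zar V" "ray_divisor v \<inter> V \<noteq> {}"
  obtains t where "t \<in> torus" "orb (cone_ray v) t \<in> V"
  using assms unfolding ray_divisor_def closure_of_def by blast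

lemma ray_divisor_vanishing:
  assumes v: "v \<in> rays" and u: "0 < pairing u v" and q: "q \<in> ray_divisor v" "q \<in> U (cone_ray v)"
  shows "ev q u = 0"
proof (rule ccontr)
  assume nz: "ev q u \<noteq> 0"
  let ?\<rho> = "cone_ray v"
  have ud: "u \<in> dual_semigroup ?\<rho>" using u by (simp add: dual_cone_ray)
  have o: "openin zar {q \<in> U ?\<rho>. ev q u \<noteq> 0}" using openin_principal[OF rays_cone[OF v] chart_ring_ev[OF ud]] .
  obtain t where "t \<in> torus" "orb ?\<rho> t \<in> {q \<in> U ?\<rho>. ev q u \<noteq> 0}"
    using ray_divisor_meets[OF o, of v] q nz by blast
  then show False using ev_orb[OF rays_cone[OF v] _ ud] u by (auto simp: perp_cone_ray split: if_splits)
qed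

text \<open>A function on the chart of a ray that vanishes on an irreducible closed set larger than the
  divisor of the ray can be divided by the local equation of the divisor again and again.\<close>

lemma vanishing_descent:
  assumes v: "v \<in> rays" and u: "pairing u v = 1" and Z: "irreducible_closed X Z" "ray_divisor v \<subset> Z"
    and B: "finite B" "B \<subseteq> dual_semigroup (cone_ray v)" "\<And>m. m \<in> B \<Longrightarrow> ipair m v \<le> int N"
    and van: "\<And>p. p \<in> Z \<Longrightarrow> p \<in> U (cone_ray v) \<Longrightarrow> (\<Sum>m\<in>B. c m * ev p m) = 0"
    and m: "m \<in> B"
  shows "c m = 0"
  using B van m
proof (induction N arbitrary: B c m)
  let ?\<rho> = "cone_ray v"
  note \<rho> = rays_cone[OF v] and lv = rays_lattice[OF v]
  have orbZ: "orb ?\<rho> t \<in> Z" if "t \<in> torus" for t :: "complex ^ 'n" using orb_in_ray_divisor[OF v that] Z(2) by blast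
  \<comment> \<open>On the orbit of the ray, which lies in Z, only exponents orthogonal to v are
    visible, and their characters are independent.\<close>
  have perp0: "c m = 0" if B: "finite B" "B \<subseteq> dual_semigroup ?\<rho>" and van: "\<And>p. p \<in> Z \<Longrightarrow> p \<in> U ?\<rho> \<Longrightarrow> (\<Sum>m\<in>B. c m * ev p m) = 0"
      and m: "m \<in> B" "m \<in> perp ?\<rho>" for B c m
  proof (rule tpow_independent[of "B \<inter> perp ?\<rho>"])
    fix t :: "complex ^ 'n" assume t: "t \<in> torus"
    have "(\<Sum>m\<in>B. c m * ev (orb ?\<rho> t) m) = (\<Sum>m\<in>B \<inter> perp ?\<rho>. c m * tpow t m)"
      by (rule chart_ring_orb[OF \<rho> \<rho> order.refl B(2,1) _ t]) simp
    then show "(\<Sum>m\<in>B \<inter> perp ?\<rho>. c m * tpow t m) = 0" using van[OF orbZ[OF t] orb_U[OF \<rho> t]] by simp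
  qed (use B m in auto)
  {
    case 0
    have "0 \<le> pairing m v" using 0(2,5) dual_cone_ray by blast
    then have "0 \<le> ipair m v" by (simp add: ipair_def)
    then have "ipair m v = 0" using 0(3)[OF 0(5)] by simp
    then have "pairing m v = 0" using of_int_ipair[OF lv, of m] by simp
    then show ?case using perp0[OF 0(1,2,4,5)] by (simp add: perp_cone_ray)
  next
    case (Suc N)
    define B' where "B' = {k\<in>B. k \<notin> perp ?\<rho>}"
    have ud: "u \<in> dual_semigroup ?\<rho>" using u by (simp add: dual_cone_ray)
    have ipu: "ipair u v = 1" using u by (simp add: ipair_def)
    have B'd: "k - u \<in> dual_semigroup ?\<rho>" if k: "k \<in> B'" for k
    proof -
      have "pairing k v > 0" using k Suc.prems(2) by (force simp: B'_def dual_cone_ray perp_cone_ray)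
      then have "real_of_int (ipair k v) > 0" using of_int_ipair[OF lv, of k] by simp
      then have "1 \<le> ipair k v" by simp
      then have "real_of_int (ipair k v) \<ge> 1" by simp
      then show ?thesis using of_int_ipair[OF lv, of k] u by (simp add: dual_cone_ray pairing_simps)
    qed
    \<comment> \<open>The remaining exponents have pairing at least 1 with v, so the sum is
      divisible by the local equation, the character of u.\<close>
    define f' where "f' p = (\<Sum>k\<in>B'. c k * ev p (k - u))" for p
    have f'r: "f' \<in> chart_ring ?\<rho>"
    proof (rule chart_ringI)
      show "finite ((\<lambda>k. k - u) ` B')" using Suc.prems(1) by (simp add: B'_def)
      show "(\<lambda>k. k - u) ` B' \<subseteq> dual_semigroup ?\<rho>" using B'd by blast
      show "f' p = (\<Sum>k\<in>(\<lambda>k. k - u) ` B'. c (k + u) * ev p k)" for p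
        unfolding f'_def by (subst sum.reindex) (auto simp: inj_on_def)
    qed
    have fac: "(\<Sum>k\<in>B. c k * ev p k) = ev p u * f' p" if p: "p \<in> U ?\<rho>" for p
    proof -
      have pp: "p \<in> pts" using U_pts[OF \<rho> p] .
      have "(\<Sum>k\<in>B. c k * ev p k) = (\<Sum>k\<in>B'. c k * ev p k)"
        unfolding B'_def using perp0[OF Suc.prems(1,2,4)] Suc.prems(1) by (intro sum.mono_neutral_right) auto
      also have "\<dots> = (\<Sum>k\<in>B'. ev p u * (c k * ev p (k - u)))"
      proof (rule sum.cong[OF refl])
        fix k assume "k \<in> B'"
        then have "ev p (u + (k - u)) = ev p u * ev p (k - u)"
          using B'd[of k] ud U_dual[OF \<rho> p] by (intro ev_add[OF pp]) auto
        then show "c k * ev p k = ev p u * (c k * ev p (k - u))" by simp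
      qed
      finally show ?thesis by (simp add: f'_def sum_distrib_left)
    qed
    have cZ: "closedin zar Z" using Z(1) by (simp add: irreducible_closed_def zar_def)
    have irr: "Z \<subseteq> A \<or> Z \<subseteq> B" if "closedin zar A" "closedin zar B" "Z \<subseteq> A \<union> B" for A B
      using Z(1) that unfolding irreducible_closed_def zar_def by blast
    define A1 where "A1 = topspace zar - {p \<in> U ?\<rho>. f' p \<noteq> 0}"
    define A2 where "A2 = topspace zar - {p \<in> U ?\<rho>. ev p u \<noteq> 0}"
    have cA: "closedin zar A1" "closedin zar A2" unfolding A1_def A2_def
      using openin_principal[OF \<rho> f'r] openin_principal[OF \<rho> chart_ring_ev[OF ud]] by auto
    have Ztop: "Z \<subseteq> topspace zar" using closedin_subset[OF cZ] .
    have "f' p = 0" if "p \<in> Z" "p \<in> U ?\<rho>" for p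
    proof -
      have "ev p u * f' p = 0" if "p \<in> Z" "p \<in> U ?\<rho>" for p using fac[OF that(2)] Suc.prems(4)[OF that] by simp
      \<comment> \<open>By irreducibility either the quotient vanishes on Z in the chart, and the
        descent goes on, or the character of u does; then Z would lie in the divisor or miss the
        chart of the ray.\<close>
      then have "Z \<subseteq> A1 \<union> A2" using Ztop unfolding A1_def A2_def by auto
      then consider "Z \<subseteq> A1" | "Z \<subseteq> A2" using irr cA by blast
      then show ?thesis
      proof cases
        case 1 then show ?thesis using that by (auto simp: A1_def)
      next
        case 2
        have "p \<in> ray_divisor v" if p: "p \<in> Z" "p \<in> U ?\<rho>" for p
        proof -
          have pp: "p \<in> pts" "cone_of p \<subseteq> ?\<rho>" using p(2) U_iff[OF \<rho>] by auto
          have "ev p u = 0" using 2 p by (auto simp: A2_def)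
          then have "u \<notin> perp (cone_of p)" using ev_nonzero_iff[OF pp(1) U_dual[OF \<rho> p(2) ud]] by blast
          then obtain w where w: "w \<in> cone_of p" "pairing u w \<noteq> 0" by (auto simp: perp_def)
          then obtain a where a: "w = a *\<^sub>R v" "0 \<le> a" using pp(2) by (auto simp: cone_ray_def)
          then have "a > 0" using w(2) u by (cases "a = 0") auto
          then have "(1 / a) *\<^sub>R w \<in> cone_of p" using convex_cone_scaleR[OF fan_cone[OF cone_of_mem[OF pp(1)]] _ w(1)] by simp
          then have "v \<in> cone_of p" using a \<open>a > 0\<close> by simp
          then have "?\<rho> \<subseteq> cone_of p" using cone_ray_subset fan_cone cone_of_mem[OF pp(1)] by blast
          then show ?thesis unfolding ray_divisor_def using orb_closure_mem[OF \<rho> pp(1)] by blast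
        qed
        then have "Z \<subseteq> ray_divisor v \<union> (topspace zar - U ?\<rho>)" using Ztop by blast
        moreover have "closedin zar (ray_divisor v)" "closedin zar (topspace zar - U ?\<rho>)"
          using openin_U[OF \<rho>] by (auto simp: ray_divisor_def)
        ultimately have "Z \<subseteq> ray_divisor v \<or> Z \<subseteq> topspace zar - U ?\<rho>" using irr by blast
        then show ?thesis using Z(2) orbZ[OF torus_1] orb_U[OF \<rho> torus_1] by blast
      qed
    qed
    then have van': "(\<Sum>k\<in>(\<lambda>k. k - u) ` B'. c (k + u) * ev p k) = 0" if "p \<in> Z" "p \<in> U ?\<rho>" for p
      using that by (subst sum.reindex) (auto simp: inj_on_def f'_def)
    show ?case
    proof (cases "m \<in> perp ?\<rho>")
      case True
      then show ?thesis using perp0[OF Suc.prems(1,2,4,5)] by simp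
    next
      case False
      have "c ((m - u) + u) = 0"
      proof (rule Suc.IH[of "(\<lambda>k. k - u) ` B'" "\<lambda>k. c (k + u)" "m - u"])
        show "finite ((\<lambda>k. k - u) ` B')" using Suc.prems(1) by (simp add: B'_def)
        show "(\<lambda>k. k - u) ` B' \<subseteq> dual_semigroup ?\<rho>" using B'd by blast
        show "ipair k v \<le> int N" if "k \<in> (\<lambda>k. k - u) ` B'" for k
          using that Suc.prems(3) by (force simp: B'_def ipair_diff[OF lv] ipu)
        show "m - u \<in> (\<lambda>k. k - u) ` B'" using False Suc.prems(5) by (auto simp: B'_def)
      qed (rule van')
      then show ?thesis by simp
    qed
  }
qed

text \<open>For codimension one: if Z were a proper closed subset, some chart function vanishing on
  Z would be nonzero at a point of the dense torus, while \<open>vanishing_descent\<close> makes all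
  its coefficients zero.\<close>

lemma ray_divisor_prime:
  assumes v: "v \<in> rays"
  shows "prime_divisor X (ray_divisor v)"
  unfolding prime_divisor_def
proof (intro conjI allI impI)
  let ?\<rho> = "cone_ray v"
  note \<rho> = rays_cone[OF v]
  show "irreducible_closed X (ray_divisor v)" unfolding ray_divisor_def by (rule orb_closure_irreducible[OF \<rho>])
  obtain u where u: "pairing u v = 1" using rays_unit[OF v] by blast
  show "ray_divisor v \<noteq> points X"
  proof
    assume "ray_divisor v = points X"
    then have "tor 1 \<in> ray_divisor v" using orb_pts[OF fan_zero_cone torus_1] points_X by simp
    moreover have "ev (tor 1) u \<noteq> 0" using ev_tor[OF torus_1] by simp
    ultimately show False using ray_divisor_vanishing[OF v, of u] u tor_U[OF torus_1 \<rho>] by simp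
  qed
  fix Z assume Z: "irreducible_closed X Z \<and> ray_divisor v \<subset> Z"
  have cZ: "closedin zar Z" using Z by (simp add: irreducible_closed_def zar_def)
  show "Z = points X"
  proof (rule ccontr)
    assume "Z \<noteq> points X"
    then have "topspace zar - Z \<noteq> {}" using closedin_subset[OF cZ] points_X topspace_zar by auto
    moreover have o: "openin zar (topspace zar - Z)" using cZ by blast
    ultimately obtain t where t: "t \<in> torus" "tor t \<in> topspace zar - Z" using tor_dense by metis
    obtain f where f: "f \<in> chart_ring ?\<rho>" "f (tor t) \<noteq> 0" "{q \<in> U ?\<rho>. f q \<noteq> 0} \<subseteq> topspace zar - Z"
      using openin_local[OF o t(2) \<rho> tor_U[OF t(1) \<rho>]] by blast
    obtain B c where B: "finite B" "B \<subseteq> dual_semigroup ?\<rho>" "\<And>p. p \<in> U ?\<rho> \<Longrightarrow> f p = (\<Sum>m\<in>B. c m * ev p m)"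
      using chart_ringE[OF f(1)] by metis
    define N where "N = (\<Sum>m\<in>B. nat (ipair m v))"
    have N: "ipair m v \<le> int N" if "m \<in> B" for m
      using member_le_sum[OF that, of "\<lambda>m. nat (ipair m v)"] B(1) unfolding N_def by linarith
    have "c m = 0" if "m \<in> B" for m
      by (rule vanishing_descent[OF v u _ _ B(1,2) N _ that]) (use Z f(3) B(3) in auto)
    then have "f (tor t) = 0" using B(3)[OF tor_U[OF t(1) \<rho>]] by simp
    then show False using f(2) by blast
  qed
qed

subsection \<open>Q-factoriality implies that the fan is simplicial\<close>

text \<open>On the chart of the ray a character of pairing 1 is a local equation of the divisor, and
  the given character is its n-th power times a regular one.\<close>

lemma character_in_divisor_ideal:
  assumes v: "v \<in> rays" and V: "openin zar V" and m: "int n \<le> ipair m v"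
    and reg: "(\<lambda>p. ev p m) \<in> regular X V"
  shows "(\<lambda>p. ev p m) \<in> divisor_ideal X n (ray_divisor v) V"
  unfolding divisor_ideal_def
proof (intro CollectI conjI reg impI)
  assume ne: "ray_divisor v \<inter> V \<noteq> {}"
  let ?\<rho> = "cone_ray v"
  note \<rho> = rays_cone[OF v] and lv = rays_lattice[OF v]
  obtain u where u: "pairing u v = 1" using rays_unit[OF v] by blast
  obtain t where t: "t \<in> torus" "orb ?\<rho> t \<in> V" using ray_divisor_meets[OF V ne] .
  define W where "W = V \<inter> U ?\<rho>"
  have W: "openin zar W" "W \<subseteq> V" "W \<subseteq> U ?\<rho>" unfolding W_def using V openin_U[OF \<rho>] by auto
  have DW: "ray_divisor v \<inter> W \<noteq> {}" using t orb_in_ray_divisor[OF v t(1)] orb_U[OF \<rho> t(1)] by (auto simp: W_def)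
  define m' where "m' = m - int n *s u"
  have ud: "u \<in> dual_semigroup ?\<rho>" using u by (simp add: dual_cone_ray)
  have m'd: "m' \<in> dual_semigroup ?\<rho>"
    using m of_int_ipair[OF lv, of m] u by (simp add: dual_cone_ray m'_def pairing_simps)
  have r: "(\<lambda>p. ev p k) \<in> regular X W" if "k \<in> dual_semigroup ?\<rho>" for k
    by (rule regular_restrict[OF regular_ev[OF \<rho> that] W(1,3)]) simp
  have van: "(\<lambda>p. ev p u) \<in> vanishing_ideal X (ray_divisor v) W"
    unfolding vanishing_ideal_def using r[OF ud] ray_divisor_vanishing[OF v, of u] u W(3) by auto
  have prod: "ev q m = (\<Sum>i<Suc 0. ev q m' * (\<Prod>j<n. ev q u))" if q: "q \<in> W" for q
  proof -
    have qU: "q \<in> U ?\<rho>" using q W(3) by blast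
    have qp: "q \<in> pts" using U_pts[OF \<rho> qU] .
    have "ev q (m' + int n *s u) = ev q m' * ev q u ^ n"
      using ev_add[OF qp U_dual[OF \<rho> qU m'd] dual_vmult[OF U_dual[OF \<rho> qU ud], of "int n"]] ev_vmult[OF qp U_dual[OF \<rho> qU ud]] by simp
    then show ?thesis by (simp add: m'_def)
  qed
  show "\<exists>W. openin (zariski X) W \<and> W \<subseteq> V \<and> ray_divisor v \<inter> W \<noteq> {} \<and>
        (\<exists>(k::nat) c a. (\<forall>i<k. c i \<in> regular X W) \<and>
           (\<forall>i<k. \<forall>j<n. a i j \<in> vanishing_ideal X (ray_divisor v) W) \<and>
           (\<forall>q\<in>W. ev q m = (\<Sum>i<k. c i q * (\<Prod>j<n. a i j q))))"
  proof (intro exI conjI allI impI ballI)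
    show "openin (zariski X) W" using W(1) by (simp add: zar_def)
    show "ev q m = (\<Sum>i<Suc 0. (\<lambda>_ q. ev q m') i q * (\<Prod>j<n. (\<lambda>_ _ q. ev q u) i j q))" if "q \<in> W" for q
      using prod[OF that] by simp
    show "(\<lambda>_ q. ev q m') i \<in> regular X W" for i :: nat using r[OF m'd] by simp
    show "(\<lambda>_ _ q. ev q u) i j \<in> vanishing_ideal X (ray_divisor v) W" for i j :: nat using van by simp
  qed (use W DW in auto)
qed

lemma divisor_ideal_vanishes:
  assumes "f \<in> divisor_ideal X n (ray_divisor v) V" "ray_divisor v \<inter> V \<noteq> {}" "n > 0"
  obtains W where "openin zar W" "W \<subseteq> V" "ray_divisor v \<inter> W \<noteq> {}" "\<And>q. q \<in> W \<Longrightarrow> q \<in> ray_divisor v \<Longrightarrow> f q = 0"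
proof -
  obtain W k c a where W: "openin (zariski X) W" "W \<subseteq> V" "ray_divisor v \<inter> W \<noteq> {}"
    and a: "\<And>i j. i < (k::nat) \<Longrightarrow> j < n \<Longrightarrow> a i j \<in> vanishing_ideal X (ray_divisor v) W"
    and f: "\<And>q. q \<in> W \<Longrightarrow> f q = (\<Sum>i<k. c i q * (\<Prod>j<n. a i j q))"
    using assms(1,2) unfolding divisor_ideal_def by blast
  have "f q = 0" if q: "q \<in> W" "q \<in> ray_divisor v" for q
  proof -
    have "(\<Prod>j<n. a i j q) = 0" if "i < k" for i
      using a[OF that assms(3)] q assms(3) by (intro prod_zero) (auto simp: vanishing_ideal_def)
    then show ?thesis using f[OF q(1)] by (simp del: prod_zero_iff)
  qed
  then show thesis using that[of W] W by (simp add: zar_def)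
qed

lemma dual_full_pointed:
  assumes "span \<sigma> = UNIV" "m \<in> dual_semigroup \<sigma>" "m' \<in> dual_semigroup \<sigma>" "m + m' = 0"
  shows "m = 0"
proof -
  have "pairing m w = 0" if "w \<in> \<sigma>" for w
  proof -
    have "pairing m w + pairing m' w = 0" using assms(4) pairing_add_left[of m m' w] by simp
    then show ?thesis using assms(2,3) that unfolding dual_semigroup_def by force
  qed
  then show ?thesis using perp_span_UNIV[OF assms(1)] by (simp add: perp_def)
qed

text \<open>A local equation of \<open>nD\<close> at the fixed point of a full-dimensional cone has, for a generic weight
  in the cone, a unique term \<open>b\<close> of lowest weight.  Every character \<open>m\<close> in the ideal of \<open>nD\<close> is a multiple of
  the equation near the fixed point; comparing terms of lowest weight shows that \<open>m - b\<close> lies in the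
  dual cone.\<close>

lemma cartier_local_character:
  assumes \<sigma>: "\<sigma> \<in> full_cones" and v: "v \<in> rays" "v \<in> \<sigma>" and n: "n > 0" "cartier_multiple X n (ray_divisor v)"
  obtains b where "b \<in> dual_semigroup \<sigma>" "pairing b v > 0"
    "\<And>m. m \<in> dual_semigroup \<sigma> \<Longrightarrow> int n \<le> ipair m v \<Longrightarrow> m - b \<in> dual_semigroup \<sigma>"
proof -
  have \<sigma>\<Sigma>: "\<sigma> \<in> \<Sigma>" and sp: "span \<sigma> = UNIV" using \<sigma> by (auto simp: full_cones_def)
  let ?\<rho> = "cone_ray v"
  note \<rho> = rays_cone[OF v(1)] and lv = rays_lattice[OF v(1)]
  have \<rho>\<sigma>: "?\<rho> \<subseteq> \<sigma>" using cone_ray_subset[OF fan_cone[OF \<sigma>\<Sigma>] v(2)] .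
  \<comment> \<open>The fixed point of the chart: only the constant character is nonzero there, so a
    function that does not vanish at \<open>x\<close> has a nonzero constant term.\<close>
  define x where "x = orb \<sigma> 1"
  have x: "x \<in> U \<sigma>" "x \<in> pts" "cone_of x = \<sigma>"
    unfolding x_def using orb_U[OF \<sigma>\<Sigma> torus_1] orb_pts[OF \<sigma>\<Sigma> torus_1] cone_of_orb[OF \<sigma>\<Sigma> torus_1] by auto
  have perp\<sigma>: "perp \<sigma> = {0}" using perp_span_UNIV[OF sp] by auto
  have const_coeff: "0 \<in> B \<and> c 0 \<noteq> 0" if "f \<in> chart_ring \<sigma>" "f x \<noteq> 0" "finite B" "B \<subseteq> dual_semigroup \<sigma>" "\<forall>p\<in>U \<sigma>. f p = (\<Sum>m\<in>B. c m * ev p m)" for f B and c :: "int ^ 'n \<Rightarrow> complex"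
  proof -
    have e: "f x = (\<Sum>m\<in>B \<inter> perp \<sigma>. c m * tpow 1 m)"
      unfolding x_def using chart_ring_orb[OF \<sigma>\<Sigma> \<sigma>\<Sigma> order.refl that(4,3,5) torus_1] .
    show ?thesis
    proof (cases "0 \<in> B")
      case True
      then have "B \<inter> perp \<sigma> = {0}" by (simp add: perp\<sigma>)
      then show ?thesis using e that(2) True by auto
    next
      case False
      then have "B \<inter> perp \<sigma> = {}" by (simp add: perp\<sigma>)
      then show ?thesis using e that(2) by simp
    qed
  qed
  have xX: "x \<in> points X" using x points_X by simp
  obtain Uo f where Uo': "openin (zariski X) Uo" "x \<in> Uo" and f: "f \<in> divisor_ideal X n (ray_divisor v) Uo"
    and gen': "\<forall>V g. openin (zariski X) V \<and> V \<subseteq> Uo \<and> g \<in> divisor_ideal X n (ray_divisor v) V \<longrightarrow>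
       (\<exists>h \<in> regular X V. \<forall>q\<in>V. g q = h q * f q)"
    using bspec[OF n(2)[unfolded cartier_multiple_def] xX] by (elim exE conjE) rule
  have Uo: "openin zar Uo" "x \<in> Uo" using Uo' by (simp_all add: zar_def)
  have gen: "\<exists>h \<in> regular X V. \<forall>q\<in>V. g q = h q * f q"
    if "openin zar V" "V \<subseteq> Uo" "g \<in> divisor_ideal X n (ray_divisor v) V" for V g
    using gen'[rule_format, of V g] that unfolding zar_def by simp
  have "f \<in> regular X Uo" using f by (simp add: divisor_ideal_def)
  then obtain P Q where P: "P \<in> chart_ring \<sigma>" and Q: "Q \<in> chart_ring \<sigma>" "Q x \<noteq> 0"
    and PQ: "\<And>q. q \<in> U \<sigma> \<Longrightarrow> Q q \<noteq> 0 \<Longrightarrow> q \<in> Uo \<and> f q = P q / Q q"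
    using regular_local[of f Uo x \<sigma>] Uo \<sigma>\<Sigma> x(1) by blast
  obtain BP cP where BP: "finite BP" "BP \<subseteq> dual_semigroup \<sigma>" "\<And>p. p \<in> U \<sigma> \<Longrightarrow> P p = (\<Sum>m\<in>BP. cP m * ev p m)" "\<And>m. m \<in> BP \<Longrightarrow> cP m \<noteq> 0"
    using chart_ringE[OF P] by metis
  obtain BQ cQ where BQ: "finite BQ" "BQ \<subseteq> dual_semigroup \<sigma>" "\<And>p. p \<in> U \<sigma> \<Longrightarrow> Q p = (\<Sum>m\<in>BQ. cQ m * ev p m)" "\<And>m. m \<in> BQ \<Longrightarrow> cQ m \<noteq> 0"
    using chart_ringE[OF Q(1)] by metis
  \<comment> \<open>Members of the ideal vanish on a nonempty open part of the divisor.
    Irreducibility of the orbit makes this part meet the set where the fraction \<open>P / Q\<close>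
    represents \<open>f\<close>.\<close>
  have P_orb: "P (orb ?\<rho> t) = 0" if t3: "t \<in> torus" for t
  proof (rule ccontr)
    assume P3: "P (orb ?\<rho> t) \<noteq> 0"
    have "x \<in> ray_divisor v" unfolding ray_divisor_def using orb_closure_mem[OF \<rho> x(2)] x(3) \<rho>\<sigma> by simp
    then have "ray_divisor v \<inter> Uo \<noteq> {}" using Uo(2) by blast
    then obtain W where W: "openin zar W" "W \<subseteq> Uo" "ray_divisor v \<inter> W \<noteq> {}" "\<And>q. q \<in> W \<Longrightarrow> q \<in> ray_divisor v \<Longrightarrow> f q = 0"
      using divisor_ideal_vanishes[OF f _ n(1)] by metis
    obtain t1 where t1: "t1 \<in> torus" "orb ?\<rho> t1 \<in> W" using ray_divisor_meets[OF W(1,3)] .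
    obtain t2 where t2: "t2 \<in> torus" "Q (orb ?\<rho> t2) \<noteq> 0"
      using chart_ring_nonzero_orb[OF \<sigma>\<Sigma> x(1) \<rho> _ Q] x(3) \<rho>\<sigma> by blast
    obtain t4 where t4: "t4 \<in> torus" "P (orb ?\<rho> t4) \<noteq> 0" "Q (orb ?\<rho> t4) \<noteq> 0"
      using chart_ring_orb_domain[OF \<sigma>\<Sigma> \<rho> \<rho>\<sigma> P Q(1) t3 P3 t2] .
    have o: "openin zar {q \<in> U \<sigma>. P q * Q q \<noteq> 0}" using openin_principal[OF \<sigma>\<Sigma> chart_ring_mult[OF \<sigma>\<Sigma> P Q(1)]] .
    have "orb ?\<rho> t4 \<in> {q \<in> U \<sigma>. P q * Q q \<noteq> 0}" using t4 orb_in_U[OF \<rho> t4(1) \<sigma>\<Sigma>] \<rho>\<sigma> by simp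
    from orb_open_Int[OF \<rho> o W(1) t4(1) this t1] obtain t5 where t5: "t5 \<in> torus" "orb ?\<rho> t5 \<in> {q \<in> U \<sigma>. P q * Q q \<noteq> 0} \<inter> W" .
    then have "f (orb ?\<rho> t5) = 0" using W(4) orb_in_ray_divisor[OF v(1)] by blast
    then show False using PQ[of "orb ?\<rho> t5"] t5 by auto
  qed
  have BPpos: "pairing b v > 0" if b: "b \<in> BP" for b
  proof -
    have "b \<notin> perp ?\<rho>"
    proof
      assume p: "b \<in> perp ?\<rho>"
      have BP3: "\<forall>p\<in>U \<sigma>. P p = (\<Sum>m\<in>BP. cP m * ev p m)" using BP(3) by blast
      have "(\<Sum>m\<in>BP \<inter> perp ?\<rho>. cP m * tpow t m) = 0" if "t \<in> torus" for t
        using chart_ring_orb[OF \<sigma>\<Sigma> \<rho> \<rho>\<sigma> BP(2,1) BP3 that] P_orb[OF that] by simp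
      then have "cP b = 0" using tpow_independent[of "BP \<inter> perp ?\<rho>" cP b] BP(1) b p by blast
      then show False using BP(4)[OF b] by simp
    qed
    moreover have "0 \<le> pairing b v" using BP(2) b v(2) by (auto simp: dual_semigroup_def)
    ultimately show ?thesis by (simp add: perp_cone_ray)
  qed
  \<comment> \<open>A weight generic for these differences is injective on \<open>BP\<close>, so the
    term of lowest weight is unique.\<close>
  define \<Delta> where "\<Delta> = (\<lambda>(b, b'). b - b') ` (BP \<times> BP) - {0}"
  have "finite \<Delta>" "0 \<notin> \<Delta>" using BP(1) by (auto simp: \<Delta>_def)
  then obtain w where w: "w \<in> \<sigma>" "\<And>d. d \<in> \<Delta> \<Longrightarrow> pairing d w \<noteq> 0"
    using generic_weight[OF fan_cone[OF \<sigma>\<Sigma>] sp] by metis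
  have winj: "b = b'" if "b \<in> BP" "b' \<in> BP" "pairing b w = pairing b' w" for b b'
  proof (rule ccontr)
    assume "b \<noteq> b'"
    then have "b - b' \<in> \<Delta>" using that unfolding \<Delta>_def by (auto intro!: image_eqI[of _ _ "(b, b')"])
    then show False using w(2) that(3) by (force simp: pairing_simps)
  qed
  have key: "BP \<noteq> {} \<and> m - arg_min_on (\<lambda>b. pairing b w) BP \<in> dual_semigroup \<sigma>" if m: "m \<in> dual_semigroup \<sigma>" "int n \<le> ipair m v" for m
  proof -
    define V where "V = Uo \<inter> U \<sigma>"
    have V: "openin zar V" "V \<subseteq> Uo" "V \<subseteq> U \<sigma>" "x \<in> V" unfolding V_def using Uo openin_U[OF \<sigma>\<Sigma>] x by auto
    have "(\<lambda>p. ev p m) \<in> regular X V" by (rule regular_restrict[OF regular_ev[OF \<sigma>\<Sigma> m(1)] V(1,3)]) simp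
    then obtain h where h: "h \<in> regular X V" "\<And>q. q \<in> V \<Longrightarrow> ev q m = h q * f q"
      using gen[OF V(1,2) character_in_divisor_ideal[OF v(1) V(1) m(2)]] by blast
    obtain A C where A: "A \<in> chart_ring \<sigma>" and C: "C \<in> chart_ring \<sigma>" "C x \<noteq> 0"
      and AC: "\<And>q. q \<in> U \<sigma> \<Longrightarrow> C q \<noteq> 0 \<Longrightarrow> q \<in> V \<and> h q = A q / C q"
      using regular_local[OF h(1) V(4) \<sigma>\<Sigma> x(1)] by blast
    obtain BA cA where BA: "finite BA" "BA \<subseteq> dual_semigroup \<sigma>" "\<And>p. p \<in> U \<sigma> \<Longrightarrow> A p = (\<Sum>m\<in>BA. cA m * ev p m)" "\<And>m. m \<in> BA \<Longrightarrow> cA m \<noteq> 0"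
      using chart_ringE[OF A] by metis
    obtain BC cC where BC: "finite BC" "BC \<subseteq> dual_semigroup \<sigma>" "\<And>p. p \<in> U \<sigma> \<Longrightarrow> C p = (\<Sum>m\<in>BC. cC m * ev p m)" "\<And>m. m \<in> BC \<Longrightarrow> cC m \<noteq> 0"
      using chart_ringE[OF C(1)] by metis
    \<comment> \<open>The relation between the character and the local equation with denominators
      cleared; it holds where \<open>C * Q\<close> is nonzero, and by irreducibility on the whole
      torus, where coefficients can be compared.\<close>
    define F where "F q = ev q m * (C q * Q q) + (- 1) * (A q * P q)" for q
    have CQ: "(\<lambda>q. C q * Q q) \<in> chart_ring \<sigma>" using chart_ring_mult[OF \<sigma>\<Sigma> C(1) Q(1)] .
    have Fr: "F \<in> chart_ring \<sigma>" unfolding F_def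
      by (intro chart_ring_add chart_ring_mult[OF \<sigma>\<Sigma>] chart_ring_ev m chart_ring_const[OF \<sigma>\<Sigma>] CQ A P)
    have Fz: "F q = 0" if "q \<in> U \<sigma>" "C q * Q q \<noteq> 0" for q
      using AC[of q] PQ[of q] h(2)[of q] that by (auto simp: F_def)
    have xz: "{0} \<subseteq> cone_of x" using x(3) zero_cone_subset[OF \<sigma>\<Sigma>] by simp
    obtain t1 where t1: "t1 \<in> torus" "C (tor t1) * Q (tor t1) \<noteq> 0"
      using chart_ring_nonzero_orb[OF \<sigma>\<Sigma> x(1) fan_zero_cone xz CQ] C(2) Q(2) by auto
    have Ftor: "F (tor t) = 0" if t: "t \<in> torus" for t
    proof (rule ccontr)
      assume Ft: "F (tor t) \<noteq> 0"
      obtain t2 where "t2 \<in> torus" "F (tor t2) \<noteq> 0" "C (tor t2) * Q (tor t2) \<noteq> 0"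
        by (rule chart_ring_orb_domain[OF \<sigma>\<Sigma> fan_zero_cone zero_cone_subset[OF \<sigma>\<Sigma>] Fr CQ t Ft t1])
      then show False using Fz tor_U[OF _ \<sigma>\<Sigma>] by blast
    qed
    let ?e1 = "\<lambda>(c, q). m + c + q" and ?e2 = "\<lambda>(a, b). a + b :: int ^ 'n"
    let ?c1 = "\<lambda>(c, q). cC c * cQ q" and ?c2 = "\<lambda>(a, b). cA a * cP b"
    have eq: "(\<Sum>i\<in>BC \<times> BQ. ?c1 i * tpow t (?e1 i)) = (\<Sum>j\<in>BA \<times> BP. ?c2 j * tpow t (?e2 j))" if t: "t \<in> torus" for t
    proof -
      note tU = tor_U[OF t \<sigma>\<Sigma>]
      have r: "C (tor t) = (\<Sum>k\<in>BC. cC k * tpow t k)" "Q (tor t) = (\<Sum>k\<in>BQ. cQ k * tpow t k)"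
        "A (tor t) = (\<Sum>k\<in>BA. cA k * tpow t k)" "P (tor t) = (\<Sum>k\<in>BP. cP k * tpow t k)"
        using BC(3)[OF tU] BQ(3)[OF tU] BA(3)[OF tU] BP(3)[OF tU] by (simp_all add: ev_tor[OF t])
      have "tpow t m * (C (tor t) * Q (tor t)) = (\<Sum>i\<in>BC \<times> BQ. ?c1 i * tpow t (?e1 i))"
        unfolding r(1,2) sum_product[of "\<lambda>k. cC k * tpow t k"] sum.cartesian_product
        unfolding sum_distrib_left
        by (intro sum.cong refl) (auto simp: tpow_add[OF t])
      then have "(\<Sum>i\<in>BC \<times> BQ. ?c1 i * tpow t (?e1 i)) = tpow t m * (C (tor t) * Q (tor t))" by simp
      also have "\<dots> = A (tor t) * P (tor t)" using Ftor[OF t] by (simp add: F_def ev_tor[OF t])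
      also have "\<dots> = (\<Sum>j\<in>BA \<times> BP. ?c2 j * tpow t (?e2 j))"
        unfolding r(3,4) sum_product[of "\<lambda>k. cA k * tpow t k"] sum.cartesian_product
        by (intro sum.cong refl) (auto simp: tpow_add[OF t])
      finally show ?thesis .
    qed
    have fib: "(\<Sum>i\<in>{i\<in>BC \<times> BQ. ?e1 i = k}. ?c1 i) = (\<Sum>j\<in>{j\<in>BA \<times> BP. ?e2 j = k}. ?c2 j)" for k
      by (rule tpow_fibre_sums[OF _ _ eq]) (use BC(1) BQ(1) BA(1) BP(1) in auto)
    have BC3: "\<forall>p\<in>U \<sigma>. C p = (\<Sum>m\<in>BC. cC m * ev p m)" and BQ3: "\<forall>p\<in>U \<sigma>. Q p = (\<Sum>m\<in>BQ. cQ m * ev p m)"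
      using BC(3) BQ(3) by blast+
    have c0: "0 \<in> BC" "cC 0 \<noteq> 0" "0 \<in> BQ" "cQ 0 \<noteq> 0"
      using const_coeff[OF C BC(1,2) BC3] const_coeff[OF Q BQ(1,2) BQ3] by auto
    \<comment> \<open>Since the dual cone is pointed, \<open>m\<close> arises on the left only from
      the two constant terms, whose product is nonzero; so it occurs on the right as
      \<open>a + b\<close>.\<close>
    have "{i\<in>BC \<times> BQ. ?e1 i = m} = {(0, 0)}"
    proof -
      have "c = 0 \<and> q = 0" if "c \<in> BC" "q \<in> BQ" "m + c + q = m" for c q
      proof -
        have "c + q = 0" using that(3) by (simp add: add.assoc)
        then show ?thesis using dual_full_pointed[OF sp, of c q] dual_full_pointed[OF sp, of q c] that BC(2) BQ(2) by (auto simp: add.commute)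
      qed
      then show ?thesis using c0 by auto
    qed
    then have "(\<Sum>i\<in>{i\<in>BC \<times> BQ. ?e1 i = m}. ?c1 i) = cC 0 * cQ 0" by simp
    then have "(\<Sum>j\<in>{j\<in>BA \<times> BP. ?e2 j = m}. ?c2 j) \<noteq> 0" unfolding fib[of m, symmetric] using c0 by simp
    then have "{j\<in>BA \<times> BP. ?e2 j = m} \<noteq> {}" by (metis (no_types, lifting) sum.empty)
    then obtain a b where ab: "a \<in> BA" "b \<in> BP" "a + b = m" by auto
    define b0 where "b0 = arg_min_on (\<lambda>b. pairing b w) BP"
    define a0 where "a0 = arg_min_on (\<lambda>b. pairing b w) BA"
    have b0: "b0 \<in> BP" "\<And>b. b \<in> BP \<Longrightarrow> pairing b0 w \<le> pairing b w"
      unfolding b0_def using arg_min_if_finite(1)[OF BP(1)] arg_min_least[OF BP(1), where f = "\<lambda>b. pairing b w"] ab by auto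
    have a0: "a0 \<in> BA" "\<And>a. a \<in> BA \<Longrightarrow> pairing a0 w \<le> pairing a w"
      unfolding a0_def using arg_min_if_finite(1)[OF BA(1)] arg_min_least[OF BA(1), where f = "\<lambda>b. pairing b w"] ab by auto
    \<comment> \<open>Conversely the lowest term on the right cannot cancel, so it occurs on the
      left, where all weights are at least that of \<open>m\<close>. This forces \<open>b\<close> to
      have the least weight.\<close>
    have "{j\<in>BA \<times> BP. ?e2 j = a0 + b0} = {(a0, b0)}"
    proof -
      have "a' = a0 \<and> b' = b0" if "a' \<in> BA" "b' \<in> BP" "a' + b' = a0 + b0" for a' b'
      proof -
        have "pairing a' w + pairing b' w = pairing a0 w + pairing b0 w"
          using that(3) by (metis pairing_add_left)
        then have "pairing b' w = pairing b0 w" using a0(2)[OF that(1)] b0(2)[OF that(2)] by linarith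
        then have "b' = b0" using winj that(2) b0(1) by blast
        then show ?thesis using that(3) by simp
      qed
      then show ?thesis using a0(1) b0(1) by auto
    qed
    then have "(\<Sum>i\<in>{i\<in>BC \<times> BQ. ?e1 i = a0 + b0}. ?c1 i) \<noteq> 0"
      using fib[of "a0 + b0"] BA(4)[OF a0(1)] BP(4)[OF b0(1)] by simp
    then have "{i\<in>BC \<times> BQ. ?e1 i = a0 + b0} \<noteq> {}" by (metis (no_types, lifting) sum.empty)
    then obtain c q where cq: "c \<in> BC" "q \<in> BQ" "m + c + q = a0 + b0" by auto
    have "pairing m w + pairing c w + pairing q w = pairing a0 w + pairing b0 w"
      using cq(3) by (metis pairing_add_left)
    moreover have "0 \<le> pairing c w" "0 \<le> pairing q w" using cq BC(2) BQ(2) w(1) by (auto simp: dual_semigroup_def)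
    moreover have "pairing m w = pairing a w + pairing b w" using ab(3) by (metis pairing_add_left)
    ultimately have "pairing b w = pairing b0 w" using a0(2)[OF ab(1)] b0(2)[OF ab(2)] by linarith
    then have "b = b0" using winj ab(2) b0(1) by blast
    then have "m - b0 = a" using ab(3) by (simp add: algebra_simps)
    then show ?thesis using ab BA(2) by (auto simp: b0_def)
  qed
  \<comment> \<open>A character positive on \<sigma> away from 0 has a multiple of order at least
    \<open>n\<close> along the divisor; hence \<open>BP\<close> is nonempty.\<close>
  obtain m1 where m1: "m1 \<in> dual_semigroup \<sigma>" "\<And>w. w \<in> \<sigma> \<Longrightarrow> pairing m1 w = 0 \<longleftrightarrow> w \<in> {0}"
    using exposing[OF \<sigma>\<Sigma> fan_zero_cone zero_cone_subset[OF \<sigma>\<Sigma>]] by metis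
  have "0 \<le> pairing m1 v" using m1(1) v(2) by (auto simp: dual_semigroup_def)
  then have "0 < pairing m1 v" using m1(2)[OF v(2)] rays_nonzero[OF v(1)] by auto
  then have "1 \<le> ipair m1 v" using of_int_ipair[OF lv, of m1] by linarith
  then have "int n \<le> ipair (int n *s m1) v" using n(1) by (simp add: ipair_vmult[OF lv])
  then have BPne: "BP \<noteq> {}" using key[OF dual_vmult[OF m1(1)], of "int n"] by simp
  have "arg_min_on (\<lambda>b. pairing b w) BP \<in> BP" using arg_min_if_finite(1)[OF BP(1) BPne] .
  then show thesis using that[of "arg_min_on (\<lambda>b. pairing b w) BP"] key BPpos BP(2) by blast
qed

text \<open>Compare b with n times a character that vanishes on v' and is positive on v: the
  difference stays in the dual cone, so b is at most 0 on v', and it is nonnegative there as a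
  member of the dual cone. Such vectors for all v make the rays of \<sigma> linearly
  independent.\<close>

lemma full_cone_dual_vector:
  assumes qf: "q_factorial X" and \<sigma>: "\<sigma> \<in> full_cones" and v: "v \<in> rays" "v \<in> \<sigma>"
  obtains b where "pairing b v > 0" "\<And>v'. v' \<in> rays \<Longrightarrow> v' \<in> \<sigma> \<Longrightarrow> v' \<noteq> v \<Longrightarrow> pairing b v' = 0"
proof -
  have \<sigma>\<Sigma>: "\<sigma> \<in> \<Sigma>" using \<sigma> by (auto simp: full_cones_def)
  obtain n where n: "n > 0" "cartier_multiple X n (ray_divisor v)"
    using qf ray_divisor_prime[OF v(1)] unfolding q_factorial_def by blast
  obtain b where b: "b \<in> dual_semigroup \<sigma>" "pairing b v > 0"
    "\<And>m. m \<in> dual_semigroup \<sigma> \<Longrightarrow> int n \<le> ipair m v \<Longrightarrow> m - b \<in> dual_semigroup \<sigma>"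
    using cartier_local_character[OF \<sigma> v n] by metis
  show thesis
  proof (rule that[OF b(2)])
    fix v' assume v': "v' \<in> rays" "v' \<in> \<sigma>" "v' \<noteq> v"
    obtain m where m: "m \<in> dual_semigroup \<sigma>" "pairing m v' = 0" "pairing m v > 0"
      using rays_separated[OF \<sigma>\<Sigma> v v'(1,2)] v'(3) by metis
    have "1 \<le> ipair m v" using of_int_ipair[OF rays_lattice[OF v(1)], of m] m(3) by linarith
    then have "int n \<le> ipair (int n *s m) v" using n(1) by (simp add: ipair_vmult[OF rays_lattice[OF v(1)]])
    then have "int n *s m - b \<in> dual_semigroup \<sigma>" using b(3) dual_vmult[OF m(1), of "int n"] by simp
    then have "0 \<le> pairing (int n *s m - b) v'" using v'(2) by (auto simp: dual_semigroup_def)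
    then have "pairing b v' \<le> 0" using m(2) by (simp add: pairing_simps)
    moreover have "0 \<le> pairing b v'" using b(1) v'(2) by (auto simp: dual_semigroup_def)
    ultimately show "pairing b v' = 0" by simp
  qed
qed

text \<open>\<open>N\<close> is the product of the pairings over all pairs of a full-dimensional
  cone and a ray in it; rescaling each dual vector by the remaining factors gives all of them the
  same value. Smaller cones inherit the vectors of a full-dimensional cone above them.\<close>

lemma simplicial_dual_basis:
  assumes qf: "q_factorial X" and supp: "\<Union>\<Sigma> = UNIV"
  obtains N where "N > 0" "\<And>\<sigma> v. \<sigma> \<in> \<Sigma> \<Longrightarrow> v \<in> rays \<Longrightarrow>
    \<exists>m. \<forall>v'\<in>rays \<inter> \<sigma>. ipair m v' = (if v' = v then N else 0)"
proof -
  define I where "I = {(\<sigma>, v). \<sigma> \<in> full_cones \<and> v \<in> rays \<and> v \<in> \<sigma>}"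
  have finI: "finite I"
    by (rule finite_subset[of _ "\<Sigma> \<times> rays"]) (use finite_fan finite_rays in \<open>auto simp: I_def full_cones_def\<close>)
  have "\<exists>b. pairing b v > 0 \<and> (\<forall>v'. v' \<in> rays \<and> v' \<in> \<sigma> \<and> v' \<noteq> v \<longrightarrow> pairing b v' = 0)" if i: "(\<sigma>, v) \<in> I" for \<sigma> v
  proof -
    have "\<sigma> \<in> full_cones" "v \<in> rays" "v \<in> \<sigma>" using i by (auto simp: I_def)
    from full_cone_dual_vector[OF qf this] show ?thesis by metis
  qed
  then obtain b where b: "\<And>\<sigma> v. (\<sigma>, v) \<in> I \<Longrightarrow> pairing (b \<sigma> v) v > 0"
    "\<And>\<sigma> v v'. (\<sigma>, v) \<in> I \<Longrightarrow> v' \<in> rays \<Longrightarrow> v' \<in> \<sigma> \<Longrightarrow> v' \<noteq> v \<Longrightarrow> pairing (b \<sigma> v) v' = 0" by metis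
  define k where "k = (\<lambda>(\<sigma>, v). ipair (b \<sigma> v) v)"
  have k: "k i > 0" if "i \<in> I" for i
  proof -
    obtain \<sigma> v where i: "i = (\<sigma>, v)" by fastforce
    have "lattice_vec v" using that rays_lattice by (auto simp: I_def i)
    then show ?thesis using b(1)[of \<sigma> v] that of_int_ipair[of v "b \<sigma> v"] by (simp add: k_def i)
  qed
  define N where "N = (\<Prod>i\<in>I. k i)"
  show thesis
  proof (rule that[of N])
    show "N > 0" unfolding N_def using k by (rule prod_pos)
    fix \<gamma> v assume \<gamma>: "\<gamma> \<in> \<Sigma>" and v: "v \<in> rays"
    obtain \<sigma> where \<sigma>: "\<sigma> \<in> full_cones" "\<gamma> \<subseteq> \<sigma>" using full_cone_above[OF supp \<gamma>] .
    show "\<exists>m. \<forall>v'\<in>rays \<inter> \<gamma>. ipair m v' = (if v' = v then N else 0)"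
    proof (cases "v \<in> \<sigma>")
      \<comment> \<open>A ray outside the large cone is outside \<open>\<gamma>\<close> as well, so
        the zero character will do.\<close>
      case False
      then show ?thesis using \<sigma>(2) by (intro exI[of _ 0]) auto
    next
      case True
      then have iI: "(\<sigma>, v) \<in> I" using \<sigma> v by (simp add: I_def)
      have N: "N = k (\<sigma>, v) * (\<Prod>i\<in>I - {(\<sigma>, v)}. k i)" unfolding N_def using finI iI by (rule prod.remove)
      have "ipair ((\<Prod>i\<in>I - {(\<sigma>, v)}. k i) *s b \<sigma> v) v' = (if v' = v then N else 0)" if v': "v' \<in> rays \<inter> \<gamma>" for v'
        using v' N b(2)[OF iI, of v'] \<sigma>(2) by (auto simp: ipair_vmult rays_lattice k_def mult.commute) (auto simp: ipair_def)
      then show ?thesis by blast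
    qed
  qed
qed

end


subsection \<open>Periods of units on the torus\<close>

text \<open>The logarithms of 1 are at least 2 pi apart, so a continuous choice among them on a
  connected set is constant.\<close>

lemma exp_1_constant_on:
  fixes f :: "'a::topological_space \<Rightarrow> complex"
  assumes "connected S" "continuous_on S f" "\<And>z. z \<in> S \<Longrightarrow> exp (f z) = 1" "x \<in> S" "y \<in> S"
  shows "f x = f y"
proof -
  have "f constant_on S"
  proof (rule continuous_discrete_range_constant[OF assms(1,2)])
    fix x assume x: "x \<in> S"
    show "\<exists>e>0. \<forall>y. y \<in> S \<and> f y \<noteq> f x \<longrightarrow> e \<le> norm (f y - f x)"
    proof (intro exI conjI allI impI)
      fix y assume y: "y \<in> S \<and> f y \<noteq> f x"
      have "exp (f y - f x) = 1" using assms(3) x y by (simp add: exp_diff)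
      then obtain n :: int where n: "Re (f y - f x) = 0" "Im (f y - f x) = of_int (2 * n) * pi" unfolding exp_eq_1 by blast
      have "n \<noteq> 0"
      proof
        assume "n = 0"
        then have "f y - f x = 0" using n by (simp add: complex_eq_iff)
        then show False using y by simp
      qed
      then have "1 \<le> \<bar>real_of_int n\<bar>" by (simp add: of_int_abs[symmetric] del: of_int_abs)
      then have "2 * pi * 1 \<le> 2 * pi * \<bar>real_of_int n\<bar>" by (intro mult_left_mono) auto
      also have "\<dots> = \<bar>Im (f y - f x)\<bar>" unfolding n(2) by (simp add: abs_mult)
      also have "\<dots> \<le> norm (f y - f x)" by (rule abs_Im_le_cmod)
      finally show "2 * pi \<le> norm (f y - f x)" by simp
    qed simp
  qed
  then show ?thesis using assms(4,5) unfolding constant_on_def by auto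
qed

lemma additive_int_vec:
  fixes f :: "int ^ 'n \<Rightarrow> complex"
  assumes add: "\<And>x y. f (x + y) = f x + f y"
  shows "f w = (\<Sum>j\<in>UNIV. of_int (w $ j) * f (axis j 1))"
proof -
  have f0: "f 0 = 0" using add[of 0 0] by simp
  have nat: "f (int k *s x) = of_nat k * f x" for k x
  proof (induction k)
    case 0
    have "int 0 *s x = 0" by (simp add: vec_eq_iff)
    then show ?case using f0 by simp
  next
    case (Suc k)
    have "int (Suc k) *s x = x + int k *s x" by (simp add: vec_eq_iff algebra_simps)
    then show ?case using add Suc by (simp add: algebra_simps)
  qed
  have neg: "f (- x) = - f x" for x using add[of x "- x"] f0 by (simp add: eq_neg_iff_add_eq_0 add.commute)
  have int: "f (k *s x) = of_int k * f x" for k x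
  proof (cases "0 \<le> k")
    case True
    then show ?thesis using nat[of "nat k" x] by simp
  next
    case False
    then have "k *s x = - (int (nat (- k)) *s x)" by (simp add: vec_eq_iff)
    then show ?thesis using neg nat[of "nat (- k)" x] False by simp
  qed
  have sum: "f (\<Sum>j\<in>J. g j) = (\<Sum>j\<in>J. f (g j))" for J and g :: "'n \<Rightarrow> int ^ 'n"
    by (induction J rule: infinite_finite_induct) (auto simp: f0 add)
  have "w = (\<Sum>j\<in>UNIV. (w $ j) *s axis j 1)"
    by (simp add: vec_eq_iff axis_def if_distrib[of "\<lambda>x. _ * x"] cong: if_cong)
  then have "f w = f (\<Sum>j\<in>UNIV. (w $ j) *s axis j 1)" by simp
  then show ?thesis by (simp add: sum int)
qed

lemma open_torus: "open (torus :: (complex ^ 'n) set)"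
proof -
  have "torus = (\<Inter>i\<in>UNIV. {t :: complex ^ 'n. t $ i \<noteq> 0})" by (auto simp: torus_def)
  moreover have "open (\<Inter>i\<in>UNIV. {t :: complex ^ 'n. t $ i \<noteq> 0})"
    by (intro open_INT ballI open_Collect_neq continuous_intros) auto
  ultimately show ?thesis by metis
qed

text \<open>A nonvanishing continuous function \<open>s\<close> on the torus behaves topologically like a character \<open>k\<close>.  If
  it extends up to the factor \<open>\<lambda>\<^sup>c\<close> along the one-parameter subgroup of \<open>v\<close> to \<open>\<lambda> = 0\<close>, the winding
  number of \<open>s\<close> along the subgroup is \<open>- c\<close>.\<close>

lemma torus_unit_period:
  fixes s :: "complex ^ 'n \<Rightarrow> complex"
  assumes s: "continuous_on torus s" "\<And>t. t \<in> torus \<Longrightarrow> s t \<noteq> 0"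
  shows "\<exists>k. \<forall>v H c e. lattice_vec v \<and> e > 0 \<and> continuous_on (cball 0 e) H \<and> (\<forall>l\<in>cball 0 e. H l \<noteq> 0) \<and>
    (\<forall>l. l \<noteq> 0 \<and> norm l \<le> e \<longrightarrow> s (\<chi> i. l powi \<lfloor>v $ i\<rfloor>) * l powi c = H l) \<longrightarrow> ipair k v = - c"
proof -
  \<comment> \<open>The universal cover of the torus. There the function has a logarithm
    \<open>L\<close>, whose increments under the deck transformations \<open>P\<close> are integral
    multiples of 2 pi i and additive in the loop.\<close>
  define E :: "complex ^ 'n \<Rightarrow> complex ^ 'n" where "E z = (\<chi> i. exp (z $ i))" for z
  have contE: "continuous_on UNIV E" unfolding E_def by (intro continuous_intros)
  have Et: "E z \<in> torus" for z by (simp add: E_def torus_def)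
  have "continuous_on UNIV (\<lambda>z. s (E z))"
    by (rule continuous_on_compose2[OF s(1) contE]) (use Et in auto)
  then obtain L where L: "continuous_on UNIV L" "\<And>z. s (E z) = exp (L z)"
    using continuous_logarithm_on_contractible[of UNIV "\<lambda>z. s (E z)"] s(2)[OF Et] convex_imp_contractible[OF convex_UNIV] by auto
  define P :: "int ^ 'n \<Rightarrow> complex ^ 'n" where "P w = (\<chi> i. 2 * of_real pi * \<i> * of_int (w $ i))" for w
  have EP: "E (z + P w) = E z" for z w
  proof -
    have "exp (2 * of_real pi * \<i> * of_int n) = 1" for n :: int
      by (subst exp_eq_1) auto
    then show ?thesis by (simp add: E_def P_def exp_add vec_eq_iff)
  qed
  define f where "f w = L (P w) - L 0" for w
  have shift: "L (z + P w) - L z = f w" for z w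
  proof -
    have "L (z + P w) - L z = L (0 + P w) - L 0"
    proof (rule exp_1_constant_on[of UNIV "\<lambda>z. L (z + P w) - L z"])
      show "continuous_on UNIV (\<lambda>z. L (z + P w) - L z)"
        by (intro continuous_intros continuous_on_compose2[OF L(1)]) auto
      show "exp (L (z + P w) - L z) = 1" for z
        using L(2)[of "z + P w"] L(2)[of z] EP[of z w] by (simp add: exp_diff)
    qed auto
    then show ?thesis by (simp add: f_def)
  qed
  have fadd: "f (x + y) = f x + f y" for x y
  proof -
    have "P (x + y) = P x + P y" by (simp add: P_def vec_eq_iff algebra_simps)
    then have "f (x + y) = L (P x + P y) - L 0" by (simp add: f_def)
    also have "L (P x + P y) = L (P x) + f y" using shift[of "P x" y] by (simp only: diff_eq_eq add.commute)
    finally show ?thesis by (simp add: f_def)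
  qed
  have "\<exists>n::int. f w = 2 * of_real pi * \<i> * of_int n" for w
  proof -
    have "exp (f w) = 1" using L(2)[of "P w"] L(2)[of 0] EP[of 0 w] by (simp add: f_def exp_diff)
    then obtain n :: int where "Re (f w) = 0" "Im (f w) = of_int (2 * n) * pi" unfolding exp_eq_1 by blast
    then show ?thesis by (intro exI[of _ n]) (simp add: complex_eq_iff)
  qed
  then obtain n where n: "\<And>w. f w = 2 * of_real pi * \<i> * of_int (n w)" by metis
  \<comment> \<open>By additivity the increments over the coordinate loops determine all
    others.\<close>
  define k :: "int ^ 'n" where "k = (\<chi> j. n (axis j 1))"
  show ?thesis
  proof (intro exI[of _ k] allI impI)
    fix v :: "real ^ 'n" and H c e
    assume "lattice_vec v \<and> e > 0 \<and> continuous_on (cball 0 e) H \<and> (\<forall>l\<in>cball 0 e. H l \<noteq> 0) \<and>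
      (\<forall>l. l \<noteq> 0 \<and> norm l \<le> e \<longrightarrow> s (\<chi> i. l powi \<lfloor>v $ i\<rfloor>) * l powi c = H l)"
    then have v: "lattice_vec v" and e: "e > 0" and H: "continuous_on (cball 0 e) H" "\<And>l. l \<in> cball 0 e \<Longrightarrow> H l \<noteq> 0"
      and sH: "\<And>l. l \<noteq> 0 \<Longrightarrow> norm l \<le> e \<Longrightarrow> s (\<chi> i. l powi \<lfloor>v $ i\<rfloor>) * l powi c = H l" by blast+
    define w :: "int ^ 'n" where "w = (\<chi> i. \<lfloor>v $ i\<rfloor>)"
    have fl: "real_of_int (w $ i) = v $ i" for i
      using v unfolding lattice_vec_def w_def by (metis Ints_cases floor_of_int vec_lambda_beta)
    have "pairing k v = real_of_int (\<Sum>j\<in>UNIV. k $ j * w $ j)" by (simp add: pairing_def fl[symmetric])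
    then have ik: "ipair k v = (\<Sum>j\<in>UNIV. k $ j * w $ j)" unfolding ipair_def by (metis floor_of_int)
    have "f w = (\<Sum>j\<in>UNIV. of_int (w $ j) * f (axis j 1))" by (rule additive_int_vec[OF fadd])
    also have "\<dots> = 2 * of_real pi * \<i> * of_int (ipair k v)"
      unfolding ik by (simp add: n k_def sum_distrib_left algebra_simps)
    finally have fw: "f w = 2 * of_real pi * \<i> * of_int (ipair k v)" .
    obtain l where l: "continuous_on (cball 0 e) l" "\<And>z. z \<in> cball 0 e \<Longrightarrow> H z = exp (l z)"
      using continuous_logarithm_on_cball[OF H] by auto
    define Y :: "complex \<Rightarrow> complex ^ 'n" where "Y z = (\<chi> i. z * of_int (w $ i))" for z
    \<comment> \<open>The half-plane covers the punctured disc by exp, and \<open>Y\<close> lifts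
      the one-parameter subgroup of \<open>v\<close> to the cover.\<close>
    define S where "S = {z. Re z \<le> ln e}"
    have expS: "exp z \<in> cball 0 e" if "z \<in> S" for z
    proof -
      have "exp (Re z) \<le> exp (ln e)" using that by (simp only: exp_le_cancel_iff S_def mem_Collect_eq)
      then show ?thesis using e by simp
    qed
    \<comment> \<open>A difference of two logarithms of the same function, hence constant. One turn
      around the disc changes the first term by the period and the last by 2 pi i c, while the
      middle term returns, since \<open>H\<close> has a logarithm on the whole disc.\<close>
    define D where "D z = L (Y z) - l (exp z) + z * of_int c" for z
    have contY: "continuous_on S Y" unfolding Y_def by (intro continuous_intros)
    have contD: "continuous_on S D" unfolding D_def
      by (intro continuous_intros continuous_on_compose2[OF L(1) contY] continuous_on_compose2[OF l(1)]) (use expS in auto)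
    have expi: "exp (z * of_int j) = exp z powi j" for z :: complex and j
      by (simp add: exp_power_int mult.commute)
    have D1: "exp (D z) = 1" if z: "z \<in> S" for z
    proof -
      have "E (Y z) = (\<chi> i. exp z powi \<lfloor>v $ i\<rfloor>)" by (simp add: E_def Y_def expi w_def)
      then have "s (E (Y z)) * exp z powi c = H (exp z)" using sH[of "exp z"] expS[OF z] by simp
      then have "exp (L (Y z)) * exp (z * of_int c) = exp (l (exp z))"
        using L(2)[of "Y z"] l(2)[OF expS[OF z]] by (simp add: expi)
      then show ?thesis by (simp add: D_def exp_add exp_diff)
    qed
    have "convex S"
    proof -
      have "S = {z. (1::complex) \<bullet> z \<le> ln e}" by (simp add: S_def inner_complex_def)
      then show ?thesis using convex_halfspace_le[of 1 "ln e"] by (simp only:)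
    qed
    then have conn: "connected S" by (rule convex_connected)
    define z0 where "z0 = complex_of_real (ln e)"
    have z0: "z0 \<in> S" "z0 + 2 * of_real pi * \<i> \<in> S" by (simp_all add: z0_def S_def)
    have "D (z0 + 2 * of_real pi * \<i>) = D z0" by (rule exp_1_constant_on[OF conn contD D1 z0(2,1)])
    moreover have "Y (z0 + 2 * of_real pi * \<i>) = Y z0 + P w" by (simp add: Y_def P_def vec_eq_iff algebra_simps)
    moreover have "exp (z0 + 2 * of_real pi * \<i>) = exp z0" by (simp add: exp_add)
    ultimately have "f w + 2 * of_real pi * \<i> * of_int c = 0"
      using shift[of "Y z0" w] by (simp add: D_def algebra_simps)
    then have "2 * of_real pi * \<i> * (of_int (ipair k v + c) :: complex) = 0" unfolding fw by (simp add: algebra_simps)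
    then have "(of_int (ipair k v + c) :: complex) = 0" by simp
    then have "ipair k v + c = 0" by (simp only: of_int_eq_0_iff)
    then show "ipair k v = - c" by simp
  qed
qed

section \<open>Line bundles given by local characters\<close>

context toric begin

lemma perp_rays:
  assumes "\<sigma> \<in> \<Sigma>" "\<And>v. v \<in> rays \<Longrightarrow> v \<in> \<sigma> \<Longrightarrow> pairing m v = 0"
  shows "m \<in> perp \<sigma>"
proof -
  have "convex_cone {v. pairing m v = 0}" by (auto simp: convex_cone_iff pairing_simps)
  then have "convex_cone hull (rays \<inter> \<sigma>) \<subseteq> {v. pairing m v = 0}" using assms(2) by (intro hull_minimal) auto
  then show ?thesis using cone_generated_by_rays[OF assms(1)] by (auto simp: perp_def)
qed

lemma perp_vmult: "m \<in> perp \<sigma> \<Longrightarrow> k *s m \<in> perp \<sigma>"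
  by (auto simp: perp_def pairing_simps)

lemma ev_perp_add:
  assumes "p \<in> pts" "m \<in> perp (cone_of p)" "m' \<in> perp (cone_of p)"
  shows "ev p (m + m') = ev p m * ev p m'"
  using ev_add[OF assms(1) perp_dual[OF assms(2)] perp_dual[OF assms(3)]] .

lemma ev_perp_nonzero: "p \<in> pts \<Longrightarrow> m \<in> perp (cone_of p) \<Longrightarrow> ev p m \<noteq> 0"
  using ev_nonzero_iff perp_dual by blast

lemma ev_perp_uminus:
  assumes p: "p \<in> pts" and m: "m \<in> perp (cone_of p)"
  shows "ev p (- m) = inverse (ev p m)"
proof -
  have "ev p (m + - m) = ev p m * ev p (- m)" using ev_perp_add[OF p m perp_uminus[OF m]] .
  then show ?thesis using ev_perp_nonzero[OF p m] p by (simp add: field_simps)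
qed

lemma ev_perp_vmult:
  assumes p: "p \<in> pts" and m: "m \<in> perp (cone_of p)"
  shows "ev p (k *s m) = ev p m powi k"
proof (cases "0 \<le> k")
  case True
  then show ?thesis using ev_vmult[OF p perp_dual[OF m], of "nat k"] by (simp add: power_int_def)
next
  case False
  have "k *s m = - (int (nat (- k)) *s m)" using False by (simp add: vec_eq_iff)
  then show ?thesis
    using False ev_vmult[OF p perp_dual[OF m], of "nat (- k)"] ev_perp_uminus[OF p perp_vmult[OF m, of "int (nat (- k))"]]
    by (simp add: power_int_def power_inverse)
qed

lemma ev_perp_sum:
  assumes p: "p \<in> pts" and m: "\<And>i. i \<in> I \<Longrightarrow> d i \<in> perp (cone_of p)"
  shows "ev p (\<Sum>i\<in>I. d i) = (\<Prod>i\<in>I. ev p (d i)) \<and> (\<Sum>i\<in>I. d i) \<in> perp (cone_of p)"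
  using m by (induction I rule: infinite_finite_induct) (auto simp: p ev_perp_add perp_add)

lemma regular_units_ev:
  assumes \<sigma>: "\<sigma> \<in> \<Sigma>" and m: "m \<in> perp \<sigma>"
  shows "(\<lambda>p. ev p m) \<in> regular_units X (U \<sigma>)"
  unfolding regular_units_def
proof (intro CollectI conjI ballI)
  show r: "(\<lambda>p. ev p m) \<in> regular X (U \<sigma>)" using regular_ev[OF \<sigma> perp_dual[OF m]] .
  show nz: "ev p m \<noteq> 0" if "p \<in> U \<sigma>" for p
    using ev_perp_nonzero[OF U_pts[OF \<sigma> that]] m perp_antimono[of "cone_of p" \<sigma>] U_iff[OF \<sigma>] that by blast
  show "(\<lambda>p. inverse (ev p m)) \<in> regular X (U \<sigma>)" using regular_inverse[OF openin_U[OF \<sigma>] r nz] .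
qed

text \<open>On a fan with the data of a simplicial one, the line bundles of (multiples of) the divisors of the rays
  outside a full-dimensional cone are independent: a trivialisation of a combination is a nonvanishing function on the
  torus whose character has prescribed pairings with all rays, zero with those of the full-dimensional cone.\<close>

definition ray_bundle :: "((real ^ 'n) set \<Rightarrow> int ^ 'n) \<Rightarrow> 'n local_toric_point set transition_data" where
  "ray_bundle M = (\<lambda>x. U (cone_of x), \<lambda>x y p. ev p (M (cone_of x) - M (cone_of y)))"

text \<open>Cartier data of a torus-invariant divisor: local characters may differ on an overlap
  only by a unit.\<close>

definition compatible :: "((real ^ 'n) set \<Rightarrow> int ^ 'n) \<Rightarrow> bool" where
  "compatible M \<longleftrightarrow> (\<forall>\<sigma>\<in>\<Sigma>. \<forall>\<tau>\<in>\<Sigma>. M \<sigma> - M \<tau> \<in> perp (\<sigma> \<inter> \<tau>))"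

lemma compatible_perp:
  assumes M: "compatible M" and x: "x \<in> pts" and y: "y \<in> pts" and p: "p \<in> U (cone_of x)" "p \<in> U (cone_of y)"
  shows "M (cone_of x) - M (cone_of y) \<in> perp (cone_of p)"
proof -
  have "cone_of p \<subseteq> cone_of x \<inter> cone_of y" using p U_iff cone_of_mem x y by blast
  then show ?thesis using M cone_of_mem[OF x] cone_of_mem[OF y] perp_antimono unfolding compatible_def by blast
qed

lemma ray_bundle_line_bundle:
  assumes M: "compatible M"
  shows "line_bundle X (ray_bundle M)"
  unfolding line_bundle_def ray_bundle_def prod.case points_X
proof (intro conjI ballI)
  fix x assume x: "x \<in> pts"
  show "openin (zariski X) (U (cone_of x))" using openin_U[OF cone_of_mem[OF x]] by (simp add: zar_def)
  show "x \<in> U (cone_of x)" using cone_of_U[OF x] .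
  fix y assume y: "y \<in> pts"
  show "(\<lambda>p. ev p (M (cone_of x) - M (cone_of y))) \<in> regular_units X (U (cone_of x) \<inter> U (cone_of y))"
    unfolding U_Int[OF cone_of_mem[OF x] cone_of_mem[OF y]]
    using regular_units_ev[OF fan_Int[OF cone_of_mem[OF x] cone_of_mem[OF y]]] M cone_of_mem[OF x] cone_of_mem[OF y]
    unfolding compatible_def by blast
  fix z p assume z: "z \<in> pts" and p: "p \<in> U (cone_of x) \<inter> U (cone_of y) \<inter> U (cone_of z)"
  have pp: "p \<in> pts" using p U_pts[OF cone_of_mem[OF x]] by blast
  have "(M (cone_of x) - M (cone_of y)) + (M (cone_of y) - M (cone_of z)) = M (cone_of x) - M (cone_of z)" by simp
  then show "ev p (M (cone_of x) - M (cone_of y)) * ev p (M (cone_of y) - M (cone_of z)) = ev p (M (cone_of x) - M (cone_of z))"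
    using ev_perp_add[OF pp compatible_perp[OF M x y, of p] compatible_perp[OF M y z, of p]] p by simp
qed

text \<open>Tensor products add local characters; negative powers are harmless because the
  differences are units on the overlap.\<close>

lemma tensor_ray_bundle:
  assumes M: "\<And>i. i < k \<Longrightarrow> compatible (M i)" and x: "x \<in> pts" and y: "y \<in> pts" and p: "p \<in> U (cone_of x)" "p \<in> U (cone_of y)"
  shows "snd (tensor_combination X k (\<lambda>i. ray_bundle (M i)) a) x y p =
    ev p ((\<Sum>i<k. a i *s M i (cone_of x)) - (\<Sum>i<k. a i *s M i (cone_of y)))"
proof -
  have pp: "p \<in> pts" using p U_pts[OF cone_of_mem[OF x]] by blast
  have d: "M i (cone_of x) - M i (cone_of y) \<in> perp (cone_of p)" if "i < k" for i
    using compatible_perp[OF M[OF that] x y p] .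
  have "ev p ((\<Sum>i<k. a i *s M i (cone_of x)) - (\<Sum>i<k. a i *s M i (cone_of y))) = ev p (\<Sum>i<k. a i *s (M i (cone_of x) - M i (cone_of y)))"
    by (simp add: sum_subtractf[symmetric] vector_ssub_ldistrib)
  also have "\<dots> = (\<Prod>i<k. ev p (a i *s (M i (cone_of x) - M i (cone_of y))))"
    using ev_perp_sum[OF pp, of "{..<k}" "\<lambda>i. a i *s (M i (cone_of x) - M i (cone_of y))"] perp_vmult[OF d] by blast
  also have "\<dots> = (\<Prod>i<k. ev p (M i (cone_of x) - M i (cone_of y)) powi a i)"
    by (intro prod.cong refl ev_perp_vmult[OF pp] d) simp
  finally show ?thesis by (simp add: tensor_combination_def ray_bundle_def)
qed

text \<open>The trivialising units divided by the local characters agree on overlaps and give one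
  nonvanishing function s on the torus. Near the orbit of a ray, s times the local character extends
  without zeros, so \<open>torus_unit_period\<close> yields the pairing of the character of s with
  that ray.\<close>

lemma trivial_bundle_character:
  assumes M: "compatible M"
    and V: "\<And>x. x \<in> pts \<Longrightarrow> openin zar (V x) \<and> x \<in> V x \<and> V x \<subseteq> U (cone_of x) \<and> h x \<in> regular_units X (V x)"
    and h: "\<And>x y p. x \<in> pts \<Longrightarrow> y \<in> pts \<Longrightarrow> p \<in> V x \<inter> V y \<Longrightarrow> ev p (M (cone_of x) - M (cone_of y)) = h x p / h y p"
  obtains k where "\<And>v. v \<in> rays \<Longrightarrow> ipair k v = - ipair (M (cone_ray v)) v"
proof -
  have hreg: "h x \<in> regular X (V x)" and hnz: "p \<in> V x \<Longrightarrow> h x p \<noteq> 0" if "x \<in> pts" for x p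
    using V[OF that] by (auto simp: regular_units_def)
  define s where "s t = h (tor t) (tor t) / tpow t (M {0})" for t
  have tp: "tor t \<in> pts" "cone_of (tor t) = {0}" if "t \<in> torus" for t
    using orb_pts[OF fan_zero_cone that] cone_of_orb[OF fan_zero_cone that] by auto
  have s_eq: "s t = h x (tor t) / tpow t (M (cone_of x))" if t: "t \<in> torus" and x: "x \<in> pts" "tor t \<in> V x" for t x
  proof -
    have "tor t \<in> V (tor t)" using V[OF tp(1)[OF t]] by blast
    then have "tpow t (M (cone_of x) - M {0}) = h x (tor t) / h (tor t) (tor t)"
      using h[OF x(1) tp(1)[OF t], of "tor t"] x(2) tp(2)[OF t] ev_tor[OF t] by simp
    moreover have "tpow t (M (cone_of x)) = tpow t (M (cone_of x) - M {0}) * tpow t (M {0})"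
      using tpow_add[OF t, of "M (cone_of x) - M {0}" "M {0}"] by simp
    moreover have "h x (tor t) \<noteq> 0" using hnz[OF x] .
    moreover have "h (tor t) (tor t) \<noteq> 0" using hnz[OF tp(1)[OF t]] V[OF tp(1)[OF t]] by blast
    ultimately show ?thesis using tpow_nonzero[OF t] by (simp add: s_def field_simps)
  qed
  have s_nz: "s t \<noteq> 0" if "t \<in> torus" for t
    using hnz[OF tp(1)[OF that]] V[OF tp(1)[OF that]] tpow_nonzero[OF that] by (simp add: s_def)
  have loc: "\<exists>T. open T \<and> t0 \<in> T \<and> T \<subseteq> torus \<and> continuous_on T s" if t0: "t0 \<in> torus" for t0
  proof -
    let ?x = "tor t0"
    obtain f g where fg: "f \<in> chart_ring {0}" "g \<in> chart_ring {0}" "g ?x \<noteq> 0" "\<And>q. q \<in> U {0} \<Longrightarrow> g q \<noteq> 0 \<Longrightarrow> q \<in> V ?x \<and> h ?x q = f q / g q"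
      using regular_local[OF hreg[OF tp(1)[OF t0]] _ fan_zero_cone tor_U[OF t0 fan_zero_cone]] V[OF tp(1)[OF t0]] by blast
    define T where "T = torus \<inter> (\<lambda>t. g (tor t)) -` (- {0})"
    have "open T" unfolding T_def
      by (rule continuous_open_preimage[OF continuous_on_chart_ring_tor[OF fg(2) fan_zero_cone] open_torus]) (simp add: open_Compl)
    moreover have "continuous_on T s"
    proof (rule continuous_on_eq[of _ "\<lambda>t. f (tor t) / g (tor t) / tpow t (M {0})"])
      have sub: "T \<subseteq> torus" by (auto simp: T_def)
      show "continuous_on T (\<lambda>t. f (tor t) / g (tor t) / tpow t (M {0}))"
        by (intro continuous_on_divide continuous_on_subset[OF continuous_on_tpow sub]
            continuous_on_subset[OF continuous_on_chart_ring_tor[OF fg(1) fan_zero_cone] sub]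
            continuous_on_subset[OF continuous_on_chart_ring_tor[OF fg(2) fan_zero_cone] sub])
          (auto simp: T_def tpow_nonzero)
      fix t assume "t \<in> T"
      then have t: "t \<in> torus" "g (tor t) \<noteq> 0" by (auto simp: T_def)
      then show "f (tor t) / g (tor t) / tpow t (M {0}) = s t"
        using s_eq[OF t(1) tp(1)[OF t0]] fg(4)[OF tor_U[OF t(1) fan_zero_cone] t(2)] tp(2)[OF t0] by simp
    qed
    moreover have "t0 \<in> T" using t0 fg(3) by (simp add: T_def)
    moreover have "T \<subseteq> torus" by (auto simp: T_def)
    ultimately show ?thesis by blast
  qed
  have "continuous_on torus s"
  proof -
    have "\<forall>t0\<in>torus. \<exists>T. open T \<and> t0 \<in> T \<and> T \<subseteq> torus \<and> continuous_on T s" using loc by blast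
    then obtain T where T: "\<And>t0. t0 \<in> torus \<Longrightarrow> open (T t0) \<and> t0 \<in> T t0 \<and> T t0 \<subseteq> torus \<and> continuous_on (T t0) s"
      by (auto dest!: bchoice)
    then have "torus = (\<Union>t\<in>torus. T t)" by blast
    moreover have "continuous_on (\<Union>t\<in>torus. T t) s" using T by (intro continuous_on_open_UN) auto
    ultimately show ?thesis by simp
  qed
  from torus_unit_period[OF this s_nz] obtain k where
    k: "\<forall>v H c e. lattice_vec v \<and> e > 0 \<and> continuous_on (cball 0 e) H \<and> (\<forall>l\<in>cball 0 e. H l \<noteq> 0) \<and>
    (\<forall>l. l \<noteq> 0 \<and> norm l \<le> e \<longrightarrow> s (\<chi> i. l powi \<lfloor>v $ i\<rfloor>) * l powi c = H l) \<longrightarrow> ipair k v = - c" ..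
  show thesis
  proof (rule that[of k])
    fix v assume v: "v \<in> rays"
    let ?\<rho> = "cone_ray v"
    note \<rho> = rays_cone[OF v] and lv = rays_lattice[OF v]
    define c where "c = ipair (M ?\<rho>) v"
    have arcU: "ray_arc ?\<rho> v 1 l \<in> U ?\<rho>" for l using ray_arc_U[OF \<rho> mem_cone_ray lv torus_1] .
    \<comment> \<open>The limit of the one-parameter subgroup is the distinguished point of the
      orbit of the ray, so the unit attached to it controls the arc near 0.\<close>
    define x where "x = ray_arc ?\<rho> v 1 0"
    have "x = orb ?\<rho> 1" unfolding x_def
    proof (rule point_eqI[OF \<rho> arcU orb_U[OF \<rho> torus_1]])
      fix m assume m: "m \<in> dual_semigroup ?\<rho>"
      have "0 \<le> ipair m v" "ipair m v = 0 \<longleftrightarrow> m \<in> perp ?\<rho>"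
        using m of_int_ipair[OF lv, of m] by (auto simp: dual_cone_ray perp_cone_ray ipair_def)
      then show "ev (ray_arc ?\<rho> v 1 0) m = ev (orb ?\<rho> 1) m"
        using ev_ray_arc[OF \<rho> mem_cone_ray lv torus_1 m] ev_orb[OF \<rho> torus_1 m] by (auto simp: power_0_left)
    qed
    then have x: "x \<in> pts" "cone_of x = ?\<rho>" using orb_pts[OF \<rho> torus_1] cone_of_orb[OF \<rho> torus_1] by auto
    have xU: "x \<in> U ?\<rho>" using arcU by (simp add: x_def)
    have xV: "x \<in> V x" using V[OF x(1)] by blast
    obtain f g where fg: "f \<in> chart_ring ?\<rho>" "g \<in> chart_ring ?\<rho>" "g x \<noteq> 0" "\<And>q. q \<in> U ?\<rho> \<Longrightarrow> g q \<noteq> 0 \<Longrightarrow> q \<in> V x \<and> h x q = f q / g q"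
      using regular_local[OF hreg[OF x(1)] xV \<rho> xU] by blast
    define fa where "fa l = f (ray_arc ?\<rho> v 1 l)" for l
    define ga where "ga l = g (ray_arc ?\<rho> v 1 l)" for l
    have cont: "continuous_on UNIV fa" "continuous_on UNIV ga" unfolding fa_def ga_def
      using continuous_on_chart_ring_arc[OF _ \<rho> mem_cone_ray lv torus_1] fg by auto
    have "g x \<noteq> 0 \<and> f x \<noteq> 0" using fg(3) fg(4)[OF xU fg(3)] hnz[OF x(1) xV] by auto
    then have "0 \<in> {l. fa l * ga l \<noteq> 0}" by (simp add: fa_def ga_def x_def)
    moreover have "open {l. fa l * ga l \<noteq> 0}" using cont by (intro open_Collect_neq continuous_intros)
    ultimately obtain e where e: "e > 0" "cball 0 e \<subseteq> {l. fa l * ga l \<noteq> 0}" using open_contains_cball by blast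
    have "ipair k v = - c"
    proof (rule k[rule_format, of v e "\<lambda>l. fa l / ga l" c], intro conjI lv e(1) ballI allI impI)
      show "continuous_on (cball 0 e) (\<lambda>l. fa l / ga l)"
        using e(2) by (intro continuous_on_divide continuous_on_subset[OF cont(1)] continuous_on_subset[OF cont(2)]) auto
      show "fa l / ga l \<noteq> 0" if "l \<in> cball 0 e" for l using that e(2) by auto
      fix l :: complex assume "l \<noteq> 0 \<and> norm l \<le> e"
      then have l: "l \<noteq> 0" "norm l \<le> e" by auto
      define t :: "complex ^ 'n" where "t = (\<chi> i. l powi \<lfloor>v $ i\<rfloor>)"
      have t1: "t = (\<chi> i. (1 :: complex ^ 'n) $ i * l powi \<lfloor>v $ i\<rfloor>)" by (simp add: t_def)
      have t: "t \<in> torus" unfolding t1 by (rule torus_twist[OF torus_1 l(1)])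
      have arc: "ray_arc ?\<rho> v 1 l = tor t" unfolding t1 by (rule ray_arc_nonzero[OF \<rho> mem_cone_ray lv torus_1 l(1)])
      have "l \<in> cball 0 e" using l by simp
      then have "ga l \<noteq> 0" using e(2) by auto
      then have "g (tor t) \<noteq> 0" by (simp add: ga_def arc)
      then have q: "tor t \<in> V x" "h x (tor t) = fa l / ga l"
        using fg(4)[OF tor_U[OF t \<rho>]] by (auto simp: fa_def ga_def arc)
      have "tpow t (M ?\<rho>) = l powi c" unfolding t1 c_def using tpow_twist[OF torus_1 l(1) lv] by simp
      then have "s t = fa l / ga l / l powi c" using s_eq[OF t x(1) q(1)] q(2) x(2) by simp
      then show "s (\<chi> i. l powi \<lfloor>v $ i\<rfloor>) * l powi c = fa l / ga l" using l(1) by (simp add: t_def[symmetric])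
    qed
    then show "ipair k v = - ipair (M ?\<rho>) v" by (simp add: c_def)
  qed
qed

text \<open>Each ray outside \<sigma>0 contributes the bundle of \<open>N\<close> times its divisor,
  with the dual vectors as local characters. A relation yields a character whose pairing with the
  j-th of these rays is -N times the j-th coefficient and which vanishes on \<sigma>0, hence is
  0.\<close>

lemma card_rays_outside_full_cone:
  assumes N: "N > 0" "\<And>\<sigma> v. \<sigma> \<in> \<Sigma> \<Longrightarrow> v \<in> rays \<Longrightarrow> \<exists>m. \<forall>v'\<in>rays \<inter> \<sigma>. ipair m v' = (if v' = v then N else 0)"
    and \<sigma>0: "\<sigma>0 \<in> full_cones"
  shows "enat (card (rays - \<sigma>0)) \<le> picard_number X"
proof -
  have \<sigma>0\<Sigma>: "\<sigma>0 \<in> \<Sigma>" and sp: "span \<sigma>0 = UNIV" using \<sigma>0 by (auto simp: full_cones_def)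
  obtain mm where mm: "\<And>\<sigma> v v'. \<sigma> \<in> \<Sigma> \<Longrightarrow> v \<in> rays \<Longrightarrow> v' \<in> rays \<inter> \<sigma> \<Longrightarrow> ipair (mm \<sigma> v) v' = (if v' = v then N else 0)"
    using N(2) by metis
  define k where "k = card (rays - \<sigma>0)"
  obtain e where e: "bij_betw e {0..<k} (rays - \<sigma>0)"
    unfolding k_def using ex_bij_betw_nat_finite[of "rays - \<sigma>0"] finite_rays by blast
  have er: "e i \<in> rays" "e i \<notin> \<sigma>0" if "i < k" for i using bij_betwE[OF e] that by auto
  have einj: "e i = e j \<longleftrightarrow> i = j" if "i < k" "j < k" for i j
    using bij_betw_imp_inj_on[OF e] that by (auto simp: inj_on_def)
  define M where "M i \<sigma> = mm \<sigma> (e i)" for i \<sigma>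
  have comp: "compatible (M i)" if i: "i < k" for i
    unfolding compatible_def
  proof (intro ballI perp_rays fan_Int)
    fix \<sigma> \<tau> v assume "\<sigma> \<in> \<Sigma>" "\<tau> \<in> \<Sigma>" "v \<in> rays" "v \<in> \<sigma> \<inter> \<tau>"
    then have "ipair (M i \<sigma> - M i \<tau>) v = 0" using mm er(1)[OF i] by (simp add: M_def ipair_diff rays_lattice)
    then show "pairing (M i \<sigma> - M i \<tau>) v = 0" using of_int_ipair[OF rays_lattice[OF \<open>v \<in> rays\<close>]] by (metis of_int_0)
  qed
  have indep: "\<forall>i<k. a i = 0" if triv: "trivial_line_bundle X (tensor_combination X k (\<lambda>i. ray_bundle (M i)) a)" for a
  proof -
    define MM where "MM \<sigma> = (\<Sum>i<k. a i *s M i \<sigma>)" for \<sigma>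
    have compMM: "compatible MM" unfolding compatible_def
    proof (intro ballI)
      fix \<sigma> \<tau> assume st: "\<sigma> \<in> \<Sigma>" "\<tau> \<in> \<Sigma>"
      have eq: "MM \<sigma> - MM \<tau> = (\<Sum>i<k. a i *s (M i \<sigma> - M i \<tau>))"
        by (simp add: MM_def sum_subtractf[symmetric] vector_ssub_ldistrib)
      have p: "a i *s (M i \<sigma> - M i \<tau>) \<in> perp (\<sigma> \<inter> \<tau>)" if "i < k" for i
        using comp[OF that] st perp_vmult unfolding compatible_def by blast
      have ps: "(\<Sum>i\<in>I. d i) \<in> perp (\<sigma> \<inter> \<tau>)" if "\<And>i. i \<in> I \<Longrightarrow> d i \<in> perp (\<sigma> \<inter> \<tau>)" for I :: "nat set" and d
        using that by (induction I rule: infinite_finite_induct) (auto intro: perp_add)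
      show "MM \<sigma> - MM \<tau> \<in> perp (\<sigma> \<inter> \<tau>)" unfolding eq by (rule ps) (use p in simp)
    qed
    show ?thesis
    \<comment> \<open>For an empty family the cover in \<open>tensor_combination\<close> consists of
      the whole space and is not contained in the charts.\<close>
    proof (cases "k = 0")
      case True then show ?thesis by simp
    next
      case False
      have fstU: "fst (tensor_combination X k (\<lambda>i. ray_bundle (M i)) a) x \<subseteq> U (cone_of x)" for x
        using False by (auto simp: tensor_combination_def ray_bundle_def)
      obtain V h where V: "\<And>x. x \<in> pts \<Longrightarrow> openin zar (V x) \<and> x \<in> V x \<and> V x \<subseteq> fst (tensor_combination X k (\<lambda>i. ray_bundle (M i)) a) x \<and> h x \<in> regular_units X (V x)"
        and h: "\<And>x y p. x \<in> pts \<Longrightarrow> y \<in> pts \<Longrightarrow> p \<in> V x \<inter> V y \<Longrightarrow> snd (tensor_combination X k (\<lambda>i. ray_bundle (M i)) a) x y p = h x p / h y p"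
        using triv unfolding trivial_line_bundle_def case_prod_unfold points_X zar_def by metis
      have V': "openin zar (V x) \<and> x \<in> V x \<and> V x \<subseteq> U (cone_of x) \<and> h x \<in> regular_units X (V x)" if "x \<in> pts" for x
        using V[OF that] fstU by blast
      have h': "ev p (MM (cone_of x) - MM (cone_of y)) = h x p / h y p" if "x \<in> pts" "y \<in> pts" "p \<in> V x \<inter> V y" for x y p
      proof -
        have "p \<in> U (cone_of x)" "p \<in> U (cone_of y)" using V'[OF that(1)] V'[OF that(2)] that(3) by auto
        then show ?thesis using h[OF that] tensor_ray_bundle[of k M x y p a, OF comp that(1,2)] unfolding MM_def by simp
      qed
      obtain \<kappa> where \<kappa>: "\<And>v. v \<in> rays \<Longrightarrow> ipair \<kappa> v = - ipair (MM (cone_ray v)) v"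
        using trivial_bundle_character[OF compMM V' h'] by blast
      have ipMM: "ipair (MM (cone_ray v)) v = (\<Sum>i<k. a i * (if v = e i then N else 0))" if v: "v \<in> rays" for v
      proof -
        have "ipair (\<Sum>i\<in>I. a i *s M i (cone_ray v)) v = (\<Sum>i\<in>I. a i * ipair (M i (cone_ray v)) v)" for I
          by (induction I rule: infinite_finite_induct) (auto simp: ipair_add ipair_vmult rays_lattice[OF v])
        then show ?thesis unfolding MM_def M_def
          using mm[OF rays_cone[OF v] er(1)] v mem_cone_ray[of v] by (auto intro!: sum.cong)
      qed
      have "\<kappa> \<in> perp \<sigma>0"
      proof (rule perp_rays[OF \<sigma>0\<Sigma>])
        fix v assume v: "v \<in> rays" "v \<in> \<sigma>0"
        have "v \<noteq> e i" if "i < k" for i using er(2)[OF that] v(2) by blast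
        then have "ipair \<kappa> v = 0" using \<kappa>[OF v(1)] ipMM[OF v(1)] by simp
        then show "pairing \<kappa> v = 0" using of_int_ipair[OF rays_lattice[OF v(1)]] by (metis of_int_0)
      qed
      then have \<kappa>0: "\<kappa> = 0" using perp_span_UNIV[OF sp] by blast
      show ?thesis
      proof (intro allI impI)
        fix j assume j: "j < k"
        have "0 = (\<Sum>i<k. a i * (if e j = e i then N else 0))" using \<kappa>[OF er(1)[OF j]] ipMM[OF er(1)[OF j]] \<kappa>0 by simp
        also have "\<dots> = (\<Sum>i<k. if i = j then a i * N else 0)" using einj[OF j] by (intro sum.cong) auto
        also have "\<dots> = a j * N" using j by simp
        finally show "a j = 0" using N(1) by simp
      qed
    qed
  qed
  have "enat k \<in> {enat k | k L. (\<forall>i<k. line_bundle X (L i)) \<and>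
     (\<forall>a. trivial_line_bundle X (tensor_combination X k L a) \<longrightarrow> (\<forall>i<k. a i = 0))}"
    using ray_bundle_line_bundle[OF comp] indep by (intro CollectI exI[of _ k] exI[of _ "\<lambda>i. ray_bundle (M i)"]) auto
  then show ?thesis unfolding picard_number_def k_def by (rule Sup_upper)
qed

end


subsection \<open>A strictly convex support function\<close>

text \<open>Helly's theorem is about a set of at least two convex sets, so an indexed family whose
  members all coincide is treated apart.\<close>

lemma Helly_real:
  fixes I :: "'i \<Rightarrow> real set"
  assumes fin: "finite A" and ne: "A \<noteq> {}" and conv: "\<And>i. i \<in> A \<Longrightarrow> convex (I i)"
    and pair: "\<And>i j. i \<in> A \<Longrightarrow> j \<in> A \<Longrightarrow> I i \<inter> I j \<noteq> {}"
  shows "(\<Inter>i\<in>A. I i) \<noteq> {}"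
proof (cases "2 \<le> card (I ` A)")
  case True
  show ?thesis
  proof (rule Helly)
    show "DIM(real) + 1 \<le> card (I ` A)" using True by simp
    show "\<forall>s\<in>I ` A. convex s" using conv by blast
    fix t assume t: "t \<subseteq> I ` A" "card t = DIM(real) + 1"
    then have "card t = 2" by simp
    then obtain a b where ab: "t = {a, b}" by (auto simp: card_2_iff)
    then have "a \<in> I ` A" "b \<in> I ` A" using t(1) by auto
    then obtain i j where ij: "a = I i" "i \<in> A" "b = I j" "j \<in> A" by (elim imageE)
    show "\<Inter>t \<noteq> {}" using pair[OF ij(2,4)] by (simp add: ab ij)
  qed
next
  case False
  moreover have "card (I ` A) \<noteq> 0" using fin ne by simp
  ultimately have "card (I ` A) = 1" by linarith
  then obtain S where S: "I ` A = {S}" by (auto simp: card_1_singleton_iff)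
  obtain i where i: "i \<in> A" using ne by blast
  then have "I i = S" using S by (metis imageI singletonD)
  then show ?thesis using pair[OF i i] S by simp
qed

context toric begin

text \<open>Strict convexity tested at one cone: the linear function that matches the values on the
  rays of \<sigma> exceeds them on all other rays.\<close>

definition support_values :: "(real ^ 'n) set \<Rightarrow> (real ^ 'n \<Rightarrow> real) set" where
  "support_values \<sigma> = {b. \<exists>u. \<forall>v\<in>rays. (v \<in> \<sigma> \<longrightarrow> u \<bullet> v = b v) \<and> (v \<notin> \<sigma> \<longrightarrow> b v < u \<bullet> v)}"

text \<open>A functional \<open>m\<close> separating the cones glues 0 on \<sigma> with
  \<open>m\<close> on \<tau>; on a ray of only one of the cones, the linear function of the other
  cone is strictly larger.\<close>

lemma support_values_pair:
  assumes "\<sigma> \<in> \<Sigma>" "\<tau> \<in> \<Sigma>"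
  shows "support_values \<sigma> \<inter> support_values \<tau> \<noteq> {}"
proof -
  obtain m where m: "m \<in> dual_semigroup \<sigma>" "\<And>v. v \<in> \<sigma> \<Longrightarrow> pairing m v = 0 \<longleftrightarrow> v \<in> \<tau>"
    "- m \<in> dual_semigroup \<tau>" "\<And>v. v \<in> \<tau> \<Longrightarrow> pairing m v = 0 \<longleftrightarrow> v \<in> \<sigma>"
    using separation[OF assms] by metis
  have ge: "v \<in> \<sigma> \<Longrightarrow> 0 \<le> pairing m v" and le: "v \<in> \<tau> \<Longrightarrow> pairing m v \<le> 0" for v
    using m(1,3) by (auto simp: dual_semigroup_def pairing_simps)
  \<comment> \<open>Rays outside both cones are pushed below both linear functions.\<close>
  define b where "b v = (if v \<in> \<sigma> then 0 else if v \<in> \<tau> then pairing m v else min 0 (pairing m v) - 1)" for v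
  have "b \<in> support_values \<sigma>" unfolding support_values_def
  proof (intro CollectI exI[of _ 0] ballI conjI impI)
    fix v assume "v \<notin> \<sigma>"
    then show "b v < 0 \<bullet> v" using m(4)[of v] le[of v] by (auto simp: b_def order_less_le)
  qed (auto simp: b_def)
  moreover have "b \<in> support_values \<tau>" unfolding support_values_def
  proof (intro CollectI exI[of _ "real_vec m"] ballI conjI impI)
    fix v assume "v \<in> \<tau>"
    then show "real_vec m \<bullet> v = b v" using m(4)[of v] by (auto simp: b_def pairing_eq_inner)
  next
    fix v assume v: "v \<notin> \<tau>"
    show "b v < real_vec m \<bullet> v"
    proof (cases "v \<in> \<sigma>")
      case True then show ?thesis using v m(2)[of v] ge[of v] by (auto simp: b_def pairing_eq_inner order_less_le)
    next
      case False then show ?thesis using v by (simp add: b_def pairing_eq_inner)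
    qed
  qed
  ultimately show ?thesis by blast
qed

lemma support_values_cong: "b \<in> support_values \<sigma> \<Longrightarrow> (\<And>v. v \<in> rays \<Longrightarrow> b' v = b v) \<Longrightarrow> b' \<in> support_values \<sigma>"
  unfolding support_values_def by simp

lemma support_values_translate:
  assumes "b \<in> support_values \<sigma>" "0 < c"
  shows "(\<lambda>v. c * (b v - u0 \<bullet> v)) \<in> support_values \<sigma>"
proof -
  obtain u where u: "\<forall>v\<in>rays. (v \<in> \<sigma> \<longrightarrow> u \<bullet> v = b v) \<and> (v \<notin> \<sigma> \<longrightarrow> b v < u \<bullet> v)"
    using assms(1) by (auto simp: support_values_def)
  then show ?thesis unfolding support_values_def
    using assms(2) by (intro CollectI exI[of _ "c *\<^sub>R (u - u0)"]) (auto simp: inner_diff_left)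
qed

lemma support_values_convex:
  assumes b: "b \<in> support_values \<sigma>" "b' \<in> support_values \<sigma>" and c: "0 \<le> c" "0 \<le> d" "c + d = 1"
  shows "(\<lambda>v. c * b v + d * b' v) \<in> support_values \<sigma>"
proof -
  obtain u where u: "\<And>v. v \<in> rays \<Longrightarrow> (v \<in> \<sigma> \<longrightarrow> u \<bullet> v = b v) \<and> (v \<notin> \<sigma> \<longrightarrow> b v < u \<bullet> v)"
    using b(1) by (auto simp: support_values_def)
  obtain u' where u': "\<And>v. v \<in> rays \<Longrightarrow> (v \<in> \<sigma> \<longrightarrow> u' \<bullet> v = b' v) \<and> (v \<notin> \<sigma> \<longrightarrow> b' v < u' \<bullet> v)"
    using b(2) by (auto simp: support_values_def)
  show ?thesis unfolding support_values_def
  proof (intro CollectI exI[of _ "c *\<^sub>R u + d *\<^sub>R u'"] ballI conjI impI)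
    fix v assume "v \<in> rays" "v \<in> \<sigma>"
    then show "(c *\<^sub>R u + d *\<^sub>R u') \<bullet> v = c * b v + d * b' v" using u u' by (simp add: inner_add_left)
  next
    fix v assume v: "v \<in> rays" "v \<notin> \<sigma>"
    have *: "b v < u \<bullet> v" "b' v < u' \<bullet> v" using u u' v by auto
    have "c * b v + d * b' v < c * (u \<bullet> v) + d * (u' \<bullet> v)"
    proof (cases "c = 0")
      case True then show ?thesis using * c by simp
    next
      case False
      then have "c * b v < c * (u \<bullet> v)" using * c by simp
      moreover have "d * b' v \<le> d * (u' \<bullet> v)" using * c by (simp add: mult_left_mono)
      ultimately show ?thesis by linarith
    qed
    then show "c * b v + d * b' v < (c *\<^sub>R u + d *\<^sub>R u') \<bullet> v" by (simp add: inner_add_left)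
  qed
qed

lemma rays_not_in_cone:
  assumes supp: "\<Union>\<Sigma> = UNIV" and \<sigma>: "\<sigma> \<in> \<Sigma>"
  shows "rays - \<sigma> \<noteq> {}"
proof
  assume "rays - \<sigma> = {}"
  then have r: "rays \<subseteq> \<sigma>" by blast
  have "\<tau> \<subseteq> \<sigma>" if \<tau>: "\<tau> \<in> \<Sigma>" for \<tau>
  proof -
    have "convex_cone hull (rays \<inter> \<tau>) \<subseteq> \<sigma>" using r fan_cone[OF \<sigma>] by (intro hull_minimal) auto
    then show ?thesis using cone_generated_by_rays[OF \<tau>] by simp
  qed
  then have "\<sigma> = UNIV" using supp by blast
  then have "(1 :: real ^ 'n) = 0" using fan_pointed[OF \<sigma>, of 1] by simp
  then show False by simp
qed

text \<open>The negative of the sum of all rays lies in some cone and is thus a nonnegative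
  combination of rays; adding the sum back makes every coefficient at least 1.\<close>

lemma positive_relation:
  assumes supp: "\<Union>\<Sigma> = UNIV"
  obtains w where "\<And>v. v \<in> rays \<Longrightarrow> 0 < w v" "(\<Sum>v\<in>rays. w v *\<^sub>R v) = 0"
proof -
  obtain \<sigma> where \<sigma>: "\<sigma> \<in> \<Sigma>" "- (\<Sum>v\<in>rays. v) \<in> \<sigma>" using supp by blast
  have fin: "finite (rays \<inter> \<sigma>)" using finite_rays by simp
  have "- (\<Sum>v\<in>rays. v) \<in> convex_cone hull (rays \<inter> \<sigma>)" using \<sigma> cone_generated_by_rays by simp
  then obtain c where c: "\<And>v. v \<in> rays \<inter> \<sigma> \<Longrightarrow> 0 \<le> c v" "- (\<Sum>v\<in>rays. v) = (\<Sum>v\<in>rays \<inter> \<sigma>. c v *\<^sub>R v)"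
    using convex_cone_hull_finite[OF fin] by blast
  define w where "w v = 1 + (if v \<in> \<sigma> then c v else 0)" for v
  have "(\<Sum>v\<in>rays. w v *\<^sub>R v) = (\<Sum>v\<in>rays. v) + (\<Sum>v\<in>rays. if v \<in> \<sigma> then c v *\<^sub>R v else 0)"
    unfolding sum.distrib[symmetric] by (intro sum.cong) (auto simp: w_def scaleR_left_distrib)
  also have "(\<Sum>v\<in>rays. if v \<in> \<sigma> then c v *\<^sub>R v else 0) = - (\<Sum>v\<in>rays. v)"
    unfolding c(2) using finite_rays by (simp add: sum.inter_restrict)
  finally have "(\<Sum>v\<in>rays. w v *\<^sub>R v) = 0" by simp
  moreover have "0 < w v" if "v \<in> rays" for v using c(1)[of v] that by (auto simp: w_def add_pos_nonneg)
  ultimately show thesis using that by blast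
qed

text \<open>Modulo linear functionals, and normalised by a positive relation between the rays, the values on the rays
  of a support function form a line when there are at most \<open>n + 2\<close> rays.  Any two of the intervals of values that
  are convex at given full-dimensional cones meet, so that Helly's theorem applies.\<close>

lemma strictly_convex_support_function:
  assumes supp: "\<Union>\<Sigma> = UNIV"
    and N: "N > 0" "\<And>v. v \<in> rays \<Longrightarrow> \<exists>m. \<forall>v'\<in>rays \<inter> \<sigma>0. ipair m v' = (if v' = v then N else 0)"
    and \<sigma>0: "\<sigma>0 \<in> full_cones" and card: "card (rays - \<sigma>0) \<le> 2"
  shows "(\<Inter>\<sigma>\<in>full_cones. support_values \<sigma>) \<noteq> {}"
proof -
  have full: "\<sigma> \<in> \<Sigma>" if "\<sigma> \<in> full_cones" for \<sigma> using that by (simp add: full_cones_def)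
  obtain w where w: "\<And>v. v \<in> rays \<Longrightarrow> 0 < w v" "(\<Sum>v\<in>rays. w v *\<^sub>R v) = 0" using positive_relation[OF supp] by metis
  \<comment> \<open>\<open>\<beta>\<close> kills linear functions and is negative on every value
    vector convex at some cone, so it can be used for normalisation.\<close>
  define \<beta> where "\<beta> b = (\<Sum>v\<in>rays. w v * b v)" for b
  have wlin: "(\<Sum>v\<in>rays. w v * (u \<bullet> v)) = 0" for u
  proof -
    have "(\<Sum>v\<in>rays. w v * (u \<bullet> v)) = u \<bullet> (\<Sum>v\<in>rays. w v *\<^sub>R v)" by (simp add: inner_sum_right)
    then show ?thesis using w(2) by simp
  qed
  have neg: "\<beta> b < 0" if b: "b \<in> support_values \<sigma>" and \<sigma>: "\<sigma> \<in> \<Sigma>" for b \<sigma>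
  proof -
    obtain u where u: "\<forall>v\<in>rays. (v \<in> \<sigma> \<longrightarrow> u \<bullet> v = b v) \<and> (v \<notin> \<sigma> \<longrightarrow> b v < u \<bullet> v)"
      using b by (auto simp: support_values_def)
    have "\<beta> b < (\<Sum>v\<in>rays. w v * (u \<bullet> v))" unfolding \<beta>_def
    proof (rule sum_strict_mono_ex1[OF finite_rays])
      show "\<forall>v\<in>rays. w v * b v \<le> w v * (u \<bullet> v)" using u w(1) by (force intro!: mult_left_mono simp: less_imp_le)
      obtain v where "v \<in> rays" "v \<notin> \<sigma>" using rays_not_in_cone[OF supp \<sigma>] by blast
      then show "\<exists>v\<in>rays. w v * b v < w v * (u \<bullet> v)" using u w(1) by auto
    qed
    then show ?thesis using wlin by simp
  qed
  obtain mm where mm: "\<And>v v'. v \<in> rays \<Longrightarrow> v' \<in> rays \<inter> \<sigma>0 \<Longrightarrow> ipair (mm v) v' = (if v' = v then N else 0)" using N(2) by metis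
  \<comment> \<open>The dual vectors divided by \<open>N\<close> interpolate arbitrary values on the
    rays of \<open>\<sigma>0\<close>; subtracting the interpolation gives the representative that
    vanishes there.\<close>
  have interp: "\<exists>u. \<forall>v\<in>rays \<inter> \<sigma>0. u \<bullet> v = b v" for b :: "real ^ 'n \<Rightarrow> real"
  proof (intro exI ballI)
    fix v assume v: "v \<in> rays \<inter> \<sigma>0"
    have "(\<Sum>v'\<in>rays \<inter> \<sigma>0. (b v' / of_int N) *\<^sub>R real_vec (mm v')) \<bullet> v = (\<Sum>v'\<in>rays \<inter> \<sigma>0. (b v' / of_int N) * pairing (mm v') v)"
      by (simp add: inner_sum_left pairing_eq_inner)
    also have "\<dots> = (\<Sum>v'\<in>rays \<inter> \<sigma>0. if v' = v then b v else 0)"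
    proof (rule sum.cong[OF refl])
      fix v' assume v': "v' \<in> rays \<inter> \<sigma>0"
      have "pairing (mm v') v = (if v = v' then of_int N else 0)"
        using mm[of v' v] v v' of_int_ipair[OF rays_lattice, of v "mm v'"] by auto
      then show "(b v' / of_int N) * pairing (mm v') v = (if v' = v then b v else 0)" using N(1) by simp
    qed
    also have "\<dots> = b v" using v finite_rays by simp
    finally show "(\<Sum>v'\<in>rays \<inter> \<sigma>0. (b v' / of_int N) *\<^sub>R real_vec (mm v')) \<bullet> v = b v" .
  qed
  have "rays - \<sigma>0 \<noteq> {}" using rays_not_in_cone[OF supp full[OF \<sigma>0]] .
  then have "card (rays - \<sigma>0) \<noteq> 0" using finite_rays by simp
  then consider "card (rays - \<sigma>0) = 1" | "card (rays - \<sigma>0) = 2" using card by linarith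
  \<comment> \<open>With a single ray outside, \<open>p\<close> and \<open>q\<close> coincide and
    the second clause of \<open>a\<close> below never applies.\<close>
  then obtain p q where pq: "rays - \<sigma>0 = {p, q}"
    by cases (auto simp: card_1_singleton_iff card_2_iff)
  \<comment> \<open>The line of candidates: zero on \<open>\<sigma>0\<close>, \<open>s\<close> at
    \<open>p\<close>, and at a different \<open>q\<close> the value that makes
    \<open>\<beta>\<close> equal to -1.\<close>
  define a where "a s v = (if v = p then s else if v = q then (- 1 - w p * s) / w q else 0)" for s v
  define J where "J \<sigma> = {s. a s \<in> support_values \<sigma>}" for \<sigma>
  have "(\<Inter>\<sigma>\<in>full_cones. J \<sigma>) \<noteq> {}"
  proof (rule Helly_real)
    show "finite full_cones" using finite_fan by (simp add: full_cones_def)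
    show "full_cones \<noteq> {}" using \<sigma>0 by blast
    show "convex (J \<sigma>)" for \<sigma>
    proof (rule convexI)
      fix x y c d :: real assume xy: "x \<in> J \<sigma>" "y \<in> J \<sigma>" and c: "0 \<le> c" "0 \<le> d" "c + d = 1"
      have "a (c * x + d * y) v = c * a x v + d * a y v" for v
      proof -
        have "- 1 - w p * (c * x + d * y) = c * (- 1 - w p * x) + d * (- 1 - w p * y)"
          using c(3) by (simp add: algebra_simps)
        then show ?thesis by (simp add: a_def add_divide_distrib)
      qed
      then show "c *\<^sub>R x + d *\<^sub>R y \<in> J \<sigma>"
        using support_values_cong[OF support_values_convex[OF _ _ c, of "a x" \<sigma> "a y"], of "a (c * x + d * y)"] xy by (simp add: J_def)
    qed
    fix \<sigma> \<tau> assume st: "\<sigma> \<in> full_cones" "\<tau> \<in> full_cones"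
    obtain b where b: "b \<in> support_values \<sigma>" "b \<in> support_values \<tau>" using support_values_pair[OF full full, OF st] by blast
    obtain u0 where u0: "\<And>v. v \<in> rays \<inter> \<sigma>0 \<Longrightarrow> u0 \<bullet> v = b v" using interp by blast
    \<comment> \<open>A value vector convex at both cones is moved onto the line: subtract the
      linear interpolation, then scale by the positive factor that makes \<open>\<beta>\<close>
      equal to -1.\<close>
    define c where "c = - 1 / \<beta> b"
    have c: "0 < c" "c * \<beta> b = - 1" using neg[OF b(1) full[OF st(1)]] by (auto simp: c_def divide_neg_neg)
    define b' where "b' v = c * (b v - u0 \<bullet> v)" for v
    have b': "b' \<in> support_values \<sigma>" "b' \<in> support_values \<tau>"
      unfolding b'_def using support_values_translate b c(1) by auto
    have b'0: "b' v = 0" if "v \<in> rays" "v \<in> \<sigma>0" for v using u0 that by (simp add: b'_def)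
    have "\<beta> b' = c * \<beta> b - c * (\<Sum>v\<in>rays. w v * (u0 \<bullet> v))"
      by (simp add: \<beta>_def b'_def sum_distrib_left sum_subtractf[symmetric] algebra_simps)
    then have \<beta>b': "\<beta> b' = - 1" using c(2) wlin by simp
    have "\<beta> b' = (\<Sum>v\<in>{p, q}. w v * b' v)" unfolding \<beta>_def pq[symmetric]
      using finite_rays b'0 by (intro sum.mono_neutral_right) auto
    then have rel: "(\<Sum>v\<in>{p, q}. w v * b' v) = - 1" using \<beta>b' by simp
    have "a (b' p) v = b' v" if v: "v \<in> rays" for v
    proof (cases "v \<in> \<sigma>0")
      case True
      then have "v \<noteq> p" "v \<noteq> q" using pq by blast+
      then show ?thesis using b'0[OF v True] by (simp add: a_def)
    next
      case False
      then have "v = p \<or> v = q" using pq v by blast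
      moreover have "a (b' p) q = b' q" if "q \<noteq> p"
      proof -
        have "w p * b' p + w q * b' q = - 1" using rel that by simp
        moreover have "w q > 0" using w(1) pq by blast
        ultimately show ?thesis using that by (simp add: a_def field_simps)
      qed
      ultimately show ?thesis by (cases "v = p") (auto simp: a_def)
    qed
    then have "b' p \<in> J \<sigma> \<inter> J \<tau>" using support_values_cong[OF b'(1)] support_values_cong[OF b'(2)] by (simp add: J_def)
    then show "J \<sigma> \<inter> J \<tau> \<noteq> {}" by blast
  qed
  then show ?thesis by (auto simp: J_def)
qed

text \<open>On a ray of \<tau> the value b is that of the linear function of \<tau>, so strict
  convexity is a finite system of sign conditions on integer forms in the coordinates of all the
  linear functions together. Rounding them at once keeps the zeros on shared rays, so the integral
  functions still glue.\<close>

lemma integral_support_function: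
  assumes "(\<Inter>\<sigma>\<in>full_cones. support_values \<sigma>) \<noteq> {}"
  obtains M where "\<And>\<sigma> \<tau> v. \<sigma> \<in> full_cones \<Longrightarrow> \<tau> \<in> full_cones \<Longrightarrow> v \<in> rays \<Longrightarrow> v \<in> \<tau> \<Longrightarrow> 0 \<le> pairing (M \<sigma> - M \<tau>) v"
    "\<And>\<sigma> \<tau> v. \<sigma> \<in> full_cones \<Longrightarrow> \<tau> \<in> full_cones \<Longrightarrow> v \<in> rays \<Longrightarrow> v \<in> \<tau> \<Longrightarrow> pairing (M \<sigma> - M \<tau>) v = 0 \<longleftrightarrow> v \<in> \<sigma>"
proof -
  obtain b where "\<forall>\<sigma>\<in>full_cones. b \<in> support_values \<sigma>" using assms by blast
  then have "\<forall>\<sigma>\<in>full_cones. \<exists>u. \<forall>v\<in>rays. (v \<in> \<sigma> \<longrightarrow> u \<bullet> v = b v) \<and> (v \<notin> \<sigma> \<longrightarrow> b v < u \<bullet> v)"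
    by (simp add: support_values_def)
  then obtain u where u: "\<forall>\<sigma>\<in>full_cones. \<forall>v\<in>rays. (v \<in> \<sigma> \<longrightarrow> u \<sigma> \<bullet> v = b v) \<and> (v \<notin> \<sigma> \<longrightarrow> b v < u \<sigma> \<bullet> v)"
    by (auto dest!: bchoice)
  have fin: "finite full_cones" using finite_fan by (simp add: full_cones_def)
  \<comment> \<open>Coefficients of the difference of two linear functions at \<open>v\<close>,
    indexed by a cone and a coordinate; the two contributions cancel when the cones
    coincide.\<close>
  define form where "form = (\<lambda>(\<sigma> :: (real ^ 'n) set, \<tau>, v :: real ^ 'n) (\<omega>, i). (if \<omega> = \<sigma> then \<lfloor>v $ i\<rfloor> else 0) - (if \<omega> = \<tau> then \<lfloor>v $ i\<rfloor> else 0))"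
  define C where "C = form ` (full_cones \<times> full_cones \<times> rays)"
  have finC: "finite C" unfolding C_def using fin finite_rays by simp
  have finI: "finite (full_cones \<times> (UNIV :: 'n set))" using fin by simp
  obtain y where y: "\<And>c. c \<in> C \<Longrightarrow> sgn (\<Sum>i\<in>full_cones \<times> UNIV. real_of_int (c i) * real_of_int (y i)) =
      sgn (\<Sum>i\<in>full_cones \<times> UNIV. real_of_int (c i) * (\<lambda>(\<omega>, i). u \<omega> $ i) i)"
    using integral_sign_vector[OF finI finC, of "\<lambda>(\<omega>, i). u \<omega> $ i"] by blast
  define M :: "(real ^ 'n) set \<Rightarrow> int ^ 'n" where "M \<omega> = (\<chi> i. y (\<omega>, i))" for \<omega>
  have val: "(\<Sum>i\<in>full_cones \<times> UNIV. real_of_int (form (\<sigma>, \<tau>, v) i) * (\<lambda>(\<omega>, i). z \<omega> $ i) i) = (z \<sigma> - z \<tau>) \<bullet> v"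
    if st: "\<sigma> \<in> full_cones" "\<tau> \<in> full_cones" and v: "v \<in> rays" for \<sigma> \<tau> v and z :: "(real ^ 'n) set \<Rightarrow> real ^ 'n"
  proof -
    have fl: "real_of_int \<lfloor>v $ i\<rfloor> = v $ i" for i
      using rays_lattice[OF v] unfolding lattice_vec_def by (metis Ints_cases floor_of_int)
    have "(\<Sum>i\<in>full_cones \<times> UNIV. real_of_int (form (\<sigma>, \<tau>, v) i) * (\<lambda>(\<omega>, i). z \<omega> $ i) i) =
       (\<Sum>\<omega>\<in>full_cones. \<Sum>i\<in>UNIV. (if \<omega> = \<sigma> then v $ i * z \<omega> $ i else 0) - (if \<omega> = \<tau> then v $ i * z \<omega> $ i else 0))"
      unfolding sum.cartesian_product by (intro sum.cong refl) (auto simp: form_def fl simp del: of_int_floor_cancel)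
    also have "\<dots> = (\<Sum>\<omega>\<in>full_cones. (if \<omega> = \<sigma> then z \<omega> \<bullet> v else 0) - (if \<omega> = \<tau> then z \<omega> \<bullet> v else 0))"
      by (intro sum.cong refl) (auto simp: inner_vec_def sum_subtractf mult.commute sum_negf)
    also have "\<dots> = (z \<sigma> - z \<tau>) \<bullet> v" using st fin by (simp add: sum_subtractf inner_diff_left)
    finally show ?thesis .
  qed
  have sgn: "sgn (pairing (M \<sigma> - M \<tau>) v) = sgn ((u \<sigma> - u \<tau>) \<bullet> v)" if st: "\<sigma> \<in> full_cones" "\<tau> \<in> full_cones" and v: "v \<in> rays" for \<sigma> \<tau> v
  proof -
    have "form (\<sigma>, \<tau>, v) \<in> C" using that by (auto simp: C_def)
    from y[OF this] have "sgn (\<Sum>i\<in>full_cones \<times> UNIV. real_of_int (form (\<sigma>, \<tau>, v) i) * (\<lambda>(\<omega>, i). real_vec (M \<omega>) $ i) i) = sgn ((u \<sigma> - u \<tau>) \<bullet> v)"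
      unfolding val[OF that, of u] by (simp add: M_def real_vec_def case_prod_unfold)
    moreover have "pairing (M \<sigma> - M \<tau>) v = (real_vec (M \<sigma>) - real_vec (M \<tau>)) \<bullet> v"
      unfolding pairing_diff_left by (simp add: pairing_eq_inner inner_diff_left)
    ultimately show ?thesis unfolding val[OF that] by simp
  qed
  show thesis
  proof (rule that[of M])
    fix \<sigma> \<tau> v assume st: "\<sigma> \<in> full_cones" "\<tau> \<in> full_cones" and v: "v \<in> rays" "v \<in> \<tau>"
    have "(u \<sigma> - u \<tau>) \<bullet> v = u \<sigma> \<bullet> v - b v" using u st v by (simp add: inner_diff_left)
    moreover have "v \<in> \<sigma> \<Longrightarrow> u \<sigma> \<bullet> v = b v" "v \<notin> \<sigma> \<Longrightarrow> b v < u \<sigma> \<bullet> v" using u st(1) v(1) by auto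
    ultimately have pos: "0 \<le> (u \<sigma> - u \<tau>) \<bullet> v" "(u \<sigma> - u \<tau>) \<bullet> v = 0 \<longleftrightarrow> v \<in> \<sigma>" by fastforce+
    have *: "sgn x = sgn y \<Longrightarrow> 0 \<le> y \<Longrightarrow> 0 \<le> x" "sgn x = sgn y \<Longrightarrow> x = 0 \<longleftrightarrow> y = 0" for x y :: real
      by (auto simp: sgn_if split: if_splits)
    show "0 \<le> pairing (M \<sigma> - M \<tau>) v" using *(1)[OF sgn[OF st v(1)] pos(1)] .
    show "pairing (M \<sigma> - M \<tau>) v = 0 \<longleftrightarrow> v \<in> \<sigma>" unfolding *(2)[OF sgn[OF st v(1)]] by (rule pos(2))
  qed
qed

end


subsection \<open>Projective space\<close>

lemma homogeneous_class_mem: "u \<in> homogeneous_class v \<longleftrightarrow> (\<exists>c. c \<noteq> 0 \<and> u = (\<lambda>i. c * v i))"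
  by (auto simp: homogeneous_class_def)

lemma homogeneous_class_self: "v \<in> homogeneous_class v"
  unfolding homogeneous_class_mem by (intro exI[of _ 1]) simp

lemma homogeneous_class_scale:
  assumes "c \<noteq> 0"
  shows "homogeneous_class (\<lambda>i. c * v i) = homogeneous_class v"
proof -
  have "(\<exists>d. d \<noteq> 0 \<and> u = (\<lambda>i. d * (c * v i))) \<longleftrightarrow> (\<exists>d. d \<noteq> 0 \<and> u = (\<lambda>i. d * v i))" for u
  proof
    assume "\<exists>d. d \<noteq> 0 \<and> u = (\<lambda>i. d * (c * v i))"
    then obtain d where "d \<noteq> 0" "u = (\<lambda>i. d * (c * v i))" by blast
    then show "\<exists>d. d \<noteq> 0 \<and> u = (\<lambda>i. d * v i)" using assms by (intro exI[of _ "d * c"]) (simp add: mult.assoc)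
  next
    assume "\<exists>d. d \<noteq> 0 \<and> u = (\<lambda>i. d * v i)"
    then obtain d where "d \<noteq> 0" "u = (\<lambda>i. d * v i)" by blast
    then show "\<exists>d. d \<noteq> 0 \<and> u = (\<lambda>i. d * (c * v i))" using assms by (intro exI[of _ "d / c"]) simp
  qed
  then show ?thesis by (simp add: set_eq_iff homogeneous_class_mem)
qed

definition proj_chart :: "nat \<Rightarrow> nat \<Rightarrow> (nat \<Rightarrow> complex) set set" where
  "proj_chart n i = {homogeneous_class v | v. (\<forall>k>n. v k = 0) \<and> v i \<noteq> 0}"

definition proj_coord :: "nat \<Rightarrow> nat \<Rightarrow> (nat \<Rightarrow> complex) set \<Rightarrow> complex" where
  "proj_coord i j L = (THE z. \<forall>v\<in>L. z = v j / v i)"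

definition proj_ring :: "nat \<Rightarrow> nat \<Rightarrow> ((nat \<Rightarrow> complex) set \<Rightarrow> complex) set" where
  "proj_ring n i = generated_algebra {proj_coord i j | j. j \<le> n}"

lemma proj_coord_class:
  assumes "v i \<noteq> 0"
  shows "proj_coord i j (homogeneous_class v) = v j / v i"
  unfolding proj_coord_def
proof (rule the_equality)
  show "\<forall>u\<in>homogeneous_class v. v j / v i = u j / u i" by (auto simp: homogeneous_class_mem)
  show "z = v j / v i" if "\<forall>u\<in>homogeneous_class v. z = u j / u i" for z
    using that homogeneous_class_self by blast
qed

lemma proj_chart_class:
  assumes "\<forall>k>n. v k = 0"
  shows "homogeneous_class v \<in> proj_chart n i \<longleftrightarrow> v i \<noteq> 0"
proof
  assume "homogeneous_class v \<in> proj_chart n i"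
  then obtain u where u: "homogeneous_class v = homogeneous_class u" "u i \<noteq> 0" by (auto simp: proj_chart_def)
  then have "u \<in> homogeneous_class v" using homogeneous_class_self by metis
  then show "v i \<noteq> 0" using u(2) by (auto simp: homogeneous_class_mem)
qed (use assms in \<open>auto simp: proj_chart_def\<close>)

definition proj_zariski :: "nat \<Rightarrow> (nat \<Rightarrow> complex) set topology" where
  "proj_zariski n = topology_generated_by {{L \<in> proj_chart n i. f L \<noteq> 0} | i f. i \<le> n \<and> f \<in> proj_ring n i}"

lemma zariski_projective_space: "zariski (projective_space n) = proj_zariski n"
proof -
  have "{{p \<in> W. f p \<noteq> 0} | W G f. (W, G) \<in> {(proj_chart n i, {proj_coord i j | j. j \<le> n}) | i. i \<le> n} \<and> f \<in> generated_algebra G}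
     = {{L \<in> proj_chart n i. f L \<noteq> 0} | i f. i \<le> n \<and> f \<in> proj_ring n i}"
    unfolding proj_ring_def by blast
  moreover have "proj_coord i j = (\<lambda>L. THE z. \<forall>v\<in>L. z = v j / v i)" for i j by (simp add: proj_coord_def fun_eq_iff)
  ultimately show ?thesis
    unfolding projective_space_def space_of_atlas_def Let_def proj_zariski_def proj_chart_def by simp
qed

lemma regular_projective_space: "h \<in> regular (projective_space n) V \<longleftrightarrow>
  (\<forall>p\<in>V. \<exists>i\<le>n. \<exists>f\<in>proj_ring n i. \<exists>g\<in>proj_ring n i. \<exists>W. openin (proj_zariski n) W \<and> p \<in> W \<and> W \<subseteq> V \<inter> proj_chart n i \<and>
     (\<forall>q\<in>W. g q \<noteq> 0 \<and> h q = f q / g q))"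
proof -
  let ?A = "{(proj_chart n i, {proj_coord i j | j. j \<le> n}) | i. i \<le> n}"
  have A: "projective_space n = space_of_atlas ?A"
    unfolding projective_space_def proj_chart_def proj_coord_def[abs_def] by simp
  have "h \<in> regular (projective_space n) V \<longleftrightarrow> (\<forall>p\<in>V. \<exists>(W, G)\<in>?A. \<exists>f \<in> generated_algebra G. \<exists>g \<in> generated_algebra G.
    \<exists>V'. openin (zariski (projective_space n)) V' \<and> p \<in> V' \<and> V' \<subseteq> V \<inter> W \<and> (\<forall>q\<in>V'. g q \<noteq> 0 \<and> h q = f q / g q))"
    unfolding A by (simp add: space_of_atlas_def Let_def)
  also have "\<dots> \<longleftrightarrow> (\<forall>p\<in>V. \<exists>i\<le>n. \<exists>f\<in>proj_ring n i. \<exists>g\<in>proj_ring n i. \<exists>W. openin (proj_zariski n) W \<and> p \<in> W \<and> W \<subseteq> V \<inter> proj_chart n i \<and>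
     (\<forall>q\<in>W. g q \<noteq> 0 \<and> h q = f q / g q))"
    unfolding zariski_projective_space proj_ring_def by (intro ball_cong refl) blast
  finally show ?thesis .
qed

lemma proj_ring_const: "(\<lambda>_. c) \<in> proj_ring n i"
  by (simp add: proj_ring_def generated_algebra.const)

lemma proj_ring_coord: "j \<le> n \<Longrightarrow> proj_coord i j \<in> proj_ring n i"
  unfolding proj_ring_def by (rule generated_algebra.gen) blast

lemma proj_ring_mult: "f \<in> proj_ring n i \<Longrightarrow> g \<in> proj_ring n i \<Longrightarrow> (\<lambda>L. f L * g L) \<in> proj_ring n i"
  unfolding proj_ring_def by (rule generated_algebra.mult)

lemma proj_ring_sum: "(\<And>j. j \<in> J \<Longrightarrow> f j \<in> proj_ring n i) \<Longrightarrow> (\<lambda>L. \<Sum>j\<in>J. f j L) \<in> proj_ring n i"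
  unfolding proj_ring_def by (rule generated_algebra_sum)

lemma openin_proj: "i \<le> n \<Longrightarrow> f \<in> proj_ring n i \<Longrightarrow> openin (proj_zariski n) {L \<in> proj_chart n i. f L \<noteq> 0}"
  unfolding proj_zariski_def by (rule topology_generated_by_Basis) blast

lemma openin_proj_chart: "i \<le> n \<Longrightarrow> openin (proj_zariski n) (proj_chart n i)"
  using openin_proj[OF _ proj_ring_const[of 1]] by simp

lemma topspace_proj: "topspace (proj_zariski n) = (\<Union>i\<le>n. proj_chart n i)"
proof
  show "(\<Union>i\<le>n. proj_chart n i) \<subseteq> topspace (proj_zariski n)" using openin_proj_chart openin_subset by blast
  show "topspace (proj_zariski n) \<subseteq> (\<Union>i\<le>n. proj_chart n i)"
    unfolding proj_zariski_def topology_generated_by_topspace by auto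
qed

text \<open>On the i-th chart, the representative whose i-th coordinate is 1; through it closed
  cones in affine space give closed sets in each projective chart.\<close>

definition dehomogenize :: "nat \<Rightarrow> nat \<Rightarrow> (nat \<Rightarrow> complex) set \<Rightarrow> nat \<Rightarrow> complex" where
  "dehomogenize n i L = (\<lambda>j. if j \<le> n then proj_coord i j L else 0)"

lemma dehomogenize_carrier: "dehomogenize n i L \<in> affine_carrier (Suc n)"
  by (simp add: dehomogenize_def affine_carrier_def)

lemma dehomogenize_open:
  assumes i: "i \<le> n" and W: "openin (zariski (affine_space (Suc n))) W"
  shows "openin (proj_zariski n) {L \<in> proj_chart n i. dehomogenize n i L \<in> W}"
proof -
  have ring: "(\<lambda>L. f (dehomogenize n i L)) \<in> proj_ring n i" if "f \<in> affine_ring (Suc n)" for f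
    using that unfolding affine_ring_def
  proof induction
    case (gen f)
    then obtain j where "f = (\<lambda>v. v j)" "j \<le> n" by auto
    then show ?case using proj_ring_coord[of j n i] by (simp add: dehomogenize_def)
  qed (auto simp: proj_ring_def intro: generated_algebra.intros)
  show ?thesis using W unfolding affine_zariski openin_topology_generated_by_iff
  proof induction
    case (Int a b)
    have e: "{L \<in> proj_chart n i. dehomogenize n i L \<in> a \<inter> b} = {L \<in> proj_chart n i. dehomogenize n i L \<in> a} \<inter> {L \<in> proj_chart n i. dehomogenize n i L \<in> b}" by auto
    show ?case unfolding e using Int.IH by (rule openin_Int)
  next
    case (UN K)
    have "{L \<in> proj_chart n i. dehomogenize n i L \<in> \<Union>K} = (\<Union>k\<in>K. {L \<in> proj_chart n i. dehomogenize n i L \<in> k})" by auto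
    then show ?case using UN.IH by auto
  next
    case (Basis W)
    then obtain f where f: "f \<in> affine_ring (Suc n)" "W = {p \<in> affine_carrier (Suc n). f p \<noteq> 0}" by blast
    have "{L \<in> proj_chart n i. dehomogenize n i L \<in> W} = {L \<in> proj_chart n i. f (dehomogenize n i L) \<noteq> 0}"
      using f(2) dehomogenize_carrier by auto
    then show ?case using openin_proj[OF i ring[OF f(1)]] by simp
  qed simp
qed

subsection \<open>The projective embedding\<close>

text \<open>The monomials \<open>a 0, \<dots>, a n\<close> are global sections of the line bundle with local characters \<open>M \<sigma>\<close>; among them
  are, for each full-dimensional cone, generators of its dual semigroup shifted by \<open>M \<sigma>\<close>.\<close>

locale polarized_fan = toric \<Sigma> for \<Sigma> :: "(real ^ 'n) set set" +
  fixes M :: "(real ^ 'n) set \<Rightarrow> int ^ 'n" and G :: "(real ^ 'n) set \<Rightarrow> (int ^ 'n) set"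
    and n :: nat and a :: "nat \<Rightarrow> int ^ 'n"
  assumes cover: "\<gamma> \<in> \<Sigma> \<Longrightarrow> \<exists>\<sigma>\<in>full_cones. \<gamma> \<subseteq> \<sigma>"
    and M_chart: "\<sigma> \<in> full_cones \<Longrightarrow> \<tau> \<in> full_cones \<Longrightarrow> p \<in> U \<tau> \<Longrightarrow> ev p (M \<sigma> - M \<tau>) \<noteq> 0 \<longleftrightarrow> p \<in> U \<sigma>"
    and a_dual: "i \<le> n \<Longrightarrow> \<tau> \<in> full_cones \<Longrightarrow> a i - M \<tau> \<in> dual_semigroup \<tau>"
    and a_gen: "\<sigma> \<in> full_cones \<Longrightarrow> g \<in> G \<sigma> \<Longrightarrow> \<exists>i\<le>n. a i = M \<sigma> + g"
    and G_zero: "\<sigma> \<in> full_cones \<Longrightarrow> 0 \<in> G \<sigma>"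
    and G_dual: "\<sigma> \<in> full_cones \<Longrightarrow> G \<sigma> \<subseteq> dual_semigroup \<sigma>"
    and G_induct: "\<sigma> \<in> full_cones \<Longrightarrow> m \<in> dual_semigroup \<sigma> \<Longrightarrow> (\<And>g. g \<in> G \<sigma> \<Longrightarrow> Q g) \<Longrightarrow>
      (\<And>b g. b \<in> dual_semigroup \<sigma> \<Longrightarrow> g \<in> G \<sigma> \<Longrightarrow> Q b \<Longrightarrow> Q g \<Longrightarrow> Q (b + g)) \<Longrightarrow> Q m"
begin

text \<open>Index of the section that is constantly 1 in the trivialisation over the chart of
  \<sigma>.\<close>

definition vertex :: "(real ^ 'n) set \<Rightarrow> nat" where
  "vertex \<sigma> = (SOME i. i \<le> n \<and> a i = M \<sigma>)"

lemma vertex: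
  assumes "\<sigma> \<in> full_cones"
  shows "vertex \<sigma> \<le> n \<and> a (vertex \<sigma>) = M \<sigma>"
proof -
  obtain i where "i \<le> n" "a i = M \<sigma> + 0" using a_gen[OF assms G_zero[OF assms]] by blast
  then have "i \<le> n \<and> a i = M \<sigma>" by simp
  then show ?thesis unfolding vertex_def by (rule someI)
qed

lemma full_fan: "\<sigma> \<in> full_cones \<Longrightarrow> \<sigma> \<in> \<Sigma>"
  by (simp add: full_cones_def)

definition full_of :: "'n local_toric_point set \<Rightarrow> (real ^ 'n) set" where
  "full_of p = (SOME \<sigma>. \<sigma> \<in> full_cones \<and> p \<in> U \<sigma>)"

lemma full_of: "p \<in> pts \<Longrightarrow> full_of p \<in> full_cones \<and> p \<in> U (full_of p)"
  unfolding full_of_def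
proof (rule someI_ex)
  assume p: "p \<in> pts"
  obtain \<sigma> where "\<sigma> \<in> full_cones" "cone_of p \<subseteq> \<sigma>" using cover[OF cone_of_mem[OF p]] by blast
  then show "\<exists>\<sigma>. \<sigma> \<in> full_cones \<and> p \<in> U \<sigma>" using p U_iff[OF full_fan] by auto
qed

text \<open>The global sections in the trivialisation over the chart of \<sigma>; another chart
  rescales all of them at a point by the same nonzero factor.\<close>

definition sections :: "(real ^ 'n) set \<Rightarrow> 'n local_toric_point set \<Rightarrow> nat \<Rightarrow> complex" where
  "sections \<sigma> p = (\<lambda>i. if i \<le> n then ev p (a i - M \<sigma>) else 0)"

definition \<phi> :: "'n local_toric_point set \<Rightarrow> (nat \<Rightarrow> complex) set" where
  "\<phi> p = homogeneous_class (sections (full_of p) p)"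

lemma sections_zero: "\<forall>k>n. sections \<sigma> p k = 0"
  by (simp add: sections_def)

lemma sections_vertex: "\<sigma> \<in> full_cones \<Longrightarrow> p \<in> pts \<Longrightarrow> sections \<sigma> p (vertex \<sigma>) = 1"
  using vertex by (simp add: sections_def)

lemma sections_change:
  assumes s: "\<sigma> \<in> full_cones" "p \<in> U \<sigma>" and t: "\<tau> \<in> full_cones" "p \<in> U \<tau>"
  shows "\<exists>c. c \<noteq> 0 \<and> sections \<sigma> p = (\<lambda>i. c * sections \<tau> p i)"
proof (intro exI conjI)
  have pp: "p \<in> pts" using U_pts[OF full_fan] s by blast
  show "ev p (M \<tau> - M \<sigma>) \<noteq> 0" using M_chart[OF t(1) s] t(2) by simp
  have d: "M \<tau> - M \<sigma> \<in> dual_semigroup (cone_of p)"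
    using a_dual[of "vertex \<tau>" \<sigma>] vertex[OF t(1)] s U_dual[OF full_fan] by auto
  have "ev p (a i - M \<sigma>) = ev p (M \<tau> - M \<sigma>) * ev p (a i - M \<tau>)" if "i \<le> n" for i
    using ev_add[OF pp d, of "a i - M \<tau>"] U_dual[OF full_fan[OF t(1)] t(2) a_dual[OF that t(1)]] by simp
  then show "sections \<sigma> p = (\<lambda>i. ev p (M \<tau> - M \<sigma>) * sections \<tau> p i)" by (auto simp: sections_def fun_eq_iff)
qed

lemma \<phi>_eq:
  assumes "\<sigma> \<in> full_cones" "p \<in> U \<sigma>"
  shows "\<phi> p = homogeneous_class (sections \<sigma> p)"
proof -
  have "p \<in> pts" using U_pts[OF full_fan] assms by blast
  then obtain c where "c \<noteq> 0" "sections (full_of p) p = (\<lambda>i. c * sections \<sigma> p i)"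
    using sections_change[OF _ _ assms] full_of by blast
  then show ?thesis unfolding \<phi>_def using homogeneous_class_scale by simp
qed

lemma \<phi>_chart: "\<sigma> \<in> full_cones \<Longrightarrow> p \<in> U \<sigma> \<Longrightarrow> \<phi> p \<in> proj_chart n i \<longleftrightarrow> sections \<sigma> p i \<noteq> 0"
  by (simp add: \<phi>_eq proj_chart_class[OF sections_zero])

lemma \<phi>_coord: "\<sigma> \<in> full_cones \<Longrightarrow> p \<in> U \<sigma> \<Longrightarrow> sections \<sigma> p i \<noteq> 0 \<Longrightarrow> proj_coord i j (\<phi> p) = sections \<sigma> p j / sections \<sigma> p i"
  by (simp add: \<phi>_eq proj_coord_class)

text \<open>The vertex section of \<sigma> is nonzero exactly on the chart of \<sigma>, so the
  preimages of these projective charts are the toric charts and the embedding can be examined chart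
  by chart.\<close>

lemma \<phi>_vertex_chart:
  assumes \<sigma>: "\<sigma> \<in> full_cones" and p: "p \<in> pts"
  shows "\<phi> p \<in> proj_chart n (vertex \<sigma>) \<longleftrightarrow> p \<in> U \<sigma>"
proof -
  have f: "full_of p \<in> full_cones" "p \<in> U (full_of p)" using full_of[OF p] by auto
  have "\<phi> p \<in> proj_chart n (vertex \<sigma>) \<longleftrightarrow> ev p (M \<sigma> - M (full_of p)) \<noteq> 0"
    using \<phi>_chart[OF f] vertex[OF \<sigma>] by (simp add: sections_def)
  then show ?thesis using M_chart[OF \<sigma> f] by simp
qed

lemma \<phi>_topspace: "p \<in> pts \<Longrightarrow> \<phi> p \<in> topspace (proj_zariski n)"
  unfolding topspace_proj using \<phi>_vertex_chart full_of vertex by blast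

text \<open>Proportional sections have factor 1, as the vertex section is 1 at both points; then the
  generators of the dual semigroup, and with them all its characters, agree.\<close>

lemma \<phi>_inj: "inj_on \<phi> pts"
proof (rule inj_onI)
  fix p q assume p: "p \<in> pts" and q: "q \<in> pts" and e: "\<phi> p = \<phi> q"
  define \<sigma> where "\<sigma> = full_of p"
  have \<sigma>: "\<sigma> \<in> full_cones" "p \<in> U \<sigma>" using full_of[OF p] by (auto simp: \<sigma>_def)
  have qU: "q \<in> U \<sigma>" using \<phi>_vertex_chart[OF \<sigma>(1)] p q e \<sigma>(2) by metis
  have "sections \<sigma> p \<in> homogeneous_class (sections \<sigma> q)"
    using e homogeneous_class_self \<phi>_eq[OF \<sigma>] \<phi>_eq[OF \<sigma>(1) qU] by metis
  then obtain c where c: "sections \<sigma> p = (\<lambda>i. c * sections \<sigma> q i)" by (auto simp: homogeneous_class_mem)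
  then have "c = 1" using sections_vertex[OF \<sigma>(1) p] sections_vertex[OF \<sigma>(1) q] by simp
  then have eq: "sections \<sigma> p = sections \<sigma> q" using c by simp
  have gen: "ev p g = ev q g" if g: "g \<in> G \<sigma>" for g
  proof -
    obtain i where i: "i \<le> n" "a i = M \<sigma> + g" using a_gen[OF \<sigma>(1) g] by blast
    then show ?thesis using fun_cong[OF eq, of i] by (simp add: sections_def)
  qed
  show "p = q"
  proof (rule point_eqI[OF full_fan[OF \<sigma>(1)] \<sigma>(2) qU])
    fix m assume "m \<in> dual_semigroup \<sigma>"
    from \<sigma>(1) this show "ev p m = ev q m"
    proof (rule G_induct)
      fix b g assume b: "b \<in> dual_semigroup \<sigma>" and g: "g \<in> G \<sigma>" and IH: "ev p b = ev q b" "ev p g = ev q g"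
      note du = U_dual[OF full_fan[OF \<sigma>(1)]]
      have gd: "g \<in> dual_semigroup \<sigma>" using G_dual[OF \<sigma>(1)] g by blast
      show "ev p (b + g) = ev q (b + g)"
        using ev_add[OF p du[OF \<sigma>(2) b] du[OF \<sigma>(2) gd]] ev_add[OF q du[OF qU b] du[OF qU gd]] IH by simp
    qed (rule gen)
  qed
qed

definition image :: "(nat \<Rightarrow> complex) set set" where
  "image = \<phi> ` pts"

lemma \<phi>_preimage_chart: "i \<le> n \<Longrightarrow> openin zar {p \<in> pts. \<phi> p \<in> proj_chart n i}"
proof (subst openin_subopen, safe)
  fix p assume i: "i \<le> n" and p: "p \<in> pts" "\<phi> p \<in> proj_chart n i"
  define \<sigma> where "\<sigma> = full_of p"
  have \<sigma>: "\<sigma> \<in> full_cones" "p \<in> U \<sigma>" using full_of[OF p(1)] by (auto simp: \<sigma>_def)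
  have "openin zar {q \<in> U \<sigma>. ev q (a i - M \<sigma>) \<noteq> 0}"
    using openin_principal[OF full_fan[OF \<sigma>(1)] chart_ring_ev[OF a_dual[OF i \<sigma>(1)]]] .
  moreover have "{q \<in> U \<sigma>. ev q (a i - M \<sigma>) \<noteq> 0} \<subseteq> {p \<in> pts. \<phi> p \<in> proj_chart n i}"
    using \<phi>_chart[OF \<sigma>(1)] U_pts[OF full_fan[OF \<sigma>(1)]] i by (auto simp: sections_def)
  moreover have "p \<in> {q \<in> U \<sigma>. ev q (a i - M \<sigma>) \<noteq> 0}" using \<phi>_chart[OF \<sigma>] p(2) \<sigma>(2) i by (simp add: sections_def)
  ultimately show "\<exists>T. openin zar T \<and> p \<in> T \<and> T \<subseteq> {p \<in> pts. \<phi> p \<in> proj_chart n i}" by blast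
qed

lemma \<phi>_pullback_regular:
  assumes i: "i \<le> n" and f: "f \<in> proj_ring n i"
  shows "(\<lambda>p. f (\<phi> p)) \<in> regular X {p \<in> pts. \<phi> p \<in> proj_chart n i}"
  using f unfolding proj_ring_def
proof induction
  let ?D = "{p \<in> pts. \<phi> p \<in> proj_chart n i}"
  note D = \<phi>_preimage_chart[OF i]
  {
    case (const c) then show ?case using regular_const[OF D] .
  next
    case (add f g) then show ?case using regular_add[OF D] by simp
  next
    case (mult f g) then show ?case using regular_mult[OF D] by simp
  next
    case (gen f)
    then obtain j where j: "f = proj_coord i j" "j \<le> n" by blast
    show ?case
    proof (rule regular_localI)
      fix p assume p: "p \<in> ?D"
      define \<sigma> where "\<sigma> = full_of p"
      have \<sigma>: "\<sigma> \<in> full_cones" "p \<in> U \<sigma>" using full_of p by (auto simp: \<sigma>_def)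
      define W where "W = ?D \<inter> U \<sigma>"
      have W: "openin zar W" "W \<subseteq> U \<sigma>" unfolding W_def using D openin_U[OF full_fan[OF \<sigma>(1)]] by auto
      have r: "(\<lambda>q. ev q (a k - M \<sigma>)) \<in> regular X W" if "k \<le> n" for k
        by (rule regular_restrict[OF regular_ev[OF full_fan[OF \<sigma>(1)] a_dual[OF that \<sigma>(1)]] W]) simp
      have nz: "ev q (a i - M \<sigma>) \<noteq> 0" if "q \<in> W" for q
        using that \<phi>_chart[OF \<sigma>(1), of q i] i by (auto simp: W_def sections_def)
      have "(\<lambda>q. ev q (a j - M \<sigma>) * inverse (ev q (a i - M \<sigma>))) \<in> regular X W"
        by (rule regular_mult[OF W(1) r[OF j(2)] regular_inverse[OF W(1) r[OF i] nz]])
      moreover have "f (\<phi> q) = ev q (a j - M \<sigma>) * inverse (ev q (a i - M \<sigma>))" if "q \<in> W" for q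
        using \<phi>_coord[OF \<sigma>(1), of q i j] W(2) nz[OF that] that i j by (auto simp: sections_def divide_inverse)
      moreover have "p \<in> W" "W \<subseteq> ?D" using p \<sigma>(2) by (auto simp: W_def)
      ultimately show "\<exists>W h'. openin zar W \<and> p \<in> W \<and> W \<subseteq> ?D \<and> h' \<in> regular X W \<and> (\<forall>q\<in>W. f (\<phi> q) = h' q)"
        using W(1) by (intro exI[of _ W] exI[of _ "\<lambda>q. ev q (a j - M \<sigma>) * inverse (ev q (a i - M \<sigma>))"]) simp
    qed
  }
qed

lemma \<phi>_preimage_open:
  assumes "openin (proj_zariski n) V"
  shows "openin zar {p \<in> pts. \<phi> p \<in> V}"
  using assms unfolding proj_zariski_def openin_topology_generated_by_iff
proof induction
  case Empty then show ?case by simp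
next
  case (Int c d)
  have e: "{p \<in> pts. \<phi> p \<in> c \<inter> d} = {p \<in> pts. \<phi> p \<in> c} \<inter> {p \<in> pts. \<phi> p \<in> d}" by auto
  show ?case unfolding e using Int.IH by (rule openin_Int)
next
  case (UN K)
  have "{p \<in> pts. \<phi> p \<in> \<Union>K} = (\<Union>k\<in>K. {p \<in> pts. \<phi> p \<in> k})" by auto
  then show ?case using UN.IH by auto
next
  case (Basis V)
  then obtain i f where f: "i \<le> n" "f \<in> proj_ring n i" "V = {L \<in> proj_chart n i. f L \<noteq> 0}" by blast
  have "{p \<in> pts. \<phi> p \<in> V} = {p \<in> {p \<in> pts. \<phi> p \<in> proj_chart n i}. f (\<phi> p) \<noteq> 0}" using f(3) by auto
  then show ?case using openin_nonvanishing[OF \<phi>_preimage_chart[OF f(1)] \<phi>_pullback_regular[OF f(1,2)]] by simp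
qed

lemma \<phi>_morphism: "morphism X (induced_on (projective_space n) image) \<phi>"
  unfolding morphism_def
proof (intro conjI allI impI)
  show "continuous_map (zariski X) (zariski (induced_on (projective_space n) image)) \<phi>"
    unfolding zar_def[symmetric] induced_on_def zariski_projective_space space_with_functions.simps
    by (rule continuous_map_into_subtopology)
      (auto simp: continuous_map_def topspace_zar image_def intro: \<phi>_topspace \<phi>_preimage_open)
  fix V f assume "openin (zariski (induced_on (projective_space n) image)) V \<and> f \<in> regular (induced_on (projective_space n) image) V"
  then have f: "\<forall>p\<in>V. \<exists>W g. openin (proj_zariski n) W \<and> p \<in> W \<and> g \<in> regular (projective_space n) W \<and> (\<forall>q\<in>W \<inter> image. q \<in> V \<and> f q = g q)"
    by (simp add: induced_on_def zariski_projective_space)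
  show "f \<circ> \<phi> \<in> regular X {x \<in> points X. \<phi> x \<in> V}"
  proof (rule regular_localI)
    fix p assume "p \<in> {x \<in> points X. \<phi> x \<in> V}"
    then have p: "p \<in> pts" "\<phi> p \<in> V" by (auto simp: points_X)
    obtain W g where W: "openin (proj_zariski n) W" "\<phi> p \<in> W" "g \<in> regular (projective_space n) W" "\<forall>q\<in>W \<inter> image. q \<in> V \<and> f q = g q"
      using bspec[OF f p(2)] by (elim exE conjE) rule
    obtain i F1 F2 W' where W': "i \<le> n" "F1 \<in> proj_ring n i" "F2 \<in> proj_ring n i" "openin (proj_zariski n) W'" "\<phi> p \<in> W'"
      "W' \<subseteq> W \<inter> proj_chart n i" "\<forall>q\<in>W'. F2 q \<noteq> 0 \<and> g q = F1 q / F2 q"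
      using bspec[OF W(3)[unfolded regular_projective_space] W(2)] by (elim exE bexE conjE) rule
    define Op where "Op = {p \<in> pts. \<phi> p \<in> W'}"
    have Op: "openin zar Op" "Op \<subseteq> {p \<in> pts. \<phi> p \<in> proj_chart n i}" "p \<in> Op"
      unfolding Op_def using \<phi>_preimage_open[OF W'(4)] W'(5,6) p(1) by auto
    have r: "(\<lambda>p. F (\<phi> p)) \<in> regular X Op" if "F \<in> proj_ring n i" for F
      by (rule regular_restrict[OF \<phi>_pullback_regular[OF W'(1) that] Op(1,2)]) simp
    have nz: "F2 (\<phi> q) \<noteq> 0" if "q \<in> Op" for q using that W'(7) by (auto simp: Op_def)
    have "(\<lambda>q. F1 (\<phi> q) * inverse (F2 (\<phi> q))) \<in> regular X Op"
      by (rule regular_mult[OF Op(1) r[OF W'(2)] regular_inverse[OF Op(1) r[OF W'(3)] nz]])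
    moreover have *: "\<phi> q \<in> V \<and> (f \<circ> \<phi>) q = F1 (\<phi> q) * inverse (F2 (\<phi> q))" if "q \<in> Op" for q
      using that W(4) W'(6,7) by (auto simp: Op_def image_def divide_inverse)
    moreover have "Op \<subseteq> {x \<in> points X. \<phi> x \<in> V}" using * by (auto simp: points_X Op_def)
    ultimately show "\<exists>W h'. openin zar W \<and> p \<in> W \<and> W \<subseteq> {x \<in> points X. \<phi> x \<in> V} \<and> h' \<in> regular X W \<and> (\<forall>q\<in>W. (f \<circ> \<phi>) q = h' q)"
      using Op(1,3) by (intro exI[of _ Op] exI[of _ "\<lambda>q. F1 (\<phi> q) * inverse (F2 (\<phi> q))"]) simp
  qed
qed

text \<open>Quotients of sections by the vertex section include the characters in
  \<open>G \<sigma>\<close>, which generate the coordinate ring; so every function of the toric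
  chart lifts to the projective chart. This makes the inverse map regular.\<close>

lemma chart_ring_proj:
  assumes \<sigma>: "\<sigma> \<in> full_cones" and f: "f \<in> chart_ring \<sigma>"
  shows "\<exists>F\<in>proj_ring n (vertex \<sigma>). \<forall>p\<in>U \<sigma>. F (\<phi> p) = f p"
proof -
  note pU = U_pts[OF full_fan[OF \<sigma>]] and du = U_dual[OF full_fan[OF \<sigma>]]
  have ch: "\<exists>F\<in>proj_ring n (vertex \<sigma>). \<forall>p\<in>U \<sigma>. F (\<phi> p) = ev p m" if "m \<in> dual_semigroup \<sigma>" for m
    using \<sigma> that
  proof (rule G_induct)
    fix g assume g: "g \<in> G \<sigma>"
    obtain i where i: "i \<le> n" "a i = M \<sigma> + g" using a_gen[OF \<sigma> g] by blast
    have "proj_coord (vertex \<sigma>) i (\<phi> p) = ev p g" if p: "p \<in> U \<sigma>" for p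
      using \<phi>_coord[OF \<sigma> p, of "vertex \<sigma>" i] sections_vertex[OF \<sigma> pU[OF p]] i by (simp add: sections_def)
    then show "\<exists>F\<in>proj_ring n (vertex \<sigma>). \<forall>p\<in>U \<sigma>. F (\<phi> p) = ev p g" using proj_ring_coord[OF i(1)] by blast
  next
    fix b g assume b: "b \<in> dual_semigroup \<sigma>" "g \<in> G \<sigma>"
      and "\<exists>F\<in>proj_ring n (vertex \<sigma>). \<forall>p\<in>U \<sigma>. F (\<phi> p) = ev p b" "\<exists>F\<in>proj_ring n (vertex \<sigma>). \<forall>p\<in>U \<sigma>. F (\<phi> p) = ev p g"
    then obtain F1 F2 where F: "F1 \<in> proj_ring n (vertex \<sigma>)" "\<forall>p\<in>U \<sigma>. F1 (\<phi> p) = ev p b" "F2 \<in> proj_ring n (vertex \<sigma>)" "\<forall>p\<in>U \<sigma>. F2 (\<phi> p) = ev p g"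
      by (elim bexE) rule
    have gd: "g \<in> dual_semigroup \<sigma>" using G_dual[OF \<sigma>] b(2) by blast
    have "F1 (\<phi> p) * F2 (\<phi> p) = ev p (b + g)" if p: "p \<in> U \<sigma>" for p
      using F(2,4) p ev_add[OF pU[OF p] du[OF p b(1)] du[OF p gd]] by simp
    then show "\<exists>F\<in>proj_ring n (vertex \<sigma>). \<forall>p\<in>U \<sigma>. F (\<phi> p) = ev p (b + g)"
      using proj_ring_mult[OF F(1,3)] by (intro bexI[of _ "\<lambda>L. F1 L * F2 L"]) simp_all
  qed
  obtain B c where B: "finite B" "B \<subseteq> dual_semigroup \<sigma>" "\<And>p. p \<in> U \<sigma> \<Longrightarrow> f p = (\<Sum>m\<in>B. c m * ev p m)"
    using chart_ringE[OF f] by metis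
  have "\<forall>m\<in>B. \<exists>F. F \<in> proj_ring n (vertex \<sigma>) \<and> (\<forall>p\<in>U \<sigma>. F (\<phi> p) = ev p m)" using ch B(2) by blast
  then obtain F where F: "\<forall>m\<in>B. F m \<in> proj_ring n (vertex \<sigma>) \<and> (\<forall>p\<in>U \<sigma>. F m (\<phi> p) = ev p m)"
    by (auto dest!: bchoice)
  show ?thesis
  proof (intro bexI ballI)
    show "(\<lambda>L. \<Sum>m\<in>B. c m * F m L) \<in> proj_ring n (vertex \<sigma>)"
      using F by (intro proj_ring_sum proj_ring_mult proj_ring_const) auto
    show "(\<Sum>m\<in>B. c m * F m (\<phi> p)) = f p" if "p \<in> U \<sigma>" for p
      using F that by (simp add: B(3)[OF that])
  qed
qed

definition \<psi> :: "(nat \<Rightarrow> complex) set \<Rightarrow> 'n local_toric_point set" where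
  "\<psi> = inv_into pts \<phi>"

lemma \<psi>_\<phi>: "p \<in> pts \<Longrightarrow> \<psi> (\<phi> p) = p"
  unfolding \<psi>_def by (rule inv_into_f_f[OF \<phi>_inj])

lemma image_points: "points (induced_on (projective_space n) image) = image"
proof -
  have "image \<subseteq> topspace (proj_zariski n)" using \<phi>_topspace by (auto simp: image_def)
  then show ?thesis by (auto simp: induced_on_def zariski_projective_space)
qed

lemma \<psi>_morphism: "morphism (induced_on (projective_space n) image) X \<psi>"
  unfolding morphism_def
proof (intro conjI allI impI)
  have top: "topspace (subtopology (proj_zariski n) image) = image"
    using image_points by (simp add: induced_on_def zariski_projective_space)
  have loc: "\<exists>i F. i \<le> n \<and> F \<in> proj_ring n i \<and> \<phi> p \<in> proj_chart n i \<and> F (\<phi> p) \<noteq> 0 \<and>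
      (\<forall>q\<in>pts. \<phi> q \<in> proj_chart n i \<and> F (\<phi> q) \<noteq> 0 \<longrightarrow> q \<in> V)" if V: "openin zar V" and p: "p \<in> V" for V p
  proof -
    have pp: "p \<in> pts" using open_pts[OF V p] .
    define \<sigma> where "\<sigma> = full_of p"
    have \<sigma>: "\<sigma> \<in> full_cones" "p \<in> U \<sigma>" using full_of[OF pp] by (auto simp: \<sigma>_def)
    obtain f where f: "f \<in> chart_ring \<sigma>" "f p \<noteq> 0" "{q \<in> U \<sigma>. f q \<noteq> 0} \<subseteq> V"
      using openin_local[OF V p full_fan[OF \<sigma>(1)] \<sigma>(2)] by blast
    obtain F where F: "F \<in> proj_ring n (vertex \<sigma>)" "\<forall>p\<in>U \<sigma>. F (\<phi> p) = f p" using chart_ring_proj[OF \<sigma>(1) f(1)] by blast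
    show ?thesis
      using F f \<sigma> vertex[OF \<sigma>(1)] \<phi>_vertex_chart[OF \<sigma>(1)] pp
      by (intro exI[of _ "vertex \<sigma>"] exI[of _ F]) auto
  qed
  show "continuous_map (zariski (induced_on (projective_space n) image)) (zariski X) \<psi>"
    unfolding zar_def[symmetric] induced_on_def zariski_projective_space space_with_functions.simps
    unfolding continuous_map_def top
  proof (intro conjI allI impI)
    show "\<psi> \<in> image \<rightarrow> topspace zar" using \<psi>_\<phi> by (auto simp: image_def topspace_zar)
    fix V assume V: "openin zar V"
    show "openin (subtopology (proj_zariski n) image) {L \<in> image. \<psi> L \<in> V}"
    proof (subst openin_subopen, safe)
      fix L assume "L \<in> image" "\<psi> L \<in> V"
      then obtain p where p: "L = \<phi> p" "p \<in> pts" "p \<in> V" using \<psi>_\<phi> by (auto simp: image_def)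
      obtain i F where F: "i \<le> n" "F \<in> proj_ring n i" "\<phi> p \<in> proj_chart n i" "F (\<phi> p) \<noteq> 0"
        "\<forall>q\<in>pts. \<phi> q \<in> proj_chart n i \<and> F (\<phi> q) \<noteq> 0 \<longrightarrow> q \<in> V" using loc[OF V p(3)] by (elim exE conjE) rule
      have "openin (subtopology (proj_zariski n) image) ({L \<in> proj_chart n i. F L \<noteq> 0} \<inter> image)"
        using openin_proj[OF F(1,2)] by (rule openin_subtopology_Int)
      moreover have "{L \<in> proj_chart n i. F L \<noteq> 0} \<inter> image \<subseteq> {L \<in> image. \<psi> L \<in> V}"
        using F(5) \<psi>_\<phi> by (auto simp: image_def)
      moreover have "L \<in> {L \<in> proj_chart n i. F L \<noteq> 0} \<inter> image" using F p by (auto simp: image_def)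
      ultimately show "\<exists>T. openin (subtopology (proj_zariski n) image) T \<and> L \<in> T \<and> T \<subseteq> {L \<in> image. \<psi> L \<in> V}" by blast
    qed
  qed
  fix V f assume "openin (zariski X) V \<and> f \<in> regular X V"
  then have V: "openin zar V" and f: "f \<in> regular X V" by (auto simp: zar_def)
  have "\<exists>W g. openin (proj_zariski n) W \<and> L \<in> W \<and> g \<in> regular (projective_space n) W \<and>
      (\<forall>q\<in>W \<inter> image. (q \<in> image \<and> \<psi> q \<in> V) \<and> f (\<psi> q) = g q)" if L: "L \<in> image" "\<psi> L \<in> V" for L
  proof -
    obtain p where p: "L = \<phi> p" "p \<in> pts" "p \<in> V" using L \<psi>_\<phi> by (auto simp: image_def)
    define \<sigma> where "\<sigma> = full_of p"
    have \<sigma>: "\<sigma> \<in> full_cones" "p \<in> U \<sigma>" using full_of[OF p(2)] by (auto simp: \<sigma>_def)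
    obtain f1 f2 where f12: "f1 \<in> chart_ring \<sigma>" "f2 \<in> chart_ring \<sigma>" "f2 p \<noteq> 0" "\<forall>q\<in>U \<sigma>. f2 q \<noteq> 0 \<longrightarrow> q \<in> V \<and> f q = f1 q / f2 q"
      using regular_local[OF f p(3) full_fan[OF \<sigma>(1)] \<sigma>(2)] by (elim bexE conjE) rule
    obtain F1 where F1: "F1 \<in> proj_ring n (vertex \<sigma>)" "\<forall>p\<in>U \<sigma>. F1 (\<phi> p) = f1 p" using chart_ring_proj[OF \<sigma>(1) f12(1)] by blast
    obtain F2 where F2: "F2 \<in> proj_ring n (vertex \<sigma>)" "\<forall>p\<in>U \<sigma>. F2 (\<phi> p) = f2 p" using chart_ring_proj[OF \<sigma>(1) f12(2)] by blast
    have v: "vertex \<sigma> \<le> n" using vertex[OF \<sigma>(1)] by simp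
    define W where "W = {L \<in> proj_chart n (vertex \<sigma>). F2 L \<noteq> 0}"
    have W: "openin (proj_zariski n) W" unfolding W_def by (rule openin_proj[OF v F2(1)])
    have reg: "(\<lambda>L. F1 L / F2 L) \<in> regular (projective_space n) W"
      unfolding regular_projective_space
    proof
      fix q assume "q \<in> W"
      then have "openin (proj_zariski n) W \<and> q \<in> W \<and> W \<subseteq> W \<inter> proj_chart n (vertex \<sigma>) \<and> (\<forall>q\<in>W. F2 q \<noteq> 0 \<and> F1 q / F2 q = F1 q / F2 q)"
        using W by (auto simp: W_def)
      then show "\<exists>i\<le>n. \<exists>f\<in>proj_ring n i. \<exists>g\<in>proj_ring n i. \<exists>W'. openin (proj_zariski n) W' \<and> q \<in> W' \<and> W' \<subseteq> W \<inter> proj_chart n i \<and>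
          (\<forall>q\<in>W'. g q \<noteq> 0 \<and> F1 q / F2 q = f q / g q)"
        by (intro exI[of _ "vertex \<sigma>"] conjI v bexI[OF _ F1(1)] bexI[OF _ F2(1)] exI[of _ W]) auto
    qed
    have sub: "(q \<in> image \<and> \<psi> q \<in> V) \<and> f (\<psi> q) = F1 q / F2 q" if q: "q \<in> W \<inter> image" for q
    proof -
      obtain r where r: "q = \<phi> r" "r \<in> pts" using q by (auto simp: image_def)
      have rU: "r \<in> U \<sigma>" using q r \<phi>_vertex_chart[OF \<sigma>(1) r(2)] by (auto simp: W_def)
      have "f2 r \<noteq> 0" using q r F2(2) rU by (auto simp: W_def)
      then show ?thesis using f12(4) rU r \<psi>_\<phi>[OF r(2)] F1(2) F2(2) by (auto simp: image_def)
    qed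
    have "L \<in> W" using p F2(2) \<sigma>(2) f12(3) \<phi>_vertex_chart[OF \<sigma>(1) p(2)] by (auto simp: W_def)
    then show ?thesis using W reg sub by (intro exI[of _ W] exI[of _ "\<lambda>L. F1 L / F2 L"]) simp
  qed
  then show "f \<circ> \<psi> \<in> regular (induced_on (projective_space n) image) {x \<in> points (induced_on (projective_space n) image). \<psi> x \<in> V}"
    unfolding image_points by (simp add: induced_on_def zariski_projective_space)
qed

text \<open>By completeness the affine cone over the image, as the second projection of the set of pairs
  \<open>(p, y)\<close> with \<open>y\<close> proportional to the sections at \<open>p\<close>, is closed in affine space.\<close>

lemma image_closed:
  assumes complete: "complete_variety X"
  shows "closedin (proj_zariski n) image"
proof -
  define C where "C = {(p, y). p \<in> pts \<and> (\<exists>c. y = (\<lambda>i. c * sections (full_of p) p i))}"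
  \<comment> \<open>The trivialisation does not matter, since a change of chart rescales the
    sections.\<close>
  have Cy: "\<exists>c. y = (\<lambda>i. c * sections \<sigma> p i)" if py: "(p, y) \<in> C" and st: "\<sigma> \<in> full_cones" "p \<in> U \<sigma>" for p y \<sigma>
  proof -
    obtain c where c: "p \<in> pts" "y = (\<lambda>i. c * sections (full_of p) p i)" using py by (auto simp: C_def)
    obtain d where "sections (full_of p) p = (\<lambda>i. d * sections \<sigma> p i)"
      using sections_change[OF _ _ st] full_of[OF c(1)] by blast
    then show ?thesis using c(2) by (intro exI[of _ "c * d"]) (simp add: mult.assoc)
  qed
  have cone: "closedin (zariski (affine_space (Suc n))) (snd ` C)"
  proof (rule complete_image_closed[OF complete])
    show "C \<subseteq> pts \<times> affine_carrier (Suc n)" by (auto simp: C_def affine_carrier_def sections_def)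
    fix x y assume x: "x \<in> pts" and y: "y \<in> affine_carrier (Suc n)" and xy: "(x, y) \<notin> C"
    define \<sigma> where "\<sigma> = full_of x"
    have \<sigma>: "\<sigma> \<in> full_cones" "x \<in> U \<sigma>" using full_of[OF x] by (auto simp: \<sigma>_def)
    have v: "vertex \<sigma> \<le> n" using vertex[OF \<sigma>(1)] by simp
    \<comment> \<open>The vertex section is 1, so the factor of proportionality can only be
      \<open>y (vertex \<sigma>)\<close>; an index where it fails gives the two-term
      equation.\<close>
    have "y \<noteq> (\<lambda>i. y (vertex \<sigma>) * sections \<sigma> x i)" using xy x by (auto simp: C_def \<sigma>_def)
    then obtain i where i: "y i \<noteq> y (vertex \<sigma>) * sections \<sigma> x i" by (auto simp: fun_eq_iff)
    have "i \<le> n"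
    proof (rule ccontr)
      assume "\<not> i \<le> n"
      then show False using i y by (simp add: affine_carrier_def sections_def)
    qed
    note o = openin_U[OF full_fan[OF \<sigma>(1)]]
    have r: "(\<lambda>p. (- 1) * ev p (a i - M \<sigma>)) \<in> regular X (U \<sigma>)"
      by (rule regular_mult[OF o regular_const[OF o] regular_ev[OF full_fan[OF \<sigma>(1)] a_dual[OF \<open>i \<le> n\<close> \<sigma>(1)]]])
    show "\<exists>V f0 f1 g0 g1. openin zar V \<and> x \<in> V \<and> f0 \<in> regular X V \<and> f1 \<in> regular X V \<and> g0 \<in> affine_ring (Suc n) \<and> g1 \<in> affine_ring (Suc n) \<and>
        f0 x * g0 y + f1 x * g1 y \<noteq> 0 \<and> (\<forall>(x', y')\<in>C. x' \<in> V \<longrightarrow> f0 x' * g0 y' + f1 x' * g1 y' = 0)"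
    proof (intro exI conjI)
      show "openin zar (U \<sigma>)" "x \<in> U \<sigma>" using o \<sigma> by auto
      show "(\<lambda>_. 1) \<in> regular X (U \<sigma>)" using regular_const[OF o] .
      show "(\<lambda>p. (- 1) * ev p (a i - M \<sigma>)) \<in> regular X (U \<sigma>)" by (rule r)
      show "(\<lambda>y. y i) \<in> affine_ring (Suc n)" "(\<lambda>y. y (vertex \<sigma>)) \<in> affine_ring (Suc n)"
        using affine_ring_coord \<open>i \<le> n\<close> v by auto
      show "1 * y i + (- 1) * ev x (a i - M \<sigma>) * y (vertex \<sigma>) \<noteq> 0" using i \<open>i \<le> n\<close> by (simp add: sections_def mult.commute)
      show "\<forall>(x', y')\<in>C. x' \<in> U \<sigma> \<longrightarrow> 1 * y' i + (- 1) * ev x' (a i - M \<sigma>) * y' (vertex \<sigma>) = 0"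
      proof (clarify)
        fix x' y' assume C: "(x', y') \<in> C" and U: "x' \<in> U \<sigma>"
        obtain c where "y' = (\<lambda>i. c * sections \<sigma> x' i)" using Cy[OF C \<sigma>(1) U] by blast
        then show "1 * y' i + (- 1) * ev x' (a i - M \<sigma>) * y' (vertex \<sigma>) = 0"
          using sections_vertex[OF \<sigma>(1) U_pts[OF full_fan[OF \<sigma>(1)] U]] \<open>i \<le> n\<close> by (simp add: sections_def)
      qed
    qed
  qed
  define Op where "Op = affine_carrier (Suc n) - snd ` C"
  have Op: "openin (zariski (affine_space (Suc n))) Op" using cone by (simp add: Op_def closedin_def affine_topspace)
  have deh: "dehomogenize n i (homogeneous_class v) = (\<lambda>j. (1 / v i) * v j)" if "\<forall>k>n. v k = 0" "v i \<noteq> 0" for i v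
    using that by (auto simp: dehomogenize_def proj_coord_class fun_eq_iff)
  have imgC: "L \<notin> image \<longleftrightarrow> dehomogenize n i L \<in> Op" if L: "L \<in> proj_chart n i" for i L
  proof
    assume Op: "dehomogenize n i L \<in> Op"
    show "L \<notin> image"
    proof
      assume "L \<in> image"
      then obtain p where p: "L = homogeneous_class (sections (full_of p) p)" "p \<in> pts" by (auto simp: image_def \<phi>_def)
      then have nz: "sections (full_of p) p i \<noteq> 0" using L proj_chart_class[OF sections_zero] by simp
      have "(p, dehomogenize n i L) \<in> C" unfolding p(1) deh[OF sections_zero nz] using p(2)
        by (simp only: C_def mem_Collect_eq prod.case) blast
      then have "dehomogenize n i L \<in> snd ` C" by (rule image_eqI[rotated]) simp
      then show False using Op by (simp add: Op_def)
    qed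
  next
    assume nL: "L \<notin> image"
    obtain v where v: "L = homogeneous_class v" "\<forall>k>n. v k = 0" "v i \<noteq> 0" using L by (auto simp: proj_chart_def)
    have "dehomogenize n i L \<notin> snd ` C"
    proof
      assume "dehomogenize n i L \<in> snd ` C"
      then obtain p c where p: "p \<in> pts" "(\<lambda>j. (1 / v i) * v j) = (\<lambda>j. c * sections (full_of p) p j)"
        unfolding v(1) deh[OF v(2,3)] by (auto simp: C_def)
      \<comment> \<open>The cone contains the origin, which is no point of projective space; the
        i-th coordinate, equal to 1, excludes it.\<close>
      have "c \<noteq> 0" using fun_cong[OF p(2), of i] v(3) by auto
      have "homogeneous_class v = homogeneous_class (\<lambda>j. (1 / v i) * v j)" using homogeneous_class_scale[of "1 / v i" v] v(3) by simp
      also have "\<dots> = \<phi> p" unfolding p(2) \<phi>_def using homogeneous_class_scale[OF \<open>c \<noteq> 0\<close>] .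
      finally show False using nL p(1) v(1) by (auto simp: image_def)
    qed
    then show "dehomogenize n i L \<in> Op" using dehomogenize_carrier by (simp add: Op_def)
  qed
  have "topspace (proj_zariski n) - image = (\<Union>i\<le>n. {L \<in> proj_chart n i. dehomogenize n i L \<in> Op})"
    unfolding topspace_proj using imgC by auto
  moreover have "openin (proj_zariski n) (\<Union>i\<le>n. {L \<in> proj_chart n i. dehomogenize n i L \<in> Op})"
    using dehomogenize_open[OF _ Op] by (intro openin_Union) auto
  moreover have "image \<subseteq> topspace (proj_zariski n)" using \<phi>_topspace by (auto simp: image_def)
  ultimately show ?thesis by (simp add: closedin_def)
qed

lemma projective:
  assumes "complete_variety X"
  shows "projective_variety X"
  unfolding projective_variety_def
proof (intro exI conjI)
  show "closedin (zariski (projective_space n)) image" using image_closed[OF assms] by (simp add: zariski_projective_space)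
  show "isomorphic X (induced_on (projective_space n) image)"
    unfolding isomorphic_def
  proof (intro exI conjI ballI)
    show "morphism X (induced_on (projective_space n) image) \<phi>" by (rule \<phi>_morphism)
    show "morphism (induced_on (projective_space n) image) X \<psi>" by (rule \<psi>_morphism)
    show "\<psi> (\<phi> x) = x" if "x \<in> points X" for x using that \<psi>_\<phi> by (simp add: points_X)
    show "\<phi> (\<psi> y) = y" if "y \<in> points (induced_on (projective_space n) image)" for y
      using that \<psi>_\<phi> unfolding image_points by (auto simp: image_def)
  qed
qed

end


subsection \<open>Projectivity\<close>

context toric begin

lemma dual_rays:
  assumes "\<sigma> \<in> \<Sigma>" "\<And>v. v \<in> rays \<Longrightarrow> v \<in> \<sigma> \<Longrightarrow> 0 \<le> pairing m v"
  shows "m \<in> dual_semigroup \<sigma>"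
  unfolding dual_semigroup_def
  using convex_cone_hull_pairing_nonneg[of "rays \<inter> \<sigma>" m] assms(2) cone_generated_by_rays[OF assms(1)] by auto

text \<open>Instead of Gordan's lemma: subtracting dual basis vectors (times \<open>N\<close>) moves every element of the dual semigroup
  of a simplicial cone into a finite box.\<close>

definition dual_box :: "int \<Rightarrow> (real ^ 'n) set \<Rightarrow> (int ^ 'n) set" where
  "dual_box N \<sigma> = {m \<in> dual_semigroup \<sigma>. \<forall>v\<in>rays \<inter> \<sigma>. ipair m v \<le> N}"

lemma finite_dual_box:
  assumes \<sigma>: "\<sigma> \<in> full_cones"
  shows "finite (dual_box N \<sigma>)"
proof -
  have \<sigma>\<Sigma>: "\<sigma> \<in> \<Sigma>" and sp: "span \<sigma> = UNIV" using \<sigma> by (auto simp: full_cones_def)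
  let ?r = "\<lambda>m. restrict (ipair m) (rays \<inter> \<sigma>)"
  have "inj_on ?r (dual_box N \<sigma>)"
  proof (rule inj_onI)
    fix m m' assume eq: "?r m = ?r m'"
    have "m - m' \<in> perp \<sigma>"
    proof (rule perp_rays[OF \<sigma>\<Sigma>])
      fix v assume v: "v \<in> rays" "v \<in> \<sigma>"
      have "ipair m v = ipair m' v" using fun_cong[OF eq, of v] v by simp
      then have "pairing m v = pairing m' v" using of_int_ipair[OF rays_lattice[OF v(1)]] by metis
      then show "pairing (m - m') v = 0" by (simp add: pairing_simps)
    qed
    then show "m = m'" using perp_span_UNIV[OF sp] by fastforce
  qed
  moreover have "?r ` dual_box N \<sigma> \<subseteq> (\<Pi>\<^sub>E v\<in>rays \<inter> \<sigma>. {0..N})"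
  proof (rule image_subsetI)
    fix m assume m: "m \<in> dual_box N \<sigma>"
    have "\<forall>v\<in>rays \<inter> \<sigma>. ipair m v \<in> {0..N}"
      using m by (auto simp: dual_box_def dual_semigroup_def ipair_def)
    then show "?r m \<in> (\<Pi>\<^sub>E v\<in>rays \<inter> \<sigma>. {0..N})" by (simp only: restrict_PiE_iff)
  qed
  moreover have "finite (\<Pi>\<^sub>E v\<in>rays \<inter> \<sigma>. {0..N})" using finite_rays by (intro finite_PiE) auto
  ultimately show ?thesis by (meson finite_imageD finite_subset)
qed

text \<open>Induction on the sum of the pairings with the rays. If one pairing exceeds
  \<open>N\<close>, subtracting the dual vector of that ray stays in the dual semigroup and lowers
  the sum by \<open>N\<close>.\<close>

lemma dual_box_induct:
  assumes \<sigma>: "\<sigma> \<in> \<Sigma>" and N: "N > 0" "\<And>v. v \<in> rays \<Longrightarrow> \<exists>m. \<forall>v'\<in>rays \<inter> \<sigma>. ipair m v' = (if v' = v then N else 0)"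
    and m: "m \<in> dual_semigroup \<sigma>"
    and base: "\<And>g. g \<in> dual_box N \<sigma> \<Longrightarrow> Q g"
    and step: "\<And>b g. b \<in> dual_semigroup \<sigma> \<Longrightarrow> g \<in> dual_box N \<sigma> \<Longrightarrow> Q b \<Longrightarrow> Q g \<Longrightarrow> Q (b + g)"
  shows "Q m"
  using m
proof (induction "\<Sum>v\<in>rays \<inter> \<sigma>. nat (ipair m v)" arbitrary: m rule: less_induct)
  case less
  show ?case
  proof (cases "m \<in> dual_box N \<sigma>")
    case True then show ?thesis by (rule base)
  next
    case False
    then obtain v where v: "v \<in> rays" "v \<in> \<sigma>" "N < ipair m v" using less.prems by (auto simp: dual_box_def not_le)
    obtain u where u: "\<And>v'. v' \<in> rays \<Longrightarrow> v' \<in> \<sigma> \<Longrightarrow> ipair u v' = (if v' = v then N else 0)" using N(2)[OF v(1)] by blast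
    have ud: "u \<in> dual_semigroup \<sigma>"
    proof (rule dual_rays[OF \<sigma>])
      fix v' assume v': "v' \<in> rays" "v' \<in> \<sigma>"
      have "0 \<le> ipair u v'" using u[OF v'] N(1) by simp
      then show "0 \<le> pairing u v'" using of_int_ipair[OF rays_lattice[OF v'(1)], of u] by linarith
    qed
    have ub: "u \<in> dual_box N \<sigma>" using ud u N(1) by (auto simp: dual_box_def)
    have ip: "ipair (m - u) v' = ipair m v' - (if v' = v then N else 0)" if "v' \<in> rays" "v' \<in> \<sigma>" for v'
      using u[OF that] by (simp add: ipair_diff rays_lattice[OF that(1)])
    have mnn: "0 \<le> ipair m v'" if "v' \<in> \<sigma>" for v' using less.prems that by (auto simp: dual_semigroup_def ipair_def)
    have md: "m - u \<in> dual_semigroup \<sigma>"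
    proof (rule dual_rays[OF \<sigma>])
      fix v' assume v': "v' \<in> rays" "v' \<in> \<sigma>"
      have "0 \<le> ipair (m - u) v'" using ip[OF v'] v(3) mnn[OF v'(2)] by auto
      then show "0 \<le> pairing (m - u) v'" using of_int_ipair[OF rays_lattice[OF v'(1)], of "m - u"] by linarith
    qed
    have "(\<Sum>v\<in>rays \<inter> \<sigma>. nat (ipair (m - u) v)) < (\<Sum>v\<in>rays \<inter> \<sigma>. nat (ipair m v))"
    proof (rule sum_strict_mono_ex1)
      show "\<forall>x\<in>rays \<inter> \<sigma>. nat (ipair (m - u) x) \<le> nat (ipair m x)" using ip N(1) by auto
      show "\<exists>x\<in>rays \<inter> \<sigma>. nat (ipair (m - u) x) < nat (ipair m x)" using ip[OF v(1,2)] v N(1) by (intro bexI[of _ v]) auto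
    qed (use finite_rays in simp)
    from less.hyps[OF this md] have "Q (m - u)" .
    from step[OF md ub this base[OF ub]] show ?thesis by simp
  qed
qed

text \<open>A generator of one dual semigroup may be negative on rays outside its cone, where strict
  convexity and integrality give a margin of at least 1. Multiplying the support function by a bound
  \<open>K\<close> for these pairings makes every shifted generator a global section and preserves
  strict convexity.\<close>

lemma projective_of_support_function:
  assumes supp: "\<Union>\<Sigma> = UNIV" and complete: "complete_variety X"
    and N: "N > 0" "\<And>\<sigma> v. \<sigma> \<in> \<Sigma> \<Longrightarrow> v \<in> rays \<Longrightarrow> \<exists>m. \<forall>v'\<in>rays \<inter> \<sigma>. ipair m v' = (if v' = v then N else 0)"
    and M: "\<And>\<sigma> \<tau> v. \<sigma> \<in> full_cones \<Longrightarrow> \<tau> \<in> full_cones \<Longrightarrow> v \<in> rays \<Longrightarrow> v \<in> \<tau> \<Longrightarrow> 0 \<le> pairing (M \<sigma> - M \<tau>) v"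
    "\<And>\<sigma> \<tau> v. \<sigma> \<in> full_cones \<Longrightarrow> \<tau> \<in> full_cones \<Longrightarrow> v \<in> rays \<Longrightarrow> v \<in> \<tau> \<Longrightarrow> pairing (M \<sigma> - M \<tau>) v = 0 \<longleftrightarrow> v \<in> \<sigma>"
  shows "projective_variety X"
proof -
  have full: "\<sigma> \<in> \<Sigma>" if "\<sigma> \<in> full_cones" for \<sigma> using that by (simp add: full_cones_def)
  have fin_full: "finite full_cones" using finite_fan by (simp add: full_cones_def)
  define S where "S = (SIGMA \<sigma>:full_cones. dual_box N \<sigma>)"
  have finS: "finite S" unfolding S_def using fin_full finite_dual_box by (intro finite_SigmaI) auto
  \<comment> \<open>The leading 1 keeps \<open>K\<close> nonzero even if all pairings vanish; a
    zeroth power would forget where the character vanishes.\<close>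
  define K where "K = 1 + (\<Sum>(\<sigma>, g)\<in>S. \<Sum>v\<in>rays. nat \<bar>ipair g v\<bar>)"
  have K: "\<bar>ipair g v\<bar> \<le> int K" if s: "(\<sigma>, g) \<in> S" and v: "v \<in> rays" for \<sigma> g v
  proof -
    have "nat \<bar>ipair g v\<bar> \<le> (\<Sum>v\<in>rays. nat \<bar>ipair g v\<bar>)" using v finite_rays by (intro member_le_sum) auto
    also have "\<dots> \<le> (\<Sum>(\<sigma>, g)\<in>S. \<Sum>v\<in>rays. nat \<bar>ipair g v\<bar>)"
      using member_le_sum[OF s, of "\<lambda>(\<sigma>, g). \<Sum>v\<in>rays. nat \<bar>ipair g v\<bar>"] finS by simp
    finally have "nat \<bar>ipair g v\<bar> \<le> K" unfolding K_def by linarith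
    then show ?thesis by linarith
  qed
  have K0: "K \<noteq> 0" by (simp add: K_def)
  define M' where "M' \<sigma> = int K *s M \<sigma>" for \<sigma>
  have M'diff: "M' \<sigma> - M' \<tau> = int K *s (M \<sigma> - M \<tau>)" for \<sigma> \<tau> by (simp add: M'_def vector_ssub_ldistrib)
  define A where "A = (\<lambda>(\<sigma>, g). M' \<sigma> + g) ` S"
  have zero_box: "0 \<in> dual_box N \<sigma>" for \<sigma> using N(1) by (simp add: dual_box_def)
  obtain \<sigma>0 where "\<sigma>0 \<in> full_cones" using full_cones_cover[OF supp] by blast
  then have "(\<sigma>0, 0) \<in> S" using zero_box by (simp add: S_def)
  then have A: "finite A" "A \<noteq> {}" using finS by (auto simp: A_def)
  then have cA: "card A > 0" by (simp add: card_gt_0_iff)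
  obtain e where e: "bij_betw e {0..<card A} A" using ex_bij_betw_nat_finite[OF A(1)] by blast
  have range: "{0..<card A} = {..card A - 1}" using cA by auto
  have eA: "e i \<in> A" if "i \<le> card A - 1" for i using bij_betwE[OF e] that cA by auto
  interpret P: polarized_fan \<Sigma> M' "dual_box N" "card A - 1" e
  proof
    show "\<exists>\<sigma>\<in>full_cones. \<gamma> \<subseteq> \<sigma>" if "\<gamma> \<in> \<Sigma>" for \<gamma> using full_cone_above[OF supp that] by blast
    show "ev p (M' \<sigma> - M' \<tau>) \<noteq> 0 \<longleftrightarrow> p \<in> U \<sigma>" if st: "\<sigma> \<in> full_cones" "\<tau> \<in> full_cones" and p: "p \<in> U \<tau>" for \<sigma> \<tau> p
    proof -
      have pp: "p \<in> pts" "cone_of p \<subseteq> \<tau>" "cone_of p \<in> \<Sigma>" using p U_iff[OF full[OF st(2)]] cone_of_mem by auto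
      have d: "M \<sigma> - M \<tau> \<in> dual_semigroup \<tau>" using dual_rays[OF full[OF st(2)]] M(1)[OF st] by blast
      have dp: "M \<sigma> - M \<tau> \<in> dual_semigroup (cone_of p)" using U_dual[OF full[OF st(2)] p d] .
      have "ev p (M' \<sigma> - M' \<tau>) = ev p (M \<sigma> - M \<tau>) ^ K" unfolding M'diff by (rule ev_vmult[OF pp(1) dp])
      then have "ev p (M' \<sigma> - M' \<tau>) \<noteq> 0 \<longleftrightarrow> ev p (M \<sigma> - M \<tau>) \<noteq> 0"
        using K0 by simp
      also have "\<dots> \<longleftrightarrow> M \<sigma> - M \<tau> \<in> perp (cone_of p)" by (rule ev_nonzero_iff[OF pp(1) dp])
      \<comment> \<open>Strict convexity: among the rays of \<open>\<tau>\<close>, the two linear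
        functions agree exactly on those in \<open>\<sigma>\<close>.\<close>
      also have "\<dots> \<longleftrightarrow> cone_of p \<subseteq> \<sigma>"
      proof
        assume m: "M \<sigma> - M \<tau> \<in> perp (cone_of p)"
        have "rays \<inter> cone_of p \<subseteq> \<sigma>"
        proof
          fix v assume v: "v \<in> rays \<inter> cone_of p"
          then have "pairing (M \<sigma> - M \<tau>) v = 0" using m by (auto simp: perp_def)
          then show "v \<in> \<sigma>" using M(2)[OF st, of v] v pp(2) by blast
        qed
        then have "convex_cone hull (rays \<inter> cone_of p) \<subseteq> \<sigma>" using fan_cone[OF full[OF st(1)]] by (rule hull_minimal)
        then show "cone_of p \<subseteq> \<sigma>" using cone_generated_by_rays[OF pp(3)] by simp
      next
        assume sub: "cone_of p \<subseteq> \<sigma>"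
        show "M \<sigma> - M \<tau> \<in> perp (cone_of p)"
          by (rule perp_rays[OF pp(3)]) (use M(2)[OF st] sub pp(2) in blast)
      qed
      finally show ?thesis using pp(1) U_iff[OF full[OF st(1)]] by simp
    qed
    show "e i - M' \<tau> \<in> dual_semigroup \<tau>" if i: "i \<le> card A - 1" and \<tau>: "\<tau> \<in> full_cones" for i \<tau>
    proof -
      obtain \<sigma> g where g: "(\<sigma>, g) \<in> S" "e i = M' \<sigma> + g" using eA[OF i] by (auto simp: A_def)
      have \<sigma>: "\<sigma> \<in> full_cones" and gd: "g \<in> dual_semigroup \<sigma>" using g(1) by (auto simp: S_def dual_box_def)
      show ?thesis
      proof (rule dual_rays[OF full[OF \<tau>]])
        fix v assume v: "v \<in> rays" "v \<in> \<tau>"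
        have "e i - M' \<tau> = (M' \<sigma> - M' \<tau>) + g" by (simp add: g(2))
        then have eq: "pairing (e i - M' \<tau>) v = real K * pairing (M \<sigma> - M \<tau>) v + pairing g v"
          unfolding M'diff by (simp only: pairing_add_left pairing_vmult of_int_of_nat_eq)
        show "0 \<le> pairing (e i - M' \<tau>) v"
        proof (cases "v \<in> \<sigma>")
          case True
          then show ?thesis unfolding eq using M(1)[OF \<sigma> \<tau> v] gd by (auto simp: dual_semigroup_def)
        next
          case False
          then have "0 < pairing (M \<sigma> - M \<tau>) v" using M(1,2)[OF \<sigma> \<tau> v] by linarith
          then have "0 < ipair (M \<sigma> - M \<tau>) v" using of_int_ipair[OF rays_lattice[OF v(1)], of "M \<sigma> - M \<tau>"] by simp
          then have "1 \<le> pairing (M \<sigma> - M \<tau>) v" using of_int_ipair[OF rays_lattice[OF v(1)], of "M \<sigma> - M \<tau>"] by linarith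
          then have "real K * 1 \<le> real K * pairing (M \<sigma> - M \<tau>) v" by (intro mult_left_mono) auto
          moreover have "- real K \<le> pairing g v"
            using K[OF g(1) v(1)] of_int_ipair[OF rays_lattice[OF v(1)], of g] by linarith
          ultimately show ?thesis unfolding eq by linarith
        qed
      qed
    qed
    show "\<exists>i\<le>card A - 1. e i = M' \<sigma> + g" if "\<sigma> \<in> full_cones" "g \<in> dual_box N \<sigma>" for \<sigma> g
    proof -
      have "(\<sigma>, g) \<in> S" using that by (simp add: S_def)
      then have "M' \<sigma> + g \<in> A" by (force simp: A_def)
      then have "M' \<sigma> + g \<in> e ` {0..<card A}" using bij_betw_imp_surj_on[OF e] by simp
      then show ?thesis unfolding range by auto
    qed
    show "0 \<in> dual_box N \<sigma>" for \<sigma> by (rule zero_box)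
    show "dual_box N \<sigma> \<subseteq> dual_semigroup \<sigma>" for \<sigma> by (auto simp: dual_box_def)
    show "Q m" if "\<sigma> \<in> full_cones" "m \<in> dual_semigroup \<sigma>" "\<And>g. g \<in> dual_box N \<sigma> \<Longrightarrow> Q g"
      "\<And>b g. b \<in> dual_semigroup \<sigma> \<Longrightarrow> g \<in> dual_box N \<sigma> \<Longrightarrow> Q b \<Longrightarrow> Q g \<Longrightarrow> Q (b + g)" for \<sigma> m Q
      using full[OF that(1)] N(1) N(2)[OF full[OF that(1)]] that(2,3,4)
      by (rule dual_box_induct[where Q = Q])
  qed
  show ?thesis by (rule P.projective[OF complete])
qed

end

theorem theorem2p2:
  fixes \<Sigma> :: "(real ^ 'n) set set"
  assumes "fan \<Sigma>"
    and "q_factorial (toric_variety \<Sigma>)"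
    and "complete_variety (toric_variety \<Sigma>)"
    and "picard_number (toric_variety \<Sigma>) = 2"
  shows "projective_variety (toric_variety \<Sigma>)"
proof -
  interpret toric \<Sigma> by unfold_locales (rule assms(1))
  have supp: "\<Union>\<Sigma> = UNIV" by (rule complete_support[OF assms(3)])
  obtain N where N: "N > 0" "\<And>\<sigma> v. \<sigma> \<in> \<Sigma> \<Longrightarrow> v \<in> rays \<Longrightarrow>
    \<exists>m. \<forall>v'\<in>rays \<inter> \<sigma>. ipair m v' = (if v' = v then N else 0)"
    by (rule simplicial_dual_basis[OF assms(2) supp]) blast
  obtain \<sigma>0 where \<sigma>0: "\<sigma>0 \<in> full_cones" using full_cones_cover[OF supp] by blast
  then have \<sigma>0\<Sigma>: "\<sigma>0 \<in> \<Sigma>" by (simp add: full_cones_def)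
  \<comment> \<open>As \<open>\<sigma>0\<close> is simplicial and full-dimensional, this bounds the
    number of rays by n + 2.\<close>
  have "enat (card (rays - \<sigma>0)) \<le> 2" using card_rays_outside_full_cone[OF N \<sigma>0] assms(4) by simp
  then have card: "card (rays - \<sigma>0) \<le> 2" by (simp add: numeral_eq_enat)
  have "(\<Inter>\<sigma>\<in>full_cones. support_values \<sigma>) \<noteq> {}"
    by (rule strictly_convex_support_function[OF supp N(1) N(2)[OF \<sigma>0\<Sigma>] \<sigma>0 card])
  then obtain M where M: "\<And>\<sigma> \<tau> v. \<sigma> \<in> full_cones \<Longrightarrow> \<tau> \<in> full_cones \<Longrightarrow> v \<in> rays \<Longrightarrow> v \<in> \<tau> \<Longrightarrow> 0 \<le> pairing (M \<sigma> - M \<tau>) v"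
    "\<And>\<sigma> \<tau> v. \<sigma> \<in> full_cones \<Longrightarrow> \<tau> \<in> full_cones \<Longrightarrow> v \<in> rays \<Longrightarrow> v \<in> \<tau> \<Longrightarrow> pairing (M \<sigma> - M \<tau>) v = 0 \<longleftrightarrow> v \<in> \<sigma>"
    by (rule integral_support_function) blast
  show ?thesis by (rule projective_of_support_function[OF supp assms(3) N M])
qed

end
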